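(* Let $X$ be an oriented smooth manifold, let $E$ and $F$ be smooth complex line bundles over $X$ equipped with smooth connections $D_E$, $D_F$ with curvature $2$-forms $\Omega_E$, $\Omega_F$, and set $e=\frac{i}{2\pi}\Omega_E$, $f=\frac{i}{2\pi}\Omega_F$. Let $\phi(u)\in\mathbf{C}[u]$ be a polynomial in one indeterminate. Then for any atomic smooth bundle map $\alpha:E\to F$ there exists a differential form $T$ on $X$ with $L^1_{\mathrm{loc}}(X)$-coefficients such that, as currents on $X$, $$\phi(f)-\phi(e)=\left\{\frac{\phi(f)-\phi(e)}{f-e}\right\}\operatorname{Div}(\alpha)+dT .$$ In fact, $T$ is given explicitly by $$T=\frac{i}{2\pi}\left\{\frac{\phi(f)-\phi(e)}{f-e}\right\}\sigma ,$$ where $\sigma$ is the complex $1$-form with $L^1_{\mathrm{loc}}(X)$-coefficients defined by $D\alpha=\sigma\alpha$.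
   Context: Forms with $L^1_{\mathrm{loc}}$ coefficients are regarded as currents on the oriented manifold $X$ by integration, and $d$ is the exterior derivative in the sense of currents (extending $d$ on smooth forms). Atomic: choosing local frames of $E$ and $F$, the bundle map $\alpha$ is represented by a smooth complex-valued function $a$. The map $\alpha$ is atomic if $\frac{da}{a}\in L^1_{\mathrm{loc}}(X)$ for all such local representations; here $da/a$ is defined off the zero set of $a$, and the condition is understood to include that the zero set has measure zero, so that $da/a$ is defined almost everywhere. The condition does not depend on the choice of frames. Divisor: for $\alpha$ atomic, $\operatorname{Div}(\alpha)$ is the $d$-closed current of degree $2$ on $X$ defined locally by $\operatorname{Div}(\alpha)=d\left(\frac{1}{2\pi i}\frac{da}{a}\right)$; it is independent of the frames and hence globally defined. The form $\sigma$: $D$ is the connection induced on $\operatorname{Hom}(E,F)$ by $D_E$ and $D_F$, i.e. $D\alpha=D_F\circ\alpha-\alpha\circ D_E$, and $\sigma$ is determined almost everywhere (off the zeros of $\alpha$) by $D\alpha=\sigma\alpha$. Locally $\sigma=\frac{da}{a}+\omega_F-\omega_E$, where $\omega_E,\omega_F$ are the connection $1$-forms of $D_E,D_F$ in the chosen frames. The expression $\frac{\phi(f)-\phi(e)}{f-e}$ denotes the polynomial $\frac{\phi(y)-\phi(x)}{y-x}\in\mathbf{C}[x,y]$ evaluated (with wedge product) at the commuting $2$-forms $x=e$, $y=f$. *)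

theory Defs
  imports "HOL-Analysis.Analysis" "HOL-Computational_Algebra.Polynomial"
begin

section \<open>Smooth maps\<close>

fun iter_deriv :: "'b list \<Rightarrow> ('b::real_normed_vector \<Rightarrow> 'c::real_normed_vector) \<Rightarrow> 'b \<Rightarrow> 'c" where
  "iter_deriv [] f = f"
| "iter_deriv (w # ws) f = (\<lambda>x. frechet_derivative (iter_deriv ws f) (at x) w)"

text \<open>Used for open \<open>S\<close> only: all iterated directional derivatives exist and are
  (Frechet) differentiable, hence continuous, on \<open>S\<close>.\<close>

definition smooth_on :: "'b::real_normed_vector set \<Rightarrow> ('b \<Rightarrow> 'c::real_normed_vector) \<Rightarrow> bool" where
  "smooth_on S f \<longleftrightarrow> (\<forall>ws. \<forall>x\<in>S. iter_deriv ws f differentiable (at x))"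


section \<open>Oriented smooth manifolds\<close>

text \<open>The manifold is the whole type \<open>'a\<close>, which is Hausdorff and second countable by its sort;
  a chart is a pair of an open domain and a coordinate map (only relevant on the domain).
  The order on \<open>'n\<close> orients \<open>real ^ 'n\<close>.\<close>

type_synonym ('a, 'n) chart = "'a set \<times> ('a \<Rightarrow> real ^ 'n)"

abbreviation dom_c :: "('a, 'n) chart \<Rightarrow> 'a set" where "dom_c \<equiv> fst"
abbreviation map_c :: "('a, 'n) chart \<Rightarrow> 'a \<Rightarrow> real ^ 'n" where "map_c \<equiv> snd"

definition inv_c :: "('a, 'n) chart \<Rightarrow> real ^ 'n \<Rightarrow> 'a" where
  "inv_c c = inv_into (dom_c c) (map_c c)"

definition trans_deriv ::
    "('a, 'n::finite) chart \<Rightarrow> ('a, 'n) chart \<Rightarrow> 'a \<Rightarrow> real ^ 'n \<Rightarrow> real ^ 'n" where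
  "trans_deriv c c' p = frechet_derivative (map_c c' \<circ> inv_c c) (at (map_c c p))"

definition oriented_atlas ::
    "('a::{t2_space, second_countable_topology}, 'n::finite) chart set \<Rightarrow> bool" where
  "oriented_atlas A \<longleftrightarrow>
     (\<Union>c\<in>A. dom_c c) = UNIV \<and>
     (\<forall>c\<in>A. open (dom_c c) \<and> open (map_c c ` dom_c c) \<and>
        homeomorphism (dom_c c) (map_c c ` dom_c c) (map_c c) (inv_c c)) \<and>
     (\<forall>c\<in>A. \<forall>c'\<in>A. smooth_on (map_c c ` (dom_c c \<inter> dom_c c')) (map_c c' \<circ> inv_c c) \<and>
        (\<forall>p\<in>dom_c c \<inter> dom_c c'. det (matrix (trans_deriv c c' p)) > 0))"

definition smooth_fun ::
    "('a, 'n::finite) chart set \<Rightarrow> 'a set \<Rightarrow> ('a \<Rightarrow> 'c::real_normed_vector) \<Rightarrow> bool" where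
  "smooth_fun A U g \<longleftrightarrow> (\<forall>c\<in>A. smooth_on (map_c c ` (U \<inter> dom_c c)) (g \<circ> inv_c c))"

text \<open>The derivative of \<open>g\<close> at \<open>p\<close> on the tangent vector with components \<open>v\<close> in the chart \<open>c\<close>.\<close>

definition dir_deriv ::
    "('a \<Rightarrow> complex) \<Rightarrow> ('a, 'n::finite) chart \<Rightarrow> 'a \<Rightarrow> real ^ 'n \<Rightarrow> complex" where
  "dir_deriv g c p v = frechet_derivative (g \<circ> inv_c c) (at (map_c c p)) v"


section \<open>Differential forms\<close>

text \<open>A complex form \<open>\<omega>\<close>, possibly of mixed degree, is given by its local representatives:
  \<open>\<omega> c p [v\<^sub>1, \<dots>, v\<^sub>k]\<close> is the value at \<open>p\<close> of the degree \<open>k\<close> component of \<open>\<omega>\<close> on the tangent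
  vectors having components \<open>v\<^sub>1, \<dots>, v\<^sub>k\<close> in the chart \<open>c\<close>. It is meaningful for \<open>c\<close> in the
  atlas and \<open>p\<close> in the domain of \<open>c\<close>.\<close>

type_synonym ('a, 'n) form = "('a, 'n) chart \<Rightarrow> 'a \<Rightarrow> (real ^ 'n) list \<Rightarrow> complex"

definition alternating :: "('v::real_vector list \<Rightarrow> complex) \<Rightarrow> bool" where
  "alternating \<beta> \<longleftrightarrow>
     (\<forall>us ws. linear (\<lambda>v. \<beta> (us @ v # ws))) \<and>
     (\<forall>us v vs ws. \<beta> (us @ v # vs @ v # ws) = 0)"

definition form_on :: "('a, 'n::finite) chart set \<Rightarrow> 'a set \<Rightarrow> ('a, 'n) form \<Rightarrow> bool" where
  "form_on A U \<omega> \<longleftrightarrow>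
     (\<forall>c\<in>A. \<forall>p\<in>U \<inter> dom_c c. alternating (\<omega> c p)) \<and>
     (\<forall>c\<in>A. \<forall>c'\<in>A. \<forall>p\<in>U \<inter> dom_c c \<inter> dom_c c'. \<forall>vs.
        \<omega> c p vs = \<omega> c' p (map (trans_deriv c c' p) vs))"

definition smooth_form :: "('a, 'n::finite) chart set \<Rightarrow> 'a set \<Rightarrow> ('a, 'n) form \<Rightarrow> bool" where
  "smooth_form A U \<omega> \<longleftrightarrow> form_on A U \<omega> \<and>
     (\<forall>c\<in>A. \<forall>vs. smooth_on (map_c c ` (U \<inter> dom_c c)) (\<lambda>x. \<omega> c (inv_c c x) vs))"

definition L1loc_form :: "('a, 'n::finite) chart set \<Rightarrow> 'a set \<Rightarrow> ('a, 'n) form \<Rightarrow> bool" where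
  "L1loc_form A U \<omega> \<longleftrightarrow> form_on A U \<omega> \<and>
     (\<forall>c\<in>A. \<forall>vs. \<forall>K. compact K \<and> K \<subseteq> map_c c ` (U \<inter> dom_c c) \<longrightarrow>
        (\<lambda>x. \<omega> c (inv_c c x) vs) absolutely_integrable_on K)"

definition form_degree :: "('a, 'n::finite) chart set \<Rightarrow> nat \<Rightarrow> ('a, 'n) form \<Rightarrow> bool" where
  "form_degree A k \<omega> \<longleftrightarrow> (\<forall>c\<in>A. \<forall>p\<in>dom_c c. \<forall>vs. length vs \<noteq> k \<longrightarrow> \<omega> c p vs = 0)"

definition form_part :: "nat \<Rightarrow> ('a, 'n) form \<Rightarrow> ('a, 'n) form" where
  "form_part k \<omega> = (\<lambda>c p vs. if length vs = k then \<omega> c p vs else 0)"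

definition form_support ::
    "('a::topological_space, 'n::finite) chart set \<Rightarrow> ('a, 'n) form \<Rightarrow> 'a set" where
  "form_support A \<omega> = closure {p. \<exists>c\<in>A. p \<in> dom_c c \<and> (\<exists>vs. \<omega> c p vs \<noteq> 0)}"

definition form_add :: "('a, 'n) form \<Rightarrow> ('a, 'n) form \<Rightarrow> ('a, 'n) form" where
  "form_add \<omega> \<eta> = (\<lambda>c p vs. \<omega> c p vs + \<eta> c p vs)"

definition form_diff :: "('a, 'n) form \<Rightarrow> ('a, 'n) form \<Rightarrow> ('a, 'n) form" where
  "form_diff \<omega> \<eta> = (\<lambda>c p vs. \<omega> c p vs - \<eta> c p vs)"

definition form_scale :: "complex \<Rightarrow> ('a, 'n) form \<Rightarrow> ('a, 'n) form" where
  "form_scale z \<omega> = (\<lambda>c p vs. z * \<omega> c p vs)"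

definition form_one :: "('a, 'n) form" where
  "form_one = (\<lambda>c p vs. if vs = [] then 1 else 0)"

text \<open>\<open>shuffle_sign m I\<close> is the sign of the permutation of \<open>{..<m}\<close> listing first \<open>I\<close> and then its
  complement, both increasingly. The wedge product is normalised so that
  \<open>(\<beta> \<and> \<gamma>)(u, v) = \<beta>(u) \<gamma>(v) - \<beta>(v) \<gamma>(u)\<close> in degree one.\<close>

definition shuffle_sign :: "nat \<Rightarrow> nat set \<Rightarrow> complex" where
  "shuffle_sign m I = (-1) ^ card {(i, j). i \<in> I \<and> j \<in> {..<m} - I \<and> j < i}"

definition wedge :: "('a, 'n) form \<Rightarrow> ('a, 'n) form \<Rightarrow> ('a, 'n) form" where
  "wedge \<omega> \<eta> = (\<lambda>c p vs. \<Sum>I\<in>Pow {..<length vs}.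
     shuffle_sign (length vs) I * \<omega> c p (nths vs I) * \<eta> c p (nths vs ({..<length vs} - I)))"

primrec form_power :: "('a, 'n) form \<Rightarrow> nat \<Rightarrow> ('a, 'n) form" where
  "form_power \<omega> 0 = form_one"
| "form_power \<omega> (Suc k) = wedge \<omega> (form_power \<omega> k)"

text \<open>The exterior derivative in coordinates,
  \<open>d\<omega>(v\<^sub>0, \<dots>, v\<^sub>k) = \<Sum>i. (-1) ^ i * \<partial>\<^sub>v\<^sub>i (\<omega>(v\<^sub>0, \<dots>, omit v\<^sub>i, \<dots>, v\<^sub>k))\<close>.\<close>

definition ext_deriv ::
    "('a, 'n::finite) chart set \<Rightarrow> ('a, 'n) form \<Rightarrow> ('a, 'n) form" where
  "ext_deriv A \<omega> = (\<lambda>c p vs. if c \<in> A \<and> p \<in> dom_c c then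
     (\<Sum>i<length vs. (-1) ^ i *
        frechet_derivative (\<lambda>x. \<omega> c (inv_c c x) (take i vs @ drop (Suc i) vs))
          (at (map_c c p)) (vs ! i))
     else 0)"


section \<open>Polynomials in even forms\<close>

definition poly_form :: "complex poly \<Rightarrow> ('a, 'n) form \<Rightarrow> ('a, 'n) form" where
  "poly_form \<phi> \<omega> = (\<lambda>c p vs. \<Sum>k\<le>degree \<phi>. coeff \<phi> k * form_power \<omega> k c p vs)"

text \<open>An element of \<open>complex poly poly\<close> is read as a polynomial in \<open>y\<close> with coefficients in
  \<open>\<complex>[x]\<close>; the division below is exact.\<close>

definition diff_quot :: "complex poly \<Rightarrow> complex poly poly" where
  "diff_quot \<phi> = (map_poly (\<lambda>a. [:a:]) \<phi> - [:\<phi>:]) div [:- [:0, 1:], 1:]"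

definition poly2_form :: "complex poly poly \<Rightarrow> ('a, 'n) form \<Rightarrow>
    ('a, 'n) form \<Rightarrow> ('a, 'n) form" where
  "poly2_form q \<xi> \<eta> = (\<lambda>c p vs. \<Sum>j\<le>degree q. \<Sum>i\<le>degree (coeff q j).
     coeff (coeff q j) i * wedge (form_power \<xi> i) (form_power \<eta> j) c p vs)"


section \<open>Integration and currents\<close>

definition partition_on :: "('a::topological_space, 'n::finite) chart set \<Rightarrow> 'a set \<Rightarrow>
    ('a, 'n) chart set \<Rightarrow> (('a, 'n) chart \<Rightarrow> 'a \<Rightarrow> real) \<Rightarrow> bool" where
  "partition_on A K C \<rho> \<longleftrightarrow> finite C \<and> C \<subseteq> A \<and>
     (\<forall>c\<in>C. smooth_fun A UNIV (\<rho> c) \<and> (\<forall>p. 0 \<le> \<rho> c p) \<and>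
        compact (closure {p. \<rho> c p \<noteq> 0}) \<and> closure {p. \<rho> c p \<noteq> 0} \<subseteq> dom_c c) \<and>
     (\<forall>p\<in>K. (\<Sum>c\<in>C. \<rho> c p) = 1)"

definition std_frame :: "(real ^ 'n::{finite, linorder}) list" where
  "std_frame = map (\<lambda>i. axis i 1) (sorted_list_of_set UNIV)"

text \<open>The integral over the manifold of the top degree part of a compactly supported form with
  \<open>L\<^sup>1\<^sub>l\<^sub>o\<^sub>c\<close> coefficients; it does not depend on the partition of unity.\<close>

definition form_integral ::
    "('a::topological_space, 'n::{finite, linorder}) chart set \<Rightarrow> ('a, 'n) form \<Rightarrow> complex" where
  "form_integral A \<omega> = (THE I. \<exists>C \<rho>. partition_on A (form_support A \<omega>) C \<rho> \<and>
     I = (\<Sum>c\<in>C. set_lebesgue_integral lebesgue (map_c c ` dom_c c)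
            (\<lambda>x. of_real (\<rho> c (inv_c c x)) * \<omega> c (inv_c c x) std_frame)))"

text \<open>Test forms have mixed degree; the second clause normalises the meaningless values.\<close>

definition test_form ::
    "('a::topological_space, 'n::finite) chart set \<Rightarrow> ('a, 'n) form \<Rightarrow> bool" where
  "test_form A \<psi> \<longleftrightarrow> smooth_form A UNIV \<psi> \<and>
     (\<forall>c p vs. \<not> (c \<in> A \<and> p \<in> dom_c c) \<longrightarrow> \<psi> c p vs = 0) \<and>
     compact (form_support A \<psi>)"

definition test_null_sequence ::
    "('a::topological_space, 'n::finite) chart set \<Rightarrow> (nat \<Rightarrow> ('a, 'n) form) \<Rightarrow> bool" where
  "test_null_sequence A \<Psi> \<longleftrightarrow> (\<forall>j. test_form A (\<Psi> j)) \<and>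
     (\<exists>K. compact K \<and> (\<forall>j. form_support A (\<Psi> j) \<subseteq> K)) \<and>
     (\<forall>c\<in>A. \<forall>L ws vs. compact L \<and> L \<subseteq> map_c c ` dom_c c \<longrightarrow>
        uniform_limit L (\<lambda>j. iter_deriv ws (\<lambda>x. \<Psi> j c (inv_c c x) vs)) (\<lambda>_. 0) sequentially)"

text \<open>Currents are functionals on test forms. Continuity is sequential, which for linear
  functionals on test forms is the same as continuity. Off the test forms the value is fixed
  to be zero, so that equality of currents is equality of functions.\<close>

type_synonym ('a, 'n) functional = "('a, 'n) form \<Rightarrow> complex"

definition current ::
    "('a::topological_space, 'n::finite) chart set \<Rightarrow> ('a, 'n) functional \<Rightarrow> bool" where
  "current A S \<longleftrightarrow>
     (\<forall>\<psi>. \<not> test_form A \<psi> \<longrightarrow> S \<psi> = 0) \<and>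
     (\<forall>\<psi> \<eta>. test_form A \<psi> \<and> test_form A \<eta> \<longrightarrow> S (form_add \<psi> \<eta>) = S \<psi> + S \<eta>) \<and>
     (\<forall>z \<psi>. test_form A \<psi> \<longrightarrow> S (form_scale z \<psi>) = z * S \<psi>) \<and>
     (\<forall>\<Psi>. test_null_sequence A \<Psi> \<longrightarrow> (\<lambda>j. S (\<Psi> j)) \<longlonglongrightarrow> 0)"

definition current_of ::
    "('a::topological_space, 'n::{finite, linorder}) chart set \<Rightarrow>
      ('a, 'n) form \<Rightarrow> ('a, 'n) functional" where
  "current_of A \<omega> = (\<lambda>\<psi>. if test_form A \<psi> then form_integral A (wedge \<omega> \<psi>) else 0)"

text \<open>The degree \<open>k\<close> component of a current sees the test forms of degree \<open>n - k\<close>. The sign makes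
  \<open>current_deriv\<close> extend the exterior derivative of smooth forms:
  \<open>\<integral> d\<omega> \<and> \<psi> = (-1) ^ (k + 1) * \<integral> \<omega> \<and> d\<psi>\<close> for \<open>\<omega>\<close> of degree \<open>k\<close>.\<close>

definition current_deriv ::
    "('a::topological_space, 'n::finite) chart set \<Rightarrow> ('a, 'n) functional \<Rightarrow> ('a, 'n) functional" where
  "current_deriv A S = (\<lambda>\<psi>. if test_form A \<psi> then
     (\<Sum>k\<le>CARD('n). (-1) ^ (k + 1) * S (form_part (CARD('n) - k) (ext_deriv A \<psi>))) else 0)"

text \<open>The product of a current with a smooth form \<open>\<eta>\<close>, which is assumed to have only components of
  even degree, so that it does not matter on which side \<open>\<eta>\<close> is multiplied.\<close>

definition even_form_times_current ::
    "('a::topological_space, 'n::finite) chart set \<Rightarrow> ('a, 'n) form \<Rightarrow> ('a, 'n) functional \<Rightarrow> ('a, 'n) functional" where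
  "even_form_times_current A \<eta> S = (\<lambda>\<psi>. if test_form A \<psi> then S (wedge \<eta> \<psi>) else 0)"


section \<open>Line bundles with connection\<close>

text \<open>The type \<open>'e\<close> is the total space; its smooth structure is the one defined by the
  trivialisations. A trivialisation is a pair of an open set \<open>U\<close> and a map to \<open>\<complex>\<close> (only relevant
  over \<open>U\<close>) that is a linear isomorphism on each fibre over \<open>U\<close>; this also forces the fibrewise
  operations to be those of one-dimensional complex vector spaces.\<close>

record ('a, 'e) line_bundle_data =
  proj :: "'e \<Rightarrow> 'a"
  fib_add :: "'e \<Rightarrow> 'e \<Rightarrow> 'e"
  fib_scale :: "complex \<Rightarrow> 'e \<Rightarrow> 'e"
  trivs :: "('a set \<times> ('e \<Rightarrow> complex)) set"

definition fibre :: "('a, 'e) line_bundle_data \<Rightarrow> 'a \<Rightarrow> 'e set" where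
  "fibre E p = {v. proj E v = p}"

definition line_bundle ::
    "('a::topological_space, 'n::finite) chart set \<Rightarrow> ('a, 'e) line_bundle_data \<Rightarrow> bool" where
  "line_bundle A E \<longleftrightarrow>
     (\<Union>(U, t)\<in>trivs E. U) = UNIV \<and>
     (\<forall>(U, t)\<in>trivs E. open U \<and>
        (\<forall>p\<in>U. bij_betw t (fibre E p) UNIV \<and>
           (\<forall>v\<in>fibre E p. \<forall>w\<in>fibre E p. fib_add E v w \<in> fibre E p \<and> t (fib_add E v w) = t v + t w) \<and>
           (\<forall>z. \<forall>v\<in>fibre E p. fib_scale E z v \<in> fibre E p \<and> t (fib_scale E z v) = z * t v))) \<and>
     (\<forall>(U, t)\<in>trivs E. \<forall>(U', t')\<in>trivs E. \<exists>g. smooth_fun A (U \<inter> U') g \<and>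
        (\<forall>p\<in>U \<inter> U'. \<forall>v\<in>fibre E p. t' v = g p * t v))"

definition smooth_section :: "('a::topological_space, 'n::finite) chart set \<Rightarrow>
    ('a, 'e) line_bundle_data \<Rightarrow> 'a set \<Rightarrow> ('a \<Rightarrow> 'e) \<Rightarrow> bool" where
  "smooth_section A E U s \<longleftrightarrow> open U \<and> (\<forall>p\<in>U. s p \<in> fibre E p) \<and>
     (\<forall>(V, t)\<in>trivs E. smooth_fun A (U \<inter> V) (t \<circ> s))"

definition local_frame :: "('a::topological_space, 'n::finite) chart set \<Rightarrow>
    ('a, 'e) line_bundle_data \<Rightarrow> 'a set \<Rightarrow> ('a \<Rightarrow> 'e) \<Rightarrow> bool" where
  "local_frame A E U s \<longleftrightarrow> smooth_section A E U s \<and>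
     (\<forall>p\<in>U. \<forall>v\<in>fibre E p. \<exists>!z. v = fib_scale E z (s p))"

text \<open>A connection differentiates local sections: \<open>D s c p v\<close> is the covariant derivative of \<open>s\<close> at
  \<open>p\<close> along the tangent vector with components \<open>v\<close> in the chart \<open>c\<close>. It is meaningful when \<open>s\<close> is
  a smooth section over some open neighbourhood of \<open>p\<close>.\<close>

type_synonym ('a, 'n, 'e) covariant_deriv =
  "('a \<Rightarrow> 'e) \<Rightarrow> ('a, 'n) chart \<Rightarrow> 'a \<Rightarrow> real ^ 'n \<Rightarrow> 'e"

definition connection :: "('a::topological_space, 'n::finite) chart set \<Rightarrow>
    ('a, 'e) line_bundle_data \<Rightarrow> ('a, 'n, 'e) covariant_deriv \<Rightarrow> bool" where
  "connection A E D \<longleftrightarrow> (\<forall>U s. smooth_section A E U s \<longrightarrow>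
     (\<forall>c\<in>A. \<forall>v. smooth_section A E (U \<inter> dom_c c) (\<lambda>p. D s c p v)) \<and>
     (\<forall>c\<in>A. \<forall>p\<in>U \<inter> dom_c c. \<forall>v w r.
        D s c p (v + w) = fib_add E (D s c p v) (D s c p w) \<and>
        D s c p (r *\<^sub>R v) = fib_scale E (of_real r) (D s c p v)) \<and>
     (\<forall>c\<in>A. \<forall>c'\<in>A. \<forall>p\<in>U \<inter> dom_c c \<inter> dom_c c'. \<forall>v.
        D s c p v = D s c' p (trans_deriv c c' p v)) \<and>
     (\<forall>s'. smooth_section A E U s' \<longrightarrow> (\<forall>c\<in>A. \<forall>p\<in>U \<inter> dom_c c. \<forall>v.
        ((\<forall>q\<in>U. s q = s' q) \<longrightarrow> D s c p v = D s' c p v) \<and>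
        D (\<lambda>q. fib_add E (s q) (s' q)) c p v = fib_add E (D s c p v) (D s' c p v))) \<and>
     (\<forall>g. smooth_fun A U g \<longrightarrow> (\<forall>c\<in>A. \<forall>p\<in>U \<inter> dom_c c. \<forall>v.
        D (\<lambda>q. fib_scale E (g q) (s q)) c p v =
          fib_add E (fib_scale E (dir_deriv g c p v) (s p)) (fib_scale E (g p) (D s c p v)))))"

text \<open>The connection form \<open>\<omega>\<close> of a frame \<open>s\<close>: \<open>D s = \<omega> s\<close>.\<close>

definition connection_form :: "('a, 'e) line_bundle_data \<Rightarrow> ('a, 'n, 'e) covariant_deriv \<Rightarrow>
    ('a \<Rightarrow> 'e) \<Rightarrow> ('a, 'n) form" where
  "connection_form E D s = (\<lambda>c p vs.
     case vs of [v] \<Rightarrow> (THE z. D s c p v = fib_scale E z (s p)) | _ \<Rightarrow> 0)"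

text \<open>The curvature is locally \<open>d\<omega> + \<omega> \<and> \<omega> = d\<omega>\<close>, for the connection form \<open>\<omega>\<close> of any local frame.\<close>

definition curvature :: "('a::topological_space, 'n::finite) chart set \<Rightarrow>
    ('a, 'e) line_bundle_data \<Rightarrow> ('a, 'n, 'e) covariant_deriv \<Rightarrow> ('a, 'n) form" where
  "curvature A E D = (\<lambda>c p vs. THE z. \<exists>U s. p \<in> U \<and> local_frame A E U s \<and>
     z = ext_deriv A (connection_form E D s) c p vs)"


section \<open>Bundle maps and their divisors\<close>

definition bundle_map :: "('a::topological_space, 'n::finite) chart set \<Rightarrow>
    ('a, 'e) line_bundle_data \<Rightarrow> ('a, 'f) line_bundle_data \<Rightarrow> ('e \<Rightarrow> 'f) \<Rightarrow> bool" where
  "bundle_map A E F \<alpha> \<longleftrightarrow>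
     (\<forall>p. \<forall>v\<in>fibre E p. \<alpha> v \<in> fibre F p \<and>
        (\<forall>w\<in>fibre E p. \<alpha> (fib_add E v w) = fib_add F (\<alpha> v) (\<alpha> w)) \<and>
        (\<forall>z. \<alpha> (fib_scale E z v) = fib_scale F z (\<alpha> v))) \<and>
     (\<forall>U s. smooth_section A E U s \<longrightarrow> smooth_section A F U (\<alpha> \<circ> s))"

definition local_rep :: "('a::topological_space, 'n::finite) chart set \<Rightarrow>
    ('a, 'e) line_bundle_data \<Rightarrow> ('a, 'f) line_bundle_data \<Rightarrow> ('e \<Rightarrow> 'f) \<Rightarrow>
    'a set \<Rightarrow> ('a \<Rightarrow> complex) \<Rightarrow> bool" where
  "local_rep A E F \<alpha> U a \<longleftrightarrow> (\<exists>s t. local_frame A E U s \<and> local_frame A F U t \<and>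
     (\<forall>p\<in>U. \<alpha> (s p) = fib_scale F (a p) (t p)))"

text \<open>\<open>da/a\<close>, with the value zero at the zeros of \<open>a\<close> (division by zero gives zero).\<close>

definition dlog :: "('a \<Rightarrow> complex) \<Rightarrow> ('a, 'n::finite) form" where
  "dlog a = (\<lambda>c p vs. case vs of [v] \<Rightarrow> dir_deriv a c p v / a p | _ \<Rightarrow> 0)"

definition atomic :: "('a::topological_space, 'n::finite) chart set \<Rightarrow>
    ('a, 'e) line_bundle_data \<Rightarrow> ('a, 'f) line_bundle_data \<Rightarrow> ('e \<Rightarrow> 'f) \<Rightarrow> bool" where
  "atomic A E F \<alpha> \<longleftrightarrow> (\<forall>U a. local_rep A E F \<alpha> U a \<longrightarrow>
     (\<forall>c\<in>A. negligible (map_c c ` {p \<in> U \<inter> dom_c c. a p = 0})) \<and>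
     L1loc_form A U (dlog a))"

text \<open>The divisor is the current restricting to \<open>d (1 / (2 \<pi> i) da/a)\<close> on each \<open>U\<close>, that is, on the
  test forms supported in \<open>U\<close>.\<close>

definition divisor :: "('a::topological_space, 'n::{finite, linorder}) chart set \<Rightarrow>
    ('a, 'e) line_bundle_data \<Rightarrow> ('a, 'f) line_bundle_data \<Rightarrow> ('e \<Rightarrow> 'f) \<Rightarrow> ('a, 'n) functional" where
  "divisor A E F \<alpha> = (THE S. current A S \<and>
     (\<forall>U a \<psi>. local_rep A E F \<alpha> U a \<and> test_form A \<psi> \<and> form_support A \<psi> \<subseteq> U \<longrightarrow>
        S \<psi> = current_deriv A (current_of A (form_scale (1 / (2 * of_real pi * \<i>)) (dlog a))) \<psi>))"

text \<open>The induced connection on \<open>Hom(E, F)\<close>: the value of \<open>D \<alpha> = D\<^sub>F \<circ> \<alpha> - \<alpha> \<circ> D\<^sub>E\<close> on a local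
  section \<open>s\<close> of \<open>E\<close>.\<close>

definition hom_deriv :: "('a, 'f) line_bundle_data \<Rightarrow> ('a, 'n, 'e) covariant_deriv \<Rightarrow>
    ('a, 'n, 'f) covariant_deriv \<Rightarrow> ('e \<Rightarrow> 'f) \<Rightarrow> ('a \<Rightarrow> 'e) \<Rightarrow> ('a, 'n) chart \<Rightarrow> 'a \<Rightarrow> real ^ 'n \<Rightarrow> 'f" where
  "hom_deriv F D\<^sub>E D\<^sub>F \<alpha> s c p v = fib_add F (D\<^sub>F (\<alpha> \<circ> s) c p v) (fib_scale F (-1) (\<alpha> (D\<^sub>E s c p v)))"

definition vanishes_at :: "('a, 'e) line_bundle_data \<Rightarrow> ('a, 'f) line_bundle_data \<Rightarrow>
    ('e \<Rightarrow> 'f) \<Rightarrow> 'a \<Rightarrow> bool" where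
  "vanishes_at E F \<alpha> p \<longleftrightarrow> (\<forall>v\<in>fibre E p. \<alpha> v = fib_scale F 0 (\<alpha> v))"

definition satisfies_sigma_eq :: "('a::topological_space, 'n::finite) chart set \<Rightarrow>
    ('a, 'e) line_bundle_data \<Rightarrow> ('a, 'f) line_bundle_data \<Rightarrow> ('a, 'n, 'e) covariant_deriv \<Rightarrow>
    ('a, 'n, 'f) covariant_deriv \<Rightarrow> ('e \<Rightarrow> 'f) \<Rightarrow> ('a, 'n) form \<Rightarrow> bool" where
  "satisfies_sigma_eq A E F D\<^sub>E D\<^sub>F \<alpha> \<sigma> \<longleftrightarrow>
     (\<forall>c\<in>A. \<forall>p\<in>dom_c c. \<not> vanishes_at E F \<alpha> p \<longrightarrow>
        (\<forall>U s v. p \<in> U \<and> smooth_section A E U s \<longrightarrow>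
           hom_deriv F D\<^sub>E D\<^sub>F \<alpha> s c p v = fib_scale F (\<sigma> c p [v]) (\<alpha> (s p))))"

end

theory Submission
  imports Defs
begin

text \<open>In local frames \<open>da/a = \<sigma> - \<omega>\<^sub>F + \<omega>\<^sub>E\<close>, and \<open>\<omega>\<^sub>F - \<omega>\<^sub>E\<close> has the smooth globally defined
  differential \<open>\<Omega>\<^sub>F - \<Omega>\<^sub>E\<close>. Hence \<open>Div(\<alpha>) = d(\<sigma>/(2\<pi>i)) - (\<Omega>\<^sub>F - \<Omega>\<^sub>E)/(2\<pi>i) = (f - e) - d(i\<sigma>/(2\<pi>))\<close>
  as currents; a partition of unity shows that a current is determined by its restrictions to the
  members of an open cover, so no other current can be the divisor. The quotient \<open>q\<close> of \<open>\<phi>(f) - \<phi>(e)\<close>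
  by \<open>f - e\<close> is a closed form of even degrees, so Leibniz' rule gives
  \<open>q Div(\<alpha>) = q (f - e) - d(i q \<sigma>/(2\<pi>)) = \<phi>(f) - \<phi>(e) - dT\<close>.\<close>

section \<open>Calculus of smooth functions\<close>

text \<open>The form \<open>\<sigma>\<close> is only locally integrable, so it is never
  differentiated itself: every derivative is moved onto the test form. Leibniz' rule is used there
  too. For the closed even form \<open>q\<close>, the exterior derivative of \<open>q \<psi>\<close>
  is \<open>q\<close> times that of \<open>\<psi>\<close>, so pairing the derivative of
  \<open>q \<sigma>\<close> with \<open>\<psi>\<close> is the same as pairing that of
  \<open>\<sigma>\<close> with the test form \<open>q \<psi>\<close>. Stokes' theorem is then needed
  for smooth forms only, and just the difference of the connection forms is integrated by parts.
  Curvature, integral and divisor are definite descriptions, so each needs existence and uniqueness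
  before anything can be computed. For the divisor, the global formula gives existence without
  gluing local currents. A form at a point is a function on lists of vectors of every length.
  Contraction with the head of the list gives recursions for the wedge product and for the exterior
  derivative, which turn associativity, Leibniz' rule and the vanishing of the second exterior
  derivative into inductions on lists. Signs are carried by the degree involution, so mixed degrees
  need not be split.\<close>

abbreviation pdir :: "'b::real_normed_vector \<Rightarrow> ('b \<Rightarrow> 'c::real_normed_vector) \<Rightarrow> 'b \<Rightarrow> 'c" where
  "pdir w f \<equiv> (\<lambda>x. frechet_derivative f (at x) w)"

text \<open>A count of derivatives replaces the lists in \<open>smooth_on\<close>, so that closure
  properties go by induction on \<open>k\<close>: the derivative of a product, composite or inverse
  again involves the functions themselves, which are known to order \<open>k\<close>.\<close>

primrec ck :: "nat \<Rightarrow> 'b::real_normed_vector set \<Rightarrow> ('b \<Rightarrow> 'c::real_normed_vector) \<Rightarrow> bool" where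
  "ck 0 S f \<longleftrightarrow> True"
| "ck (Suc k) S f \<longleftrightarrow> (\<forall>x\<in>S. f differentiable (at x)) \<and> (\<forall>w. ck k S (pdir w f))"

lemma iter_deriv_append:
  "iter_deriv (us @ ws) f = iter_deriv us (iter_deriv ws f)"
  by (induction us) auto

text \<open>\<open>iter_deriv\<close> puts a new direction outermost while \<open>ck\<close> strips
  the innermost derivative, so the lists are split at their last element.\<close>

lemma ck_iff: "ck k S f \<longleftrightarrow> (\<forall>ws. length ws < k \<longrightarrow> (\<forall>x\<in>S. iter_deriv ws f differentiable (at x)))"
proof (induction k arbitrary: f)
  case (Suc k)
  show ?case
  proof
    assume L: "ck (Suc k) S f"
    show "\<forall>ws. length ws < Suc k \<longrightarrow> (\<forall>x\<in>S. iter_deriv ws f differentiable (at x))"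
    proof (intro allI impI)
      fix ws :: "'a list" assume ws: "length ws < Suc k"
      show "\<forall>x\<in>S. iter_deriv ws f differentiable (at x)"
      proof (cases ws rule: rev_cases)
        case Nil
        then show ?thesis using L by simp
      next
        case (snoc us w)
        then show ?thesis using L Suc.IH[of "pdir w f"] ws by (simp add: iter_deriv_append)
      qed
    qed
  next
    assume R: "\<forall>ws. length ws < Suc k \<longrightarrow> (\<forall>x\<in>S. iter_deriv ws f differentiable (at x))"
    have "ck k S (pdir w f)" for w
      unfolding Suc.IH
    proof (intro allI impI)
      fix ws :: "'a list" assume "length ws < k"
      then show "\<forall>x\<in>S. iter_deriv ws (pdir w f) differentiable (at x)"
        using R[rule_format, of "ws @ [w]"] by (simp add: iter_deriv_append)
    qed
    then show "ck (Suc k) S f" using R[rule_format, of "[]"] by simp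
  qed
qed simp

lemma smooth_on_ck: "smooth_on S f \<longleftrightarrow> (\<forall>k. ck k S f)"
  unfolding smooth_on_def ck_iff by auto

lemma smooth_on_iff_step:
  "smooth_on S f \<longleftrightarrow> (\<forall>x\<in>S. f differentiable (at x)) \<and> (\<forall>w. smooth_on S (pdir w f))"
proof -
  have "(\<forall>k. ck k S f) \<longleftrightarrow> (\<forall>k. ck (Suc k) S f)"
    by (metis ck.simps(1) not0_implies_Suc)
  then show ?thesis unfolding smooth_on_ck by auto
qed

lemma smooth_on_differentiable: "smooth_on S f \<Longrightarrow> x \<in> S \<Longrightarrow> f differentiable (at x)"
  using smooth_on_iff_step by blast

lemma smooth_on_pdir: "smooth_on S f \<Longrightarrow> smooth_on S (pdir w f)"
  using smooth_on_iff_step by blast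

lemma smooth_on_has_derivative:
  "smooth_on S f \<Longrightarrow> x \<in> S \<Longrightarrow> (f has_derivative frechet_derivative f (at x)) (at x)"
  using smooth_on_differentiable frechet_derivative_works by blast

lemma smooth_on_continuous_on: "smooth_on S f \<Longrightarrow> continuous_on S f"
  by (meson smooth_on_differentiable continuous_at_imp_continuous_on differentiable_imp_continuous_within)

lemma smooth_on_subset: "smooth_on S f \<Longrightarrow> T \<subseteq> S \<Longrightarrow> smooth_on T f"
  unfolding smooth_on_def by blast

lemma smooth_on_local: "(\<And>x. x \<in> S \<Longrightarrow> \<exists>T. x \<in> T \<and> smooth_on T f) \<Longrightarrow> smooth_on S f"
  unfolding smooth_on_def by blast

lemma frechet_derivative_cong_open:
  assumes "open S" "x \<in> S" "\<And>y. y \<in> S \<Longrightarrow> f y = g y"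
  shows "frechet_derivative f (at x) = frechet_derivative g (at x)"
proof -
  have "(f has_derivative f') (at x) \<longleftrightarrow> (g has_derivative f') (at x)" for f'
    using assms by (metis has_derivative_transform_within_open)
  then show ?thesis unfolding frechet_derivative_def by simp
qed

lemma differentiable_cong_open:
  assumes "open S" "x \<in> S" "\<And>y. y \<in> S \<Longrightarrow> f y = g y"
  shows "f differentiable (at x) \<longleftrightarrow> g differentiable (at x)"
  unfolding differentiable_def using assms by (metis has_derivative_transform_within_open)

lemma ck_cong:
  assumes "open S" "\<And>y. y \<in> S \<Longrightarrow> f y = g y"
  shows "ck k S f \<longleftrightarrow> ck k S g"
  using assms(2)
proof (induction k arbitrary: f g)
  case (Suc k)
  have "ck k S (pdir w f) \<longleftrightarrow> ck k S (pdir w g)" for w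
    using frechet_derivative_cong_open[OF assms(1) _ Suc.prems] by (intro Suc.IH) auto
  then show ?case
    using differentiable_cong_open[OF assms(1) _ Suc.prems] by auto
qed simp

lemma smooth_on_cong:
  assumes "open S" "\<And>y. y \<in> S \<Longrightarrow> f y = g y"
  shows "smooth_on S f \<longleftrightarrow> smooth_on S g"
  unfolding smooth_on_ck using ck_cong[OF assms] by auto

lemma iter_deriv_cong_open:
  assumes "open S" "x \<in> S" "\<And>y. y \<in> S \<Longrightarrow> f y = g y"
  shows "iter_deriv ws f x = iter_deriv ws g x"
  using assms(2)
proof (induction ws arbitrary: x)
  case (Cons w ws)
  then show ?case using frechet_derivative_cong_open[OF assms(1) Cons.prems Cons.IH] by simp
qed (use assms in simp)

section \<open>Closure of smooth functions under linear maps, products, composition and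
  quotients\<close>

lemma ck_Suc_D: "ck (Suc k) S f \<Longrightarrow> ck k S f"
  by (auto simp: ck_iff)

lemma ck_const: "ck k S (\<lambda>x. c)"
proof (induction k arbitrary: c)
  case (Suc k)
  have "pdir w (\<lambda>x::'a. c) = (\<lambda>x. 0)" for w by (simp add: frechet_derivative_const)
  then show ?case using Suc by simp
qed simp

lemma smooth_on_const [simp]: "smooth_on S (\<lambda>x. c)"
  by (simp add: smooth_on_ck ck_const)

lemma pdir_bounded_linear:
  assumes "bounded_linear h" "f differentiable (at x)"
  shows "pdir w (\<lambda>x. h (f x)) x = h (pdir w f x)"
proof -
  have "((\<lambda>x. h (f x)) has_derivative (\<lambda>w. h (frechet_derivative f (at x) w))) (at x)"
    using assms bounded_linear.has_derivative frechet_derivative_works by blast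
  then show ?thesis by (metis frechet_derivative_at)
qed

lemma differentiable_bounded_linear:
  assumes "bounded_linear h" "f differentiable (at x)"
  shows "(\<lambda>x. h (f x)) differentiable (at x)"
  using assms bounded_linear.has_derivative unfolding differentiable_def by blast

lemma ck_bounded_linear:
  assumes "open S" "bounded_linear h" "ck k S f"
  shows "ck k S (\<lambda>x. h (f x))"
  using assms(3)
proof (induction k arbitrary: f)
  case (Suc k)
  have "ck k S (pdir w (\<lambda>x. h (f x)))" for w
  proof -
    have "ck k S (\<lambda>x. h (pdir w f x))" using Suc by auto
    then show ?thesis
      by (subst ck_cong[OF assms(1), where g="\<lambda>x. h (pdir w f x)"])
         (use pdir_bounded_linear[OF assms(2)] Suc.prems in auto)
  qed
  then show ?case using differentiable_bounded_linear[OF assms(2)] Suc.prems by auto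
qed simp

lemma smooth_on_bounded_linear:
  "open S \<Longrightarrow> bounded_linear h \<Longrightarrow> smooth_on S f \<Longrightarrow> smooth_on S (\<lambda>x. h (f x))"
  by (simp add: smooth_on_ck ck_bounded_linear)

lemma smooth_on_linear:
  assumes "bounded_linear h"
  shows "smooth_on S h"
proof -
  have "frechet_derivative h (at x) = h" for x
    using assms by (metis bounded_linear_imp_has_derivative frechet_derivative_at)
  then show ?thesis
    by (subst smooth_on_iff_step) (use assms in \<open>auto simp: bounded_linear_imp_differentiable\<close>)
qed

lemma pdir_add:
  assumes "f differentiable (at x)" "g differentiable (at x)"
  shows "pdir w (\<lambda>x. f x + g x) x = pdir w f x + pdir w g x"
proof -
  have "((\<lambda>x. f x + g x) has_derivative
      (\<lambda>w. frechet_derivative f (at x) w + frechet_derivative g (at x) w)) (at x)"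
    using assms by (intro has_derivative_add) (auto simp: frechet_derivative_works)
  then show ?thesis by (metis frechet_derivative_at)
qed

lemma ck_add:
  assumes "open S" "ck k S f" "ck k S g"
  shows "ck k S (\<lambda>x. f x + g x)"
  using assms(2,3)
proof (induction k arbitrary: f g)
  case (Suc k)
  have "ck k S (pdir w (\<lambda>x. f x + g x))" for w
  proof -
    have "ck k S (\<lambda>x. pdir w f x + pdir w g x)" using Suc by auto
    then show ?thesis
      by (subst ck_cong[OF assms(1), where g="\<lambda>x. pdir w f x + pdir w g x"])
         (use Suc.prems in \<open>auto intro!: pdir_add\<close>)
  qed
  then show ?case using Suc.prems by auto
qed simp

lemma smooth_on_add:
  "open S \<Longrightarrow> smooth_on S f \<Longrightarrow> smooth_on S g \<Longrightarrow> smooth_on S (\<lambda>x. f x + g x)"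
  by (simp add: smooth_on_ck ck_add)

lemma smooth_on_uminus:
  "open S \<Longrightarrow> smooth_on S f \<Longrightarrow> smooth_on S (\<lambda>x. - f x)"
  by (rule smooth_on_bounded_linear) (auto intro: bounded_linear_minus bounded_linear_ident)

lemma smooth_on_diff:
  assumes "open S" "smooth_on S f" "smooth_on S g"
  shows "smooth_on S (\<lambda>x. f x - g x)"
  using smooth_on_add[OF assms(1,2) smooth_on_uminus[OF assms(1,3)]] by simp

lemma ck_sum:
  assumes "open S" "\<And>i. i \<in> I \<Longrightarrow> ck k S (f i)"
  shows "ck k S (\<lambda>x. \<Sum>i\<in>I. f i x)"
  using assms(2) by (induction I rule: infinite_finite_induct) (auto intro: ck_const ck_add[OF assms(1)])

lemma smooth_on_sum:
  "open S \<Longrightarrow> (\<And>i. i \<in> I \<Longrightarrow> smooth_on S (f i)) \<Longrightarrow> smooth_on S (\<lambda>x. \<Sum>i\<in>I. f i x)"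
  by (simp add: smooth_on_ck ck_sum)

lemma pdir_sum:
  assumes "\<And>i. i \<in> I \<Longrightarrow> f i differentiable (at x)"
  shows "pdir w (\<lambda>x. \<Sum>i\<in>I. f i x) x = (\<Sum>i\<in>I. pdir w (f i) x)"
proof -
  have "((\<lambda>x. \<Sum>i\<in>I. f i x) has_derivative (\<lambda>w. \<Sum>i\<in>I. frechet_derivative (f i) (at x) w)) (at x)"
    using assms by (intro has_derivative_sum) (auto simp: frechet_derivative_works)
  then show ?thesis by (metis frechet_derivative_at)
qed

lemma pdir_bilinear:
  assumes "bounded_bilinear pr" "f differentiable (at x)" "g differentiable (at x)"
  shows "pdir w (\<lambda>x. pr (f x) (g x)) x = pr (f x) (pdir w g x) + pr (pdir w f x) (g x)"
proof -
  have "((\<lambda>x. pr (f x) (g x)) has_derivative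
     (\<lambda>w. pr (f x) (frechet_derivative g (at x) w) + pr (frechet_derivative f (at x) w) (g x))) (at x)"
    using assms(2,3) by (intro bounded_bilinear.FDERIV[OF assms(1)]) (auto simp: frechet_derivative_works)
  then show ?thesis by (metis frechet_derivative_at)
qed

text \<open>Each term of the product rule pairs one function with a derivative of the other. The
  induction hypothesis applies once the undifferentiated factor is lowered from order
  \<open>Suc k\<close> to \<open>k\<close>.\<close>

lemma ck_bilinear:
  assumes "open S" "bounded_bilinear pr" "ck k S f" "ck k S g"
  shows "ck k S (\<lambda>x. pr (f x) (g x))"
  using assms(3,4)
proof (induction k arbitrary: f g)
  case (Suc k)
  have "ck k S (pdir w (\<lambda>x. pr (f x) (g x)))" for w
  proof -
    have "ck k S (\<lambda>x. pr (f x) (pdir w g x) + pr (pdir w f x) (g x))"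
      using Suc.prems by (intro ck_add assms(1) Suc.IH) (auto intro: ck_Suc_D simp del: ck.simps, auto)
    then show ?thesis
      by (subst ck_cong[OF assms(1), where g="\<lambda>x. pr (f x) (pdir w g x) + pr (pdir w f x) (g x)"])
         (use Suc.prems in \<open>auto intro!: pdir_bilinear[OF assms(2)]\<close>)
  qed
  moreover have "(\<lambda>x. pr (f x) (g x)) differentiable (at x)" if "x \<in> S" for x
    using Suc.prems that bounded_bilinear.FDERIV[OF assms(2)] unfolding differentiable_def ck.simps by blast
  ultimately show ?case by auto
qed simp

lemma smooth_on_bilinear:
  "open S \<Longrightarrow> bounded_bilinear pr \<Longrightarrow> smooth_on S f \<Longrightarrow> smooth_on S g \<Longrightarrow> smooth_on S (\<lambda>x. pr (f x) (g x))"
  by (simp add: smooth_on_ck ck_bilinear)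

lemma smooth_on_mult:
  fixes f g :: "'b::real_normed_vector \<Rightarrow> 'c::real_normed_algebra"
  shows "open S \<Longrightarrow> smooth_on S f \<Longrightarrow> smooth_on S g \<Longrightarrow> smooth_on S (\<lambda>x. f x * g x)"
  by (rule smooth_on_bilinear[OF _ bounded_bilinear_mult])

lemma smooth_on_cmult:
  fixes f :: "'b::real_normed_vector \<Rightarrow> 'c::real_normed_algebra"
  shows "open S \<Longrightarrow> smooth_on S f \<Longrightarrow> smooth_on S (\<lambda>x. c * f x)"
  by (rule smooth_on_mult) auto

lemma pdir_mult:
  fixes f g :: "'b::real_normed_vector \<Rightarrow> 'c::real_normed_algebra"
  assumes "f differentiable (at x)" "g differentiable (at x)"
  shows "pdir w (\<lambda>x. f x * g x) x = f x * pdir w g x + pdir w f x * g x"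
  by (rule pdir_bilinear[OF bounded_bilinear_mult assms])

lemma pdir_cmult:
  fixes f :: "'b::real_normed_vector \<Rightarrow> 'c::real_normed_algebra"
  assumes "f differentiable (at x)"
  shows "pdir w (\<lambda>x. c * f x) x = c * pdir w f x"
  by (rule pdir_bounded_linear[OF bounded_linear_mult_right assms])

lemma pdir_compose:
  assumes "f differentiable (at x)" "g differentiable (at (f x))"
  shows "pdir w (\<lambda>x. g (f x)) x = frechet_derivative g (at (f x)) (pdir w f x)"
  using frechet_derivative_compose[OF assms] by (simp add: o_def)

lemma linear_frechet_derivative: "f differentiable (at x) \<Longrightarrow> linear (frechet_derivative f (at x))"
  by (metis frechet_derivative_works has_derivative_linear)

text \<open>In the chain rule the direction \<open>pdir w f x\<close> varies with \<open>x\<close>.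
  Expanding it in the basis leaves derivatives of \<open>g\<close> in fixed directions, composed
  with \<open>f\<close>, and the induction hypothesis for arbitrary \<open>g\<close> applies to
  these.\<close>

lemma ck_compose:
  fixes f :: "'b::real_normed_vector \<Rightarrow> 'c::euclidean_space" and g :: "'c \<Rightarrow> 'd::real_normed_vector"
  assumes "open S" "f ` S \<subseteq> T" "ck k S f" "ck k T g"
  shows "ck k S (\<lambda>x. g (f x))"
  using assms(3,4)
proof (induction k arbitrary: g)
  case (Suc k)
  have "ck k S (pdir w (\<lambda>x. g (f x)))" for w
  proof -
    let ?h = "\<lambda>x. \<Sum>b\<in>Basis. (pdir w f x \<bullet> b) *\<^sub>R pdir b g (f x)"
    have "ck k S ?h"
    proof (intro ck_sum assms(1) ck_bilinear[OF _ bounded_bilinear_scaleR])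
      fix b :: 'c
      show "ck k S (\<lambda>x. pdir w f x \<bullet> b)"
        using Suc.prems by (intro ck_bounded_linear[OF assms(1) bounded_linear_inner_left]) auto
      show "ck k S (\<lambda>x. pdir b g (f x))"
        using Suc.prems ck_Suc_D[OF Suc.prems(1)] by (intro Suc.IH) auto
    qed
    moreover have "pdir w (\<lambda>x. g (f x)) x = ?h x" if "x \<in> S" for x
    proof -
      have d: "f differentiable (at x)" "g differentiable (at (f x))"
        using Suc.prems that assms(2) by auto
      have "frechet_derivative g (at (f x)) (pdir w f x)
          = frechet_derivative g (at (f x)) (\<Sum>b\<in>Basis. (pdir w f x \<bullet> b) *\<^sub>R b)"
        by (simp add: euclidean_representation)
      also have "\<dots> = ?h x"
        using linear_frechet_derivative[OF d(2)] by (simp add: linear_sum linear_cmul)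
      finally show ?thesis using pdir_compose[OF d] by simp
    qed
    ultimately show ?thesis using ck_cong[OF assms(1), of "pdir w (\<lambda>x. g (f x))" ?h] by auto
  qed
  moreover have "(\<lambda>x. g (f x)) differentiable (at x)" if "x \<in> S" for x
    using differentiable_chain_at[of f x g] Suc.prems that assms(2) by (auto simp: o_def)
  ultimately show ?case by simp
qed simp

lemma smooth_on_compose:
  fixes f :: "'b::real_normed_vector \<Rightarrow> 'c::euclidean_space" and g :: "'c \<Rightarrow> 'd::real_normed_vector"
  shows "open S \<Longrightarrow> f ` S \<subseteq> T \<Longrightarrow> smooth_on S f \<Longrightarrow> smooth_on T g \<Longrightarrow> smooth_on S (\<lambda>x. g (f x))"
  unfolding smooth_on_ck using ck_compose by blast

lemma has_derivative_inverse_fun: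
  fixes f :: "'b::real_normed_vector \<Rightarrow> 'c::real_normed_field"
  assumes "f differentiable (at x)" "f x \<noteq> 0"
  shows "((\<lambda>x. inverse (f x)) has_derivative
     (\<lambda>w. - (inverse (f x) * frechet_derivative f (at x) w * inverse (f x)))) (at x)"
  using Deriv.has_derivative_inverse[of f x "frechet_derivative f (at x)" UNIV] assms
  by (auto simp: frechet_derivative_works)

text \<open>The derivative of the inverse contains the inverse as a factor twice, and the induction
  hypothesis gives that factor order \<open>k\<close>.\<close>

lemma ck_inverse:
  fixes f :: "'b::real_normed_vector \<Rightarrow> 'c::real_normed_field"
  assumes "open S" "\<And>x. x \<in> S \<Longrightarrow> f x \<noteq> 0" "ck k S f"
  shows "ck k S (\<lambda>x. inverse (f x))"
  using assms(3)
proof (induction k)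
  case (Suc k)
  have "ck k S (pdir w (\<lambda>x. inverse (f x)))" for w
  proof -
    let ?h = "\<lambda>x. - (inverse (f x) * pdir w f x * inverse (f x))"
    have "ck k S (\<lambda>x. inverse (f x))" using Suc ck_Suc_D by blast
    then have "ck k S ?h" using Suc.prems
      by (intro ck_bounded_linear[OF assms(1) bounded_linear_minus[OF bounded_linear_ident]]
         ck_bilinear[OF assms(1) bounded_bilinear_mult]) auto
    moreover have "pdir w (\<lambda>x. inverse (f x)) x = ?h x" if "x \<in> S" for x
      using has_derivative_inverse_fun[of f x] Suc.prems that assms(2)
      by (auto dest!: frechet_derivative_at simp: fun_eq_iff)
    ultimately show ?thesis using ck_cong[OF assms(1), of "pdir w (\<lambda>x. inverse (f x))" ?h] by auto
  qed
  moreover have "(\<lambda>x. inverse (f x)) differentiable (at x)" if "x \<in> S" for x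
    using has_derivative_inverse_fun[of f x] Suc.prems that assms(2) by (auto intro: differentiableI)
  ultimately show ?case by simp
qed simp

lemma smooth_on_inverse:
  fixes f :: "'b::real_normed_vector \<Rightarrow> 'c::real_normed_field"
  shows "open S \<Longrightarrow> (\<And>x. x \<in> S \<Longrightarrow> f x \<noteq> 0) \<Longrightarrow> smooth_on S f \<Longrightarrow> smooth_on S (\<lambda>x. inverse (f x))"
  by (simp add: smooth_on_ck ck_inverse)

lemma smooth_on_divide:
  fixes f :: "'b::real_normed_vector \<Rightarrow> 'c::real_normed_field"
  shows "open S \<Longrightarrow> smooth_on S f \<Longrightarrow> (\<And>x. x \<in> S \<Longrightarrow> g x \<noteq> 0) \<Longrightarrow> smooth_on S g \<Longrightarrow> smooth_on S (\<lambda>x. f x / g x)"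
  unfolding divide_inverse by (intro smooth_on_mult smooth_on_inverse)

lemma iter_deriv_sum:
  assumes "open S" "x \<in> S" "\<And>i. i \<in> I \<Longrightarrow> smooth_on S (f i)"
  shows "iter_deriv ws (\<lambda>x. \<Sum>i\<in>I. f i x) x = (\<Sum>i\<in>I. iter_deriv ws (f i) x)"
  using assms(2)
proof (induction ws arbitrary: x)
  case (Cons w ws)
  have "frechet_derivative (iter_deriv ws (\<lambda>x. \<Sum>i\<in>I. f i x)) (at x) w
      = pdir w (\<lambda>x. \<Sum>i\<in>I. iter_deriv ws (f i) x) x"
    using frechet_derivative_cong_open[OF assms(1) Cons.prems Cons.IH] by simp
  also have "\<dots> = (\<Sum>i\<in>I. pdir w (iter_deriv ws (f i)) x)"
    by (rule pdir_sum) (use assms(3) Cons.prems in \<open>auto simp: smooth_on_def\<close>)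
  finally show ?case by simp
qed simp

lemma iter_deriv_cmult:
  fixes f :: "'b::real_normed_vector \<Rightarrow> 'c::real_normed_algebra"
  assumes "open S" "x \<in> S" "smooth_on S f"
  shows "iter_deriv ws (\<lambda>x. c * f x) x = c * iter_deriv ws f x"
  using assms(2)
proof (induction ws arbitrary: x)
  case (Cons w ws)
  have "frechet_derivative (iter_deriv ws (\<lambda>x. c * f x)) (at x) w
      = pdir w (\<lambda>x. c * iter_deriv ws f x) x"
    using frechet_derivative_cong_open[OF assms(1) Cons.prems Cons.IH] by simp
  also have "\<dots> = c * pdir w (iter_deriv ws f) x"
    by (rule pdir_cmult) (use assms(3) Cons.prems in \<open>auto simp: smooth_on_def\<close>)
  finally show ?case by simp
qed simp

subsection \<open>Symmetry of second derivatives\<close>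

lemma line_has_real_derivative:
  fixes f :: "'b::real_normed_vector \<Rightarrow> real"
  assumes "f differentiable (at (y + s *\<^sub>R v))"
  shows "((\<lambda>s. f (y + s *\<^sub>R v)) has_real_derivative pdir v f (y + s *\<^sub>R v)) (at s)"
proof -
  have 1: "((\<lambda>s. y + s *\<^sub>R v) has_derivative (\<lambda>s. s *\<^sub>R v)) (at s)"
    by (auto intro!: derivative_eq_intros)
  have "(f has_derivative frechet_derivative f (at (y + s *\<^sub>R v))) (at (y + s *\<^sub>R v))"
    using assms frechet_derivative_works by blast
  from diff_chain_at[OF 1 this]
  have "((\<lambda>s. f (y + s *\<^sub>R v)) has_derivative (\<lambda>t. frechet_derivative f (at (y + s *\<^sub>R v)) (t *\<^sub>R v))) (at s)"
    by (simp add: o_def)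
  moreover have "frechet_derivative f (at (y + s *\<^sub>R v)) (t *\<^sub>R v) = pdir v f (y + s *\<^sub>R v) * t" for t
    using linear_frechet_derivative[OF assms] by (simp add: linear_cmul)
  ultimately show ?thesis unfolding has_field_derivative_def by simp
qed

text \<open>The mean value theorem is applied twice: along \<open>v\<close> to the increment of
  \<open>f\<close> in the direction \<open>w\<close>, then along \<open>w\<close> to the derivative
  of \<open>f\<close> in the direction \<open>v\<close>.\<close>

lemma second_difference_mvt:
  fixes f :: "'b::real_normed_vector \<Rightarrow> real"
  assumes S: "smooth_on S f" and t: "t > 0"
    and sub: "\<And>s r. 0 \<le> s \<Longrightarrow> s \<le> t \<Longrightarrow> 0 \<le> r \<Longrightarrow> r \<le> t \<Longrightarrow> x + s *\<^sub>R v + r *\<^sub>R w \<in> S"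
  shows "\<exists>s r. 0 < s \<and> s < t \<and> 0 < r \<and> r < t \<and>
     f (x + t *\<^sub>R v + t *\<^sub>R w) - f (x + t *\<^sub>R v) - f (x + t *\<^sub>R w) + f x
       = t * t * pdir w (pdir v f) (x + s *\<^sub>R v + r *\<^sub>R w)"
proof -
  have diff: "f differentiable (at (x + s *\<^sub>R v + r *\<^sub>R w))"
    "pdir v f differentiable (at (x + s *\<^sub>R v + r *\<^sub>R w))"
    if "0 \<le> s" "s \<le> t" "0 \<le> r" "r \<le> t" for s r
    using smooth_on_differentiable[OF S] smooth_on_differentiable[OF smooth_on_pdir[OF S]] sub that by blast+
  let ?p = "\<lambda>s. f ((x + t *\<^sub>R w) + s *\<^sub>R v) - f (x + s *\<^sub>R v)"
  have "(?p has_real_derivative pdir v f ((x + t *\<^sub>R w) + s *\<^sub>R v) - pdir v f (x + s *\<^sub>R v)) (at s)"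
    if "0 \<le> s" "s \<le> t" for s
    using that t diff(1)[of s t] diff(1)[of s 0]
    by (intro DERIV_diff line_has_real_derivative) (auto simp: algebra_simps)
  from MVT2[OF t this]
  obtain s where s: "0 < s" "s < t"
     "?p t - ?p 0 = t * (pdir v f ((x + t *\<^sub>R w) + s *\<^sub>R v) - pdir v f (x + s *\<^sub>R v))"
    by auto
  have "((\<lambda>r. pdir v f ((x + s *\<^sub>R v) + r *\<^sub>R w)) has_real_derivative
        pdir w (pdir v f) ((x + s *\<^sub>R v) + r *\<^sub>R w)) (at r)"
    if "0 \<le> r" "r \<le> t" for r
    using that s diff(2)[of s r]
    by (intro line_has_real_derivative) (auto simp: algebra_simps)
  from MVT2[OF t this]
  obtain r where r: "0 < r" "r < t"
     "pdir v f ((x + s *\<^sub>R v) + t *\<^sub>R w) - pdir v f (x + s *\<^sub>R v) = t * pdir w (pdir v f) ((x + s *\<^sub>R v) + r *\<^sub>R w)"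
    by auto
  show ?thesis
    using s r by (intro exI[of _ s] exI[of _ r]) (simp add: algebra_simps)
qed

text \<open>The intermediate points of \<open>second_difference_mvt\<close> shrink to
  \<open>x\<close>, where the mixed derivative is continuous. The second difference is symmetric in
  \<open>v\<close> and \<open>w\<close>, so uniqueness of the limit gives the symmetry of second
  derivatives.\<close>

lemma second_difference_tendsto:
  fixes f :: "'b::real_normed_vector \<Rightarrow> real"
  assumes "open S" "x \<in> S" and S: "smooth_on S f"
  shows "((\<lambda>t. (f (x + t *\<^sub>R v + t *\<^sub>R w) - f (x + t *\<^sub>R v) - f (x + t *\<^sub>R w) + f x) / (t * t))
    \<longlongrightarrow> pdir w (pdir v f) x) (at_right 0)"
proof (rule tendstoI)
  fix e :: real assume e: "e > 0"
  have "isCont (pdir w (pdir v f)) x"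
    using smooth_on_continuous_on[OF smooth_on_pdir[OF smooth_on_pdir[OF S]]] assms continuous_on_eq_continuous_at by blast
  then obtain d1 where d1: "d1 > 0" "\<And>y. dist y x < d1 \<Longrightarrow> dist (pdir w (pdir v f) y) (pdir w (pdir v f) x) < e"
    using e unfolding continuous_at_eps_delta by (metis)
  obtain d2 where d2: "d2 > 0" "ball x d2 \<subseteq> S" using assms openE by blast
  \<comment> \<open>Keeps all intermediate points in both balls as long as both step lengths stay
    below \<open>d\<close>; the summand 1 keeps the denominator positive when \<open>v\<close> and
    \<open>w\<close> vanish.\<close>
  define d where "d = min d1 d2 / (norm v + norm w + 1)"
  have nw: "norm v + norm w + 1 > 0" by (smt (verit) norm_ge_zero)
  have dpos: "d > 0" unfolding d_def using d1 d2 nw by simp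
  have near: "dist (x + s *\<^sub>R v + r *\<^sub>R w) x < min d1 d2"
    if "0 \<le> s" "s \<le> t" "0 \<le> r" "r \<le> t" "t < d" for s r t
  proof -
    have "dist (x + s *\<^sub>R v + r *\<^sub>R w) x = norm (s *\<^sub>R v + r *\<^sub>R w)" by (simp add: dist_norm)
    also have "\<dots> \<le> s * norm v + r * norm w"
      using norm_triangle_ineq[of "s *\<^sub>R v" "r *\<^sub>R w"] that by simp
    also have "\<dots> \<le> t * norm v + t * norm w" using that by (intro add_mono mult_right_mono) auto
    also have "\<dots> \<le> t * (norm v + norm w + 1)" using that by (simp add: algebra_simps)
    also have "\<dots> < d * (norm v + norm w + 1)" using that nw by (intro mult_strict_right_mono) auto
    also have "\<dots> = min d1 d2" unfolding d_def using nw by simp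
    finally show ?thesis .
  qed
  show "\<forall>\<^sub>F t in at_right 0. dist ((f (x + t *\<^sub>R v + t *\<^sub>R w) - f (x + t *\<^sub>R v) - f (x + t *\<^sub>R w) + f x) / (t * t))
     (pdir w (pdir v f) x) < e"
    unfolding eventually_at_right_field
  proof (intro exI[of _ d] conjI dpos allI impI)
    fix t :: real assume t: "0 < t" "t < d"
    have "\<exists>s r. 0 < s \<and> s < t \<and> 0 < r \<and> r < t \<and>
     f (x + t *\<^sub>R v + t *\<^sub>R w) - f (x + t *\<^sub>R v) - f (x + t *\<^sub>R w) + f x
       = t * t * pdir w (pdir v f) (x + s *\<^sub>R v + r *\<^sub>R w)"
    proof (rule second_difference_mvt[OF S t(1)])
      fix s r assume "0 \<le> s" "s \<le> t" "0 \<le> r" "r \<le> t"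
      then have "dist (x + s *\<^sub>R v + r *\<^sub>R w) x < d2" using near[of s t r] t by simp
      then show "x + s *\<^sub>R v + r *\<^sub>R w \<in> S" using d2 by (auto simp: dist_commute)
    qed
    then obtain s r where sr: "0 < s" "s < t" "0 < r" "r < t"
      "(f (x + t *\<^sub>R v + t *\<^sub>R w) - f (x + t *\<^sub>R v) - f (x + t *\<^sub>R w) + f x)
         = t * t * pdir w (pdir v f) (x + s *\<^sub>R v + r *\<^sub>R w)"
      by blast
    show "dist ((f (x + t *\<^sub>R v + t *\<^sub>R w) - f (x + t *\<^sub>R v) - f (x + t *\<^sub>R w) + f x) / (t * t))
     (pdir w (pdir v f) x) < e"
      unfolding sr(5) using d1(2)[of "x + s *\<^sub>R v + r *\<^sub>R w"] near[of s t r] sr t by simp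
  qed
qed

lemma pdir_commute_real:
  fixes f :: "'b::real_normed_vector \<Rightarrow> real"
  assumes "open S" "x \<in> S" "smooth_on S f"
  shows "pdir w (pdir v f) x = pdir v (pdir w f) x"
proof (rule tendsto_unique[OF _ second_difference_tendsto[OF assms]])
  show "((\<lambda>t. (f (x + t *\<^sub>R v + t *\<^sub>R w) - f (x + t *\<^sub>R v) - f (x + t *\<^sub>R w) + f x) / (t * t))
    \<longlongrightarrow> pdir v (pdir w f) x) (at_right 0)"
    using second_difference_tendsto[OF assms, of w v] by (simp add: algebra_simps)
qed simp

text \<open>The mean value theorem concerns real functions, so the real and imaginary parts are
  treated separately.\<close>

lemma pdir_commute:
  fixes f :: "'b::real_normed_vector \<Rightarrow> complex"
  assumes "open S" "x \<in> S" "smooth_on S f"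
  shows "pdir w (pdir v f) x = pdir v (pdir w f) x"
proof -
  have "h (pdir w (pdir v f) x) = h (pdir v (pdir w f) x)" if h: "bounded_linear h" for h :: "complex \<Rightarrow> real"
  proof -
    have *: "h (pdir w (pdir v f) x) = pdir w (pdir v (\<lambda>x. h (f x))) x" for v w
    proof -
      have "pdir w (pdir v (\<lambda>x. h (f x))) x = pdir w (\<lambda>x. h (pdir v f x)) x"
        using pdir_bounded_linear[OF h smooth_on_differentiable[OF assms(3)]]
        by (subst frechet_derivative_cong_open[OF assms(1,2)]) auto
      also have "\<dots> = h (pdir w (pdir v f) x)"
        using pdir_bounded_linear[OF h smooth_on_differentiable[OF smooth_on_pdir[OF assms(3)] assms(2)]] by simp
      finally show ?thesis by simp
    qed
    show ?thesis unfolding *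
      by (rule pdir_commute_real[OF assms(1,2) smooth_on_bounded_linear[OF assms(1) h assms(3)]])
  qed
  from this[OF bounded_linear_Re] this[OF bounded_linear_Im] show ?thesis by (rule complex_eqI)
qed

section \<open>Exterior algebra of functions on lists of vectors\<close>

text \<open>The value of \<open>wedge\<close> at one point of one chart. Freed from chart and point,
  it is accessible to induction on the argument list.\<close>

definition lwedge :: "('v list \<Rightarrow> complex) \<Rightarrow> ('v list \<Rightarrow> complex) \<Rightarrow> 'v list \<Rightarrow> complex" where
  "lwedge \<beta> \<gamma> vs = (\<Sum>I\<in>Pow {..<length vs}.
     shuffle_sign (length vs) I * \<beta> (nths vs I) * \<gamma> (nths vs ({..<length vs} - I)))"

text \<open>The degree involution. It lets the graded sign rules be stated for forms of mixed
  degree.\<close>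

definition lhat :: "('v list \<Rightarrow> complex) \<Rightarrow> 'v list \<Rightarrow> complex" where
  "lhat \<beta> vs = (-1) ^ length vs * \<beta> vs"

text \<open>The interior product with \<open>v\<close>.\<close>

definition lins :: "'v \<Rightarrow> ('v list \<Rightarrow> complex) \<Rightarrow> 'v list \<Rightarrow> complex" where
  "lins v \<beta> vs = \<beta> (v # vs)"

definition even_fun :: "('v list \<Rightarrow> complex) \<Rightarrow> bool" where
  "even_fun \<beta> \<longleftrightarrow> (\<forall>vs. odd (length vs) \<longrightarrow> \<beta> vs = 0)"

definition odd_fun :: "('v list \<Rightarrow> complex) \<Rightarrow> bool" where
  "odd_fun \<beta> \<longleftrightarrow> (\<forall>vs. even (length vs) \<longrightarrow> \<beta> vs = 0)"

lemma wedge_lwedge: "wedge \<omega> \<eta> c p = lwedge (\<omega> c p) (\<eta> c p)"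
  unfolding wedge_def lwedge_def by (rule ext) simp

lemma lwedge_Nil [simp]: "lwedge \<beta> \<gamma> [] = \<beta> [] * \<gamma> []"
  by (simp add: lwedge_def shuffle_sign_def)

text \<open>Position 0, when it belongs to the first block, has nothing before it and adds no
  inversion.\<close>

lemma shuffle_sign_insert:
  "shuffle_sign (Suc m) (insert 0 (Suc ` J)) = shuffle_sign m J"
proof -
  have "{(i, j). i \<in> insert 0 (Suc ` J) \<and> j \<in> {..<Suc m} - insert 0 (Suc ` J) \<and> j < i}
      = map_prod Suc Suc ` {(i, j). i \<in> J \<and> j \<in> {..<m} - J \<and> j < i}" (is "?L = ?R")
  proof
    show "?L \<subseteq> ?R"
    proof
      fix x assume "x \<in> ?L"
      then obtain i j where x: "x = (i, j)" "i \<in> insert 0 (Suc ` J)" "j < Suc m"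
        "j \<notin> insert 0 (Suc ` J)" "j < i" by auto
      then obtain i' j' where "i = Suc i'" "i' \<in> J" "j = Suc j'"
        by (cases j) auto
      then show "x \<in> ?R" using x by (auto intro!: image_eqI[of _ _ "(i', j')"])
    qed
  qed auto
  moreover have "inj (map_prod Suc Suc)" by (intro prod.inj_map) auto
  ultimately show ?thesis unfolding shuffle_sign_def
    by (simp add: card_image inj_on_subset)
qed

text \<open>Position 0, when it is left to the second block, is passed by every element of the first
  one. The resulting sign is what \<open>lhat\<close> puts on the first factor in
  \<open>lwedge_Cons\<close>.\<close>

lemma shuffle_sign_Suc:
  assumes "J \<subseteq> {..<m}"
  shows "shuffle_sign (Suc m) (Suc ` J) = (-1) ^ card J * shuffle_sign m J"
proof -
  have "{(i, j). i \<in> Suc ` J \<and> j \<in> {..<Suc m} - Suc ` J \<and> j < i}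
      = map_prod Suc Suc ` {(i, j). i \<in> J \<and> j \<in> {..<m} - J \<and> j < i} \<union> (\<lambda>i. (Suc i, 0)) ` J"
    (is "?L = ?R1 \<union> ?R2")
  proof
    show "?L \<subseteq> ?R1 \<union> ?R2"
    proof
      fix x assume "x \<in> ?L"
      then obtain i j where x: "x = (Suc i, j)" "i \<in> J" "j < Suc m" "j \<notin> Suc ` J" "j < Suc i" by auto
      then show "x \<in> ?R1 \<union> ?R2"
        by (cases j) (auto intro!: image_eqI[of _ "map_prod Suc Suc" "(i, j - 1)"])
    qed
  qed auto
  moreover have "inj (map_prod Suc Suc)" by (intro prod.inj_map) auto
  then have "card ?R1 = card {(i, j). i \<in> J \<and> j \<in> {..<m} - J \<and> j < i}"
    by (simp add: card_image inj_on_subset)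
  moreover have "card ?R2 = card J" by (simp add: card_image inj_on_def)
  moreover have fin: "finite J" using assms finite_subset by blast
  have "finite {(i, j). i \<in> J \<and> j \<in> {..<m} - J \<and> j < i}"
    by (rule finite_subset[of _ "J \<times> {..<m}"]) (use fin in auto)
  then have "card (?R1 \<union> ?R2) = card ?R1 + card ?R2"
    by (intro card_Un_disjoint) (use fin in auto)
  ultimately show ?thesis unfolding shuffle_sign_def by (simp add: power_add)
qed

lemma Pow_lessThan_Suc:
  "Pow {..<Suc m} = (\<lambda>J. insert 0 (Suc ` J)) ` Pow {..<m} \<union> (\<lambda>J. Suc ` J) ` Pow {..<m}"
proof
  show "Pow {..<Suc m} \<subseteq> (\<lambda>J. insert 0 (Suc ` J)) ` Pow {..<m} \<union> (\<lambda>J. Suc ` J) ` Pow {..<m}"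
  proof
    fix I assume I: "I \<in> Pow {..<Suc m}"
    let ?J = "{j. Suc j \<in> I}"
    have J: "?J \<in> Pow {..<m}" using I by auto
    have S: "Suc ` ?J = I - {0}"
    proof (rule set_eqI)
      fix x show "x \<in> Suc ` ?J \<longleftrightarrow> x \<in> I - {0}" by (cases x) auto
    qed
    show "I \<in> (\<lambda>J. insert 0 (Suc ` J)) ` Pow {..<m} \<union> (\<lambda>J. Suc ` J) ` Pow {..<m}"
    proof (cases "0 \<in> I")
      case True
      then have "I = insert 0 (Suc ` ?J)" using S by auto
      then show ?thesis using J by blast
    next
      case False
      then have "I = Suc ` ?J" using S by auto
      then show ?thesis using J by blast
    qed
  qed
qed (auto simp: less_Suc_eq_0_disj)

text \<open>Contraction with a vector is an antiderivation. This recursion along the list of arguments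
  turns the identities of exterior algebra into inductions on lists.\<close>

lemma lwedge_Cons:
  "lwedge \<beta> \<gamma> (v # vs) = lwedge (lins v \<beta>) \<gamma> vs + lwedge (lhat \<beta>) (lins v \<gamma>) vs"
proof -
  let ?m = "length vs"
  let ?t = "\<lambda>I. shuffle_sign (Suc ?m) I * \<beta> (nths (v # vs) I) * \<gamma> (nths (v # vs) ({..<Suc ?m} - I))"
  have inj0: "inj_on (\<lambda>J. insert 0 (Suc ` J)) (Pow {..<?m})"
  proof (rule inj_onI)
    fix J K assume "insert 0 (Suc ` J) = insert 0 (Suc ` K)"
    then have "Suc ` J = Suc ` K" by auto
    then show "J = K" by (simp add: inj_image_eq_iff)
  qed
  have inj1: "inj_on (\<lambda>J. Suc ` J) (Pow {..<?m})" by (simp add: inj_on_def inj_image_eq_iff)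
  have "lwedge \<beta> \<gamma> (v # vs) = sum ?t (Pow {..<Suc ?m})"
    by (simp add: lwedge_def)
  also have "\<dots> = sum ?t ((\<lambda>J. insert 0 (Suc ` J)) ` Pow {..<?m}) + sum ?t ((\<lambda>J. Suc ` J) ` Pow {..<?m})"
    unfolding Pow_lessThan_Suc by (rule sum.union_disjoint) auto
  also have "sum ?t ((\<lambda>J. insert 0 (Suc ` J)) ` Pow {..<?m}) = lwedge (lins v \<beta>) \<gamma> vs"
    unfolding lwedge_def sum.reindex[OF inj0] o_def
  proof (rule sum.cong[OF refl])
    fix J assume "J \<in> Pow {..<?m}"
    have 1: "{j. Suc j \<in> insert 0 (Suc ` J)} = J" by auto
    have 2: "{j. Suc j \<in> {..<Suc ?m} - insert 0 (Suc ` J)} = {..<?m} - J" by auto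
    show "?t (insert 0 (Suc ` J)) = shuffle_sign ?m J * lins v \<beta> (nths vs J) * \<gamma> (nths vs ({..<?m} - J))"
      unfolding nths_Cons 1 2 by (simp add: shuffle_sign_insert lins_def)
  qed
  also have "sum ?t ((\<lambda>J. Suc ` J) ` Pow {..<?m}) = lwedge (lhat \<beta>) (lins v \<gamma>) vs"
    unfolding lwedge_def sum.reindex[OF inj1] o_def
  proof (rule sum.cong[OF refl])
    fix J assume J: "J \<in> Pow {..<?m}"
    have 1: "{j. Suc j \<in> Suc ` J} = J" by auto
    have 2: "{j. Suc j \<in> {..<Suc ?m} - Suc ` J} = {..<?m} - J" by auto
    have "{i. i < ?m \<and> i \<in> J} = J" using J by auto
    then have "length (nths vs J) = card J" by (simp add: length_nths)
    then show "?t (Suc ` J) = shuffle_sign ?m J * lhat \<beta> (nths vs J) * lins v \<gamma> (nths vs ({..<?m} - J))"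
      unfolding nths_Cons 1 2 using J by (simp add: shuffle_sign_Suc lins_def lhat_def)
  qed
  finally show ?thesis .
qed

lemma lwedge_add_left: "lwedge (\<lambda>vs. a vs + b vs) c vs = lwedge a c vs + lwedge b c vs"
  by (simp add: lwedge_def sum.distrib algebra_simps)

lemma lwedge_add_right: "lwedge a (\<lambda>vs. b vs + c vs) vs = lwedge a b vs + lwedge a c vs"
  by (simp add: lwedge_def sum.distrib algebra_simps)

lemma lwedge_diff_left: "lwedge (\<lambda>vs. a vs - b vs) c vs = lwedge a c vs - lwedge b c vs"
  by (simp add: lwedge_def sum_subtractf algebra_simps)

lemma lwedge_diff_right: "lwedge a (\<lambda>vs. b vs - c vs) vs = lwedge a b vs - lwedge a c vs"
  by (simp add: lwedge_def sum_subtractf algebra_simps)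

lemma lwedge_cmult_left: "lwedge (\<lambda>vs. z * a vs) c vs = z * lwedge a c vs"
  by (simp add: lwedge_def sum_distrib_left algebra_simps)

lemma lwedge_cmult_right: "lwedge a (\<lambda>vs. z * c vs) vs = z * lwedge a c vs"
  by (simp add: lwedge_def sum_distrib_left algebra_simps)

lemma lwedge_uminus_left: "lwedge (\<lambda>vs. - a vs) c vs = - lwedge a c vs"
  using lwedge_cmult_left[of "-1"] by simp

lemma lwedge_uminus_right: "lwedge a (\<lambda>vs. - c vs) vs = - lwedge a c vs"
  using lwedge_cmult_right[of _ "-1"] by simp

lemma lwedge_zero_left: "lwedge (\<lambda>vs. 0) c vs = 0"
  by (simp add: lwedge_def)

lemma lwedge_zero_right: "lwedge a (\<lambda>vs. 0) vs = 0"
  by (simp add: lwedge_def)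

lemma lwedge_sum_right: "lwedge c (\<lambda>vs. \<Sum>i\<in>I. a i vs) vs = (\<Sum>i\<in>I. lwedge c (a i) vs)"
  by (induction I rule: infinite_finite_induct) (simp_all add: lwedge_add_right lwedge_zero_right)

lemma lhat_lhat [simp]: "lhat (lhat a) = a"
  by (rule ext) (simp add: lhat_def flip: power_add)

lemma lins_lhat: "lins v (lhat a) = (\<lambda>vs. - lhat (lins v a) vs)"
  by (rule ext) (simp add: lins_def lhat_def)

lemma lins_lwedge: "lins v (lwedge a b) = (\<lambda>vs. lwedge (lins v a) b vs + lwedge (lhat a) (lins v b) vs)"
  by (rule ext) (simp add: lins_def[of v "lwedge a b"] lwedge_Cons)

text \<open>\<open>lhat\<close> anticommutes with contraction, so both terms of the recursion change
  their sign alike.\<close>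

lemma lhat_lwedge: "lhat (lwedge a b) = lwedge (lhat a) (lhat b)"
proof
  fix vs show "lhat (lwedge a b) vs = lwedge (lhat a) (lhat b) vs"
  proof (induction vs arbitrary: a b)
    case (Cons v vs)
    have "lhat (lwedge a b) (v # vs) = - (lhat (lwedge (lins v a) b) vs + lhat (lwedge (lhat a) (lins v b)) vs)"
      by (simp add: lhat_def lwedge_Cons algebra_simps)
    then show ?case
      by (simp add: Cons lwedge_Cons lins_lhat lwedge_uminus_left lwedge_uminus_right)
  qed (simp add: lhat_def)
qed

text \<open>Contracting either side with the head of the list gives the same three terms, one for
  each factor, with \<open>lhat\<close> on the factors to the left of the contracted one. The
  induction hypothesis is used for contracted factors, hence the arbitrary \<open>a\<close>,
  \<open>b\<close>, \<open>c\<close>.\<close>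

lemma lwedge_assoc: "lwedge (lwedge a b) c = lwedge a (lwedge b c)"
proof
  fix vs show "lwedge (lwedge a b) c vs = lwedge a (lwedge b c) vs"
    by (induction vs arbitrary: a b c)
       (simp_all add: lwedge_Cons lins_lwedge lhat_lwedge lwedge_add_left lwedge_add_right)
qed

lemma even_fun_lhat: "even_fun a \<Longrightarrow> lhat a = a"
  by (rule ext) (metis even_fun_def lhat_def mult_1 mult_zero_right neg_one_even_power)

lemma odd_fun_lhat: "odd_fun a \<Longrightarrow> lhat a = (\<lambda>vs. - a vs)"
  by (rule ext) (metis odd_fun_def lhat_def minus_zero mult_minus1 mult_zero_right neg_one_odd_power)

lemma even_fun_lins: "even_fun a \<Longrightarrow> odd_fun (lins v a)"
  by (simp add: even_fun_def odd_fun_def lins_def)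

lemma odd_fun_lins: "odd_fun a \<Longrightarrow> even_fun (lins v a)"
  by (simp add: even_fun_def odd_fun_def lins_def)

text \<open>Contraction flips the parity of the contracted factor, so the even and the odd rule are
  proved in one induction.\<close>

lemma lwedge_commute:
  "even_fun a \<Longrightarrow> lwedge a b = lwedge b a" "odd_fun a \<Longrightarrow> lwedge a b = lwedge (lhat b) a"
proof -
  have "(even_fun a \<longrightarrow> lwedge a b vs = lwedge b a vs) \<and> (odd_fun a \<longrightarrow> lwedge a b vs = lwedge (lhat b) a vs)" for vs
  proof (induction vs arbitrary: a b)
    case Nil
    then show ?case by (simp add: lhat_def)
  next
    case (Cons v vs)
    show ?case
    proof (intro conjI impI)
      assume a: "even_fun a"
      have "lwedge (lins v a) b vs = lwedge (lhat b) (lins v a) vs"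
        using Cons even_fun_lins[OF a] by blast
      moreover have "lwedge a (lins v b) vs = lwedge (lins v b) a vs"
        using Cons a by blast
      ultimately show "lwedge a b (v # vs) = lwedge b a (v # vs)"
        using a by (simp add: lwedge_Cons even_fun_lhat)
    next
      assume a: "odd_fun a"
      have "lwedge a (lins v b) vs = lwedge (lhat (lins v b)) a vs"
        using Cons a by blast
      moreover have "lwedge (lins v a) b vs = lwedge b (lins v a) vs"
        using Cons odd_fun_lins[OF a] by blast
      ultimately show "lwedge a b (v # vs) = lwedge (lhat b) a (v # vs)"
        using a by (simp add: lwedge_Cons odd_fun_lhat lins_lhat lwedge_uminus_left)
    qed
  qed
  then show "even_fun a \<Longrightarrow> lwedge a b = lwedge b a" "odd_fun a \<Longrightarrow> lwedge a b = lwedge (lhat b) a"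
    by auto
qed

lemma lwedge_map: "lwedge (\<lambda>vs. a (map L vs)) (\<lambda>vs. b (map L vs)) vs = lwedge a b (map L vs)"
  by (simp add: lwedge_def nths_map)

lemma length_nths_subset:
  assumes "I \<subseteq> {..<length vs}"
  shows "length (nths vs I) = card I"
proof -
  have "{i. i < length vs \<and> i \<in> I} = I" using assms by auto
  then show ?thesis by (simp add: length_nths)
qed

lemma length_nths_compl:
  assumes "I \<subseteq> {..<length vs}"
  shows "length (nths vs ({..<length vs} - I)) = length vs - card I"
  using assms finite_subset[OF assms] by (simp add: length_nths_subset card_Diff_subset)

text \<open>Every term splits the list into parts of lengths \<open>card I\<close> and
  \<open>length vs - card I\<close>; if the total length has the wrong parity, one of the two
  factors vanishes on its part.\<close>

lemma lwedge_parity: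
  "(even_fun a \<and> even_fun b) \<or> (odd_fun a \<and> odd_fun b) \<Longrightarrow> even_fun (lwedge a b)"
  "(even_fun a \<and> odd_fun b) \<or> (odd_fun a \<and> even_fun b) \<Longrightarrow> odd_fun (lwedge a b)"
proof -
  have 1: "card I \<le> length vs" if "I \<subseteq> {..<length vs}" for I and vs :: "'a list"
    using card_mono[OF _ that] by simp
  show "(even_fun a \<and> even_fun b) \<or> (odd_fun a \<and> odd_fun b) \<Longrightarrow> even_fun (lwedge a b)"
    unfolding even_fun_def[of "lwedge a b"] lwedge_def
  proof (intro allI impI sum.neutral ballI)
    fix vs :: "'a list" and I
    assume *: "(even_fun a \<and> even_fun b) \<or> (odd_fun a \<and> odd_fun b)" "odd (length vs)" "I \<in> Pow {..<length vs}"
    show "shuffle_sign (length vs) I * a (nths vs I) * b (nths vs ({..<length vs} - I)) = 0"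
      using * 1[of I vs] length_nths_subset[of I vs] length_nths_compl[of I vs]
      unfolding even_fun_def odd_fun_def by (cases "even (card I)") auto
  qed
  show "(even_fun a \<and> odd_fun b) \<or> (odd_fun a \<and> even_fun b) \<Longrightarrow> odd_fun (lwedge a b)"
    unfolding odd_fun_def[of "lwedge a b"] lwedge_def
  proof (intro allI impI sum.neutral ballI)
    fix vs :: "'a list" and I
    assume *: "(even_fun a \<and> odd_fun b) \<or> (odd_fun a \<and> even_fun b)" "even (length vs)" "I \<in> Pow {..<length vs}"
    show "shuffle_sign (length vs) I * a (nths vs I) * b (nths vs ({..<length vs} - I)) = 0"
      using * 1[of I vs] length_nths_subset[of I vs] length_nths_compl[of I vs]
      unfolding even_fun_def odd_fun_def by (cases "even (card I)") auto
  qed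
qed

text \<open>The signs of \<open>current_deriv\<close> disappear for currents of odd degree.\<close>

lemma odd_fun_signed_parts:
  assumes "odd_fun a"
  shows "(\<Sum>k\<le>length vs. (-1) ^ (k + 1) * lwedge a (\<lambda>us. if length us = length vs - k then b us else 0) vs)
    = lwedge a b vs"
proof -
  let ?m = "length vs"
  let ?s = "\<lambda>I. shuffle_sign ?m I * a (nths vs I)"
  have "(\<Sum>k\<le>?m. (-1) ^ (k + 1) * lwedge a (\<lambda>us. if length us = ?m - k then b us else 0) vs)
     = (\<Sum>k\<le>?m. \<Sum>I\<in>Pow {..<?m}. (-1) ^ (k + 1) * (?s I *
         (if length (nths vs ({..<?m} - I)) = ?m - k then b (nths vs ({..<?m} - I)) else 0)))"
    by (simp add: lwedge_def sum_distrib_left)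
  also have "\<dots> = (\<Sum>I\<in>Pow {..<?m}. \<Sum>k\<le>?m. (-1) ^ (k + 1) * (?s I *
         (if length (nths vs ({..<?m} - I)) = ?m - k then b (nths vs ({..<?m} - I)) else 0)))"
    by (rule sum.swap)
  also have "\<dots> = (\<Sum>I\<in>Pow {..<?m}. ?s I * b (nths vs ({..<?m} - I)))"
  proof (rule sum.cong[OF refl])
    fix I assume I: "I \<in> Pow {..<?m}"
    have le: "card I \<le> ?m" using I card_mono[of "{..<?m}" I] by auto
    have eq: "(length (nths vs ({..<?m} - I)) = ?m - k) = (k = card I)" if "k \<le> ?m" for k
      using I le that by (subst length_nths_compl) auto
    have "(\<Sum>k\<le>?m. (-1) ^ (k + 1) * (?s I *
         (if length (nths vs ({..<?m} - I)) = ?m - k then b (nths vs ({..<?m} - I)) else 0)))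
       = (\<Sum>k\<le>?m. if k = card I then (-1) ^ (card I + 1) * (?s I * b (nths vs ({..<?m} - I))) else 0)"
      by (rule sum.cong[OF refl]) (use eq in auto)
    also have "\<dots> = (-1) ^ (card I + 1) * (?s I * b (nths vs ({..<?m} - I)))"
      using le by simp
    also have "\<dots> = ?s I * b (nths vs ({..<?m} - I))"
    proof (cases "even (card I)")
      case True
      then have "a (nths vs I) = 0" using assms I length_nths_subset[of I vs] by (auto simp: odd_fun_def)
      then show ?thesis by simp
    qed simp
    finally show "(\<Sum>k\<le>?m. (-1) ^ (k + 1) * (?s I *
         (if length (nths vs ({..<?m} - I)) = ?m - k then b (nths vs ({..<?m} - I)) else 0)))
       = ?s I * b (nths vs ({..<?m} - I))" .
  qed
  finally show ?thesis by (simp add: lwedge_def)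
qed

subsection \<open>Alternating functions\<close>

lemma alternating_linear: "alternating \<beta> \<Longrightarrow> linear (\<lambda>v. \<beta> (us @ v # ws))"
  by (simp add: alternating_def)

lemma alternating_zero: "alternating \<beta> \<Longrightarrow> \<beta> (us @ v # vs @ v # ws) = 0"
  by (simp add: alternating_def)

text \<open>Polarisation: expand the zero value at two adjacent arguments \<open>a + b\<close>.
  Repetitions are assumed to be adjacent because \<open>alternatingI_adjacent\<close> rests on this
  lemma.\<close>

lemma alternating_swap:
  assumes lin: "\<And>us ws. linear (\<lambda>v. \<beta> (us @ v # ws))"
    and adj: "\<And>us v ws. \<beta> (us @ v # v # ws) = 0"
  shows "\<beta> (us @ a # b # ws) = - \<beta> (us @ b # a # ws)"
proof -
  have 1: "\<beta> (us @ (a + b) # w # ws) = \<beta> (us @ a # w # ws) + \<beta> (us @ b # w # ws)" for w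
    using linear_add[OF lin] by blast
  have 2: "\<beta> (us @ w # (a + b) # ws) = \<beta> (us @ w # a # ws) + \<beta> (us @ w # b # ws)" for w
    using linear_add[OF lin[of "us @ [w]"]] by simp
  have "0 = \<beta> (us @ (a + b) # (a + b) # ws)" by (simp add: adj)
  also have "\<dots> = \<beta> (us @ a # b # ws) + \<beta> (us @ b # a # ws)"
    unfolding 1 2 by (simp add: adj)
  finally show ?thesis by (simp add: eq_neg_iff_add_eq_0)
qed

text \<open>A transposition brings two equal arguments one place closer at the cost of a sign.
  Adjacent repetitions are what the recursions on the head of a list can test.\<close>

lemma alternatingI_adjacent:
  assumes lin: "\<And>us ws. linear (\<lambda>v. \<beta> (us @ v # ws))"
    and adj: "\<And>us v ws. \<beta> (us @ v # v # ws) = 0"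
  shows "alternating \<beta>"
proof -
  have "\<beta> (us @ v # vs @ v # ws) = 0" for us v vs ws
  proof (induction vs arbitrary: us)
    case (Cons x vs)
    have "\<beta> (us @ v # (x # vs) @ v # ws) = - \<beta> ((us @ [x]) @ v # vs @ v # ws)"
      using alternating_swap[OF assms, of us v x "vs @ v # ws"] by simp
    then show ?case using Cons[of "us @ [x]"] by simp
  qed (simp add: adj)
  then show ?thesis unfolding alternating_def using lin by blast
qed

lemma alternating_lins: "alternating \<beta> \<Longrightarrow> alternating (lins v \<beta>)"
  using alternating_linear[of \<beta> "v # _"] alternating_zero[of \<beta> "v # _"]
  by (simp add: alternating_def lins_def)

lemma linear_cmult_complex: "linear f \<Longrightarrow> linear (\<lambda>v. z * f v :: complex)"
  by (simp add: linear_iff algebra_simps)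

lemma alternating_cmult: "alternating \<beta> \<Longrightarrow> alternating (\<lambda>vs. z * \<beta> vs)"
  unfolding alternating_def by (simp add: linear_cmult_complex)

lemma alternating_add: "alternating \<beta> \<Longrightarrow> alternating \<gamma> \<Longrightarrow> alternating (\<lambda>vs. \<beta> vs + \<gamma> vs)"
  unfolding alternating_def by (simp add: linear_compose_add)

lemma alternating_diff: "alternating \<beta> \<Longrightarrow> alternating \<gamma> \<Longrightarrow> alternating (\<lambda>vs. \<beta> vs - \<gamma> vs)"
  unfolding alternating_def by (simp add: linear_compose_sub)

lemma alternating_0: "alternating (\<lambda>vs. 0)"
  unfolding alternating_def by (simp add: linear_iff)

lemma alternating_sum: "(\<And>i. i \<in> I \<Longrightarrow> alternating (\<beta> i)) \<Longrightarrow> alternating (\<lambda>vs. \<Sum>i\<in>I. \<beta> i vs)"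
  by (induction I rule: infinite_finite_induct) (simp_all add: alternating_0 alternating_add)

text \<open>The sign depends on the length only, so it is a constant factor in each slot.\<close>

lemma alternating_lhat: "alternating \<beta> \<Longrightarrow> alternating (lhat \<beta>)"
proof -
  assume a: "alternating \<beta>"
  have "lhat \<beta> (us @ v # ws) = (-1) ^ Suc (length us + length ws) * \<beta> (us @ v # ws)" for us v ws
    by (simp add: lhat_def)
  then have "linear (\<lambda>v. lhat \<beta> (us @ v # ws))" for us ws
    using linear_cmult_complex[OF alternating_linear[OF a]] by presburger
  moreover have "lhat \<beta> (us @ v # vs @ v # ws) = 0" for us v vs ws
    using alternating_zero[OF a] by (simp add: lhat_def)
  ultimately show "alternating (lhat \<beta>)" by (simp add: alternating_def)
qed

lemma alternating_if_length: "alternating \<beta> \<Longrightarrow> alternating (\<lambda>vs. if length vs = k then \<beta> vs else 0)"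
proof -
  assume a: "alternating \<beta>"
  have "linear (\<lambda>v. if length (us @ v # ws) = k then \<beta> (us @ v # ws) else 0)" for us ws
    using alternating_linear[OF a] by (cases "length us + Suc (length ws) = k") (simp_all add: linear_zero)
  then show ?thesis using alternating_zero[OF a] by (simp add: alternating_def)
qed

lemma alternating_map:
  assumes "alternating \<beta>" "linear L"
  shows "alternating (\<lambda>vs. \<beta> (map L vs))"
  unfolding alternating_def
proof (intro conjI allI)
  fix us ws :: "'b list"
  show "linear (\<lambda>v. \<beta> (map L (us @ v # ws)))"
    using linear_compose[OF assms(2) alternating_linear[OF assms(1)]] by (simp add: o_def)
next
  fix us v vs ws show "\<beta> (map L (us @ v # vs @ v # ws)) = 0"
    using alternating_zero[OF assms(1)] by simp
qed

text \<open>Induction on \<open>us\<close> moves the slot in question to the head of the list.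
  There, linearity is that of contraction; for a repeated vector the double contractions vanish and
  the two mixed terms have opposite signs.\<close>

lemma alternating_lwedge:
  assumes "alternating a" "alternating b"
  shows "alternating (lwedge a b)"
proof (rule alternatingI_adjacent)
  fix us ws
  show "linear (\<lambda>v. lwedge a b (us @ v # ws))"
    using assms
  proof (induction us arbitrary: a b)
    case Nil
    have 1: "lins (x + y) b = (\<lambda>vs. lins x b vs + lins y b vs)" "lins (r *\<^sub>R x) b = (\<lambda>vs. of_real r * lins x b vs)"
      if "alternating b" for b :: "'a list \<Rightarrow> complex" and x y r
      using linear_add[OF alternating_linear[OF that, of "[]"]] linear_cmul[OF alternating_linear[OF that, of "[]"]]
      by (auto simp: fun_eq_iff lins_def scaleR_conv_of_real)
    show ?case
      by (rule linearI) (simp_all add: lwedge_Cons 1 Nil lwedge_add_left lwedge_add_right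
          lwedge_cmult_left lwedge_cmult_right scaleR_conv_of_real algebra_simps)
  next
    case (Cons u us)
    then show ?case
      by (simp add: lwedge_Cons linear_compose_add alternating_lins alternating_lhat)
  qed
next
  fix us v ws
  show "lwedge a b (us @ v # v # ws) = 0"
    using assms
  proof (induction us arbitrary: a b)
    case Nil
    have 0: "lins v (lins v a) = (\<lambda>vs. 0)" if "alternating a" for a
      using alternating_zero[OF that, of "[]" v "[]"] by (auto simp: fun_eq_iff lins_def)
    show ?case
      by (simp add: lwedge_Cons 0 Nil lins_lhat lwedge_uminus_left lwedge_zero_left lwedge_zero_right)
  next
    case (Cons u us)
    then show ?case by (simp add: lwedge_Cons alternating_lins alternating_lhat)
  qed
qed

lemma lins_commute:
  assumes "alternating a"
  shows "lins v (lins w a) = (\<lambda>vs. - lins w (lins v a) vs)"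
proof
  fix vs
  show "lins v (lins w a) vs = - lins w (lins v a) vs"
    using alternating_swap[of a "[]" w v vs] alternating_linear[OF assms] alternating_zero[OF assms, of _ _ "[]"]
    by (simp add: lins_def)
qed

subsection \<open>Powers\<close>

definition lone :: "'v list \<Rightarrow> complex" where
  "lone vs = (if vs = [] then 1 else 0)"

primrec lpow :: "('v list \<Rightarrow> complex) \<Rightarrow> nat \<Rightarrow> 'v list \<Rightarrow> complex" where
  "lpow a 0 = lone"
| "lpow a (Suc k) = lwedge a (lpow a k)"

lemma form_power_lpow: "form_power \<omega> k c p = lpow (\<omega> c p) k"
  by (induction k) (simp_all add: form_one_def lone_def[abs_def] wedge_lwedge)

lemma even_fun_lone: "even_fun lone"
  by (auto simp: even_fun_def lone_def)

lemma even_fun_lpow: "even_fun a \<Longrightarrow> even_fun (lpow a k)"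
  by (induction k) (auto simp: even_fun_lone lwedge_parity)

lemma lwedge_lone_left: "lwedge lone a = a"
proof
  fix vs show "lwedge lone a vs = a vs"
  proof (induction vs arbitrary: a)
    case (Cons v vs)
    have "lins v lone = (\<lambda>vs. 0)" by (auto simp: fun_eq_iff lins_def lone_def)
    then show ?case using Cons
      by (simp add: lwedge_Cons even_fun_lhat[OF even_fun_lone] lwedge_zero_left lins_def)
  qed (simp add: lone_def)
qed

lemma lwedge_lone_right: "lwedge a lone = a"
  using lwedge_commute(1)[OF even_fun_lone] lwedge_lone_left by metis

lemma alternating_lone: "alternating lone"
  by (auto simp: alternating_def lone_def linear_iff)

section \<open>The exterior derivative in coordinates\<close>

text \<open>The coordinate expression of \<open>ext_deriv\<close>, separated from charts so that the
  rules of calculus are proved on open sets of a vector space.\<close>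

definition ld :: "('v::real_normed_vector \<Rightarrow> 'v list \<Rightarrow> complex) \<Rightarrow> 'v \<Rightarrow> 'v list \<Rightarrow> complex" where
  "ld \<omega> x vs = (\<Sum>i<length vs. (-1) ^ i *
     frechet_derivative (\<lambda>y. \<omega> y (take i vs @ drop (Suc i) vs)) (at x) (vs ! i))"

definition fsmooth :: "'v::real_normed_vector set \<Rightarrow> ('v \<Rightarrow> 'w list \<Rightarrow> complex) \<Rightarrow> bool" where
  "fsmooth S \<omega> \<longleftrightarrow> (\<forall>vs. smooth_on S (\<lambda>x. \<omega> x vs))"

lemma fsmoothD: "fsmooth S \<omega> \<Longrightarrow> smooth_on S (\<lambda>x. \<omega> x vs)"
  by (simp add: fsmooth_def)

lemma fsmooth_cong:
  assumes "open S" "fsmooth S \<eta>" "\<And>x vs. x \<in> S \<Longrightarrow> \<omega> x vs = \<eta> x vs"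
  shows "fsmooth S \<omega>"
  unfolding fsmooth_def
proof
  fix vs show "smooth_on S (\<lambda>x. \<omega> x vs)"
    using smooth_on_cong[OF assms(1), of "\<lambda>x. \<omega> x vs" "\<lambda>x. \<eta> x vs"] assms(3) fsmoothD[OF assms(2)]
    by simp
qed

lemma fsmooth_subset: "fsmooth S \<omega> \<Longrightarrow> T \<subseteq> S \<Longrightarrow> fsmooth T \<omega>"
  unfolding fsmooth_def using smooth_on_subset by blast

lemma fsmooth_differentiable: "fsmooth S \<omega> \<Longrightarrow> x \<in> S \<Longrightarrow> (\<lambda>x. \<omega> x vs) differentiable (at x)"
  using fsmoothD smooth_on_differentiable by blast

lemma ld_Nil [simp]: "ld \<omega> x [] = 0"
  by (simp add: ld_def)

text \<open>Cartan's formula for the constant vector field \<open>v\<close>: the contraction of the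
  exterior derivative is the derivative along \<open>v\<close> minus the exterior derivative of the
  contraction. It plays the role that \<open>lwedge_Cons\<close> has for products.\<close>

lemma ld_Cons: "ld \<omega> x (v # vs) = pdir v (\<lambda>y. \<omega> y vs) x - ld (\<lambda>y. lins v (\<omega> y)) x vs"
  by (simp add: ld_def sum.lessThan_Suc_shift lins_def sum_negf del: sum.lessThan_Suc)

text \<open>The exterior derivative at a nonempty list looks only at lists that are shorter by one.
  Restricting the hypothesis to this length allows a single degree to be singled out later.\<close>

lemma ld_cong_open:
  assumes "open S" "x \<in> S" "\<And>y us. y \<in> S \<Longrightarrow> length us = length vs - 1 \<Longrightarrow> \<omega> y us = \<eta> y us"
  shows "ld \<omega> x vs = ld \<eta> x vs"
  unfolding ld_def
proof (rule sum.cong[OF refl])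
  fix i assume "i \<in> {..<length vs}"
  then have "length (take i vs @ drop (Suc i) vs) = length vs - 1" by auto
  then show "(-1) ^ i * pdir (vs ! i) (\<lambda>y. \<omega> y (take i vs @ drop (Suc i) vs)) x
      = (-1) ^ i * pdir (vs ! i) (\<lambda>y. \<eta> y (take i vs @ drop (Suc i) vs)) x"
    using frechet_derivative_cong_open[OF assms(1,2)] assms(3) by (metis (no_types, lifting))
qed

lemma ld_zero:
  assumes "open S" "x \<in> S" "\<And>y us. y \<in> S \<Longrightarrow> length us = length vs - 1 \<Longrightarrow> \<omega> y us = 0"
  shows "ld \<omega> x vs = 0"
  using ld_cong_open[OF assms(1,2), of vs \<omega> "\<lambda>_ _. 0"] assms(3)
  by (simp add: ld_def frechet_derivative_const)

lemma ld_const: "ld (\<lambda>y. c) x vs = 0"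
  by (simp add: ld_def frechet_derivative_const)

lemma pdir_diff:
  assumes "f differentiable (at x)" "g differentiable (at x)"
  shows "pdir w (\<lambda>x. f x - g x) x = pdir w f x - pdir w g x"
proof -
  have "((\<lambda>x. f x - g x) has_derivative
      (\<lambda>w. frechet_derivative f (at x) w - frechet_derivative g (at x) w)) (at x)"
    using assms by (intro has_derivative_diff) (auto simp: frechet_derivative_works)
  then show ?thesis by (metis frechet_derivative_at)
qed

lemma ld_add:
  assumes "fsmooth S \<omega>" "fsmooth S \<eta>" "x \<in> S"
  shows "ld (\<lambda>y vs. \<omega> y vs + \<eta> y vs) x vs = ld \<omega> x vs + ld \<eta> x vs"
  using assms by (simp add: ld_def pdir_add fsmooth_differentiable sum.distrib algebra_simps)

lemma ld_diff:
  assumes "fsmooth S \<omega>" "fsmooth S \<eta>" "x \<in> S"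
  shows "ld (\<lambda>y vs. \<omega> y vs - \<eta> y vs) x vs = ld \<omega> x vs - ld \<eta> x vs"
  using assms by (simp add: ld_def pdir_diff fsmooth_differentiable sum_subtractf algebra_simps)

lemma ld_cmult:
  assumes "fsmooth S \<omega>" "x \<in> S"
  shows "ld (\<lambda>y vs. z * \<omega> y vs) x vs = z * ld \<omega> x vs"
  using assms by (simp add: ld_def pdir_cmult fsmooth_differentiable sum_distrib_left algebra_simps)

lemma ld_sum:
  assumes "\<And>i. i \<in> I \<Longrightarrow> fsmooth S (\<omega> i)" "x \<in> S"
  shows "ld (\<lambda>y vs. \<Sum>i\<in>I. \<omega> i y vs) x vs = (\<Sum>i\<in>I. ld (\<omega> i) x vs)"
proof -
  have "ld (\<lambda>y vs. \<Sum>i\<in>I. \<omega> i y vs) x vs = (\<Sum>j<length vs. \<Sum>i\<in>I. (-1) ^ j *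
      pdir (vs ! j) (\<lambda>y. \<omega> i y (take j vs @ drop (Suc j) vs)) x)"
    unfolding ld_def by (subst pdir_sum) (use fsmooth_differentiable[OF assms] in \<open>auto simp: sum_distrib_left\<close>)
  then show ?thesis unfolding ld_def by (subst sum.swap)
qed

lemma fsmooth_lwedge:
  assumes "open S" "fsmooth S \<omega>" "fsmooth S \<eta>"
  shows "fsmooth S (\<lambda>x. lwedge (\<omega> x) (\<eta> x))"
proof -
  have "smooth_on S (\<lambda>x. lwedge (\<omega> x) (\<eta> x) vs)" for vs
    unfolding lwedge_def
    by (intro smooth_on_sum smooth_on_mult assms(1) smooth_on_const fsmoothD[OF assms(2)] fsmoothD[OF assms(3)])
  then show ?thesis by (simp add: fsmooth_def)
qed

lemma fsmooth_lins: "fsmooth S \<omega> \<Longrightarrow> fsmooth S (\<lambda>x. lins v (\<omega> x))"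
  by (simp add: fsmooth_def lins_def)

lemma fsmooth_lhat: "open S \<Longrightarrow> fsmooth S \<omega> \<Longrightarrow> fsmooth S (\<lambda>x. lhat (\<omega> x))"
  by (simp add: fsmooth_def lhat_def smooth_on_cmult)

lemma fsmooth_ld: "open S \<Longrightarrow> fsmooth S \<omega> \<Longrightarrow> fsmooth S (ld \<omega>)"
  unfolding fsmooth_def ld_def
  by (auto intro!: smooth_on_sum smooth_on_cmult smooth_on_pdir)

lemma fsmooth_pdir: "fsmooth S \<omega> \<Longrightarrow> fsmooth S (\<lambda>x vs. pdir w (\<lambda>y. \<omega> y vs) x)"
  unfolding fsmooth_def by (auto intro!: smooth_on_pdir)

lemma fsmooth_add: "open S \<Longrightarrow> fsmooth S \<omega> \<Longrightarrow> fsmooth S \<eta> \<Longrightarrow> fsmooth S (\<lambda>x vs. \<omega> x vs + \<eta> x vs)"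
  unfolding fsmooth_def by (auto intro!: smooth_on_add)

lemma fsmooth_diff: "open S \<Longrightarrow> fsmooth S \<omega> \<Longrightarrow> fsmooth S \<eta> \<Longrightarrow> fsmooth S (\<lambda>x vs. \<omega> x vs - \<eta> x vs)"
  unfolding fsmooth_def by (auto intro!: smooth_on_diff)

lemma fsmooth_cmult: "open S \<Longrightarrow> fsmooth S \<omega> \<Longrightarrow> fsmooth S (\<lambda>x vs. z * \<omega> x vs)"
  unfolding fsmooth_def by (auto intro!: smooth_on_cmult)

lemma fsmooth_sum: "open S \<Longrightarrow> (\<And>i. i \<in> I \<Longrightarrow> fsmooth S (\<omega> i)) \<Longrightarrow> fsmooth S (\<lambda>x vs. \<Sum>i\<in>I. \<omega> i x vs)"
  unfolding fsmooth_def by (auto intro!: smooth_on_sum)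

lemma fsmooth_const: "fsmooth S (\<lambda>x. c)"
  unfolding fsmooth_def by simp

lemma fsmooth_if: "fsmooth S \<omega> \<Longrightarrow> fsmooth S (\<lambda>x vs. if P vs then \<omega> x vs else 0)"
proof -
  assume "fsmooth S \<omega>"
  then have "smooth_on S (\<lambda>x. if P vs then \<omega> x vs else 0)" for vs
    by (cases "P vs") (simp_all add: fsmoothD)
  then show ?thesis by (simp add: fsmooth_def)
qed

text \<open>This is where the symmetry of second derivatives enters the exterior calculus.\<close>

lemma pdir_ld:
  assumes "open S" "x \<in> S" "fsmooth S \<omega>"
  shows "pdir v (\<lambda>y. ld \<omega> y vs) x = ld (\<lambda>x vs. pdir v (\<lambda>y. \<omega> y vs) x) x vs"
proof -
  let ?o = "\<lambda>i y. \<omega> y (take i vs @ drop (Suc i) vs)"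
  have s: "smooth_on S (pdir w (?o i))" for w i
    by (intro smooth_on_pdir fsmoothD assms)
  have "pdir v (\<lambda>y. ld \<omega> y vs) x = (\<Sum>i<length vs. (-1) ^ i * pdir v (pdir (vs ! i) (?o i)) x)"
    unfolding ld_def
    by (subst pdir_sum)
       (auto intro!: sum.cong pdir_cmult smooth_on_differentiable[OF s assms(2)]
         smooth_on_differentiable[OF smooth_on_cmult[OF assms(1) s] assms(2)])
  also have "\<dots> = (\<Sum>i<length vs. (-1) ^ i * pdir (vs ! i) (pdir v (?o i)) x)"
    using pdir_commute[OF assms(1,2) fsmoothD[OF assms(3)]] by (intro sum.cong) (metis | simp)+
  finally show ?thesis by (simp add: ld_def)
qed

text \<open>Apply Cartan's formula twice: the terms differentiated along \<open>v\<close> cancel by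
  \<open>pdir_ld\<close>, and what remains is the claim for the contraction with
  \<open>v\<close>.\<close>

lemma ld_ld:
  assumes "open S" "x \<in> S" "fsmooth S \<omega>"
  shows "ld (ld \<omega>) x vs = 0"
  using assms(3)
proof (induction vs arbitrary: \<omega>)
  case (Cons v vs)
  let ?D = "\<lambda>x vs. pdir v (\<lambda>y. \<omega> y vs) x" and ?i = "\<lambda>y. lins v (\<omega> y)"
  have "ld (\<lambda>y. lins v (ld \<omega> y)) x vs = ld (\<lambda>y vs. ?D y vs - ld ?i y vs) x vs"
    by (simp add: lins_def[of v "ld \<omega> _", abs_def] ld_Cons)
  also have "\<dots> = ld ?D x vs - ld (ld ?i) x vs"
    by (intro ld_diff[OF _ _ assms(2)] fsmooth_pdir fsmooth_ld fsmooth_lins assms(1) Cons.prems)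
  also have "ld (ld ?i) x vs = 0" by (intro Cons.IH fsmooth_lins Cons.prems)
  finally show ?case
    by (simp add: ld_Cons[of "ld \<omega>"] pdir_ld[OF assms(1,2) Cons.prems])
qed simp

lemma pdir_lwedge:
  assumes "x \<in> S" "fsmooth S \<omega>" "fsmooth S \<eta>"
  shows "pdir v (\<lambda>y. lwedge (\<omega> y) (\<eta> y) vs) x
    = lwedge (\<lambda>vs. pdir v (\<lambda>y. \<omega> y vs) x) (\<eta> x) vs + lwedge (\<omega> x) (\<lambda>vs. pdir v (\<lambda>y. \<eta> y vs) x) vs"
proof -
  note d = fsmooth_differentiable[OF assms(2,1)] fsmooth_differentiable[OF assms(3,1)]
  show ?thesis
    unfolding lwedge_def
    by (subst pdir_sum)
       (auto simp: pdir_mult pdir_cmult d sum.distrib[symmetric] algebra_simps intro!: sum.cong)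
qed

text \<open>The exterior derivative raises the degree by one, hence it anticommutes with the degree
  involution.\<close>

lemma lhat_ld:
  assumes "x \<in> S" "fsmooth S \<omega>"
  shows "lhat (ld \<omega> x) vs = - ld (\<lambda>y. lhat (\<omega> y)) x vs"
proof -
  have "(-1) ^ length vs * ((-1) ^ i * pdir (vs ! i) (\<lambda>y. \<omega> y (take i vs @ drop (Suc i) vs)) x) =
      - ((-1) ^ i * pdir (vs ! i) (\<lambda>y. (-1) ^ length (take i vs @ drop (Suc i) vs) * \<omega> y (take i vs @ drop (Suc i) vs)) x)"
    if i: "i < length vs" for i
  proof -
    obtain m where m: "length vs = Suc m" using i by (cases "length vs") auto
    then have "length (take i vs @ drop (Suc i) vs) = m" using i by auto
    then show ?thesis
      unfolding m by (subst pdir_cmult[OF fsmooth_differentiable[OF assms(2,1)]]) simp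
  qed
  then show ?thesis
    by (simp add: lhat_def ld_def sum_distrib_left sum_negf[symmetric] del: length_append)
qed

text \<open>Leibniz' rule in mixed degree, with the sign carried by \<open>lhat\<close>. Cartan's
  formula reduces it to the product rule for the derivative along \<open>v\<close> and, since
  contraction is an antiderivation, to the same rule for contracted factors.\<close>

lemma ld_lwedge:
  assumes "open S" "x \<in> S" "fsmooth S \<omega>" "fsmooth S \<eta>"
  shows "ld (\<lambda>y. lwedge (\<omega> y) (\<eta> y)) x vs
    = lwedge (ld \<omega> x) (\<eta> x) vs + lwedge (lhat (\<omega> x)) (ld \<eta> x) vs"
  using assms(3,4)
proof (induction vs arbitrary: \<omega> \<eta>)
  case (Cons v vs)
  let ?i = "\<lambda>\<omega> y. lins v (\<omega> y)" and ?D = "\<lambda>\<omega>::'a \<Rightarrow> 'a list \<Rightarrow> complex. \<lambda>vs. pdir v (\<lambda>y. \<omega> y vs) x"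
  have sm: "fsmooth S (\<lambda>y. lwedge (?i \<omega> y) (\<eta> y))" "fsmooth S (\<lambda>y. lwedge (lhat (\<omega> y)) (?i \<eta> y))"
    by (intro fsmooth_lwedge fsmooth_lins fsmooth_lhat assms(1) Cons.prems)+
  have lin: "lins v (ld \<omega> x) = (\<lambda>vs. ?D \<omega> vs - ld (?i \<omega>) x vs)" for \<omega>
    by (simp add: lins_def[of v "ld \<omega> x", abs_def] ld_Cons)
  have hat: "lhat (ld \<omega> x) = (\<lambda>vs. - ld (\<lambda>y. lhat (\<omega> y)) x vs)"
    using lhat_ld[OF assms(2) Cons.prems(1)] by (rule ext)
  have "ld (\<lambda>y. lins v (lwedge (\<omega> y) (\<eta> y))) x vs
     = ld (\<lambda>y. lwedge (?i \<omega> y) (\<eta> y)) x vs + ld (\<lambda>y. lwedge (lhat (\<omega> y)) (?i \<eta> y)) x vs"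
    unfolding lins_lwedge by (rule ld_add[OF sm assms(2)])
  also have "\<dots> = lwedge (ld (?i \<omega>) x) (\<eta> x) vs + lwedge (lhat (?i \<omega> x)) (ld \<eta> x) vs
     + (lwedge (ld (\<lambda>y. lhat (\<omega> y)) x) (?i \<eta> x) vs + lwedge (lhat (lhat (\<omega> x))) (ld (?i \<eta>) x) vs)"
    by (intro arg_cong2[of _ _ _ _ "(+)"] Cons.IH fsmooth_lins fsmooth_lhat assms(1) Cons.prems)
  finally have 1: "ld (\<lambda>y. lins v (lwedge (\<omega> y) (\<eta> y))) x vs = \<dots>" .
  show ?case
    unfolding ld_Cons[of "\<lambda>y. lwedge (\<omega> y) (\<eta> y)"] 1 pdir_lwedge[OF assms(2) Cons.prems]
    by (simp add: lwedge_Cons lin hat lins_lhat lwedge_diff_left lwedge_diff_right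
        lwedge_uminus_left lwedge_uminus_right)
qed simp

text \<open>As for \<open>lwedge\<close>, the slot is moved to the head. For a vector
  \<open>v\<close> repeated at the head, Cartan's formula applied twice produces the same derivative
  along \<open>v\<close> with both signs, and the double contraction that remains is zero.\<close>

lemma alternating_ld:
  assumes "open S" "x \<in> S" "fsmooth S \<omega>" "\<And>y. y \<in> S \<Longrightarrow> alternating (\<omega> y)"
  shows "alternating (ld \<omega> x)"
proof (rule alternatingI_adjacent)
  fix us ws
  show "linear (\<lambda>v. ld \<omega> x (us @ v # ws))"
    using assms(3,4)
  proof (induction us arbitrary: \<omega>)
    case Nil
    have "ld (\<lambda>y. lins (v + w) (\<omega> y)) x ws = ld (\<lambda>y. lins v (\<omega> y)) x ws + ld (\<lambda>y. lins w (\<omega> y)) x ws" for v w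
    proof -
      have "ld (\<lambda>y. lins (v + w) (\<omega> y)) x ws = ld (\<lambda>y vs. lins v (\<omega> y) vs + lins w (\<omega> y) vs) x ws"
        by (rule ld_cong_open[OF assms(1,2)])
           (use linear_add[OF alternating_linear[OF Nil(2), of _ "[]"]] in \<open>simp add: lins_def\<close>)
      then show ?thesis
        by (simp add: ld_add[OF fsmooth_lins fsmooth_lins assms(2)] Nil)
    qed
    moreover have "ld (\<lambda>y. lins (r *\<^sub>R v) (\<omega> y)) x ws = r *\<^sub>R ld (\<lambda>y. lins v (\<omega> y)) x ws" for r v
    proof -
      have "ld (\<lambda>y. lins (r *\<^sub>R v) (\<omega> y)) x ws = ld (\<lambda>y vs. of_real r * lins v (\<omega> y) vs) x ws"
        by (rule ld_cong_open[OF assms(1,2)])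
           (use linear_cmul[OF alternating_linear[OF Nil(2), of _ "[]"]] in \<open>simp add: lins_def scaleR_conv_of_real\<close>)
      then show ?thesis
        by (simp add: ld_cmult[OF fsmooth_lins assms(2)] Nil scaleR_conv_of_real)
    qed
    ultimately have "linear (\<lambda>v. ld (\<lambda>y. lins v (\<omega> y)) x ws)" by (rule linearI)
    then show ?case
      using linear_frechet_derivative[OF fsmooth_differentiable[OF Nil(1) assms(2)], of ws]
      by (simp add: ld_Cons linear_compose_sub)
  next
    case (Cons u us)
    have "linear (\<lambda>v. pdir u (\<lambda>y. \<omega> y (us @ v # ws)) x)"
    proof (rule linearI)
      fix v w
      have "pdir u (\<lambda>y. \<omega> y (us @ (v + w) # ws)) x = pdir u (\<lambda>y. \<omega> y (us @ v # ws) + \<omega> y (us @ w # ws)) x"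
        using linear_add[OF alternating_linear[OF Cons.prems(2)]]
        by (subst frechet_derivative_cong_open[OF assms(1,2)]) auto
      then show "pdir u (\<lambda>y. \<omega> y (us @ (v + w) # ws)) x =
         pdir u (\<lambda>y. \<omega> y (us @ v # ws)) x + pdir u (\<lambda>y. \<omega> y (us @ w # ws)) x"
        by (simp add: pdir_add fsmooth_differentiable[OF Cons.prems(1) assms(2)])
    next
      fix r v
      have "pdir u (\<lambda>y. \<omega> y (us @ (r *\<^sub>R v) # ws)) x = pdir u (\<lambda>y. of_real r * \<omega> y (us @ v # ws)) x"
        using linear_cmul[OF alternating_linear[OF Cons.prems(2)]]
        by (subst frechet_derivative_cong_open[OF assms(1,2)]) (auto simp: scaleR_conv_of_real)
      then show "pdir u (\<lambda>y. \<omega> y (us @ (r *\<^sub>R v) # ws)) x = r *\<^sub>R pdir u (\<lambda>y. \<omega> y (us @ v # ws)) x"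
        by (simp add: pdir_cmult fsmooth_differentiable[OF Cons.prems(1) assms(2)] scaleR_conv_of_real)
    qed
    moreover have "linear (\<lambda>v. ld (\<lambda>y. lins u (\<omega> y)) x (us @ v # ws))"
      by (intro Cons.IH fsmooth_lins Cons.prems alternating_lins)
    ultimately show ?case by (simp add: ld_Cons linear_compose_sub)
  qed
next
  fix us v ws
  show "ld \<omega> x (us @ v # v # ws) = 0"
    using assms(3,4)
  proof (induction us arbitrary: \<omega>)
    case Nil
    have "ld (\<lambda>y. lins v (lins v (\<omega> y))) x ws = 0"
      by (rule ld_zero[OF assms(1,2)])
         (use alternating_zero[OF Nil(2), of _ "[]" v "[]"] in \<open>simp add: lins_def\<close>)
    then show ?case by (simp add: ld_Cons lins_def)
  next
    case (Cons u us)
    have "pdir u (\<lambda>y. \<omega> y (us @ v # v # ws)) x = pdir u (\<lambda>y. 0) x"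
      using alternating_zero[OF Cons.prems(2), of _ us v "[]" ws]
      by (subst frechet_derivative_cong_open[OF assms(1,2)]) auto
    moreover have "ld (\<lambda>y. lins u (\<omega> y)) x (us @ v # v # ws) = 0"
      by (intro Cons.IH fsmooth_lins Cons.prems alternating_lins)
    ultimately show ?case by (simp add: ld_Cons frechet_derivative_const)
  qed
qed

subsection \<open>Pullback\<close>

text \<open>The constant one-form dual to the basis vector \<open>b\<close>, a coordinate
  differential.\<close>

definition cdx :: "'v::euclidean_space \<Rightarrow> 'v list \<Rightarrow> complex" where
  "cdx b vs = (case vs of [v] \<Rightarrow> of_real (v \<bullet> b) | _ \<Rightarrow> 0)"

lemma odd_fun_cdx: "odd_fun (cdx b)"
  by (auto simp: odd_fun_def cdx_def split: list.splits)

text \<open>Euler's identity; it reduces statements about forms to forms of lower degree.\<close>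

lemma sum_cdx_lins:
  fixes a :: "'v::euclidean_space list \<Rightarrow> complex"
  assumes "alternating a"
  shows "(\<Sum>b\<in>Basis. lwedge (cdx b) (lins b a) vs) = of_nat (length vs) * a vs"
  using assms
proof (induction vs arbitrary: a)
  case Nil
  then show ?case by (simp add: cdx_def)
next
  case (Cons v vs)
  have 1: "lins v (cdx b) = (\<lambda>vs. of_real (v \<bullet> b) * lone vs)" for b
    by (auto simp: fun_eq_iff lins_def cdx_def lone_def split: list.splits)
  have "(\<Sum>b\<in>Basis. lwedge (lins v (cdx b)) (lins b a) vs) = (\<Sum>b\<in>Basis. of_real (v \<bullet> b) * a (b # vs))"
    by (simp add: 1 lwedge_cmult_left lwedge_lone_left lins_def)
  also have "\<dots> = a ((\<Sum>b\<in>Basis. (v \<bullet> b) *\<^sub>R b) # vs)"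
    using linear_sum[OF alternating_linear[OF Cons.prems, of "[]" vs], of "\<lambda>b. (v \<bullet> b) *\<^sub>R b" Basis]
      linear_cmul[OF alternating_linear[OF Cons.prems, of "[]" vs]]
    by (simp add: scaleR_conv_of_real)
  finally have 2: "(\<Sum>b\<in>Basis. lwedge (lins v (cdx b)) (lins b a) vs) = a (v # vs)"
    by (simp add: euclidean_representation)
  have "(\<Sum>b\<in>Basis. lwedge (lhat (cdx b)) (lins v (lins b a)) vs) = (\<Sum>b\<in>Basis. lwedge (cdx b) (lins b (lins v a)) vs)"
    by (simp add: odd_fun_lhat[OF odd_fun_cdx] lins_commute[OF Cons.prems, of v]
        lwedge_uminus_left lwedge_uminus_right)
  also have "\<dots> = of_nat (length vs) * a (v # vs)"
    using Cons.IH[OF alternating_lins[OF Cons.prems, of v]] by (simp add: lins_def[of v a vs])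
  finally show ?case using 2
    by (simp add: lwedge_Cons sum.distrib algebra_simps)
qed

definition lpull :: "('v::real_normed_vector \<Rightarrow> 'w::real_normed_vector) \<Rightarrow> ('w \<Rightarrow> 'w list \<Rightarrow> complex) \<Rightarrow> 'v \<Rightarrow> 'v list \<Rightarrow> complex" where
  "lpull \<tau> \<omega> x vs = \<omega> (\<tau> x) (map (frechet_derivative \<tau> (at x)) vs)"

context
  fixes \<tau> :: "'v::euclidean_space \<Rightarrow> 'w::euclidean_space" and S T
  assumes S: "open S" and T: "open T" and \<tau>: "smooth_on S \<tau>" "\<tau> ` S \<subseteq> T"
begin

text \<open>A coordinate differential pulls back to the differential of a coordinate of
  \<open>\<tau>\<close>. Hence the pullback is smooth, and closed by \<open>ld_ld\<close>.\<close>

lemma lpull_cdx: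
  assumes "x \<in> S"
  shows "lpull \<tau> (\<lambda>_. cdx b) x = ld (\<lambda>y vs. if vs = [] then of_real (\<tau> y \<bullet> b) else 0) x"
proof
  fix vs
  have "bounded_linear (\<lambda>z. complex_of_real (z \<bullet> b))"
    by (rule bounded_linear_compose[OF bounded_linear_of_real bounded_linear_inner_left])
  then have "pdir v (\<lambda>y. complex_of_real (\<tau> y \<bullet> b)) x = of_real (pdir v \<tau> x \<bullet> b)" for v
    by (rule pdir_bounded_linear[OF _ smooth_on_differentiable[OF \<tau>(1) assms]])
  moreover have "ld (\<lambda>y vs. if vs = [] then complex_of_real (\<tau> y \<bullet> b) else 0) x vs = 0" if "length vs \<noteq> 1"
  proof (cases vs)
    case (Cons v us)
    then show ?thesis using that by (intro ld_zero[OF S assms]) auto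
  qed simp
  ultimately show "lpull \<tau> (\<lambda>_. cdx b) x vs = ld (\<lambda>y vs. if vs = [] then of_real (\<tau> y \<bullet> b) else 0) x vs"
    by (cases vs; cases "tl vs") (auto simp: lpull_def cdx_def ld_Cons)
qed

lemma fsmooth_coordinate: "fsmooth S (\<lambda>y (vs::'v list). if vs = [] then complex_of_real (\<tau> y \<bullet> b) else 0)"
proof -
  have "smooth_on S (\<lambda>y. complex_of_real (\<tau> y \<bullet> b))"
    by (rule smooth_on_bounded_linear[OF S bounded_linear_compose[OF bounded_linear_of_real bounded_linear_inner_left] \<tau>(1)])
  then have "smooth_on S (\<lambda>y. if vs = [] then complex_of_real (\<tau> y \<bullet> b) else 0)" for vs :: "'v list"
    by (cases "vs = []") simp_all
  then show ?thesis by (simp add: fsmooth_def)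
qed

text \<open>Degree 0 is the chain rule. In degree \<open>Suc k\<close>, Euler's identity writes
  \<open>\<omega>\<close> through products of coordinate differentials with contractions of
  \<open>\<omega>\<close>; as the pulled back differentials are closed, Leibniz' rule reduces the
  claim to the contractions. Smoothness of the pullback is carried along because Leibniz' rule asks
  for it.\<close>

lemma lpull_degree_step:
  assumes "fsmooth T \<omega>" "\<And>y. y \<in> T \<Longrightarrow> alternating (\<omega> y)"
    and "\<And>y vs. y \<in> T \<Longrightarrow> length vs \<noteq> k \<Longrightarrow> \<omega> y vs = 0"
  shows "fsmooth S (lpull \<tau> \<omega>) \<and> (\<forall>x\<in>S. ld (lpull \<tau> \<omega>) x = lpull \<tau> (ld \<omega>) x)"
  using assms
proof (induction k arbitrary: \<omega>)
  case 0
  have eq: "lpull \<tau> \<omega> x vs = (if vs = [] then \<omega> (\<tau> x) [] else 0)" if "x \<in> S" for x vs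
    using 0(3)[of "\<tau> x"] that \<tau>(2) by (auto simp: lpull_def)
  have "smooth_on S (\<lambda>x. if vs = [] then \<omega> (\<tau> x) [] else 0)" for vs :: "'v list"
    using smooth_on_compose[OF S \<tau>(2,1) fsmoothD[OF 0(1)], of "[]"] by (cases "vs = []") simp_all
  then have "fsmooth S (\<lambda>x (vs::'v list). if vs = [] then \<omega> (\<tau> x) [] else 0)"
    by (simp add: fsmooth_def)
  then have "fsmooth S (lpull \<tau> \<omega>)"
    by (rule fsmooth_cong[OF S]) (rule eq)
  moreover have "ld (lpull \<tau> \<omega>) x vs = lpull \<tau> (ld \<omega>) x vs" if x: "x \<in> S" for x vs
  proof (cases "length vs = 1")
    case True
    then obtain v where v: "vs = [v]" by (cases vs) auto
    have "\<tau> x \<in> T" using x \<tau>(2) by auto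
    have "pdir v (\<lambda>y. \<omega> (\<tau> y) []) x = frechet_derivative (\<lambda>y. \<omega> y []) (at (\<tau> x)) (pdir v \<tau> x)"
      by (rule pdir_compose[OF smooth_on_differentiable[OF \<tau>(1) x] fsmooth_differentiable[OF 0(1) \<open>\<tau> x \<in> T\<close>]])
    then show ?thesis by (simp add: v ld_Cons lpull_def)
  next
    case False
    have "ld (lpull \<tau> \<omega>) x vs = 0"
    proof (cases "vs = []")
      case vs: False
      then have "length vs - 1 \<noteq> 0" using False by (cases vs) auto
      then show ?thesis by (intro ld_zero[OF S x]) (auto simp: eq)
    qed simp
    moreover have "ld \<omega> (\<tau> x) (map (frechet_derivative \<tau> (at x)) vs) = 0"
    proof (cases "vs = []")
      case vs: False
      then have "length vs - 1 \<noteq> 0" using False by (cases vs) auto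
      moreover have "\<tau> x \<in> T" using x \<tau>(2) by auto
      ultimately show ?thesis by (intro ld_zero[OF T] 0(3)) auto
    qed simp
    ultimately show ?thesis by (simp add: lpull_def)
  qed
  ultimately show ?case by blast
next
  case (Suc k)
  \<comment> \<open>Compensates the factor that Euler's identity produces on lists of length
    \<open>Suc k\<close>.\<close>
  let ?c = "1 / of_nat (Suc k) :: complex"
  let ?i = "\<lambda>b y. lins b (\<omega> y)" and ?x = "\<lambda>b. lpull \<tau> (\<lambda>_. cdx b)"
  have sm: "fsmooth T (?i b)" for b by (intro fsmooth_lins Suc.prems)
  have IH: "fsmooth S (lpull \<tau> (?i b)) \<and> (\<forall>x\<in>S. ld (lpull \<tau> (?i b)) x = lpull \<tau> (ld (?i b)) x)" for b
  proof (rule Suc.IH[OF sm])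
    show "lins b (\<omega> y) vs = 0" if "y \<in> T" "length vs \<noteq> k" for y vs
      using that Suc.prems(3) by (simp add: lins_def)
  qed (intro alternating_lins Suc.prems)
  have eq\<omega>: "\<omega> y vs = (\<Sum>b\<in>Basis. ?c * lwedge (cdx b) (?i b y) vs)" if "y \<in> T" for y vs
  proof -
    have "(\<Sum>b\<in>Basis. ?c * lwedge (cdx b) (?i b y) vs) = ?c * (of_nat (length vs) * \<omega> y vs)"
      by (simp only: sum_distrib_left[symmetric] sum_cdx_lins[OF Suc.prems(2)[OF that]])
    moreover have "(of_nat (Suc k) :: complex) \<noteq> 0" by (simp only: of_nat_eq_0_iff)
    ultimately show ?thesis using Suc.prems(3)[OF that, of vs]
      by (cases "length vs = Suc k") (auto simp del: of_nat_Suc)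
  qed
  have eqp: "lpull \<tau> \<omega> x vs = (\<Sum>b\<in>Basis. ?c * lwedge (?x b x) (lpull \<tau> (?i b) x) vs)" if "x \<in> S" for x vs
  proof -
    have "\<tau> x \<in> T" using that \<tau>(2) by auto
    then show ?thesis
      by (simp add: lpull_def[abs_def] lwedge_map eq\<omega>)
  qed
  have smx: "fsmooth S (?x b)" for b
    by (rule fsmooth_cong[OF S fsmooth_ld[OF S fsmooth_coordinate[of b]]]) (simp add: lpull_cdx)
  have smw: "fsmooth S (\<lambda>x. lwedge (?x b x) (lpull \<tau> (?i b) x))" for b
    using fsmooth_lwedge[OF S smx] IH by blast
  have smc: "fsmooth S (\<lambda>x vs. ?c * lwedge (?x b x) (lpull \<tau> (?i b) x) vs)" for b
    by (rule fsmooth_cmult[OF S smw])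
  have 1: "fsmooth S (lpull \<tau> \<omega>)"
    by (rule fsmooth_cong[OF S fsmooth_sum[OF S smc]]) (rule eqp)
  have 2: "ld (lpull \<tau> \<omega>) x vs = lpull \<tau> (ld \<omega>) x vs" if x: "x \<in> S" for x vs
  proof -
    let ?vs = "map (frechet_derivative \<tau> (at x)) vs"
    have x': "\<tau> x \<in> T" using x \<tau>(2) by auto
    have odd: "lhat (?x b x) = (\<lambda>vs. - ?x b x vs)" for b
      by (intro odd_fun_lhat) (use odd_fun_cdx[of b] in \<open>auto simp: odd_fun_def lpull_def\<close>)
    have closed: "ld (?x b) x = (\<lambda>vs. 0)" for b
    proof
      fix vs
      have "ld (?x b) x vs = ld (ld (\<lambda>y vs. if vs = [] then of_real (\<tau> y \<bullet> b) else 0)) x vs"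
        by (rule ld_cong_open[OF S x]) (simp add: lpull_cdx)
      then show "ld (?x b) x vs = 0" using ld_ld[OF S x fsmooth_coordinate] by simp
    qed
    have "ld (lpull \<tau> \<omega>) x vs = ld (\<lambda>x vs. \<Sum>b\<in>Basis. ?c * lwedge (?x b x) (lpull \<tau> (?i b) x) vs) x vs"
      by (rule ld_cong_open[OF S x]) (rule eqp)
    also have "\<dots> = (\<Sum>b\<in>Basis. ?c * ld (\<lambda>x. lwedge (?x b x) (lpull \<tau> (?i b) x)) x vs)"
      by (simp only: ld_sum[OF smc x] ld_cmult[OF smw x])
    also have "\<dots> = (\<Sum>b\<in>Basis. ?c * - lwedge (?x b x) (lpull \<tau> (ld (?i b)) x) vs)"
    proof (rule sum.cong[OF refl])
      fix b :: 'w
      have "ld (\<lambda>x. lwedge (?x b x) (lpull \<tau> (?i b) x)) x vs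
         = lwedge (ld (?x b) x) (lpull \<tau> (?i b) x) vs + lwedge (lhat (?x b x)) (ld (lpull \<tau> (?i b)) x) vs"
        using ld_lwedge[OF S x smx] IH by blast
      then show "?c * ld (\<lambda>x. lwedge (?x b x) (lpull \<tau> (?i b) x)) x vs = ?c * - lwedge (?x b x) (lpull \<tau> (ld (?i b)) x) vs"
        using IH x by (simp add: closed odd lwedge_zero_left lwedge_uminus_left)
    qed
    also have "\<dots> = (\<Sum>b\<in>Basis. ?c * - lwedge (cdx b) (ld (?i b) (\<tau> x)) ?vs)"
      by (simp add: lpull_def[abs_def] lwedge_map)
    also have "\<dots> = (\<Sum>b\<in>Basis. ?c * ld (\<lambda>y. lwedge (cdx b) (?i b y)) (\<tau> x) ?vs)"
    proof (rule sum.cong[OF refl])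
      fix b :: 'w
      have "ld (\<lambda>y. lwedge (cdx b) (?i b y)) (\<tau> x) ?vs
        = lwedge (ld (\<lambda>y. cdx b) (\<tau> x)) (?i b (\<tau> x)) ?vs + lwedge (lhat (cdx b)) (ld (?i b) (\<tau> x)) ?vs"
        by (rule ld_lwedge[OF T x' fsmooth_const sm])
      moreover have "ld (\<lambda>y. cdx b) (\<tau> x) = (\<lambda>vs. 0)" by (simp add: fun_eq_iff ld_const)
      ultimately show "?c * - lwedge (cdx b) (ld (?i b) (\<tau> x)) ?vs = ?c * ld (\<lambda>y. lwedge (cdx b) (?i b y)) (\<tau> x) ?vs"
        by (simp add: odd_fun_lhat[OF odd_fun_cdx] lwedge_zero_left lwedge_uminus_left)
    qed
    also have "\<dots> = ld (\<lambda>y vs. \<Sum>b\<in>Basis. ?c * lwedge (cdx b) (?i b y) vs) (\<tau> x) ?vs"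
    proof -
      have "fsmooth T (\<lambda>y. lwedge (cdx b) (?i b y))" for b
        by (intro fsmooth_lwedge T fsmooth_const sm)
      then show ?thesis
        by (subst ld_sum[OF fsmooth_cmult[OF T] x']) (simp_all only: ld_cmult[OF _ x'])
    qed
    also have "\<dots> = ld \<omega> (\<tau> x) ?vs"
      by (rule ld_cong_open[OF T x']) (rule eq\<omega>[symmetric])
    finally show ?thesis by (simp add: lpull_def)
  qed
  show ?case using 1 2 by blast
qed

text \<open>Naturality of the exterior derivative in mixed degree. At the list \<open>vs\<close>
  only the component of degree \<open>length vs - 1\<close> counts, and it is covered by
  \<open>lpull_degree_step\<close>.\<close>

lemma ld_lpull:
  assumes "fsmooth T \<omega>" "\<And>y. y \<in> T \<Longrightarrow> alternating (\<omega> y)" "x \<in> S"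
  shows "ld (lpull \<tau> \<omega>) x vs = lpull \<tau> (ld \<omega>) x vs"
proof -
  let ?k = "length vs - 1"
  let ?\<omega> = "\<lambda>y us. if length us = ?k then \<omega> y us else 0"
  have "fsmooth T ?\<omega>" using assms(1) by (rule fsmooth_if)
  then have 1: "ld (lpull \<tau> ?\<omega>) x vs = lpull \<tau> (ld ?\<omega>) x vs"
    using lpull_degree_step[of ?\<omega> ?k] assms(2,3) alternating_if_length by fastforce
  have 2: "ld (lpull \<tau> ?\<omega>) x vs = ld (lpull \<tau> \<omega>) x vs"
    by (rule ld_cong_open[OF S assms(3)]) (simp add: lpull_def)
  have "\<tau> x \<in> T" using assms(3) \<tau>(2) by auto
  then have "lpull \<tau> (ld ?\<omega>) x vs = lpull \<tau> (ld \<omega>) x vs"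
    unfolding lpull_def by (intro ld_cong_open[OF T]) auto
  then show ?thesis using 1 2 by simp
qed

end

section \<open>Forms of top degree and change of variables\<close>

lemma alternating_move:
  assumes "alternating \<beta>"
  shows "\<beta> (as @ x # bs) = \<beta> (x # as @ bs) \<or> \<beta> (as @ x # bs) = - \<beta> (x # as @ bs)"
  using assms
proof (induction as arbitrary: \<beta>)
  case (Cons a as)
  have "\<beta> (a # x # as @ bs) = - \<beta> (x # a # as @ bs)"
    using alternating_swap[of \<beta> "[]" a x "as @ bs"] alternating_linear[OF Cons.prems]
      alternating_zero[OF Cons.prems, of _ _ "[]"] by simp
  then show ?case
    using Cons.IH[OF alternating_lins[OF Cons.prems, of a]] by (auto simp: lins_def)
qed simp

text \<open>Its purpose is to carry the vanishing of \<open>\<beta>\<close> from one ordering to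
  another, so the sign of the permutation is left open.\<close>

lemma alternating_mset:
  assumes "alternating \<beta>" "mset xs = mset ys"
  shows "\<beta> ys = \<beta> xs \<or> \<beta> ys = - \<beta> xs"
  using assms
proof (induction xs arbitrary: \<beta> ys)
  case (Cons x xs)
  from Cons.prems(2) have "x \<in> set ys" by (metis list.set_intros(1) set_mset_mset)
  then obtain as bs where ys: "ys = as @ x # bs" by (meson split_list)
  then have "mset xs = mset (as @ bs)" using Cons.prems(2) by simp
  then have "\<beta> (x # as @ bs) = \<beta> (x # xs) \<or> \<beta> (x # as @ bs) = - \<beta> (x # xs)"
    using Cons.IH[OF alternating_lins[OF Cons.prems(1), of x]] by (auto simp: lins_def)
  then show ?case
    using alternating_move[OF Cons.prems(1), of as x bs] unfolding ys by auto
qed simp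

lemma linear_zero_on_Basis:
  fixes f :: "'v::euclidean_space \<Rightarrow> 'w::real_vector"
  assumes "linear f" "\<And>b. b \<in> Basis \<Longrightarrow> f b = 0"
  shows "f v = 0"
proof -
  have "f v = f (\<Sum>b\<in>Basis. (v \<bullet> b) *\<^sub>R b)" by (simp add: euclidean_representation)
  also have "\<dots> = (\<Sum>b\<in>Basis. (v \<bullet> b) *\<^sub>R f b)" using assms(1) by (simp add: linear_sum linear_cmul)
  finally show ?thesis using assms(2) by simp
qed

text \<open>By linearity in one argument after the other, the arguments may be taken from the basis.
  Such a list either has a repetition or is a rearrangement of \<open>fr\<close>.\<close>

lemma alternating_top_zero:
  fixes \<beta> :: "'v::euclidean_space list \<Rightarrow> complex"
  assumes \<beta>: "alternating \<beta>" and fr: "distinct fr" "set fr = Basis" "\<beta> fr = 0"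
    and len: "length vs = DIM('v)"
  shows "\<beta> vs = 0"
proof -
  have basis: "\<beta> us = 0" if us: "set us \<subseteq> Basis" "length us = DIM('v)" for us
  proof (cases "distinct us")
    case True
    have "card (set us) = DIM('v)" using us(2) distinct_card[OF True] by simp
    then have "set us = Basis" using us(1) by (intro card_subset_eq) auto
    then have "mset fr = mset us" using True fr(1,2) by (simp add: set_eq_iff_mset_eq_distinct[symmetric])
    then show ?thesis using alternating_mset[OF \<beta>, of fr us] fr(3) by auto
  next
    case False
    then obtain xs y ys zs where "us = xs @ [y] @ ys @ [y] @ zs" using not_distinct_decomp by blast
    then show ?thesis using alternating_zero[OF \<beta>, of xs y ys zs] by simp
  qed
  have "\<beta> (us @ vs) = 0" if "set us \<subseteq> Basis" "length us + length vs = DIM('v)" for us vs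
    using that
  proof (induction vs arbitrary: us)
    case (Cons v vs)
    have "\<beta> (us @ b # vs) = 0" if "b \<in> Basis" for b
      using Cons.IH[of "us @ [b]"] Cons.prems that by simp
    then show ?case by (rule linear_zero_on_Basis[OF alternating_linear[OF \<beta>]])
  qed (simp add: basis)
  from this[of "[]" vs] show ?thesis using len by simp
qed

text \<open>Top degree forms make up a line: the difference of the two sides is alternating and
  vanishes on \<open>fr\<close>.\<close>

lemma alternating_top:
  fixes \<beta> :: "'v::euclidean_space list \<Rightarrow> complex"
  assumes "alternating \<beta>" "alternating D" and fr: "distinct fr" "set fr = Basis" "D fr = 1"
    and len: "length vs = DIM('v)"
  shows "\<beta> vs = D vs * \<beta> fr"
proof -
  have "alternating (\<lambda>vs. \<beta> vs - \<beta> fr * D vs)"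
    by (intro alternating_diff alternating_cmult assms)
  from alternating_top_zero[OF this fr(1,2) _ len] fr(3) show ?thesis by simp
qed

text \<open>\<open>pos\<close> numbers the rows: the argument at index \<open>pos i\<close> becomes
  row \<open>i\<close>. The value 0 at other lengths makes this a form of pure top degree.\<close>

definition ldet :: "('m \<Rightarrow> nat) \<Rightarrow> (real ^ 'm::finite) list \<Rightarrow> complex" where
  "ldet pos vs = (if length vs = CARD('m) then of_real (det (\<chi> i. vs ! pos i)) else 0)"

lemma alternating_ldet:
  fixes pos :: "'m::finite \<Rightarrow> nat"
  assumes pos: "bij_betw pos UNIV {..<CARD('m)}"
  shows "alternating (ldet pos)"
  unfolding alternating_def
proof (intro conjI allI)
  fix us ws :: "(real ^ 'm) list"
  show "linear (\<lambda>v. ldet pos (us @ v # ws))"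
  proof (cases "length us + Suc (length ws) = CARD('m)")
    case True
    then have "length us \<in> pos ` UNIV" using pos by (auto simp: bij_betw_def)
    then obtain k where k: "pos k = length us" by auto
    let ?c = "\<lambda>i. (us @ 0 # ws) ! pos i"
    have "(us @ v # ws) ! pos i = (if i = k then v else ?c i)" for i v
    proof (cases "i = k")
      case False
      then have "pos i \<noteq> length us" using k pos by (auto simp: bij_betw_def inj_on_def)
      then show ?thesis using False by (simp add: nth_append nth_Cons')
    qed (simp add: k nth_append)
    then have eq: "(\<chi> i. (us @ v # ws) ! pos i) = (\<chi> i. if i = k then v else ?c i)" for v
      by (simp add: vec_eq_iff)
    have "linear (\<lambda>v. det (\<chi> i. if i = k then v else ?c i))"
    proof (rule linearI)
      show "det (\<chi> i. if i = k then x + y else ?c i) = det (\<chi> i. if i = k then x else ?c i) + det (\<chi> i. if i = k then y else ?c i)"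
        for x y by (rule det_row_add)
      show "det (\<chi> i. if i = k then r *\<^sub>R x else ?c i) = r *\<^sub>R det (\<chi> i. if i = k then x else ?c i)" for r x
        using det_row_mul[of k r "\<lambda>_. x" ?c, unfolded scalar_mult_eq_scaleR] by simp
    qed
    from linear_compose[OF this bounded_linear.linear[OF bounded_linear_of_real[where 'a=complex]]]
    show ?thesis unfolding ldet_def eq using True by (simp add: o_def)
  next
    case False
    then show ?thesis by (simp add: ldet_def linear_zero)
  qed
next
  fix us v vs and ws :: "(real ^ 'm) list"
  show "ldet pos (us @ v # vs @ v # ws) = 0"
  proof (cases "length (us @ v # vs @ v # ws) = CARD('m)")
    case True
    then have "length us \<in> pos ` UNIV" "length us + Suc (length vs) \<in> pos ` UNIV"
      using pos by (auto simp: bij_betw_def)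
    then obtain k l where k: "pos k = length us" and l: "pos l = length us + Suc (length vs)"
      by (metis imageE)
    then have "k \<noteq> l" by auto
    then have "det (\<chi> i. (us @ v # vs @ v # ws) ! pos i) = 0"
      by (rule det_identical_rows) (simp add: row_def k l nth_append)
    then show ?thesis by (simp add: ldet_def)
  qed (simp add: ldet_def)
qed

text \<open>The index of \<open>i\<close> in the increasing enumeration of its type, which is the
  order of \<open>std_frame\<close>.\<close>

definition spos :: "'n::{finite, linorder} \<Rightarrow> nat" where
  "spos i = (THE k. k < CARD('n) \<and> sorted_list_of_set UNIV ! k = i)"

lemma spos:
  fixes i :: "'n::{finite, linorder}"
  shows "spos i < CARD('n)" "sorted_list_of_set UNIV ! spos i = i"
proof -
  let ?l = "sorted_list_of_set (UNIV :: 'n set)"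
  have l: "distinct ?l" "length ?l = CARD('n)" "set ?l = UNIV" by auto
  obtain k where k: "k < CARD('n)" "?l ! k = i" using l by (metis UNIV_I in_set_conv_nth)
  have "\<exists>!k. k < CARD('n) \<and> ?l ! k = i"
  proof (rule ex1I[of _ k])
    show "j = k" if "j < CARD('n) \<and> ?l ! j = i" for j
      using that k l nth_eq_iff_index_eq[OF l(1)] by metis
  qed (use k in simp)
  from theI'[OF this] show "spos i < CARD('n)" "?l ! spos i = i"
    unfolding spos_def by auto
qed

lemma bij_spos: "bij_betw (spos :: 'n::{finite, linorder} \<Rightarrow> nat) UNIV {..<CARD('n)}"
proof -
  have inj: "inj (spos :: 'n \<Rightarrow> nat)" by (rule injI) (metis spos(2))
  have "range (spos :: 'n \<Rightarrow> nat) \<subseteq> {..<CARD('n)}" using spos(1) by auto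
  moreover have "card (range (spos :: 'n \<Rightarrow> nat)) = card {..<CARD('n)}" using inj by (simp add: card_image)
  ultimately have "range (spos :: 'n \<Rightarrow> nat) = {..<CARD('n)}" by (intro card_subset_eq) auto
  then show ?thesis using inj by (simp add: bij_betw_def)
qed

lemma std_frame_props:
  fixes i :: "'n::{finite, linorder}"
  shows "length (std_frame :: (real, 'n) vec list) = CARD('n)"
  "distinct (std_frame :: (real, 'n) vec list)"
  "set (std_frame :: (real, 'n) vec list) = Basis"
  "std_frame ! spos i = axis i (1::real)"
proof -
  show "distinct (std_frame :: (real, 'n) vec list)"
    by (auto simp: std_frame_def distinct_map inj_on_def axis_eq_axis)
  show "set (std_frame :: (real, 'n) vec list) = Basis"
    by (auto simp: std_frame_def Basis_vec_def)
  show "std_frame ! spos i = axis i (1::real)"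
    using spos[of i] by (simp add: std_frame_def)
qed (simp add: std_frame_def)

lemma ldet_std_frame: "ldet spos (std_frame :: (real ^ 'n::{finite, linorder}) list) = 1"
proof -
  have "(\<chi> i. axis i 1) = (mat 1 :: ((real, 'n) vec, 'n) vec)" by (simp add: mat_def axis_def vec_eq_iff)
  then show ?thesis by (simp add: ldet_def std_frame_props)
qed

lemma matrix_rows_transpose: "(\<chi> i. L (axis i 1)) = transpose (matrix L)"
  by (simp add: matrix_def transpose_def vec_eq_iff)

lemma ldet_map_std_frame:
  "ldet spos (map L (std_frame :: (real ^ 'n::{finite, linorder}) list)) = of_real (det (matrix L))"
  by (simp add: ldet_def std_frame_props spos(1) matrix_rows_transpose)

text \<open>Comparison with the determinant by \<open>alternating_top\<close>. This is how the
  Jacobian enters the transformation of top degree coefficients.\<close>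

lemma alternating_map_std_frame:
  fixes \<beta> :: "(real ^ 'n::{finite, linorder}) list \<Rightarrow> complex"
  assumes "alternating \<beta>"
  shows "\<beta> (map L std_frame) = of_real (det (matrix L)) * \<beta> std_frame"
  using alternating_top[OF assms alternating_ldet[OF bij_spos] std_frame_props(2,3) ldet_std_frame, of "map L std_frame"]
  by (simp add: ldet_map_std_frame std_frame_props)

subsection \<open>Change of variables\<close>

text \<open>The library states change of variables for a well-ordered index type. A finite linear order
  is one, but not by its sort, so a copy of the index type is made with that sort.\<close>

typedef 'n wo = "UNIV :: 'n set" ..

instantiation wo :: (linorder) linorder
begin
definition "x \<le> y \<longleftrightarrow> Rep_wo x \<le> Rep_wo y"
definition "x < y \<longleftrightarrow> Rep_wo x < Rep_wo y"
instance by standard (auto simp: less_eq_wo_def less_wo_def Rep_wo_inject less_le_not_le)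
end

lemma Abs_wo_inverse' [simp]: "Rep_wo (Abs_wo i) = i"
  by (simp add: Abs_wo_inverse)

lemma bij_Rep_wo: "bij Rep_wo"
  by (rule bij_betw_byWitness[of _ Abs_wo]) (auto simp: Rep_wo_inverse)

instance wo :: (finite) finite
proof
  have "finite (Abs_wo ` (UNIV :: 'a set))" by simp
  moreover have "Abs_wo ` (UNIV :: 'a set) = UNIV"
    by (metis Rep_wo_inverse surjI)
  ultimately show "finite (UNIV :: 'a wo set)" by simp
qed

instance wo :: ("{finite, linorder}") wellorder
proof -
  have "wf {(x :: 'a wo, y). x < y}"
    by (auto simp add: trancl_def tranclp_less intro!: finite_acyclic_wf acyclicI)
  then show "OFCLASS('a wo, wellorder_class)"
    by (rule wf_wellorderI) intro_classes
qed

definition to_wo :: "real ^ 'n \<Rightarrow> real ^ ('n::finite) wo" where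
  "to_wo x = (\<chi> i. x $ Rep_wo i)"

definition of_wo :: "real ^ ('n::finite) wo \<Rightarrow> real ^ 'n" where
  "of_wo x = (\<chi> i. x $ Abs_wo i)"

lemma of_to_wo [simp]: "of_wo (to_wo x) = x"
  by (simp add: of_wo_def to_wo_def vec_eq_iff)

lemma to_of_wo [simp]: "to_wo (of_wo x) = x"
  by (simp add: of_wo_def to_wo_def vec_eq_iff Rep_wo_inverse)

lemma linear_to_wo: "linear to_wo"
  by (rule linearI) (simp_all add: to_wo_def vec_eq_iff)

lemma linear_of_wo: "linear of_wo"
  by (rule linearI) (simp_all add: of_wo_def vec_eq_iff)

lemma to_wo_axis: "to_wo (axis i c) = axis (Abs_wo i) c"
proof -
  have "Rep_wo j = i \<longleftrightarrow> j = Abs_wo i" for j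
    by (auto simp: Rep_wo_inverse)
  then show ?thesis by (simp add: to_wo_def axis_def vec_eq_iff)
qed

lemma of_wo_axis: "of_wo (axis i c) = axis (Rep_wo i) c"
  using to_wo_axis[of "Rep_wo i" c] of_to_wo[of "axis (Rep_wo i) c"] by (simp add: Rep_wo_inverse)

lemma bij_betw_to_wo: "bij_betw to_wo Basis Basis"
  by (rule bij_betw_byWitness[of _ of_wo]) (auto simp: Basis_vec_def to_wo_axis of_wo_axis)

lemma bij_betw_of_wo: "bij_betw of_wo Basis Basis"
  by (rule bij_betw_byWitness[of _ to_wo]) (auto simp: Basis_vec_def to_wo_axis of_wo_axis)

text \<open>Instead of reindexing permutations, the determinant over the copied index type is pulled
  back along \<open>to_wo\<close>. The result is a top degree form with value 1 on
  \<open>std_frame\<close>, so applying \<open>L\<close> multiplies it by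
  \<open>det (matrix L)\<close>.\<close>

lemma det_to_wo:
  fixes L :: "(real, 'n::{finite, linorder}) vec \<Rightarrow> (real, 'n) vec"
  shows "det (matrix (\<lambda>x. to_wo (L (of_wo x)))) = det (matrix L)"
proof -
  let ?D = "\<lambda>vs. ldet (\<lambda>i::'n wo. spos (Rep_wo i)) (map to_wo vs) :: complex"
  have card: "CARD('n wo) = CARD('n)" using bij_Rep_wo by (rule bij_betw_same_card)
  have "bij_betw (spos \<circ> Rep_wo :: 'n wo \<Rightarrow> nat) UNIV {..<CARD('n wo)}"
    unfolding card by (rule bij_betw_trans[OF bij_Rep_wo bij_spos])
  then have alt: "alternating ?D"
    by (intro alternating_map alternating_ldet linear_to_wo) (simp add: o_def)
  have 1: "?D std_frame = 1"
  proof -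
    have "(\<chi> i. axis i 1) = (mat 1 :: ((real, 'n wo) vec, 'n wo) vec)" by (simp add: mat_def axis_def vec_eq_iff)
    then show ?thesis by (simp add: ldet_def std_frame_props spos(1) card to_wo_axis Rep_wo_inverse)
  qed
  have "?D (map L std_frame) = ?D std_frame * of_real (det (matrix L))"
    using alternating_map_std_frame[OF alt, of L] by simp
  moreover have "?D (map L std_frame) = of_real (det (matrix (\<lambda>x. to_wo (L (of_wo x)))))"
  proof -
    have "(\<chi> i. to_wo (L (axis (Rep_wo i) 1))) = transpose (matrix (\<lambda>x. to_wo (L (of_wo x))))"
      using matrix_rows_transpose[of "\<lambda>x. to_wo (L (of_wo x))"] by (simp add: of_wo_axis)
    then show ?thesis by (simp add: ldet_def std_frame_props spos(1) card)
  qed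
  ultimately show ?thesis using 1 by (simp only: mult_1 of_real_eq_iff)
qed

text \<open>A linear map that matches two bases only renames coordinates. The preimage of a box is
  therefore a box with the same side lengths, and boxes determine \<open>lborel\<close>; completion
  carries the result over to \<open>lebesgue\<close>.\<close>

lemma
  fixes W :: "'v::euclidean_space \<Rightarrow> 'w::euclidean_space"
  assumes W: "linear W" "bij_betw W Basis Basis"
  shows basis_map_measurable: "W \<in> lebesgue \<rightarrow>\<^sub>M lebesgue"
    and basis_map_distr: "distr lebesgue lebesgue W = lebesgue"
proof -
  have borel[measurable]: "W \<in> borel \<rightarrow>\<^sub>M borel"
    using W(1) by (simp add: borel_measurable_continuous_onI linear_continuous_on linear_conv_bounded_linear)
  have bij: "\<exists>b\<in>Basis. c = W b" if "c \<in> Basis" for c using W(2) that by (auto simp: bij_betw_def)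
  have bij2: "W b \<in> Basis" if "b \<in> Basis" for b using W(2) that by (auto simp: bij_betw_def)
  have inner: "W x \<bullet> W b = x \<bullet> b" if b: "b \<in> Basis" for x b
  proof -
    have "W x = W (\<Sum>c\<in>Basis. (x \<bullet> c) *\<^sub>R c)" by (simp add: euclidean_representation)
    also have "\<dots> = (\<Sum>c\<in>Basis. (x \<bullet> c) *\<^sub>R W c)" using W(1) by (simp add: linear_sum linear_cmul)
    finally have "W x \<bullet> W b = (\<Sum>c\<in>Basis. (x \<bullet> c) * (W c \<bullet> W b))" by (simp add: inner_sum_left)
    also have "\<dots> = (\<Sum>c\<in>Basis. if c = b then x \<bullet> c else 0)"
    proof (rule sum.cong[OF refl])
      fix c :: 'v assume c: "c \<in> Basis"
      have "W c = W b \<longleftrightarrow> c = b" using W(2) b c by (auto simp: bij_betw_def inj_on_def)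
      then have "W c \<bullet> W b = (if c = b then 1 else 0)"
        using inner_Basis[OF bij2[OF c] bij2[OF b]] by simp
      then show "(x \<bullet> c) * (W c \<bullet> W b) = (if c = b then x \<bullet> c else 0)" by simp
    qed
    finally show ?thesis using b by simp
  qed
  have lb: "lborel = distr lborel borel W"
  proof (rule lborel_eqI)
    fix l u :: 'w assume lu: "\<And>b. b \<in> Basis \<Longrightarrow> l \<bullet> b \<le> u \<bullet> b"
    define l' u' where "l' = (\<Sum>b\<in>Basis. (l \<bullet> W b) *\<^sub>R b)" and "u' = (\<Sum>b\<in>Basis. (u \<bullet> W b) *\<^sub>R b)"
    have l': "l' \<bullet> b = l \<bullet> W b" and u': "u' \<bullet> b = u \<bullet> W b" if "b \<in> Basis" for b
      using that by (auto simp: l'_def u'_def)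
    have "W -` box l u = box l' u'"
    proof (rule set_eqI)
      fix x
      have "x \<in> W -` box l u \<longleftrightarrow> (\<forall>c\<in>Basis. l \<bullet> c < W x \<bullet> c \<and> W x \<bullet> c < u \<bullet> c)"
        by (simp add: mem_box)
      also have "\<dots> \<longleftrightarrow> (\<forall>b\<in>Basis. l \<bullet> W b < W x \<bullet> W b \<and> W x \<bullet> W b < u \<bullet> W b)"
        using bij bij2 by blast
      finally show "x \<in> W -` box l u \<longleftrightarrow> x \<in> box l' u'" by (simp add: mem_box l' u' inner)
    qed
    then have "emeasure (distr lborel borel W) (box l u) = emeasure lborel (box l' u')"
      by (simp add: emeasure_distr)
    also have "\<dots> = (\<Prod>b\<in>Basis. (u' - l') \<bullet> b)"
      by (rule emeasure_lborel_box) (use lu bij2 in \<open>simp add: l' u'\<close>)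
    also have "(\<Prod>b\<in>Basis. (u' - l') \<bullet> b) = (\<Prod>b\<in>Basis. (u - l) \<bullet> W b)"
      by (rule prod.cong) (auto simp: l' u' inner_diff_left)
    also have "\<dots> = (\<Prod>b\<in>Basis. (u - l) \<bullet> b)"
      by (rule prod.reindex_bij_betw[OF W(2)])
    finally show "emeasure (distr lborel borel W) (box l u) = (\<Prod>b\<in>Basis. (u - l) \<bullet> b)" by simp
  qed simp
  have lb2: "distr lebesgue lborel W = lborel"
  proof -
    have "distr lebesgue lborel W = distr lborel lborel W" by (rule distr_completion) simp
    also have "\<dots> = distr lborel borel W" by (rule distr_cong) auto
    finally show ?thesis using lb by simp
  qed
  then have eq: "null_sets lborel = null_sets (distr lebesgue lborel W)" by simp
  show "W \<in> lebesgue \<rightarrow>\<^sub>M lebesgue"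
    by (simp add: completion.measurable_completion2 eq measurable_completion)
  have "distr lebesgue lebesgue W = completion (distr lebesgue lborel W)"
    by (subst completion.completion_distr_eq) (auto simp: eq measurable_completion)
  then show "distr lebesgue lebesgue W = lebesgue" by (simp add: lb2)
qed

lemma absolutely_integrable_basis_map:
  fixes W :: "'v::euclidean_space \<Rightarrow> 'w::euclidean_space" and g :: "'w \<Rightarrow> complex"
  assumes W: "linear W" "bij_betw W Basis Basis" and g: "g absolutely_integrable_on X"
  shows "(\<lambda>x. g (W x)) absolutely_integrable_on (W -` X) \<and> integral (W -` X) (\<lambda>x. g (W x)) = integral X g"
proof -
  have int: "integrable (distr lebesgue lebesgue W) (\<lambda>x. indicat_real X x *\<^sub>R g x)"
    using g unfolding basis_map_distr[OF W] set_integrable_def .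
  have ind: "indicat_real X (W x) = indicat_real (W -` X) x" for x by (simp add: indicator_def)
  have 1: "(\<lambda>x. g (W x)) absolutely_integrable_on (W -` X)"
    using integrable_distr[OF basis_map_measurable[OF W] int] unfolding set_integrable_def ind .
  have "(\<integral>x. indicat_real X x *\<^sub>R g x \<partial>(distr lebesgue lebesgue W)) = (\<integral>x. indicat_real X (W x) *\<^sub>R g (W x) \<partial>lebesgue)"
    by (rule integral_distr[OF basis_map_measurable[OF W]])
       (use g in \<open>auto simp: set_integrable_def dest: borel_measurable_integrable\<close>)
  then have "integral X g = integral (W -` X) (\<lambda>x. g (W x))"
    using set_lebesgue_integral_eq_integral(2)[OF 1] set_lebesgue_integral_eq_integral(2)[OF g]
    unfolding set_lebesgue_integral_def basis_map_distr[OF W] ind by simp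
  then show ?thesis using 1 by simp
qed

text \<open>Complex integrands pass through \<open>real ^ 2\<close>, since change of variables is
  applied to integrands with values in a vector type.\<close>

definition complex_vec :: "complex \<Rightarrow> real ^ 2" where
  "complex_vec z = (\<chi> i. if i = 1 then Re z else Im z)"

definition vec_complex :: "real ^ 2 \<Rightarrow> complex" where
  "vec_complex v = Complex (v $ 1) (v $ 2)"

lemma vec_complex_inverse: "vec_complex (complex_vec z) = z"
  by (simp add: vec_complex_def complex_vec_def)

lemma bounded_linear_complex_vec: "bounded_linear complex_vec"
  by (intro linear_conv_bounded_linear[THEN iffD1] linearI) (auto simp: complex_vec_def vec_eq_iff)

lemma bounded_linear_vec_complex: "bounded_linear vec_complex"
  by (intro linear_conv_bounded_linear[THEN iffD1] linearI) (auto simp: vec_complex_def complex_eq_iff)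

lemma change_of_variables_wo:
  fixes \<tau> :: "(real, 'm::{finite, wellorder}) vec \<Rightarrow> (real, 'm) vec" and f :: "(real, 'm) vec \<Rightarrow> complex"
  assumes S: "open S" and der: "\<And>x. x \<in> S \<Longrightarrow> (\<tau> has_derivative \<tau>' x) (at x)" and inj: "inj_on \<tau> S"
    and f: "f absolutely_integrable_on (\<tau> ` S)"
  shows "(\<lambda>x. of_real \<bar>det (matrix (\<tau>' x))\<bar> * f (\<tau> x)) absolutely_integrable_on S \<and>
    integral S (\<lambda>x. of_real \<bar>det (matrix (\<tau>' x))\<bar> * f (\<tau> x)) = integral (\<tau> ` S) f"
proof -
  have f1: "complex_vec \<circ> f absolutely_integrable_on (\<tau> ` S)"
    by (rule absolutely_integrable_linear[OF f bounded_linear_complex_vec])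
  have f2: "integral (\<tau> ` S) (complex_vec \<circ> f) = complex_vec (integral (\<tau> ` S) f)"
    by (rule integral_linear[OF set_lebesgue_integral_eq_integral(1)[OF f] bounded_linear_complex_vec])
  have 1: "(\<lambda>x. \<bar>det (matrix (\<tau>' x))\<bar> *\<^sub>R (complex_vec \<circ> f) (\<tau> x)) absolutely_integrable_on S \<and>
     integral S (\<lambda>x. \<bar>det (matrix (\<tau>' x))\<bar> *\<^sub>R (complex_vec \<circ> f) (\<tau> x)) = complex_vec (integral (\<tau> ` S) f)"
    by (subst has_absolute_integral_change_of_variables)
       (use S inj has_derivative_at_withinI[OF der] f1 f2 in auto)
  have eq: "vec_complex \<circ> (\<lambda>x. \<bar>det (matrix (\<tau>' x))\<bar> *\<^sub>R (complex_vec \<circ> f) (\<tau> x)) =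
     (\<lambda>x. of_real \<bar>det (matrix (\<tau>' x))\<bar> * f (\<tau> x))"
    using linear_cmul[OF bounded_linear.linear[OF bounded_linear_vec_complex]]
    by (simp add: fun_eq_iff vec_complex_inverse scaleR_conv_of_real)
  show ?thesis
    using absolutely_integrable_linear[OF conjunct1[OF 1] bounded_linear_vec_complex]
      integral_linear[OF set_lebesgue_integral_eq_integral(1)[OF conjunct1[OF 1]] bounded_linear_vec_complex]
      conjunct2[OF 1]
    unfolding eq by (simp add: vec_complex_inverse)
qed

text \<open>Conjugation by \<open>to_wo\<close> and \<open>of_wo\<close>, which preserve measure and
  leave the Jacobian determinant unchanged.\<close>

lemma change_of_variables:
  fixes \<tau> :: "(real, 'n::{finite, linorder}) vec \<Rightarrow> (real, 'n) vec" and f :: "(real, 'n) vec \<Rightarrow> complex"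
  assumes S: "open S" and der: "\<And>x. x \<in> S \<Longrightarrow> (\<tau> has_derivative \<tau>' x) (at x)" and inj: "inj_on \<tau> S"
    and f: "f absolutely_integrable_on (\<tau> ` S)"
  shows "(\<lambda>x. of_real \<bar>det (matrix (\<tau>' x))\<bar> * f (\<tau> x)) absolutely_integrable_on S"
    and "integral S (\<lambda>x. of_real \<bar>det (matrix (\<tau>' x))\<bar> * f (\<tau> x)) = integral (\<tau> ` S) f"
proof -
  let ?S = "of_wo -` S" and ?\<tau> = "\<lambda>y. to_wo (\<tau> (of_wo y))" and ?f = "\<lambda>y. f (of_wo y)"
  let ?\<tau>' = "\<lambda>y v. to_wo (\<tau>' (of_wo y) (of_wo v))"
  let ?g = "\<lambda>y. of_real \<bar>det (matrix (?\<tau>' y))\<bar> * ?f (?\<tau> y)"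
  have bl: "bounded_linear (to_wo :: (real, 'n) vec \<Rightarrow> _)" "bounded_linear (of_wo :: _ \<Rightarrow> (real, 'n) vec)"
    using linear_to_wo linear_of_wo linear_conv_bounded_linear by blast+
  have "open ?S"
    using S linear_continuous_on[OF bl(2)] by (simp add: open_vimage)
  have img: "?\<tau> ` ?S = of_wo -` (\<tau> ` S)"
  proof (intro equalityI subsetI)
    fix y assume "y \<in> of_wo -` (\<tau> ` S)"
    then obtain x where x: "x \<in> S" "of_wo y = \<tau> x" by auto
    then have "y = ?\<tau> (to_wo x)" by (metis of_to_wo to_of_wo)
    then show "y \<in> ?\<tau> ` ?S" using x by (intro image_eqI[of _ _ "to_wo x"]) simp_all
  qed auto
  have f': "?f absolutely_integrable_on (?\<tau> ` ?S)" "integral (?\<tau> ` ?S) ?f = integral (\<tau> ` S) f"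
    using absolutely_integrable_basis_map[OF linear_of_wo bij_betw_of_wo f] unfolding img by auto
  have der': "(?\<tau> has_derivative ?\<tau>' y) (at y)" if "y \<in> ?S" for y
  proof -
    have "(\<tau> has_derivative \<tau>' (of_wo y)) (at (of_wo y))" using der that by auto
    from diff_chain_at[OF bounded_linear_imp_has_derivative[OF bl(2)] this]
    have "((\<lambda>y. \<tau> (of_wo y)) has_derivative (\<lambda>v. \<tau>' (of_wo y) (of_wo v))) (at y)" by (simp add: o_def)
    then show ?thesis by (rule bounded_linear.has_derivative[OF bl(1)])
  qed
  have inj': "inj_on ?\<tau> ?S"
  proof (rule inj_onI)
    fix x y assume "x \<in> ?S" "y \<in> ?S" and "?\<tau> x = ?\<tau> y"
    then have "\<tau> (of_wo x) = \<tau> (of_wo y)" by (metis of_to_wo)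
    with \<open>x \<in> ?S\<close> \<open>y \<in> ?S\<close> have "of_wo x = of_wo y" using inj_onD[OF inj] by auto
    then show "x = y" by (metis to_of_wo)
  qed
  have g: "?g absolutely_integrable_on ?S" "integral ?S ?g = integral (\<tau> ` S) f"
    using change_of_variables_wo[OF \<open>open ?S\<close> der' inj' f'(1)] f'(2) by auto
  have eq: "?g (to_wo x) = of_real \<bar>det (matrix (\<tau>' x))\<bar> * f (\<tau> x)" for x
    using det_to_wo[of "\<tau>' x"] by simp
  have pre: "to_wo -` ?S = S" by auto
  show "(\<lambda>x. of_real \<bar>det (matrix (\<tau>' x))\<bar> * f (\<tau> x)) absolutely_integrable_on S"
    "integral S (\<lambda>x. of_real \<bar>det (matrix (\<tau>' x))\<bar> * f (\<tau> x)) = integral (\<tau> ` S) f"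
    using absolutely_integrable_basis_map[OF linear_to_wo bij_betw_to_wo g(1), unfolded eq pre] g(2)
    by auto
qed

section \<open>Bump functions and partitions of unity\<close>

text \<open>For \<open>k = 0\<close> this is the standard flat function
  \<open>exp (- (1 / t))\<close>, extended by zero. With the powers included, derivatives are
  combinations of members of the family, so that smoothness becomes an induction for all
  \<open>k\<close> at once.\<close>

definition bexp :: "nat \<Rightarrow> real \<Rightarrow> real" where
  "bexp k t = (if t > 0 then (1 / t) ^ k * exp (- (1 / t)) else 0)"

lemma bexp_tendsto: "(bexp k \<longlongrightarrow> 0) (at_right 0)"
proof -
  have "((\<lambda>x::real. x ^ k / exp x) \<longlongrightarrow> 0) at_top" by (rule tendsto_power_div_exp_0)
  then have "((\<lambda>t::real. (inverse t) ^ k / exp (inverse t)) \<longlongrightarrow> 0) (at_right 0)"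
    by (rule filterlim_compose[OF _ filterlim_inverse_at_top_right])
  then show ?thesis
    by (rule Lim_transform_eventually)
       (auto simp: eventually_at_right_field bexp_def exp_minus divide_inverse intro!: exI[of _ 1])
qed

text \<open>The case that matters is 0: there the difference quotient is 0 from the left and
  \<open>bexp (k + 1)\<close> from the right, which tends to 0.\<close>

lemma bexp_has_derivative:
  "(bexp k has_real_derivative (bexp (k + 2) t - real k * bexp (k + 1) t)) (at t)"
proof -
  consider "t > 0" | "t < 0" | "t = 0" by linarith
  then show ?thesis
  proof cases
    case 1
    have "((\<lambda>t. (1 / t) ^ k * exp (- (1 / t))) has_real_derivative
       (real k * (1 / t) ^ (k - 1) * (- (1 / t\<^sup>2))) * exp (- (1 / t)) + (1 / t) ^ k * (exp (- (1 / t)) * (1 / t\<^sup>2))) (at t)"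
      using 1 by (auto intro!: derivative_eq_intros simp: power2_eq_square)
    moreover have "(real k * (1 / t) ^ (k - 1) * (- (1 / t\<^sup>2))) * exp (- (1 / t)) + (1 / t) ^ k * (exp (- (1 / t)) * (1 / t\<^sup>2))
       = bexp (k + 2) t - real k * bexp (k + 1) t"
      using 1 by (cases k) (simp_all add: bexp_def power2_eq_square power_add algebra_simps divide_simps)
    ultimately have "((\<lambda>t. (1 / t) ^ k * exp (- (1 / t))) has_real_derivative
       bexp (k + 2) t - real k * bexp (k + 1) t) (at t)" by simp
    then show ?thesis
      by (rule has_field_derivative_transform_within_open[where S="{0<..}"]) (use 1 in \<open>auto simp: bexp_def\<close>)
  next
    case 2
    have "((\<lambda>t. 0) has_real_derivative bexp (k + 2) t - real k * bexp (k + 1) t) (at t)"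
      using 2 by (simp add: bexp_def)
    then show ?thesis
      by (rule has_field_derivative_transform_within_open[where S="{..<0}"]) (use 2 in \<open>auto simp: bexp_def\<close>)
  next
    case 3
    have "((\<lambda>h. (bexp k (0 + h) - bexp k 0) / h) \<longlongrightarrow> 0) (at 0)"
    proof (rule filterlim_split_at)
      show "((\<lambda>h. (bexp k (0 + h) - bexp k 0) / h) \<longlongrightarrow> 0) (at_left 0)"
        by (rule Lim_transform_eventually[OF tendsto_const])
           (auto simp: eventually_at_left_field bexp_def intro!: exI[of _ "-1"])
      show "((\<lambda>h. (bexp k (0 + h) - bexp k 0) / h) \<longlongrightarrow> 0) (at_right 0)"
        by (rule Lim_transform_eventually[OF bexp_tendsto[of "k + 1"]])
           (auto simp: eventually_at_right_field bexp_def intro!: exI[of _ 1])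
    qed
    then show ?thesis using 3 by (simp add: DERIV_def bexp_def)
  qed
qed

lemma smooth_bexp: "smooth_on UNIV (bexp k)"
  unfolding smooth_on_ck
proof
  fix n show "ck n UNIV (bexp k)"
  proof (induction n arbitrary: k)
    case (Suc n)
    have d: "(bexp k has_derivative (\<lambda>w. (bexp (k + 2) t - real k * bexp (k + 1) t) * w)) (at t)" for t
      using bexp_has_derivative[of k t] unfolding has_field_derivative_def by simp
    have "ck n UNIV (pdir w (bexp k))" for w
    proof -
      have "pdir w (bexp k) = (\<lambda>t. (bexp (k + 2) t + (- real k) * bexp (k + 1) t) * w)"
        using frechet_derivative_at[OF d] by (metis (no_types, lifting) add_uminus_conv_diff mult_minus_left)
      then show ?thesis
        by (simp only:) (intro ck_bilinear[OF open_UNIV bounded_bilinear_mult] ck_add open_UNIV ck_const Suc)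
    qed
    then show ?case using d by (auto intro: differentiableI)
  qed simp
qed

text \<open>A smooth step from 0 to 1 on the unit interval. The denominator is positive because
  \<open>t\<close> and \<open>1 - t\<close> are never both nonpositive.\<close>

definition sstep :: "real \<Rightarrow> real" where
  "sstep t = bexp 0 t / (bexp 0 t + bexp 0 (1 - t))"

lemma bexp_sum_pos: "bexp 0 t + bexp 0 (1 - t) > 0"
  by (auto simp: bexp_def add_pos_pos)

lemma smooth_sstep: "smooth_on UNIV sstep"
proof -
  have "smooth_on UNIV (\<lambda>t::real. 1 - t)"
    by (intro smooth_on_diff open_UNIV smooth_on_const smooth_on_linear bounded_linear_ident)
  then have "smooth_on UNIV (\<lambda>t. bexp 0 (1 - t))"
    using smooth_on_compose[OF open_UNIV _ _ smooth_bexp, of "\<lambda>t. 1 - t" 0] by simp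
  then have "smooth_on UNIV (\<lambda>t. bexp 0 t / (bexp 0 t + bexp 0 (1 - t)))"
    using bexp_sum_pos by (intro smooth_on_divide smooth_on_add open_UNIV smooth_bexp) (auto simp: less_imp_neq[symmetric])
  then show ?thesis by (simp add: sstep_def[abs_def])
qed

lemma sstep_props: "0 \<le> sstep t" "sstep t \<le> 1" "t \<le> 0 \<Longrightarrow> sstep t = 0" "t \<ge> 1 \<Longrightarrow> sstep t = 1"
  using bexp_sum_pos[of t] by (auto simp: sstep_def bexp_def)

text \<open>The squared distance is used because it is smooth at the centre. For positive
  \<open>r\<close>, the argument of the step is at least 1 within radius \<open>r\<close> and
  negative from radius \<open>2 * r\<close> on.\<close>

definition bump :: "'v::euclidean_space \<Rightarrow> real \<Rightarrow> 'v \<Rightarrow> real" where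
  "bump a r x = sstep (2 - ((x - a) \<bullet> (x - a)) / r\<^sup>2)"

lemma smooth_bump: "smooth_on UNIV (bump a r)"
proof -
  have 1: "smooth_on UNIV (\<lambda>x. x - a)"
    by (intro smooth_on_diff open_UNIV smooth_on_const smooth_on_linear bounded_linear_ident)
  have "smooth_on UNIV (\<lambda>x. (x - a) \<bullet> (x - a) * (1 / r\<^sup>2))"
    by (intro smooth_on_mult open_UNIV smooth_on_const smooth_on_bilinear[OF open_UNIV bounded_bilinear_inner] 1)
  then have "smooth_on UNIV (\<lambda>x. 2 - (x - a) \<bullet> (x - a) / r\<^sup>2)"
    by (intro smooth_on_diff open_UNIV smooth_on_const) simp
  from smooth_on_compose[OF open_UNIV _ this smooth_sstep] show ?thesis by (simp add: bump_def[abs_def])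
qed

lemma bump_props:
  assumes "r > 0"
  shows "0 \<le> bump a r x" "bump a r x \<le> 1" "dist a x \<le> r \<Longrightarrow> bump a r x = 1" "dist a x \<ge> 2 * r \<Longrightarrow> bump a r x = 0"
proof -
  have eq: "(x - a) \<bullet> (x - a) = (dist a x)\<^sup>2"
    by (metis dist_commute dist_norm power2_norm_eq_inner)
  show "bump a r x = 1" if "dist a x \<le> r"
  proof -
    have "(dist a x)\<^sup>2 / r\<^sup>2 \<le> 1" using that assms by (simp add: power_mono)
    then show ?thesis unfolding bump_def eq by (intro sstep_props) simp
  qed
  show "bump a r x = 0" if "dist a x \<ge> 2 * r"
  proof -
    have "(2 * r)\<^sup>2 \<le> (dist a x)\<^sup>2" using that assms by (intro power_mono) auto
    then have "(dist a x)\<^sup>2 / r\<^sup>2 \<ge> 4" using assms by (simp add: field_simps)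
    then show ?thesis unfolding bump_def eq by (intro sstep_props) simp
  qed
qed (simp_all add: bump_def sstep_props)

lemma compact_closed_subset: "compact K \<Longrightarrow> closed S \<Longrightarrow> S \<subseteq> K \<Longrightarrow> compact S"
  using compact_Int_closed[of K S] by (simp add: inf.absorb2)

subsection \<open>Charts\<close>

locale oriented_manifold =
  fixes A :: "('a::{t2_space, second_countable_topology}, 'n::{finite, linorder}) chart set"
  assumes atlas: "oriented_atlas A"
begin

lemma chart_open: "c \<in> A \<Longrightarrow> open (dom_c c)"
  and chart_open_image: "c \<in> A \<Longrightarrow> open (map_c c ` dom_c c)"
  and chart_homeomorphism: "c \<in> A \<Longrightarrow> homeomorphism (dom_c c) (map_c c ` dom_c c) (map_c c) (inv_c c)"
  and transition_smooth: "c \<in> A \<Longrightarrow> c' \<in> A \<Longrightarrow> smooth_on (map_c c ` (dom_c c \<inter> dom_c c')) (map_c c' \<circ> inv_c c)"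
  and transition_det: "c \<in> A \<Longrightarrow> c' \<in> A \<Longrightarrow> p \<in> dom_c c \<Longrightarrow> p \<in> dom_c c' \<Longrightarrow> det (matrix (trans_deriv c c' p)) > 0"
  using atlas unfolding oriented_atlas_def by blast+

lemma chart_cover: obtains c where "c \<in> A" "p \<in> dom_c c"
  using atlas unfolding oriented_atlas_def by blast

lemma inv_map [simp]: "c \<in> A \<Longrightarrow> p \<in> dom_c c \<Longrightarrow> inv_c c (map_c c p) = p"
  using chart_homeomorphism homeomorphism_apply1 by blast

lemma map_inv [simp]: "c \<in> A \<Longrightarrow> x \<in> map_c c ` dom_c c \<Longrightarrow> map_c c (inv_c c x) = x"
  using chart_homeomorphism homeomorphism_apply2 by blast

lemma inv_in_dom: "c \<in> A \<Longrightarrow> x \<in> map_c c ` dom_c c \<Longrightarrow> inv_c c x \<in> dom_c c"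
  by auto

lemma inj_map_c: "c \<in> A \<Longrightarrow> inj_on (map_c c) (dom_c c)"
  by (metis inj_on_inverseI inv_map)

lemma continuous_map_c: "c \<in> A \<Longrightarrow> continuous_on (dom_c c) (map_c c)"
  using chart_homeomorphism homeomorphism_def by metis

lemma continuous_inv_c: "c \<in> A \<Longrightarrow> continuous_on (map_c c ` dom_c c) (inv_c c)"
  using chart_homeomorphism homeomorphism_def by metis

lemma open_chart_image:
  assumes "c \<in> A" "open W"
  shows "open (map_c c ` (W \<inter> dom_c c))"
proof -
  have "openin (top_of_set (map_c c ` dom_c c)) (map_c c ` (W \<inter> dom_c c))"
    by (rule homeomorphism_imp_open_map[OF chart_homeomorphism[OF assms(1)]])
       (use assms(2) in \<open>auto simp: openin_open\<close>)
  then show ?thesis using chart_open_image[OF assms(1)] by (rule openin_open_trans)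
qed

lemma compact_chart_image:
  assumes "c \<in> A" "compact K" "K \<subseteq> dom_c c"
  shows "compact (map_c c ` K)"
  using compact_continuous_image continuous_on_subset[OF continuous_map_c] assms by blast

lemma compact_chart_preimage:
  assumes "c \<in> A" "compact L" "L \<subseteq> map_c c ` dom_c c"
  shows "compact (inv_c c ` L)"
  using compact_continuous_image continuous_on_subset[OF continuous_inv_c] assms by blast

text \<open>The intersection is formed in the manifold, where \<open>Z\<close> is closed, since the
  image of \<open>Z\<close> in the chart is closed only relative to the chart.\<close>

lemma compact_Int_chart_image:
  assumes "c \<in> A" "compact K" "K \<subseteq> map_c c ` dom_c c" "closed Z"
  shows "compact (K \<inter> map_c c ` (Z \<inter> dom_c c))"
proof -
  have "compact (inv_c c ` K \<inter> Z)"
    using compact_chart_preimage assms by (intro compact_Int_closed) auto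
  then have "compact (map_c c ` (inv_c c ` K \<inter> Z))"
    by (rule compact_chart_image[OF assms(1)]) (use inv_in_dom assms in blast)
  moreover have "map_c c ` (inv_c c ` K \<inter> Z) = K \<inter> map_c c ` (Z \<inter> dom_c c)"
  proof (intro equalityI subsetI)
    fix x assume "x \<in> map_c c ` (inv_c c ` K \<inter> Z)"
    then obtain y where y: "y \<in> K" "inv_c c y \<in> Z" "x = map_c c (inv_c c y)" by auto
    moreover have "y \<in> map_c c ` dom_c c" using y assms by auto
    ultimately show "x \<in> K \<inter> map_c c ` (Z \<inter> dom_c c)" using assms(1) inv_in_dom by auto
  next
    fix x assume "x \<in> K \<inter> map_c c ` (Z \<inter> dom_c c)"
    then obtain p where p: "x \<in> K" "x = map_c c p" "p \<in> Z" "p \<in> dom_c c" by auto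
    then have "p = inv_c c x" using assms(1) by simp
    then show "x \<in> map_c c ` (inv_c c ` K \<inter> Z)" using p by blast
  qed
  ultimately show ?thesis by simp
qed

lemma smooth_funD: "smooth_fun A U g \<Longrightarrow> c \<in> A \<Longrightarrow> smooth_on (map_c c ` (U \<inter> dom_c c)) (\<lambda>x. g (inv_c c x))"
  unfolding smooth_fun_def o_def by blast

lemma smooth_fun_const: "smooth_fun A U (\<lambda>p. z)"
  by (simp add: smooth_fun_def o_def)

lemma smooth_fun_subset: "smooth_fun A U g \<Longrightarrow> V \<subseteq> U \<Longrightarrow> smooth_fun A V g"
  unfolding smooth_fun_def by (meson smooth_on_subset image_mono Int_mono order_refl)

lemma smooth_fun_mult:
  fixes f g :: "'a \<Rightarrow> 'c::real_normed_algebra"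
  shows "open U \<Longrightarrow> smooth_fun A U f \<Longrightarrow> smooth_fun A U g \<Longrightarrow> smooth_fun A U (\<lambda>p. f p * g p)"
  unfolding smooth_fun_def o_def by (auto intro!: smooth_on_mult open_chart_image)

lemma smooth_fun_add:
  "open U \<Longrightarrow> smooth_fun A U f \<Longrightarrow> smooth_fun A U g \<Longrightarrow> smooth_fun A U (\<lambda>p. f p + g p)"
  unfolding smooth_fun_def o_def by (auto intro!: smooth_on_add open_chart_image)

lemma smooth_fun_diff:
  "open U \<Longrightarrow> smooth_fun A U f \<Longrightarrow> smooth_fun A U g \<Longrightarrow> smooth_fun A U (\<lambda>p. f p - g p)"
  unfolding smooth_fun_def o_def by (auto intro!: smooth_on_diff open_chart_image)

lemma smooth_fun_divide:
  fixes f g :: "'a \<Rightarrow> 'c::real_normed_field"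
  assumes "open U" "smooth_fun A U f" "smooth_fun A U g" "\<And>p. p \<in> U \<Longrightarrow> g p \<noteq> 0"
  shows "smooth_fun A U (\<lambda>p. f p / g p)"
  unfolding smooth_fun_def o_def
proof
  fix c assume c: "c \<in> A"
  show "smooth_on (map_c c ` (U \<inter> dom_c c)) (\<lambda>x. f (inv_c c x) / g (inv_c c x))"
    by (rule smooth_on_divide[OF open_chart_image[OF c assms(1)] smooth_funD[OF assms(2) c] _ smooth_funD[OF assms(3) c]])
       (use assms(4) c in auto)
qed

lemma smooth_fun_local:
  assumes "\<And>p. p \<in> U \<Longrightarrow> \<exists>V. p \<in> V \<and> smooth_fun A V g"
  shows "smooth_fun A U g"
  unfolding smooth_fun_def
proof (intro ballI smooth_on_local)
  fix c x assume "c \<in> A" "x \<in> map_c c ` (U \<inter> dom_c c)"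
  then obtain p where p: "p \<in> U" "p \<in> dom_c c" "x = map_c c p" by auto
  then obtain V where "p \<in> V" "smooth_fun A V g" using assms by blast
  then show "\<exists>T. x \<in> T \<and> smooth_on T (g \<circ> inv_c c)"
    using p \<open>c \<in> A\<close> unfolding smooth_fun_def by (intro exI[of _ "map_c c ` (V \<inter> dom_c c)"]) auto
qed

lemma smooth_fun_cong:
  assumes "open U" "smooth_fun A U g" "\<And>p. p \<in> U \<Longrightarrow> f p = g p"
  shows "smooth_fun A U f"
  unfolding smooth_fun_def
proof
  fix c assume c: "c \<in> A"
  show "smooth_on (map_c c ` (U \<inter> dom_c c)) (f \<circ> inv_c c)"
    by (subst smooth_on_cong[OF open_chart_image[OF c assms(1)], where g="g \<circ> inv_c c"])
       (use assms c in \<open>auto simp: smooth_fun_def\<close>)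
qed

lemma smooth_fun_prod:
  fixes f :: "'i \<Rightarrow> 'a \<Rightarrow> real"
  assumes "open U" "\<And>i. i \<in> I \<Longrightarrow> smooth_fun A U (f i)"
  shows "smooth_fun A U (\<lambda>p. \<Prod>i\<in>I. f i p)"
  using assms(2)
  by (induction I rule: infinite_finite_induct) (auto intro: smooth_fun_const smooth_fun_mult[OF assms(1)])

lemma smooth_fun_sum:
  assumes "open U" "\<And>i. i \<in> I \<Longrightarrow> smooth_fun A U (f i)"
  shows "smooth_fun A U (\<lambda>p. \<Sum>i\<in>I. f i p)"
  using assms(2)
  by (induction I rule: infinite_finite_induct) (auto intro: smooth_fun_const smooth_fun_add[OF assms(1)])

subsection \<open>Partitions of unity\<close>

text \<open>A Euclidean bump is transplanted by a chart and extended by zero. The extension is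
  smooth because it vanishes off a compact subset of the chart domain, and compact sets are closed
  in a Hausdorff space.\<close>

lemma manifold_bump:
  assumes "open W" "p \<in> W"
  obtains \<theta> :: "'a \<Rightarrow> real" and c V where "c \<in> A" "smooth_fun A UNIV \<theta>" "\<And>q. 0 \<le> \<theta> q" "\<And>q. \<theta> q \<le> 1"
    "compact (closure {q. \<theta> q \<noteq> 0})" "closure {q. \<theta> q \<noteq> 0} \<subseteq> W \<inter> dom_c c"
    "open V" "p \<in> V" "\<And>q. q \<in> V \<Longrightarrow> \<theta> q = 1"
proof -
  obtain c where c: "c \<in> A" "p \<in> dom_c c" by (rule chart_cover)
  let ?x = "map_c c p"
  have "open (map_c c ` (W \<inter> dom_c c))" "?x \<in> map_c c ` (W \<inter> dom_c c)"
    using open_chart_image[OF c(1) assms(1)] assms(2) c by auto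
  then obtain r0 where r0: "r0 > 0" "cball ?x r0 \<subseteq> map_c c ` (W \<inter> dom_c c)"
    using open_contains_cball by blast
  \<comment> \<open>The bump of radius \<open>r\<close> lives in the ball of radius
    \<open>2 * r\<close>, which is the one that has to fit.\<close>
  define r where "r = r0 / 2"
  have r: "r > 0" "cball ?x (2 * r) \<subseteq> map_c c ` (W \<inter> dom_c c)" using r0 by (auto simp: r_def)
  define K where "K = inv_c c ` cball ?x (2 * r)"
  have subs: "cball ?x (2 * r) \<subseteq> map_c c ` dom_c c" using r(2) by auto
  have K: "compact K" unfolding K_def by (rule compact_chart_preimage[OF c(1) _ subs]) simp
  have KW: "K \<subseteq> W \<inter> dom_c c"
  proof
    fix q assume "q \<in> K"
    then obtain x where "x \<in> cball ?x (2 * r)" "q = inv_c c x" by (auto simp: K_def)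
    then obtain q' where "q' \<in> W \<inter> dom_c c" "x = map_c c q'" "q = inv_c c x" using r(2) by blast
    then show "q \<in> W \<inter> dom_c c" using c by simp
  qed
  define \<theta> where "\<theta> q = (if q \<in> dom_c c then bump ?x r (map_c c q) else 0)" for q
  have supp: "\<theta> q = 0" if "q \<notin> K" for q
  proof (cases "q \<in> dom_c c")
    case True
    then have "map_c c q \<notin> cball ?x (2 * r)" using that c unfolding K_def by (metis image_eqI inv_map)
    then show ?thesis using True bump_props(4)[OF r(1), of ?x "map_c c q"] by (simp add: \<theta>_def)
  qed (simp add: \<theta>_def)
  have clK: "closure {q. \<theta> q \<noteq> 0} \<subseteq> K"
    by (rule closure_minimal) (use supp K compact_imp_closed in auto)
  have smooth: "smooth_fun A UNIV \<theta>"
  proof (rule smooth_fun_local)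
    fix q :: 'a
    show "\<exists>V. q \<in> V \<and> smooth_fun A V \<theta>"
    proof (cases "q \<in> dom_c c")
      case True
      have "smooth_fun A (dom_c c) \<theta>"
        unfolding smooth_fun_def
      proof
        fix c' assume c': "c' \<in> A"
        have o: "open (map_c c' ` (dom_c c \<inter> dom_c c'))" by (rule open_chart_image[OF c' chart_open[OF c(1)]])
        have "smooth_on (map_c c' ` (dom_c c \<inter> dom_c c')) (\<lambda>x. bump ?x r ((map_c c \<circ> inv_c c') x))"
          using transition_smooth[OF c' c(1)]
          by (intro smooth_on_compose[OF o _ _ smooth_bump]) (simp_all add: Int_commute o_def)
        then show "smooth_on (map_c c' ` (dom_c c \<inter> dom_c c')) (\<theta> \<circ> inv_c c')"
          by (subst smooth_on_cong[OF o]) (use c' in \<open>auto simp: \<theta>_def\<close>)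
      qed
      then show ?thesis using True by blast
    next
      case False
      then have "q \<in> - K" using KW by auto
      moreover have "smooth_fun A (- K) \<theta>"
        by (rule smooth_fun_cong[OF _ smooth_fun_const[of _ 0]])
           (use supp compact_imp_closed[OF K] in auto)
      ultimately show ?thesis by blast
    qed
  qed
  define V where "V = dom_c c \<inter> map_c c -` ball ?x r"
  have "open V" unfolding V_def
    using continuous_open_preimage[OF continuous_map_c[OF c(1)] chart_open[OF c(1)]] by auto
  moreover have "p \<in> V" using c r by (simp add: V_def)
  moreover have "\<theta> q = 1" if "q \<in> V" for q
    using that bump_props(3)[OF r(1), of ?x "map_c c q"] by (auto simp: V_def \<theta>_def)
  moreover have "0 \<le> \<theta> q" "\<theta> q \<le> 1" for q
    using bump_props(1,2)[OF r(1)] by (auto simp: \<theta>_def)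
  moreover have "compact (closure {q. \<theta> q \<noteq> 0})"
    by (rule compact_closed_subset[OF K closed_closure clK])
  ultimately show ?thesis
    using that[of c \<theta> V] c(1) smooth clK KW by blast
qed

lemma telescoping_product:
  fixes n :: nat
  shows "(\<Sum>i<n. \<theta> i * (\<Prod>j<i. 1 - \<theta> j)) = 1 - (\<Prod>j<n. 1 - \<theta> j :: real)"
  by (induction n) (simp_all add: algebra_simps)

text \<open>Bumps that are 1 near the points of \<open>K\<close> are multiplied by the complements
  to 1 of all earlier bumps. The sum telescopes and equals 1 wherever some bump is 1, so the
  normalisation comes without a division. The predicate \<open>P\<close> records a property of the
  covering sets that the caller wants to keep.\<close>

lemma partition_of_unity:
  assumes K: "compact K" and cov: "\<And>p. p \<in> K \<Longrightarrow> \<exists>W. open W \<and> p \<in> W \<and> P W"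
  obtains n :: nat and \<rho> :: "nat \<Rightarrow> 'a \<Rightarrow> real" and c W where
    "\<And>i. i < n \<Longrightarrow> c i \<in> A" "\<And>i. i < n \<Longrightarrow> P (W i)" "\<And>i. i < n \<Longrightarrow> open (W i)"
    "\<And>i. i < n \<Longrightarrow> smooth_fun A UNIV (\<rho> i)" "\<And>i q. i < n \<Longrightarrow> 0 \<le> \<rho> i q"
    "\<And>i. i < n \<Longrightarrow> compact (closure {q. \<rho> i q \<noteq> 0})"
    "\<And>i. i < n \<Longrightarrow> closure {q. \<rho> i q \<noteq> 0} \<subseteq> W i \<inter> dom_c (c i)"
    "\<And>p. p \<in> K \<Longrightarrow> (\<Sum>i<n. \<rho> i p) = 1"
proof -
  define Q where "Q p \<theta> c V W \<longleftrightarrow> c \<in> A \<and> P W \<and> open W \<and> smooth_fun A UNIV \<theta> \<and> (\<forall>q. 0 \<le> \<theta> q) \<and> (\<forall>q. \<theta> q \<le> 1) \<and>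
     compact (closure {q. \<theta> q \<noteq> 0}) \<and> closure {q. \<theta> q \<noteq> 0} \<subseteq> W \<inter> dom_c c \<and>
     open V \<and> p \<in> V \<and> (\<forall>q\<in>V. \<theta> q = (1::real))" for p \<theta> c V W
  have ex: "\<exists>\<theta> c V W. Q p \<theta> c V W" if p: "p \<in> K" for p
  proof -
    obtain W where W: "open W" "p \<in> W" "P W" using cov p by blast
    obtain \<theta> :: "'a \<Rightarrow> real" and c V where "c \<in> A" "smooth_fun A UNIV \<theta>" "\<And>q. 0 \<le> \<theta> q" "\<And>q. \<theta> q \<le> 1"
      "compact (closure {q. \<theta> q \<noteq> 0})" "closure {q. \<theta> q \<noteq> 0} \<subseteq> W \<inter> dom_c c"
      "open V" "p \<in> V" "\<And>q. q \<in> V \<Longrightarrow> \<theta> q = 1"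
      by (rule manifold_bump[OF W(1,2)], rule that)
    then have "Q p \<theta> c V W" unfolding Q_def using W by blast
    then show ?thesis by blast
  qed
  obtain \<theta> c V W where Q0: "\<And>p. p \<in> K \<Longrightarrow> Q p (\<theta> p) (c p) (V p) (W p)"
    using ex by metis
  note Q = Q0[unfolded Q_def]
  obtain F where F: "F \<subseteq> K" "finite F" "K \<subseteq> (\<Union>p\<in>F. V p)"
  proof (rule compactE_image[OF K, of K V])
    show "open (V p)" if "p \<in> K" for p using Q[OF that] by blast
    show "K \<subseteq> (\<Union>p\<in>K. V p)" using Q by blast
  qed (rule that)
  \<comment> \<open>The enumeration supplies the order in which bumps count as earlier.\<close>
  obtain e n where e: "F = e ` {i::nat. i < n}" "inj_on e {i. i < n}"
    using finite_imp_nat_seg_image_inj_on[OF F(2)] by blast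
  have eK: "e i \<in> K" if "i < n" for i using that e(1) F(1) by auto
  note Q' = Q[OF eK]
  define \<rho> where "\<rho> i p = \<theta> (e i) p * (\<Prod>j<i. 1 - \<theta> (e j) p)" for i p
  have sub: "closure {q. \<rho> i q \<noteq> 0} \<subseteq> closure {q. \<theta> (e i) q \<noteq> 0}" for i
    by (rule closure_mono) (auto simp: \<rho>_def)
  show ?thesis
  proof (rule that[of n "c \<circ> e" "W \<circ> e" \<rho>])
    fix i assume i: "i < n"
    note q = Q'[OF i]
    then show "(c \<circ> e) i \<in> A" "P ((W \<circ> e) i)" "open ((W \<circ> e) i)" by auto
    show "smooth_fun A UNIV (\<rho> i)"
      unfolding \<rho>_def using Q' i
      by (intro smooth_fun_mult smooth_fun_prod smooth_fun_diff smooth_fun_const open_UNIV) auto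
    show "0 \<le> \<rho> i q" for q
      unfolding \<rho>_def using Q' i by (intro mult_nonneg_nonneg prod_nonneg) auto
    show "compact (closure {q. \<rho> i q \<noteq> 0})"
      by (rule compact_closed_subset[OF _ closed_closure sub[of i]]) (use q in simp)
    show "closure {q. \<rho> i q \<noteq> 0} \<subseteq> (W \<circ> e) i \<inter> dom_c ((c \<circ> e) i)"
      using q sub[of i] by auto
  next
    fix p assume "p \<in> K"
    then obtain i where i: "i < n" "p \<in> V (e i)" using F(3) e(1) by auto
    then have "\<theta> (e i) p = 1" using Q'[OF i(1)] by blast
    then have "(\<Prod>j<n. 1 - \<theta> (e j) p) = 0" using i(1) by auto
    then show "(\<Sum>i<n. \<rho> i p) = 1" unfolding \<rho>_def telescoping_product by simp
  qed
qed

text \<open>\<open>partition_on\<close> has one function for each chart, so functions subordinate to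
  the same chart are added up.\<close>

lemma partition_on_exists:
  assumes "compact K"
  obtains C \<rho> where "partition_on A K C \<rho>"
proof -
  obtain n :: nat and \<rho> :: "nat \<Rightarrow> 'a \<Rightarrow> real" and c and W :: "nat \<Rightarrow> 'a set" where
    \<rho>: "\<And>i. i < n \<Longrightarrow> c i \<in> A" "\<And>i. i < n \<Longrightarrow> True" "\<And>i. i < n \<Longrightarrow> open (W i)"
    "\<And>i. i < n \<Longrightarrow> smooth_fun A UNIV (\<rho> i)" "\<And>i q. i < n \<Longrightarrow> 0 \<le> \<rho> i q"
    "\<And>i. i < n \<Longrightarrow> compact (closure {q. \<rho> i q \<noteq> 0})"
    "\<And>i. i < n \<Longrightarrow> closure {q. \<rho> i q \<noteq> 0} \<subseteq> W i \<inter> dom_c (c i)"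
    "\<And>p. p \<in> K \<Longrightarrow> (\<Sum>i<n. \<rho> i p) = 1"
    by (rule partition_of_unity[OF assms, of "\<lambda>_. True"], blast, rule that)
  define R where "R d p = (\<Sum>i\<in>{i. i < n \<and> c i = d}. \<rho> i p)" for d p
  show ?thesis
  proof (rule that[of "c ` {..<n}" R], unfold partition_on_def, intro conjI ballI)
    fix d assume d: "d \<in> c ` {..<n}"
    let ?Z = "\<Union>i\<in>{i. i < n \<and> c i = d}. closure {q. \<rho> i q \<noteq> 0}"
    have Z: "compact ?Z" by (rule compact_UN) (use \<rho>(6) in auto)
    have sub: "closure {q. R d q \<noteq> 0} \<subseteq> ?Z"
    proof (rule closure_minimal)
      show "{q. R d q \<noteq> 0} \<subseteq> ?Z"
      proof
        fix q assume "q \<in> {q. R d q \<noteq> 0}"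
        then obtain i where "i < n" "c i = d" "\<rho> i q \<noteq> 0"
          unfolding R_def by (metis (mono_tags, lifting) mem_Collect_eq sum.neutral)
        then show "q \<in> ?Z" using closure_subset[of "{q. \<rho> i q \<noteq> 0}"] by blast
      qed
    qed (rule compact_imp_closed[OF Z])
    show "smooth_fun A UNIV (R d)"
      unfolding R_def by (intro smooth_fun_sum open_UNIV \<rho>(4)) auto
    show "\<forall>p. 0 \<le> R d p" unfolding R_def by (auto intro!: sum_nonneg \<rho>(5))
    show "compact (closure {p. R d p \<noteq> 0})"
      by (rule compact_closed_subset[OF Z closed_closure sub])
    show "closure {p. R d p \<noteq> 0} \<subseteq> dom_c d" using sub \<rho>(7) by fastforce
  next
    fix p assume "p \<in> K"
    have "(\<Sum>d\<in>c ` {..<n}. R d p) = (\<Sum>d\<in>c ` {..<n}. \<Sum>i\<in>{i \<in> {..<n}. c i = d}. \<rho> i p)"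
      unfolding R_def by simp
    also have "\<dots> = (\<Sum>i<n. \<rho> i p)" by (rule sum.image_gen[symmetric]) simp
    finally show "(\<Sum>d\<in>c ` {..<n}. R d p) = 1" using \<rho>(8)[OF \<open>p \<in> K\<close>] by simp
  qed (use \<rho>(1) in auto)
qed

end

section \<open>Forms on manifolds\<close>

definition loc :: "('a, 'n) chart \<Rightarrow> ('a, 'n) form \<Rightarrow> (real, 'n::finite) vec \<Rightarrow> (real, 'n) vec list \<Rightarrow> complex" where
  "loc c \<omega> x = \<omega> c (inv_c c x)"

lemma loc_wedge: "loc c (wedge \<omega> \<eta>) x = lwedge (loc c \<omega> x) (loc c \<eta> x)"
  by (simp add: loc_def wedge_lwedge)

context oriented_manifold
begin

lemma form_onD:
  assumes "form_on A U \<omega>" "c \<in> A" "p \<in> U" "p \<in> dom_c c"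
  shows "alternating (\<omega> c p)"
    and "c' \<in> A \<Longrightarrow> p \<in> dom_c c' \<Longrightarrow> \<omega> c p vs = \<omega> c' p (map (trans_deriv c c' p) vs)"
  using assms unfolding form_on_def by blast+

lemma form_onI:
  assumes "\<And>c p. c \<in> A \<Longrightarrow> p \<in> U \<Longrightarrow> p \<in> dom_c c \<Longrightarrow> alternating (\<omega> c p)"
    and "\<And>c c' p vs. c \<in> A \<Longrightarrow> c' \<in> A \<Longrightarrow> p \<in> U \<Longrightarrow> p \<in> dom_c c \<Longrightarrow> p \<in> dom_c c' \<Longrightarrow>
      \<omega> c p vs = \<omega> c' p (map (trans_deriv c c' p) vs)"
  shows "form_on A U \<omega>"
  using assms unfolding form_on_def by blast

lemma form_on_subset: "form_on A U \<omega> \<Longrightarrow> V \<subseteq> U \<Longrightarrow> form_on A V \<omega>"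
  unfolding form_on_def by blast

lemma form_support_closed: "closed (form_support A \<omega>)"
  by (simp add: form_support_def)

lemma form_support_zero: "c \<in> A \<Longrightarrow> p \<in> dom_c c \<Longrightarrow> p \<notin> form_support A \<omega> \<Longrightarrow> \<omega> c p vs = 0"
  using closure_subset[of "{p. \<exists>c\<in>A. p \<in> dom_c c \<and> (\<exists>vs. \<omega> c p vs \<noteq> 0)}"]
  unfolding form_support_def by (metis (mono_tags, lifting) mem_Collect_eq subsetD)

lemma form_support_subset:
  assumes "closed Z" "\<And>c p vs. c \<in> A \<Longrightarrow> p \<in> dom_c c \<Longrightarrow> p \<notin> Z \<Longrightarrow> \<omega> c p vs = 0"
  shows "form_support A \<omega> \<subseteq> Z"
  unfolding form_support_def using assms by (intro closure_minimal) auto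

lemma form_support_wedge_right: "form_support A (wedge \<omega> \<eta>) \<subseteq> form_support A \<eta>"
proof (rule form_support_subset[OF form_support_closed])
  fix c p vs assume "c \<in> A" "p \<in> dom_c c" "p \<notin> form_support A \<eta>"
  then have "\<eta> c p = (\<lambda>vs. 0)" by (simp add: fun_eq_iff form_support_zero)
  then show "wedge \<omega> \<eta> c p vs = 0" by (simp add: wedge_lwedge lwedge_zero_right)
qed

text \<open>\<open>\<omega>\<close> is known to be a form on \<open>U\<close> only; elsewhere
  \<open>\<eta>\<close>, and with it the product, is zero.\<close>

lemma form_on_wedge:
  assumes "form_on A U \<omega>" "form_on A UNIV \<eta>" "form_support A \<eta> \<subseteq> U"
  shows "form_on A UNIV (wedge \<omega> \<eta>)"
proof (rule form_onI)
  fix c p assume p: "c \<in> A" "p \<in> dom_c c"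
  show "alternating (wedge \<omega> \<eta> c p)"
  proof (cases "p \<in> U")
    case True
    then show ?thesis using form_onD(1) assms p by (simp add: wedge_lwedge alternating_lwedge)
  next
    case False
    then have "wedge \<omega> \<eta> c p = (\<lambda>vs. 0)"
      using form_support_zero[of c p "wedge \<omega> \<eta>"] form_support_wedge_right assms(3) p by blast
    then show ?thesis by (simp add: alternating_0)
  qed
next
  fix c c' p vs assume p: "c \<in> A" "c' \<in> A" "p \<in> dom_c c" "p \<in> dom_c c'"
  show "wedge \<omega> \<eta> c p vs = wedge \<omega> \<eta> c' p (map (trans_deriv c c' p) vs)"
  proof (cases "p \<in> U")
    case True
    have "\<omega> c p = (\<lambda>vs. \<omega> c' p (map (trans_deriv c c' p) vs))" "\<eta> c p = (\<lambda>vs. \<eta> c' p (map (trans_deriv c c' p) vs))"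
      using form_onD(2) assms(1,2) p True by blast+
    then show ?thesis unfolding wedge_lwedge by (simp add: lwedge_map)
  next
    case False
    then have "wedge \<omega> \<eta> d p us = 0" if "d \<in> A" "p \<in> dom_c d" for d us
      using form_support_zero[of d p "wedge \<omega> \<eta>"] form_support_wedge_right assms(3) that by blast
    then show ?thesis using p by simp
  qed
qed

lemma form_on_sum:
  assumes "\<And>i. i \<in> I \<Longrightarrow> form_on A U (\<omega> i)"
  shows "form_on A U (\<lambda>c p vs. \<Sum>i\<in>I. \<omega> i c p vs)"
  by (rule form_onI) (use assms in \<open>auto intro!: alternating_sum form_onD(1) sum.cong form_onD(2)\<close>)

lemma form_on_diff: "form_on A U \<omega> \<Longrightarrow> form_on A U \<eta> \<Longrightarrow> form_on A U (form_diff \<omega> \<eta>)"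
  unfolding form_diff_def
  by (rule form_onI) (auto intro!: alternating_diff form_onD(1) arg_cong2[of _ _ _ _ "(-)"] form_onD(2))

lemma form_on_add: "form_on A U \<omega> \<Longrightarrow> form_on A U \<eta> \<Longrightarrow> form_on A U (form_add \<omega> \<eta>)"
  unfolding form_add_def
  by (rule form_onI) (auto intro!: alternating_add form_onD(1) arg_cong2[of _ _ _ _ "(+)"] form_onD(2))

lemma form_on_scale_fun: "form_on A U \<omega> \<Longrightarrow> form_on A U (\<lambda>c p vs. g p * \<omega> c p vs)"
  by (rule form_onI) (auto intro!: alternating_cmult form_onD(1) arg_cong2[of _ _ _ _ "(*)"] form_onD(2))

lemma form_on_scale: "form_on A U \<omega> \<Longrightarrow> form_on A U (form_scale z \<omega>)"
  unfolding form_scale_def by (rule form_on_scale_fun)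

lemma form_on_part: "form_on A U \<omega> \<Longrightarrow> form_on A U (form_part k \<omega>)"
  unfolding form_part_def
  by (rule form_onI) (auto intro!: alternating_if_length form_onD(1) form_onD(2))

lemma smooth_formD: "smooth_form A U \<omega> \<Longrightarrow> form_on A U \<omega>"
  "smooth_form A U \<omega> \<Longrightarrow> c \<in> A \<Longrightarrow> fsmooth (map_c c ` (U \<inter> dom_c c)) (loc c \<omega>)"
  unfolding smooth_form_def fsmooth_def loc_def by blast+

lemma smooth_formI:
  assumes "form_on A U \<omega>" "\<And>c. c \<in> A \<Longrightarrow> fsmooth (map_c c ` (U \<inter> dom_c c)) (loc c \<omega>)"
  shows "smooth_form A U \<omega>"
  using assms unfolding smooth_form_def fsmooth_def loc_def by blast

lemma smooth_form_subset: "smooth_form A U \<omega> \<Longrightarrow> V \<subseteq> U \<Longrightarrow> smooth_form A V \<omega>"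
  by (rule smooth_formI) (auto intro: form_on_subset smooth_formD(1) fsmooth_subset[OF smooth_formD(2)])

lemma smooth_form_wedge:
  assumes "smooth_form A UNIV \<omega>" "smooth_form A UNIV \<eta>"
  shows "smooth_form A UNIV (wedge \<omega> \<eta>)"
proof (rule smooth_formI)
  show "form_on A UNIV (wedge \<omega> \<eta>)" using assms form_on_wedge smooth_formD(1) by blast
  fix c assume c: "c \<in> A"
  show "fsmooth (map_c c ` (UNIV \<inter> dom_c c)) (loc c (wedge \<omega> \<eta>))"
    using fsmooth_lwedge[OF open_chart_image[OF c open_UNIV] smooth_formD(2)[OF assms(1) c] smooth_formD(2)[OF assms(2) c]]
    by (simp add: loc_wedge[abs_def])
qed

lemma smooth_form_sum:
  assumes "open U" "\<And>i. i \<in> I \<Longrightarrow> smooth_form A U (\<omega> i)"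
  shows "smooth_form A U (\<lambda>c p vs. \<Sum>i\<in>I. \<omega> i c p vs)"
proof (rule smooth_formI)
  show "form_on A U (\<lambda>c p vs. \<Sum>i\<in>I. \<omega> i c p vs)" by (intro form_on_sum smooth_formD(1) assms)
  fix c assume c: "c \<in> A"
  show "fsmooth (map_c c ` (U \<inter> dom_c c)) (loc c (\<lambda>c p vs. \<Sum>i\<in>I. \<omega> i c p vs))"
  proof -
    have "fsmooth (map_c c ` (U \<inter> dom_c c)) (\<lambda>x vs. \<Sum>i\<in>I. loc c (\<omega> i) x vs)"
      by (rule fsmooth_sum[OF open_chart_image[OF c assms(1)] smooth_formD(2)[OF assms(2) c]])
    then show ?thesis by (simp add: loc_def[abs_def])
  qed
qed

lemma smooth_form_scale_fun:
  assumes "open U" "smooth_fun A U g" "smooth_form A U \<omega>"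
  shows "smooth_form A U (\<lambda>c p vs. g p * \<omega> c p vs)"
proof (rule smooth_formI)
  show "form_on A U (\<lambda>c p vs. g p * \<omega> c p vs)" by (intro form_on_scale_fun smooth_formD(1) assms)
  fix c assume c: "c \<in> A"
  show "fsmooth (map_c c ` (U \<inter> dom_c c)) (loc c (\<lambda>c p vs. g p * \<omega> c p vs))"
    using smooth_on_mult[OF open_chart_image[OF c assms(1)] smooth_funD[OF assms(2) c] fsmoothD[OF smooth_formD(2)[OF assms(3) c]]]
    by (simp add: fsmooth_def loc_def)
qed

lemma smooth_form_scale: "open U \<Longrightarrow> smooth_form A U \<omega> \<Longrightarrow> smooth_form A U (form_scale z \<omega>)"
  unfolding form_scale_def using smooth_form_scale_fun[of U "\<lambda>p. z"] smooth_fun_const by blast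

lemma smooth_form_diff:
  assumes "open U" "smooth_form A U \<omega>" "smooth_form A U \<eta>"
  shows "smooth_form A U (form_diff \<omega> \<eta>)"
proof (rule smooth_formI)
  show "form_on A U (form_diff \<omega> \<eta>)" by (intro form_on_diff smooth_formD(1) assms)
  fix c assume c: "c \<in> A"
  show "fsmooth (map_c c ` (U \<inter> dom_c c)) (loc c (form_diff \<omega> \<eta>))"
    using fsmooth_diff[OF open_chart_image[OF c assms(1)] smooth_formD(2)[OF assms(2) c] smooth_formD(2)[OF assms(3) c]]
    by (simp add: form_diff_def loc_def[abs_def])
qed

lemma smooth_form_add:
  assumes "open U" "smooth_form A U \<omega>" "smooth_form A U \<eta>"
  shows "smooth_form A U (form_add \<omega> \<eta>)"
proof (rule smooth_formI)
  show "form_on A U (form_add \<omega> \<eta>)" by (intro form_on_add smooth_formD(1) assms)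
  fix c assume c: "c \<in> A"
  show "fsmooth (map_c c ` (U \<inter> dom_c c)) (loc c (form_add \<omega> \<eta>))"
    using fsmooth_add[OF open_chart_image[OF c assms(1)] smooth_formD(2)[OF assms(2) c] smooth_formD(2)[OF assms(3) c]]
    by (simp add: form_add_def loc_def[abs_def])
qed

lemma smooth_form_part:
  assumes "smooth_form A U \<omega>"
  shows "smooth_form A U (form_part k \<omega>)"
proof (rule smooth_formI)
  show "form_on A U (form_part k \<omega>)" by (intro form_on_part smooth_formD(1) assms)
  fix c assume c: "c \<in> A"
  show "fsmooth (map_c c ` (U \<inter> dom_c c)) (loc c (form_part k \<omega>))"
    using fsmooth_if[OF smooth_formD(2)[OF assms c], of "\<lambda>vs. length vs = k"]
    by (simp add: form_part_def loc_def[abs_def] cong: if_cong)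
qed

lemma ext_deriv_ld: "c \<in> A \<Longrightarrow> p \<in> dom_c c \<Longrightarrow> ext_deriv A \<omega> c p = ld (loc c \<omega>) (map_c c p)"
  by (rule ext) (simp add: ext_deriv_def ld_def loc_def)

lemma ext_deriv_outside: "\<not> (c \<in> A \<and> p \<in> dom_c c) \<Longrightarrow> ext_deriv A \<omega> c p vs = 0"
  by (auto simp: ext_deriv_def)

lemma loc_ext_deriv: "c \<in> A \<Longrightarrow> x \<in> map_c c ` dom_c c \<Longrightarrow> loc c (ext_deriv A \<omega>) x = ld (loc c \<omega>) x"
  by (auto simp: loc_def ext_deriv_ld)

text \<open>Compatibility of the representatives means that the transition map pulls one back to the
  other. This connects \<open>form_on\<close> with \<open>ld_lpull\<close>.\<close>

lemma form_on_lpull: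
  assumes "form_on A U \<omega>" "c \<in> A" "c' \<in> A" "x \<in> map_c c ` (U \<inter> dom_c c \<inter> dom_c c')"
  shows "loc c \<omega> x vs = lpull (map_c c' \<circ> inv_c c) (loc c' \<omega>) x vs"
proof -
  obtain p where p: "p \<in> U" "p \<in> dom_c c" "p \<in> dom_c c'" "x = map_c c p" using assms(4) by auto
  then show ?thesis
    using form_onD(2)[OF assms(1,2) p(1,2) assms(3) p(3)] assms(2,3)
    by (simp add: loc_def lpull_def trans_deriv_def)
qed

text \<open>Independence of the chart is the naturality of \<open>ld\<close> under the transition
  map on the overlap.\<close>

lemma smooth_form_ext_deriv:
  assumes U: "open U" and \<omega>: "smooth_form A U \<omega>"
  shows "smooth_form A U (ext_deriv A \<omega>)"
proof (rule smooth_formI)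
  note sm = smooth_formD(2)[OF \<omega>]
  show "form_on A U (ext_deriv A \<omega>)"
  proof (rule form_onI)
    fix c p assume p: "c \<in> A" "p \<in> U" "p \<in> dom_c c"
    have "alternating (ld (loc c \<omega>) (map_c c p))"
    proof (rule alternating_ld[OF open_chart_image[OF p(1) U] _ sm[OF p(1)]])
      fix y assume "y \<in> map_c c ` (U \<inter> dom_c c)"
      then show "alternating (loc c \<omega> y)"
        using p(1) form_onD(1)[OF smooth_formD(1)[OF \<omega>] p(1)] by (auto simp: loc_def)
    qed (use p in auto)
    then show "alternating (ext_deriv A \<omega> c p)" using p by (simp add: ext_deriv_ld)
  next
    fix c c' p vs assume p: "c \<in> A" "c' \<in> A" "p \<in> U" "p \<in> dom_c c" "p \<in> dom_c c'"
    let ?W = "U \<inter> (dom_c c \<inter> dom_c c')"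
    let ?S = "map_c c ` (?W \<inter> dom_c c)" and ?T = "map_c c' ` (U \<inter> dom_c c')" and ?\<tau> = "map_c c' \<circ> inv_c c"
    have W: "open ?W" by (intro open_Int U chart_open p)
    have S: "open ?S" by (rule open_chart_image[OF p(1) W])
    have x: "map_c c p \<in> ?S" using p by auto
    have \<tau>: "smooth_on ?S ?\<tau>" by (rule smooth_on_subset[OF transition_smooth[OF p(1,2)]]) auto
    have \<tau>2: "?\<tau> ` ?S \<subseteq> ?T" using p(1) by auto
    have alt: "alternating (loc c' \<omega> y)" if "y \<in> ?T" for y
      using that p(2) form_onD(1)[OF smooth_formD(1)[OF \<omega>] p(2)] by (auto simp: loc_def)
    have "ext_deriv A \<omega> c p vs = ld (loc c \<omega>) (map_c c p) vs" using p by (simp add: ext_deriv_ld)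
    also have "\<dots> = ld (lpull ?\<tau> (loc c' \<omega>)) (map_c c p) vs"
      by (rule ld_cong_open[OF S x]) (rule form_on_lpull[OF smooth_formD(1)[OF \<omega>] p(1,2)], auto)
    also have "\<dots> = lpull ?\<tau> (ld (loc c' \<omega>)) (map_c c p) vs"
      by (rule ld_lpull[OF S open_chart_image[OF p(2) U] \<tau> \<tau>2 sm[OF p(2)] alt x])
    also have "\<dots> = ext_deriv A \<omega> c' p (map (trans_deriv c c' p) vs)"
      using p by (simp add: lpull_def trans_deriv_def ext_deriv_ld)
    finally show "ext_deriv A \<omega> c p vs = ext_deriv A \<omega> c' p (map (trans_deriv c c' p) vs)" .
  qed
next
  fix c assume c: "c \<in> A"
  show "fsmooth (map_c c ` (U \<inter> dom_c c)) (loc c (ext_deriv A \<omega>))"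
    by (rule fsmooth_cong[OF _ fsmooth_ld[OF _ smooth_formD(2)[OF \<omega> c]]])
       (auto simp: open_chart_image[OF c U] c loc_ext_deriv)
qed

lemma form_support_ext_deriv: "form_support A (ext_deriv A \<omega>) \<subseteq> form_support A \<omega>"
proof (rule form_support_subset[OF form_support_closed])
  fix c p vs assume p: "c \<in> A" "p \<in> dom_c c" "p \<notin> form_support A \<omega>"
  let ?W = "- form_support A \<omega>"
  have "loc c \<omega> y us = 0" if "y \<in> map_c c ` (?W \<inter> dom_c c)" for y us
    using that p(1) form_support_zero[OF p(1)] by (auto simp: loc_def)
  then have "ld (loc c \<omega>) (map_c c p) vs = 0"
    by (intro ld_zero[OF open_chart_image[OF p(1), of ?W]])
       (use p form_support_closed in auto)
  then show "ext_deriv A \<omega> c p vs = 0" using p by (simp add: ext_deriv_ld)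
qed

lemma ext_deriv_cong:
  assumes "open U" "c \<in> A" "p \<in> U" "p \<in> dom_c c"
    and "\<And>q vs. q \<in> U \<Longrightarrow> q \<in> dom_c c \<Longrightarrow> \<omega> c q vs = \<eta> c q vs"
  shows "ext_deriv A \<omega> c p vs = ext_deriv A \<eta> c p vs"
proof -
  have "ld (loc c \<omega>) (map_c c p) vs = ld (loc c \<eta>) (map_c c p) vs"
    by (rule ld_cong_open[OF open_chart_image[OF assms(2,1)]]) (use assms in \<open>auto simp: loc_def\<close>)
  then show ?thesis using assms by (simp add: ext_deriv_ld)
qed

lemma ext_deriv_wedge:
  assumes U: "open U" and \<omega>: "smooth_form A U \<omega>" and \<eta>: "smooth_form A U \<eta>" and p: "c \<in> A" "p \<in> U" "p \<in> dom_c c"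
  shows "ext_deriv A (wedge \<omega> \<eta>) c p vs
    = lwedge (ext_deriv A \<omega> c p) (\<eta> c p) vs + lwedge (lhat (\<omega> c p)) (ext_deriv A \<eta> c p) vs"
proof -
  have "ext_deriv A (wedge \<omega> \<eta>) c p vs = ld (\<lambda>x. lwedge (loc c \<omega> x) (loc c \<eta> x)) (map_c c p) vs"
    using p by (simp add: ext_deriv_ld loc_wedge[abs_def])
  also have "\<dots> = lwedge (ld (loc c \<omega>) (map_c c p)) (loc c \<eta> (map_c c p)) vs
      + lwedge (lhat (loc c \<omega> (map_c c p))) (ld (loc c \<eta>) (map_c c p)) vs"
    by (rule ld_lwedge[OF open_chart_image[OF p(1) U] _ smooth_formD(2)[OF \<omega> p(1)] smooth_formD(2)[OF \<eta> p(1)]])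
       (use p in auto)
  finally show ?thesis using p by (simp add: ext_deriv_ld loc_def)
qed

lemma ext_deriv_ext_deriv:
  assumes U: "open U" and \<omega>: "smooth_form A U \<omega>" and p: "c \<in> A" "p \<in> U" "p \<in> dom_c c"
  shows "ext_deriv A (ext_deriv A \<omega>) c p vs = 0"
proof -
  have "ld (loc c (ext_deriv A \<omega>)) (map_c c p) vs = ld (ld (loc c \<omega>)) (map_c c p) vs"
    by (rule ld_cong_open[OF open_chart_image[OF p(1) U]]) (use p in \<open>auto simp: loc_ext_deriv\<close>)
  also have "\<dots> = 0"
    by (rule ld_ld[OF open_chart_image[OF p(1) U] _ smooth_formD(2)[OF \<omega> p(1)]]) (use p in auto)
  finally show ?thesis using p by (simp add: ext_deriv_ld)
qed

lemma ext_deriv_diff: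
  assumes U: "open U" and \<omega>: "smooth_form A U \<omega>" and \<eta>: "smooth_form A U \<eta>" and p: "c \<in> A" "p \<in> U" "p \<in> dom_c c"
  shows "ext_deriv A (form_diff \<omega> \<eta>) c p vs = ext_deriv A \<omega> c p vs - ext_deriv A \<eta> c p vs"
  using ld_diff[OF smooth_formD(2)[OF \<omega> p(1)] smooth_formD(2)[OF \<eta> p(1)], of "map_c c p" vs] p
  by (simp add: ext_deriv_ld form_diff_def loc_def[abs_def])

lemma ext_deriv_add:
  assumes U: "open U" and \<omega>: "smooth_form A U \<omega>" and \<eta>: "smooth_form A U \<eta>" and p: "c \<in> A" "p \<in> U" "p \<in> dom_c c"
  shows "ext_deriv A (form_add \<omega> \<eta>) c p vs = ext_deriv A \<omega> c p vs + ext_deriv A \<eta> c p vs"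
  using ld_add[OF smooth_formD(2)[OF \<omega> p(1)] smooth_formD(2)[OF \<eta> p(1)], of "map_c c p" vs] p
  by (simp add: ext_deriv_ld form_add_def loc_def[abs_def])

lemma ext_deriv_scale:
  assumes U: "open U" and \<omega>: "smooth_form A U \<omega>" and p: "c \<in> A" "p \<in> U" "p \<in> dom_c c"
  shows "ext_deriv A (form_scale z \<omega>) c p vs = z * ext_deriv A \<omega> c p vs"
  using ld_cmult[OF smooth_formD(2)[OF \<omega> p(1)], of "map_c c p" z vs] p
  by (simp add: ext_deriv_ld form_scale_def loc_def[abs_def])

lemma ext_deriv_sum:
  assumes U: "open U" and \<omega>: "\<And>i. i \<in> I \<Longrightarrow> smooth_form A U (\<omega> i)" and p: "c \<in> A" "p \<in> U" "p \<in> dom_c c"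
  shows "ext_deriv A (\<lambda>c p vs. \<Sum>i\<in>I. \<omega> i c p vs) c p vs = (\<Sum>i\<in>I. ext_deriv A (\<omega> i) c p vs)"
proof -
  have "ld (\<lambda>y vs. \<Sum>i\<in>I. loc c (\<omega> i) y vs) (map_c c p) vs = (\<Sum>i\<in>I. ld (loc c (\<omega> i)) (map_c c p) vs)"
    by (rule ld_sum[OF smooth_formD(2)[OF \<omega> p(1)]]) (use p in auto)
  then show ?thesis using p by (simp add: ext_deriv_ld loc_def[abs_def])
qed

subsection \<open>Locally integrable forms\<close>

lemma L1loc_formD:
  "L1loc_form A U \<omega> \<Longrightarrow> form_on A U \<omega>"
  "L1loc_form A U \<omega> \<Longrightarrow> c \<in> A \<Longrightarrow> compact K \<Longrightarrow> K \<subseteq> map_c c ` (U \<inter> dom_c c) \<Longrightarrow>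
     (\<lambda>x. loc c \<omega> x vs) absolutely_integrable_on K"
  unfolding L1loc_form_def loc_def by blast+

lemma L1loc_formI:
  assumes "form_on A U \<omega>"
    and "\<And>c K vs. c \<in> A \<Longrightarrow> compact K \<Longrightarrow> K \<subseteq> map_c c ` (U \<inter> dom_c c) \<Longrightarrow> (\<lambda>x. loc c \<omega> x vs) absolutely_integrable_on K"
  shows "L1loc_form A U \<omega>"
  using assms unfolding L1loc_form_def loc_def by blast

end

section \<open>Integrability over compact sets\<close>

lemma absolutely_integrable_continuous_mult:
  fixes f g :: "'v::euclidean_space \<Rightarrow> complex"
  assumes K: "compact K" and f: "continuous_on K f" and g: "g absolutely_integrable_on K"
  shows "(\<lambda>x. f x * g x) absolutely_integrable_on K"
proof -
  have S: "K \<in> sets lebesgue" using K by (simp add: compact_imp_closed)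
  have "bilinear ((*) :: complex \<Rightarrow> complex \<Rightarrow> complex)"
    by (rule bilinear_times)
  from absolutely_integrable_bounded_measurable_product[OF this
      continuous_imp_measurable_on_sets_lebesgue[OF f S] S compact_imp_bounded[OF compact_continuous_image[OF f K]] g]
  show ?thesis .
qed

lemma absolutely_integrable_continuous_compact:
  fixes f :: "'v::euclidean_space \<Rightarrow> complex"
  assumes K: "compact K" and f: "continuous_on K f"
  shows "f absolutely_integrable_on K"
proof -
  have "(\<lambda>x. 1 :: complex) absolutely_integrable_on K"
    using lmeasurable_compact[OF K] by (simp add: absolutely_integrable_on_const)
  from absolutely_integrable_continuous_mult[OF K f this] show ?thesis by simp
qed

lemma absolutely_integrable_on_zero_outside:
  fixes f :: "'v::euclidean_space \<Rightarrow> complex"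
  assumes "K \<subseteq> S" "\<And>x. x \<in> S \<Longrightarrow> x \<notin> K \<Longrightarrow> f x = 0"
  shows "f absolutely_integrable_on S \<longleftrightarrow> f absolutely_integrable_on K"
    and "set_lebesgue_integral lebesgue S f = set_lebesgue_integral lebesgue K f"
proof -
  have "(\<lambda>x. indicat_real S x *\<^sub>R f x) = (\<lambda>x. indicat_real K x *\<^sub>R f x)"
    using assms by (auto simp: indicator_def fun_eq_iff)
  then show "f absolutely_integrable_on S \<longleftrightarrow> f absolutely_integrable_on K"
    "set_lebesgue_integral lebesgue S f = set_lebesgue_integral lebesgue K f"
    unfolding set_integrable_def set_lebesgue_integral_def by simp_all
qed

context oriented_manifold
begin

lemma smooth_form_L1loc:
  assumes "open U" "smooth_form A U \<omega>"
  shows "L1loc_form A U \<omega>"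
proof (rule L1loc_formI)
  show "form_on A U \<omega>" by (rule smooth_formD(1)[OF assms(2)])
  fix c K vs assume "c \<in> A" "compact K" "K \<subseteq> map_c c ` (U \<inter> dom_c c)"
  then show "(\<lambda>x. loc c \<omega> x vs) absolutely_integrable_on K"
    using smooth_on_continuous_on[OF fsmoothD[OF smooth_formD(2)[OF assms(2)]]] continuous_on_subset
    by (intro absolutely_integrable_continuous_compact) blast+
qed

text \<open>\<open>\<omega>\<close> is controlled on compact sets over \<open>U\<close> only. The
  part of \<open>K\<close> over the support of \<open>\<eta>\<close> is such a set, the coefficients
  of \<open>\<eta>\<close> are continuous there, and the product is zero on the rest of
  \<open>K\<close>.\<close>

lemma L1loc_form_wedge:
  assumes \<omega>: "L1loc_form A U \<omega>" and \<eta>: "smooth_form A UNIV \<eta>" and supp: "form_support A \<eta> \<subseteq> U"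
  shows "L1loc_form A UNIV (wedge \<omega> \<eta>)"
proof (rule L1loc_formI)
  show "form_on A UNIV (wedge \<omega> \<eta>)"
    by (rule form_on_wedge[OF L1loc_formD(1)[OF \<omega>] smooth_formD(1)[OF \<eta>] supp])
  fix c K vs assume c: "c \<in> A" and K: "compact K" "K \<subseteq> map_c c ` (UNIV \<inter> dom_c c)"
  let ?L = "K \<inter> map_c c ` (form_support A \<eta> \<inter> dom_c c)"
  have L: "compact ?L" by (rule compact_Int_chart_image[OF c K(1) _ form_support_closed]) (use K(2) in simp)
  have sub: "?L \<subseteq> map_c c ` (U \<inter> dom_c c)" using supp by auto
  have "(\<lambda>x. loc c (wedge \<omega> \<eta>) x vs) absolutely_integrable_on ?L"
  proof -
    have "continuous_on ?L (\<lambda>x. loc c \<eta> x us)" for us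
      using smooth_on_continuous_on[OF fsmoothD[OF smooth_formD(2)[OF \<eta> c]]]
      by (rule continuous_on_subset) auto
    then have "(\<lambda>x. (shuffle_sign (length vs) I * loc c \<eta> x (nths vs ({..<length vs} - I))) * loc c \<omega> x (nths vs I))
        absolutely_integrable_on ?L" for I
      by (intro absolutely_integrable_continuous_mult L L1loc_formD(2)[OF \<omega> c L sub] continuous_intros)
    then have "(\<lambda>x. \<Sum>I\<in>Pow {..<length vs}. (shuffle_sign (length vs) I * loc c \<eta> x (nths vs ({..<length vs} - I))) * loc c \<omega> x (nths vs I))
        absolutely_integrable_on ?L"
      by (intro absolutely_integrable_sum) auto
    then show ?thesis by (simp add: loc_wedge lwedge_def mult_ac)
  qed
  moreover have "loc c (wedge \<omega> \<eta>) x vs = 0" if "x \<in> K" "x \<notin> ?L" for x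
  proof -
    from that K(2) obtain p where p: "p \<in> dom_c c" "x = map_c c p" by blast
    then have "p \<notin> form_support A (wedge \<omega> \<eta>)" using that form_support_wedge_right by blast
    then show ?thesis using p c form_support_zero[OF c p(1)] by (simp add: loc_def)
  qed
  ultimately show "(\<lambda>x. loc c (wedge \<omega> \<eta>) x vs) absolutely_integrable_on K"
    using absolutely_integrable_on_zero_outside(1)[of ?L K "\<lambda>x. loc c (wedge \<omega> \<eta>) x vs"] by blast
qed

lemma L1loc_form_cong:
  assumes "L1loc_form A UNIV \<eta>" "\<And>c p vs. c \<in> A \<Longrightarrow> p \<in> dom_c c \<Longrightarrow> \<omega> c p vs = \<eta> c p vs"
  shows "L1loc_form A UNIV \<omega>"
proof (rule L1loc_formI)
  have eq: "\<omega> c p = \<eta> c p" if "c \<in> A" "p \<in> dom_c c" for c p using assms(2)[OF that] by blast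
  show "form_on A UNIV \<omega>"
  proof (rule form_onI)
    note f = form_onD[OF L1loc_formD(1)[OF assms(1)]]
    show "alternating (\<omega> c p)" if "c \<in> A" "p \<in> dom_c c" for c p
      unfolding eq[OF that] using f(1) that by blast
    show "\<omega> c p vs = \<omega> c' p (map (trans_deriv c c' p) vs)"
      if "c \<in> A" "c' \<in> A" "p \<in> dom_c c" "p \<in> dom_c c'" for c c' p vs
      unfolding eq[OF that(1,3)] eq[OF that(2,4)] using f(2) that by blast
  qed
  fix c K vs assume c: "c \<in> A" and K: "compact K" "K \<subseteq> map_c c ` (UNIV \<inter> dom_c c)"
  have "loc c \<omega> x vs = loc c \<eta> x vs" if "x \<in> K" for x
  proof -
    have "inv_c c x \<in> dom_c c" using that K(2) inv_in_dom[OF c] by auto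
    then show ?thesis using eq[OF c] by (simp add: loc_def)
  qed
  then have "(\<lambda>x. indicat_real K x *\<^sub>R loc c \<omega> x vs) = (\<lambda>x. indicat_real K x *\<^sub>R loc c \<eta> x vs)"
    by (auto simp: indicator_def fun_eq_iff)
  then show "(\<lambda>x. loc c \<omega> x vs) absolutely_integrable_on K"
    using L1loc_formD(2)[OF assms(1) c K] unfolding set_integrable_def by simp
qed

lemma L1loc_form_lincomb:
  assumes "L1loc_form A U \<omega>" "L1loc_form A U \<eta>"
  shows "L1loc_form A U (\<lambda>c p vs. z * \<omega> c p vs + w * \<eta> c p vs)"
proof (rule L1loc_formI)
  show "form_on A U (\<lambda>c p vs. z * \<omega> c p vs + w * \<eta> c p vs)"
    using form_on_add[OF form_on_scale[OF L1loc_formD(1)[OF assms(1)], of z] form_on_scale[OF L1loc_formD(1)[OF assms(2)], of w]]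
    by (simp add: form_add_def form_scale_def)
  fix c K vs assume c: "c \<in> A" and K: "compact K" "K \<subseteq> map_c c ` (U \<inter> dom_c c)"
  show "(\<lambda>x. loc c (\<lambda>c p vs. z * \<omega> c p vs + w * \<eta> c p vs) x vs) absolutely_integrable_on K"
    using L1loc_formD(2)[OF assms(1) c K] L1loc_formD(2)[OF assms(2) c K]
    unfolding loc_def
    by (intro set_integral_add(1) absolutely_integrable_continuous_mult[OF K(1)] continuous_on_const)
qed

lemma L1loc_form_scale: "L1loc_form A U \<omega> \<Longrightarrow> L1loc_form A U (form_scale z \<omega>)"
  using L1loc_form_lincomb[of U \<omega> \<omega> z 0] by (simp add: form_scale_def)

end

section \<open>Integration of forms\<close>

context oriented_manifold
begin

definition cutoff :: "('a, 'n) chart \<Rightarrow> ('a \<Rightarrow> real) \<Rightarrow> bool" where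
  "cutoff c g \<longleftrightarrow> smooth_fun A UNIV g \<and> compact (closure {p. g p \<noteq> 0}) \<and> closure {p. g p \<noteq> 0} \<subseteq> dom_c c"

text \<open>A summand of \<open>form_integral\<close>, with an arbitrary function in place of a
  member of the partition; products of members of two partitions have to be allowed.\<close>

definition cint :: "('a, 'n) chart \<Rightarrow> ('a \<Rightarrow> real) \<Rightarrow> ('a, 'n) form \<Rightarrow> complex" where
  "cint c g \<eta> = set_lebesgue_integral lebesgue (map_c c ` dom_c c)
     (\<lambda>x. of_real (g (inv_c c x)) * \<eta> c (inv_c c x) std_frame)"

lemma cutoff_zero: "p \<notin> closure {p. g p \<noteq> 0} \<Longrightarrow> g p = 0"
  using closure_subset[of "{p. g p \<noteq> 0}"] by blast

lemma cutoff_outside: "cutoff c g \<Longrightarrow> p \<notin> dom_c c \<Longrightarrow> g p = 0"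
  unfolding cutoff_def using closure_subset[of "{p. g p \<noteq> 0}"] by blast

lemma cutoff_mult:
  assumes "cutoff c g" "smooth_fun A UNIV h"
  shows "cutoff c (\<lambda>p. g p * h p)"
proof -
  have sub: "closure {p. g p * h p \<noteq> 0} \<subseteq> closure {p. g p \<noteq> 0}" by (rule closure_mono) auto
  have g: "smooth_fun A UNIV g" "compact (closure {p. g p \<noteq> 0})" "closure {p. g p \<noteq> 0} \<subseteq> dom_c c"
    using assms(1) by (auto simp: cutoff_def)
  show ?thesis unfolding cutoff_def
    using smooth_fun_mult[OF open_UNIV g(1) assms(2)] compact_closed_subset[OF g(2) closed_closure sub] sub g(3)
    by blast
qed

lemma partition_cutoff: "partition_on A K C \<rho> \<Longrightarrow> c \<in> C \<Longrightarrow> cutoff c (\<rho> c) \<and> c \<in> A"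
  unfolding partition_on_def cutoff_def by blast

lemma continuous_smooth_fun:
  assumes "smooth_fun A UNIV g" "c \<in> A"
  shows "continuous_on (map_c c ` dom_c c) (\<lambda>x. g (inv_c c x))"
  using smooth_on_continuous_on[OF smooth_funD[OF assms]] by simp

lemma cutoff_integrable:
  assumes c: "c \<in> A" and g: "cutoff c g" and \<eta>: "L1loc_form A UNIV \<eta>"
  shows "(\<lambda>x. of_real (g (inv_c c x)) * \<eta> c (inv_c c x) vs) absolutely_integrable_on (map_c c ` dom_c c)"
proof -
  let ?Z = "closure {p. g p \<noteq> 0}" let ?L = "map_c c ` ?Z"
  have Z: "compact ?Z" "?Z \<subseteq> dom_c c" using g by (auto simp: cutoff_def)
  have L: "compact ?L" by (rule compact_chart_image[OF c Z])
  have sub: "?L \<subseteq> map_c c ` dom_c c" using Z by blast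
  have "continuous_on (map_c c ` dom_c c) (\<lambda>x. complex_of_real (g (inv_c c x)))"
    using continuous_smooth_fun[OF _ c] g by (auto simp: cutoff_def intro: continuous_on_of_real)
  then have "continuous_on ?L (\<lambda>x. complex_of_real (g (inv_c c x)))"
    by (rule continuous_on_subset[OF _ sub])
  then have int: "(\<lambda>x. of_real (g (inv_c c x)) * \<eta> c (inv_c c x) vs) absolutely_integrable_on ?L"
    using L1loc_formD(2)[OF \<eta> c L, of vs] sub unfolding loc_def
    by (intro absolutely_integrable_continuous_mult L) auto
  have zero: "of_real (g (inv_c c x)) * \<eta> c (inv_c c x) vs = 0" if "x \<in> map_c c ` dom_c c" "x \<notin> ?L" for x
  proof -
    have "inv_c c x \<notin> ?Z"
      using that map_inv[OF c that(1)] by (metis imageI)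
    then show ?thesis using cutoff_zero[of "inv_c c x" g] by simp
  qed
  show ?thesis
    by (subst absolutely_integrable_on_zero_outside(1)[OF sub zero]) (use int in auto)
qed

lemma cint_cong:
  assumes "c \<in> A" "\<And>p. p \<in> dom_c c \<Longrightarrow> of_real (g p) * \<eta> c p std_frame = of_real (h p) * \<omega> c p std_frame"
  shows "cint c g \<eta> = cint c h \<omega>"
proof -
  have "(\<lambda>x. indicat_real (map_c c ` dom_c c) x *\<^sub>R (of_real (g (inv_c c x)) * \<eta> c (inv_c c x) std_frame))
    = (\<lambda>x. indicat_real (map_c c ` dom_c c) x *\<^sub>R (of_real (h (inv_c c x)) * \<omega> c (inv_c c x) std_frame))"
  proof
    fix x
    show "indicat_real (map_c c ` dom_c c) x *\<^sub>R (of_real (g (inv_c c x)) * \<eta> c (inv_c c x) std_frame)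
     = indicat_real (map_c c ` dom_c c) x *\<^sub>R (of_real (h (inv_c c x)) * \<omega> c (inv_c c x) std_frame)"
    proof (cases "x \<in> map_c c ` dom_c c")
      case True
      show ?thesis unfolding assms(2)[OF inv_in_dom[OF assms(1) True]] ..
    qed simp
  qed
  then show ?thesis by (simp add: cint_def set_lebesgue_integral_def)
qed

lemma cint_cong_AE:
  assumes c: "c \<in> A" and g: "cutoff c g" and L1: "L1loc_form A UNIV \<eta>" "L1loc_form A UNIV \<omega>"
    and N: "negligible N" "\<And>p. p \<in> dom_c c \<Longrightarrow> map_c c p \<notin> N \<Longrightarrow> \<eta> c p std_frame = \<omega> c p std_frame"
  shows "cint c g \<eta> = cint c g \<omega>"
  unfolding cint_def set_lebesgue_integral_eq_integral(2)[OF cutoff_integrable[OF c g L1(1)]]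
    set_lebesgue_integral_eq_integral(2)[OF cutoff_integrable[OF c g L1(2)]]
proof (rule integral_spike[OF N(1)])
  fix x assume "x \<in> map_c c ` dom_c c - N"
  then obtain p where "p \<in> dom_c c" "x = map_c c p" "map_c c p \<notin> N" by blast
  then show "of_real (g (inv_c c x)) * \<omega> c (inv_c c x) std_frame = of_real (g (inv_c c x)) * \<eta> c (inv_c c x) std_frame"
    using N(2) c by simp
qed

lemma cint_sum:
  assumes c: "c \<in> A" and I: "\<And>i. i \<in> I \<Longrightarrow> cutoff c (g i)" and \<eta>: "L1loc_form A UNIV \<eta>"
  shows "cint c (\<lambda>p. \<Sum>i\<in>I. g i p) \<eta> = (\<Sum>i\<in>I. cint c (g i) \<eta>)"
proof -
  let ?S = "map_c c ` dom_c c"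
  let ?f = "\<lambda>i x. indicat_real ?S x *\<^sub>R (of_real (g i (inv_c c x)) * \<eta> c (inv_c c x) std_frame)"
  have "cint c (\<lambda>p. \<Sum>i\<in>I. g i p) \<eta> = (\<integral>x. (\<Sum>i\<in>I. ?f i x) \<partial>lebesgue)"
    by (simp add: cint_def set_lebesgue_integral_def sum_distrib_right scaleR_sum_right)
  also have "\<dots> = (\<Sum>i\<in>I. integral\<^sup>L lebesgue (?f i))"
    by (rule Bochner_Integration.integral_sum)
       (use cutoff_integrable[OF c I \<eta>] in \<open>simp add: set_integrable_def\<close>)
  finally show ?thesis by (simp add: cint_def set_lebesgue_integral_def)
qed

lemma cint_lincomb:
  assumes c: "c \<in> A" and g: "cutoff c g" and L1: "L1loc_form A UNIV \<eta>" "L1loc_form A UNIV \<omega>"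
  shows "cint c g (\<lambda>c p vs. z * \<eta> c p vs + w * \<omega> c p vs) = z * cint c g \<eta> + w * cint c g \<omega>"
proof -
  let ?S = "map_c c ` dom_c c"
  let ?f = "\<lambda>\<eta> x. indicat_real ?S x *\<^sub>R (of_real (g (inv_c c x)) * \<eta> c (inv_c c x) std_frame)"
  have i: "integrable lebesgue (?f \<eta>)" "integrable lebesgue (?f \<omega>)"
    using cutoff_integrable[OF c g L1(1), of std_frame] cutoff_integrable[OF c g L1(2), of std_frame]
    by (simp_all add: set_integrable_def)
  have "cint c g (\<lambda>c p vs. z * \<eta> c p vs + w * \<omega> c p vs) = (\<integral>x. z * ?f \<eta> x + w * ?f \<omega> x \<partial>lebesgue)"
    unfolding cint_def set_lebesgue_integral_def
    by (rule arg_cong[of _ _ "integral\<^sup>L lebesgue"]) (simp add: fun_eq_iff algebra_simps scaleR_conv_of_real)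
  also have "\<dots> = z * integral\<^sup>L lebesgue (?f \<eta>) + w * integral\<^sup>L lebesgue (?f \<omega>)"
    by (subst Bochner_Integration.integral_add)
       (use i in \<open>simp_all only: integrable_mult_right integral_mult_right_zero\<close>)
  finally show ?thesis by (simp only: cint_def set_lebesgue_integral_def)
qed

lemma cint_restrict:
  assumes c: "c \<in> A" and W: "W \<subseteq> dom_c c" "\<And>p. p \<in> dom_c c \<Longrightarrow> p \<notin> W \<Longrightarrow> g p = 0"
  shows "cint c g \<eta> = set_lebesgue_integral lebesgue (map_c c ` W)
     (\<lambda>x. of_real (g (inv_c c x)) * \<eta> c (inv_c c x) std_frame)"
  unfolding cint_def
proof (rule absolutely_integrable_on_zero_outside(2))
  show "map_c c ` W \<subseteq> map_c c ` dom_c c" using W(1) by blast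
  fix x assume "x \<in> map_c c ` dom_c c" "x \<notin> map_c c ` W"
  then obtain p where "p \<in> dom_c c" "x = map_c c p" "p \<notin> W" by blast
  then show "of_real (g (inv_c c x)) * \<eta> c (inv_c c x) std_frame = 0" using W(2) c by simp
qed

text \<open>\<open>g\<close> is supported in both domains, so both integrals live on the overlap.
  The determinant that relates the two top coefficients is positive for an oriented atlas, hence
  equal to the absolute value in the change of variables.\<close>

lemma cint_change_chart:
  assumes c: "c \<in> A" "c' \<in> A" and g: "cutoff c g" "cutoff c' g" and \<eta>: "L1loc_form A UNIV \<eta>"
  shows "cint c g \<eta> = cint c' g \<eta>"
proof -
  let ?W = "dom_c c \<inter> dom_c c'" let ?S = "map_c c ` ?W" and ?S' = "map_c c' ` ?W"
  let ?\<tau> = "map_c c' \<circ> inv_c c"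
  let ?f = "\<lambda>c x. of_real (g (inv_c c x)) * \<eta> c (inv_c c x) std_frame"
  have z: "g p = 0" if "p \<notin> ?W" for p using that cutoff_outside g by blast
  have S: "open ?S" using open_chart_image[OF c(1) chart_open[OF c(2)]] by (simp add: Int_commute)
  have img: "?\<tau> ` ?S = ?S'" using c by (auto simp: image_iff)
  have int: "?f d absolutely_integrable_on map_c d ` ?W" if "d = c \<or> d = c'" for d
  proof -
    have "?f d absolutely_integrable_on map_c d ` dom_c d"
      using that c g cutoff_integrable[OF _ _ \<eta>] by blast
    moreover have sub: "map_c d ` ?W \<subseteq> map_c d ` dom_c d" using that by auto
    moreover have zero: "?f d x = 0" if "x \<in> map_c d ` dom_c d" "x \<notin> map_c d ` ?W" for x
    proof -
      from that obtain p where "p \<in> dom_c d" "x = map_c d p" "p \<notin> ?W" by blast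
      then show ?thesis using z[of p] \<open>d = c \<or> d = c'\<close> c by auto
    qed
    ultimately show ?thesis using absolutely_integrable_on_zero_outside(1)[OF sub zero] by auto
  qed
  have der: "(?\<tau> has_derivative frechet_derivative ?\<tau> (at x)) (at x)" if "x \<in> ?S" for x
    using smooth_on_has_derivative[OF transition_smooth[OF c]] that by blast
  have inj: "inj_on ?\<tau> ?S"
  proof (rule inj_onI)
    fix x y assume "x \<in> ?S" "y \<in> ?S" "?\<tau> x = ?\<tau> y"
    then obtain p q where "p \<in> ?W" "q \<in> ?W" "x = map_c c p" "y = map_c c q" "map_c c' p = map_c c' q"
      using c by auto
    then show "x = y" using inj_onD[OF inj_map_c[OF c(2)]] by auto
  qed
  have "cint c' g \<eta> = set_lebesgue_integral lebesgue ?S' (?f c')"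
    by (rule cint_restrict[OF c(2)]) (use z in auto)
  also have "\<dots> = integral (?\<tau> ` ?S) (?f c')"
    unfolding img using set_lebesgue_integral_eq_integral(2)[OF int] by blast
  also have "\<dots> = integral ?S (\<lambda>x. of_real \<bar>det (matrix (frechet_derivative ?\<tau> (at x)))\<bar> * ?f c' (?\<tau> x))"
    using change_of_variables(2)[OF S der inj, of "?f c'"] int[of c'] unfolding img by simp
  also have "\<dots> = integral ?S (?f c)"
  proof (rule Henstock_Kurzweil_Integration.integral_cong)
    fix x assume "x \<in> ?S"
    then obtain p where p: "p \<in> dom_c c" "p \<in> dom_c c'" "x = map_c c p" by auto
    let ?L = "trans_deriv c c' p"
    have "\<eta> c p std_frame = \<eta> c' p (map ?L std_frame)"
      by (rule form_onD(2)[OF L1loc_formD(1)[OF \<eta>] c(1) _ p(1) c(2) p(2)]) simp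
    also have "\<dots> = of_real (det (matrix ?L)) * \<eta> c' p std_frame"
      by (rule alternating_map_std_frame[OF form_onD(1)[OF L1loc_formD(1)[OF \<eta>] c(2) _ p(2)]]) simp
    finally show "of_real \<bar>det (matrix (frechet_derivative ?\<tau> (at x)))\<bar> * ?f c' (?\<tau> x) = ?f c x"
      using transition_det[OF c p(1,2)] c p by (simp add: trans_deriv_def)
  qed
  also have "\<dots> = set_lebesgue_integral lebesgue ?S (?f c)"
    using set_lebesgue_integral_eq_integral(2)[OF int[of c]] by simp
  also have "\<dots> = cint c g \<eta>"
    by (rule cint_restrict[OF c(1), symmetric]) (use z in auto)
  finally show ?thesis by simp
qed

text \<open>Both sums are refined by the products of members of the two partitions. Such a product
  is supported in two charts and may be integrated in either.\<close>

lemma partition_independent: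
  assumes P: "partition_on A K C \<rho>" and Q: "partition_on A K' D \<theta>" and \<eta>: "L1loc_form A UNIV \<eta>"
    and K: "form_support A \<eta> \<subseteq> K" "form_support A \<eta> \<subseteq> K'"
  shows "(\<Sum>c\<in>C. cint c (\<rho> c) \<eta>) = (\<Sum>d\<in>D. cint d (\<theta> d) \<eta>)"
proof -
  have expand: "(\<Sum>c\<in>C. cint c (\<rho> c) \<eta>) = (\<Sum>c\<in>C. \<Sum>d\<in>D. cint c (\<lambda>p. \<rho> c p * \<theta> d p) \<eta>)"
    if P: "partition_on A K C \<rho>" and Q: "partition_on A K' D \<theta>" and K': "form_support A \<eta> \<subseteq> K'" for K C \<rho> K' D \<theta>
  proof (rule sum.cong[OF refl])
    fix c assume "c \<in> C"
    then have c: "cutoff c (\<rho> c)" "c \<in> A" using partition_cutoff[OF P] by auto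
    have s: "smooth_fun A UNIV (\<theta> d)" if "d \<in> D" for d using Q that by (auto simp: partition_on_def)
    have "cint c (\<rho> c) \<eta> = cint c (\<lambda>p. \<Sum>d\<in>D. \<rho> c p * \<theta> d p) \<eta>"
    proof (rule cint_cong[OF c(2)])
      fix p assume p: "p \<in> dom_c c"
      show "of_real (\<rho> c p) * \<eta> c p std_frame = of_real (\<Sum>d\<in>D. \<rho> c p * \<theta> d p) * \<eta> c p std_frame"
      proof (cases "p \<in> form_support A \<eta>")
        case True
        then have "(\<Sum>d\<in>D. \<theta> d p) = 1" using Q K' by (auto simp: partition_on_def)
        then show ?thesis by (simp add: sum_distrib_left[symmetric])
      next
        case False
        then show ?thesis using form_support_zero[OF c(2) p] by simp
      qed
    qed
    also have "\<dots> = (\<Sum>d\<in>D. cint c (\<lambda>p. \<rho> c p * \<theta> d p) \<eta>)"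
      by (rule cint_sum[OF c(2) cutoff_mult[OF c(1) s] \<eta>])
    finally show "cint c (\<rho> c) \<eta> = (\<Sum>d\<in>D. cint c (\<lambda>p. \<rho> c p * \<theta> d p) \<eta>)" .
  qed
  have swap: "cint c (\<lambda>p. \<rho> c p * \<theta> d p) \<eta> = cint d (\<lambda>p. \<theta> d p * \<rho> c p) \<eta>" if "c \<in> C" "d \<in> D" for c d
  proof -
    have 1: "cutoff c (\<rho> c)" "c \<in> A" "cutoff d (\<theta> d)" "d \<in> A"
      using partition_cutoff P Q that by blast+
    moreover have "smooth_fun A UNIV (\<rho> c)" "smooth_fun A UNIV (\<theta> d)"
      using 1 by (auto simp: cutoff_def)
    ultimately have "cutoff c (\<lambda>p. \<rho> c p * \<theta> d p)" "cutoff d (\<lambda>p. \<theta> d p * \<rho> c p)"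
      by (blast intro: cutoff_mult)+
    then show ?thesis using cint_change_chart[OF 1(2,4) _ _ \<eta>] by (simp add: mult.commute)
  qed
  show ?thesis
    unfolding expand[OF P Q K(2)] expand[OF Q P K(1)]
    by (subst sum.swap) (intro sum.cong refl swap)
qed

lemma partition_on_mono: "partition_on A K C \<rho> \<Longrightarrow> K' \<subseteq> K \<Longrightarrow> partition_on A K' C \<rho>"
  unfolding partition_on_def by blast

text \<open>Resolves the definite description in \<open>form_integral\<close>. The partition may
  belong to a larger set \<open>K\<close>, so that several forms can be integrated with the same
  one.\<close>

lemma form_integral_eq:
  assumes \<eta>: "L1loc_form A UNIV \<eta>" and P: "partition_on A K C \<rho>" and K: "form_support A \<eta> \<subseteq> K"
  shows "form_integral A \<eta> = (\<Sum>c\<in>C. cint c (\<rho> c) \<eta>)"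
  unfolding form_integral_def cint_def[symmetric]
proof (rule the_equality)
  show "\<exists>C' \<rho>'. partition_on A (form_support A \<eta>) C' \<rho>' \<and> (\<Sum>c\<in>C. cint c (\<rho> c) \<eta>) = (\<Sum>c\<in>C'. cint c (\<rho>' c) \<eta>)"
    using partition_on_mono[OF P K] by blast
  fix I assume "\<exists>C' \<rho>'. partition_on A (form_support A \<eta>) C' \<rho>' \<and> I = (\<Sum>c\<in>C'. cint c (\<rho>' c) \<eta>)"
  then show "I = (\<Sum>c\<in>C. cint c (\<rho> c) \<eta>)"
    using partition_independent[OF _ P \<eta> order_refl K] by blast
qed

text \<open>The integral sees only the coefficient on \<open>std_frame\<close>, and in each chart
  only up to a null set. This makes the values of \<open>\<sigma>\<close> at the zeros of the bundle
  map harmless.\<close>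

lemma form_integral_cong_AE:
  assumes L1: "L1loc_form A UNIV \<eta>" "L1loc_form A UNIV \<omega>"
    and K: "compact K" "form_support A \<eta> \<subseteq> K" "form_support A \<omega> \<subseteq> K"
    and N: "\<And>c. c \<in> A \<Longrightarrow> \<exists>N. negligible N \<and> (\<forall>p\<in>dom_c c \<inter> K. map_c c p \<notin> N \<longrightarrow> \<eta> c p std_frame = \<omega> c p std_frame)"
  shows "form_integral A \<eta> = form_integral A \<omega>"
proof -
  obtain C \<rho> where P: "partition_on A K C \<rho>" by (rule partition_on_exists[OF K(1)])
  have "cint c (\<rho> c) \<eta> = cint c (\<rho> c) \<omega>" if "c \<in> C" for c
  proof -
    have c: "cutoff c (\<rho> c)" "c \<in> A" using partition_cutoff[OF P that] by auto
    obtain N where N: "negligible N" "\<And>p. p \<in> dom_c c \<inter> K \<Longrightarrow> map_c c p \<notin> N \<Longrightarrow> \<eta> c p std_frame = \<omega> c p std_frame"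
      using N[OF c(2)] by blast
    show ?thesis
    proof (rule cint_cong_AE[OF c(2,1) L1 N(1)])
      fix p assume p: "p \<in> dom_c c" "map_c c p \<notin> N"
      show "\<eta> c p std_frame = \<omega> c p std_frame"
      proof (cases "p \<in> K")
        case False
        then show ?thesis
          using form_support_zero[OF c(2) p(1)] K(2,3) by (metis subsetD)
      qed (use N(2) p in blast)
    qed
  qed
  then show ?thesis
    unfolding form_integral_eq[OF L1(1) P K(2)] form_integral_eq[OF L1(2) P K(3)] by simp
qed

lemma form_integral_cong:
  assumes L1: "L1loc_form A UNIV \<eta>" "L1loc_form A UNIV \<omega>"
    and K: "compact K" "form_support A \<eta> \<subseteq> K" "form_support A \<omega> \<subseteq> K"
    and eq: "\<And>c p. c \<in> A \<Longrightarrow> p \<in> dom_c c \<Longrightarrow> p \<in> K \<Longrightarrow> \<eta> c p std_frame = \<omega> c p std_frame"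
  shows "form_integral A \<eta> = form_integral A \<omega>"
  by (rule form_integral_cong_AE[OF assms(1-5)]) (use eq in \<open>auto intro: exI[of _ "{}"]\<close>)

lemma form_integral_lincomb:
  assumes L1: "L1loc_form A UNIV \<eta>" "L1loc_form A UNIV \<omega>"
    and K: "compact K" "form_support A \<eta> \<subseteq> K" "form_support A \<omega> \<subseteq> K"
  shows "form_integral A (\<lambda>c p vs. z * \<eta> c p vs + w * \<omega> c p vs) = z * form_integral A \<eta> + w * form_integral A \<omega>"
proof -
  obtain C \<rho> where P: "partition_on A K C \<rho>" by (rule partition_on_exists[OF K(1)])
  have "form_support A (\<lambda>c p vs. z * \<eta> c p vs + w * \<omega> c p vs) \<subseteq> K"
    by (rule form_support_subset[OF compact_imp_closed[OF K(1)]])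
       (use K(2,3) form_support_zero in \<open>metis add.right_neutral mult_zero_right subsetD\<close>)
  note fi = form_integral_eq[OF L1loc_form_lincomb[OF L1] P this]
  show ?thesis
    unfolding fi form_integral_eq[OF L1(1) P K(2)] form_integral_eq[OF L1(2) P K(3)]
    using partition_cutoff[OF P]
    by (simp add: cint_lincomb[OF _ _ L1] sum.distrib sum_distrib_left)
qed

lemma form_integral_scale:
  assumes "L1loc_form A UNIV \<eta>" "compact (form_support A \<eta>)"
  shows "form_integral A (form_scale z \<eta>) = z * form_integral A \<eta>"
  using form_integral_lincomb[OF assms(1,1,2) order_refl order_refl, of z 0] by (simp add: form_scale_def)

text \<open>Integrability and support of the sum belong to the conclusion because the induction step
  for the integral uses them.\<close>

lemma form_integral_sum:
  assumes I: "finite I" "\<And>i. i \<in> I \<Longrightarrow> L1loc_form A UNIV (\<omega> i)" and K: "compact K" "\<And>i. i \<in> I \<Longrightarrow> form_support A (\<omega> i) \<subseteq> K"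
  shows "L1loc_form A UNIV (\<lambda>c p vs. \<Sum>i\<in>I. \<omega> i c p vs) \<and> form_support A (\<lambda>c p vs. \<Sum>i\<in>I. \<omega> i c p vs) \<subseteq> K \<and>
    form_integral A (\<lambda>c p vs. \<Sum>i\<in>I. \<omega> i c p vs) = (\<Sum>i\<in>I. form_integral A (\<omega> i))"
  using I K(2)
proof (induction I rule: finite_induct)
  case empty
  have s: "form_support A (\<lambda>c p vs. 0) = {}" by (simp add: form_support_def)
  have "smooth_form A UNIV (\<lambda>c p vs. 0)"
    by (rule smooth_formI[OF form_onI]) (auto simp: alternating_0 loc_def[abs_def] fsmooth_const)
  then have L1: "L1loc_form A UNIV (\<lambda>c p vs. 0)" by (rule smooth_form_L1loc[OF open_UNIV])
  obtain C \<rho> where P: "partition_on A K C \<rho>" by (rule partition_on_exists[OF K(1)])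
  have "form_integral A (\<lambda>c p vs. 0) = 0"
    by (subst form_integral_eq[OF L1 P]) (simp_all add: s cint_def)
  then show ?case using L1 s by simp
next
  case (insert i I)
  have IH: "L1loc_form A UNIV (\<lambda>c p vs. \<Sum>i\<in>I. \<omega> i c p vs)" "form_support A (\<lambda>c p vs. \<Sum>i\<in>I. \<omega> i c p vs) \<subseteq> K"
    "form_integral A (\<lambda>c p vs. \<Sum>i\<in>I. \<omega> i c p vs) = (\<Sum>i\<in>I. form_integral A (\<omega> i))"
    using insert by auto
  have i: "L1loc_form A UNIV (\<omega> i)" "form_support A (\<omega> i) \<subseteq> K" using insert by auto
  have "form_support A (\<lambda>c p vs. \<omega> i c p vs + (\<Sum>i\<in>I. \<omega> i c p vs)) \<subseteq> K"
  proof (rule form_support_subset[OF compact_imp_closed[OF K(1)]])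
    fix c p vs assume p: "c \<in> A" "p \<in> dom_c c" "p \<notin> K"
    have "\<omega> i c p vs = 0" "(\<Sum>i\<in>I. \<omega> i c p vs) = 0"
      using form_support_zero[OF p(1,2), of "\<omega> i"] form_support_zero[OF p(1,2), of "\<lambda>c p vs. \<Sum>i\<in>I. \<omega> i c p vs"]
        i(2) IH(2) p(3) by blast+
    then show "\<omega> i c p vs + (\<Sum>i\<in>I. \<omega> i c p vs) = 0" by simp
  qed
  then show ?case
    using form_integral_lincomb[OF i(1) IH(1) K(1) i(2) IH(2), of 1 1] L1loc_form_lincomb[OF i(1) IH(1), of 1 1] IH insert(1,2)
    by simp
qed

end

section \<open>Stokes' theorem\<close>

text \<open>By translation invariance every difference quotient of \<open>G\<close> along
  \<open>v\<close> has integral zero. The quotients are uniformly bounded and vanish off one ball,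
  so dominated convergence passes to the derivative.\<close>

lemma integral_pdir_zero:
  fixes G :: "'v::euclidean_space \<Rightarrow> complex"
  assumes G: "smooth_on UNIV G" and L: "compact L" "\<And>x. x \<notin> L \<Longrightarrow> G x = 0"
  shows "integrable lebesgue (pdir v G)" "integral\<^sup>L lebesgue (pdir v G) = 0"
proof -
  let ?D = "pdir v G"
  have contG: "continuous_on UNIV G" and contD: "continuous_on UNIV ?D"
    using smooth_on_continuous_on[OF G] smooth_on_continuous_on[OF smooth_on_pdir[OF G]] by auto
  have mG[measurable]: "G \<in> borel_measurable borel" and mD[measurable]: "?D \<in> borel_measurable borel"
    using contG contD by (auto intro: borel_measurable_continuous_onI)
  have D0: "?D x = 0" if "x \<notin> L" for x
  proof -
    have "frechet_derivative G (at x) = frechet_derivative (\<lambda>_. 0) (at x)"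
      by (rule frechet_derivative_cong_open[of "- L"]) (use that L compact_imp_closed in auto)
    then show ?thesis by (simp add: frechet_derivative_const)
  qed
  obtain M0 where M0: "\<And>x. x \<in> L \<Longrightarrow> norm (?D x) \<le> M0"
    using compact_imp_bounded[OF compact_continuous_image[OF continuous_on_subset[OF contD subset_UNIV] L(1)]]
    unfolding bounded_iff by auto
  define M where "M = max M0 0"
  have M: "norm (?D x) \<le> M" for x
    using M0[of x] D0[of x] by (cases "x \<in> L") (auto simp: M_def)
  have M_pos: "0 \<le> M" by (simp add: M_def)
  obtain R where R: "\<And>x. x \<in> L \<Longrightarrow> norm x \<le> R"
    using compact_imp_bounded[OF L(1)] unfolding bounded_iff by auto
  have line: "((\<lambda>s. G (x + s *\<^sub>R v)) has_vector_derivative ?D (x + s *\<^sub>R v)) (at s)" for x s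
  proof -
    have 1: "((\<lambda>s. x + s *\<^sub>R v) has_derivative (\<lambda>s. s *\<^sub>R v)) (at s)"
      by (auto intro!: derivative_eq_intros)
    have "(G has_derivative frechet_derivative G (at (x + s *\<^sub>R v))) (at (x + s *\<^sub>R v))"
      using smooth_on_has_derivative[OF G] by blast
    from diff_chain_at[OF 1 this]
    have "((\<lambda>s. G (x + s *\<^sub>R v)) has_derivative (\<lambda>t. frechet_derivative G (at (x + s *\<^sub>R v)) (t *\<^sub>R v))) (at s)"
      by (simp add: o_def)
    then show ?thesis
      using linear_frechet_derivative[OF smooth_on_differentiable[OF G UNIV_I]]
      by (simp add: has_vector_derivative_def linear_cmul)
  qed
  have incr: "norm (G (x + t *\<^sub>R v) - G x) \<le> M * t" if t: "t > 0" for x t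
  proof -
    have cont: "continuous_on {0..t} (\<lambda>s. G (x + s *\<^sub>R v))"
      by (intro continuous_on_compose2[OF contG] continuous_intros) auto
    have "norm ((\<lambda>s. G (x + s *\<^sub>R v)) t - (\<lambda>s. G (x + s *\<^sub>R v)) 0) \<le> M * t - M * 0"
      by (rule differentiable_bound_general[OF t cont, where f'="\<lambda>s. ?D (x + s *\<^sub>R v)" and \<phi>'="\<lambda>_. M"])
         (use M line in \<open>auto intro!: continuous_intros derivative_eq_intros simp: has_real_derivative_iff_has_vector_derivative[symmetric]\<close>)
    then show ?thesis by simp
  qed
  define t where "t j = 1 / real (Suc j)" for j
  have t: "t j > 0" "t j \<le> 1" for j by (auto simp: t_def)
  define s where "s j x = (1 / t j) *\<^sub>R (G (x + t j *\<^sub>R v) - G x)" for j x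
  \<comment> \<open>\<open>L\<close> lies within radius \<open>R\<close>, and since
    \<open>t j\<close> is at most 1, a step from outside this larger ball cannot reach it.\<close>
  let ?w = "\<lambda>x::'v. M * indicator (cball 0 (R + norm v)) x :: real"
  have w: "integrable lborel ?w"
    using emeasure_lborel_cball_finite[of "0::'v" "R + norm v"]
    by (intro integrable_mult_right integrable_real_indicator) (auto simp: less_top)
  have lim: "(\<lambda>j. s j x) \<longlonglongrightarrow> ?D x" for x
  proof -
    have "((\<lambda>h. (1 / h) *\<^sub>R (G (x + h *\<^sub>R v) - G x)) \<longlongrightarrow> ?D x) (at 0)"
    proof (rule LIM_zero_cancel, rule tendsto_norm_zero_cancel)
      let ?A = "\<lambda>h. G (x + h *\<^sub>R v) - G x"
      have "((\<lambda>h. norm (?A h - h *\<^sub>R ?D x) / norm h) \<longlongrightarrow> 0) (at 0)"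
        using line[of x 0] unfolding has_vector_derivative_def has_derivative_iff_norm by simp
      then show "((\<lambda>h. norm ((1 / h) *\<^sub>R ?A h - ?D x)) \<longlongrightarrow> 0) (at 0)"
      proof (rule Lim_transform_within[where d=1])
        fix h :: real assume "0 < dist h 0"
        then have "(1 / h) *\<^sub>R ?A h - ?D x = (1 / h) *\<^sub>R (?A h - h *\<^sub>R ?D x)"
          by (simp add: scaleR_diff_right)
        then show "norm (?A h - h *\<^sub>R ?D x) / norm h = norm ((1 / h) *\<^sub>R ?A h - ?D x)"
          by simp
      qed simp
    qed
    moreover have "filterlim t (at 0) sequentially"
      unfolding filterlim_at t_def using LIMSEQ_inverse_real_of_nat
      by (auto simp: inverse_eq_divide)
    ultimately show ?thesis unfolding s_def by (rule filterlim_compose)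
  qed
  have bound: "norm (s j x) \<le> ?w x" for j x
  proof (cases "x \<in> cball 0 (R + norm v)")
    case True
    have "norm (s j x) = (1 / t j) * norm (G (x + t j *\<^sub>R v) - G x)"
      using t[of j] by (simp add: s_def)
    also have "\<dots> \<le> (1 / t j) * (M * t j)"
      using t[of j] by (intro mult_left_mono incr) auto
    also have "\<dots> = M" using t[of j] by simp
    finally show ?thesis using True by simp
  next
    case False
    then have nx: "norm x > R + norm v" by simp
    have "norm (t j *\<^sub>R v) \<le> norm v" using t[of j] by (simp add: mult_left_le_one_le)
    then have "norm (x + t j *\<^sub>R v) > R"
      using nx norm_diff_ineq[of x "t j *\<^sub>R v"] by linarith
    then have "G (x + t j *\<^sub>R v) = 0" using R L(2) by force
    moreover have "norm x > R" using nx norm_ge_zero[of v] by linarith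
    then have "G x = 0" using R L(2) by force
    ultimately show ?thesis using M_pos by (simp add: s_def)
  qed
  have ms: "s j \<in> borel_measurable lborel" for j
    unfolding s_def by measurable
  have intD: "integrable lborel ?D"
    by (rule integrable_dominated_convergence[of ?D lborel s ?w]) (use w lim bound ms in auto)
  have conv: "(\<lambda>j. integral\<^sup>L lborel (s j)) \<longlonglongrightarrow> integral\<^sup>L lborel ?D"
    by (rule integral_dominated_convergence[of ?D lborel s ?w]) (use w lim bound ms in auto)
  have intG: "integrable lborel G"
  proof -
    have "G absolutely_integrable_on L"
      by (rule absolutely_integrable_continuous_compact[OF L(1) continuous_on_subset[OF contG subset_UNIV]])
    then have "G absolutely_integrable_on UNIV"
      using absolutely_integrable_on_zero_outside(1)[of L UNIV G] L(2) by blast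
    then have "integrable lebesgue G" by (simp add: set_integrable_def)
    then show ?thesis using integrable_completion[of G lborel] by simp
  qed
  have shift: "integrable lborel (\<lambda>x. G (x + a)) \<and> integral\<^sup>L lborel (\<lambda>x. G (x + a)) = integral\<^sup>L lborel G" for a
  proof -
    have "integrable (distr lborel borel ((+) a)) G" using intG by (simp add: lborel_distr_plus)
    then have "integrable lborel (\<lambda>x. G (a + x))" by (subst (asm) integrable_distr_eq) auto
    moreover have "integral\<^sup>L (distr lborel borel ((+) a)) G = integral\<^sup>L lborel (\<lambda>x. G (a + x))"
      by (rule integral_distr) auto
    ultimately show ?thesis by (simp add: lborel_distr_plus add.commute)
  qed
  have "integral\<^sup>L lborel (s j) = 0" for j
    unfolding s_def using shift[of "t j *\<^sub>R v"] intG by simp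
  then have "integral\<^sup>L lborel ?D = 0"
    using LIMSEQ_unique[OF conv] by simp
  then show "integrable lebesgue ?D" "integral\<^sup>L lebesgue ?D = 0"
    using intD integrable_completion[of ?D lborel] integral_completion[of ?D lborel] by auto
qed

context oriented_manifold
begin

lemma smooth_fun_of_real: "open U \<Longrightarrow> smooth_fun A U g \<Longrightarrow> smooth_fun A U (\<lambda>p. complex_of_real (g p))"
  unfolding smooth_fun_def o_def
  by (auto intro!: smooth_on_bounded_linear[OF _ bounded_linear_of_real] open_chart_image)

text \<open>In the chart, each summand of the exterior derivative is a directional derivative of a
  coefficient. As the support is compact, the coefficient extended by zero is smooth on the whole
  vector space, and \<open>integral_pdir_zero\<close> applies.\<close>

lemma chart_integral_ext_deriv:
  assumes c: "c \<in> A" and \<theta>: "smooth_form A UNIV \<theta>" and Z: "compact Z" "Z \<subseteq> dom_c c" "form_support A \<theta> \<subseteq> Z"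
  shows "set_lebesgue_integral lebesgue (map_c c ` dom_c c) (\<lambda>x. ext_deriv A \<theta> c (inv_c c x) vs) = 0"
proof -
  let ?S = "map_c c ` dom_c c" and ?L = "map_c c ` Z"
  have S: "open ?S" by (rule chart_open_image[OF c])
  have L: "compact ?L" by (rule compact_chart_image[OF c Z(1,2)])
  define G where "G us x = (if x \<in> ?S then loc c \<theta> x us else 0)" for us x
  have G0: "G us x = 0" if "x \<notin> ?L" for us x
  proof (cases "x \<in> ?S")
    case True
    then obtain p where "p \<in> dom_c c" "x = map_c c p" by blast
    then have "p \<notin> form_support A \<theta>" "p \<in> dom_c c" using that Z(3) by blast+
    then show ?thesis using \<open>x = map_c c p\<close> c form_support_zero[of c p \<theta>] by (simp add: G_def loc_def)
  qed (simp add: G_def)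
  have sm: "smooth_on UNIV (G us)" for us
  proof (rule smooth_on_local)
    fix x
    show "\<exists>T. x \<in> T \<and> smooth_on T (G us)"
    proof (cases "x \<in> ?S")
      case True
      have "smooth_on ?S (\<lambda>x. loc c \<theta> x us)" using fsmoothD[OF smooth_formD(2)[OF \<theta> c]] by simp
      then have "smooth_on ?S (G us)" by (subst smooth_on_cong[OF S]) (auto simp: G_def)
      then show ?thesis using True by blast
    next
      case False
      then have "x \<in> - ?L" using Z(2) by blast
      moreover have o: "open (- ?L)" using L by (simp add: compact_imp_closed open_Compl)
      have "smooth_on (- ?L) (G us)"
        by (subst smooth_on_cong[OF o, where g="\<lambda>_. 0"]) (use G0 in auto)
      ultimately show ?thesis by blast
    qed
  qed
  let ?u = "\<lambda>i. take i vs @ drop (Suc i) vs"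
  have eq: "indicat_real ?S x *\<^sub>R ext_deriv A \<theta> c (inv_c c x) vs = (\<Sum>i<length vs. (-1) ^ i * pdir (vs ! i) (G (?u i)) x)" for x
  proof (cases "x \<in> ?S")
    case True
    have "pdir (vs ! i) (\<lambda>y. loc c \<theta> y (?u i)) x = pdir (vs ! i) (G (?u i)) x" for i
      by (subst frechet_derivative_cong_open[OF S True, of _ "G (?u i)"]) (auto simp: G_def)
    then show ?thesis using True c inv_in_dom[OF c True]
      by (simp add: ext_deriv_ld ld_def)
  next
    case False
    then have x: "x \<in> - ?L" using Z(2) by blast
    have o: "open (- ?L)" using L by (simp add: compact_imp_closed open_Compl)
    have "pdir w (G us) x = 0" for w us
      using frechet_derivative_cong_open[OF o x, of "G us" "\<lambda>_. 0"] G0 by (simp add: frechet_derivative_const)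
    then show ?thesis using False by simp
  qed
  note i0 = integral_pdir_zero[OF sm L G0]
  have "set_lebesgue_integral lebesgue ?S (\<lambda>x. ext_deriv A \<theta> c (inv_c c x) vs)
    = (\<integral>x. (\<Sum>i<length vs. (-1) ^ i * pdir (vs ! i) (G (?u i)) x) \<partial>lebesgue)"
    unfolding set_lebesgue_integral_def eq ..
  also have "\<dots> = (\<Sum>i<length vs. (\<integral>x. (-1) ^ i * pdir (vs ! i) (G (?u i)) x \<partial>lebesgue))"
    by (intro Bochner_Integration.integral_sum integrable_mult_right i0(1))
  also have "\<dots> = 0" by (simp add: i0(2))
  finally show ?thesis .
qed

text \<open>The integral is defined by partitions of unity, so a partition with the single chart
  \<open>c\<close> is built: a finite sum of functions supported in the domain of \<open>c\<close>
  that is 1 on \<open>Z\<close>.\<close>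

lemma form_integral_single_chart:
  assumes c: "c \<in> A" and \<eta>: "L1loc_form A UNIV \<eta>" and Z: "compact Z" "Z \<subseteq> dom_c c" "form_support A \<eta> \<subseteq> Z"
  shows "form_integral A \<eta> = set_lebesgue_integral lebesgue (map_c c ` dom_c c) (\<lambda>x. \<eta> c (inv_c c x) std_frame)"
proof -
  have cov: "\<exists>W. open W \<and> p \<in> W \<and> W \<subseteq> dom_c c" if "p \<in> Z" for p
    using chart_open[OF c] Z(2) that by blast
  obtain n :: nat and \<rho> :: "nat \<Rightarrow> 'a \<Rightarrow> real" and d and W :: "nat \<Rightarrow> 'a set" where
    \<rho>: "\<And>i. i < n \<Longrightarrow> d i \<in> A" "\<And>i. i < n \<Longrightarrow> W i \<subseteq> dom_c c" "\<And>i. i < n \<Longrightarrow> open (W i)"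
    "\<And>i. i < n \<Longrightarrow> smooth_fun A UNIV (\<rho> i)" "\<And>i q. i < n \<Longrightarrow> 0 \<le> \<rho> i q"
    "\<And>i. i < n \<Longrightarrow> compact (closure {q. \<rho> i q \<noteq> 0})"
    "\<And>i. i < n \<Longrightarrow> closure {q. \<rho> i q \<noteq> 0} \<subseteq> W i \<inter> dom_c (d i)"
    "\<And>p. p \<in> Z \<Longrightarrow> (\<Sum>i<n. \<rho> i p) = 1"
    by (rule partition_of_unity[OF Z(1), of "\<lambda>W. W \<subseteq> dom_c c"], rule cov, assumption, rule that)
  define g where "g p = (\<Sum>i<n. \<rho> i p)" for p
  let ?Y = "\<Union>i<n. closure {q. \<rho> i q \<noteq> 0}"
  have Y: "compact ?Y" by (rule compact_UN) (use \<rho>(6) in auto)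
  have sub: "closure {p. g p \<noteq> 0} \<subseteq> ?Y"
  proof (rule closure_minimal)
    show "{p. g p \<noteq> 0} \<subseteq> ?Y"
    proof
      fix q assume "q \<in> {p. g p \<noteq> 0}"
      then obtain i where "i < n" "\<rho> i q \<noteq> 0"
        unfolding g_def by (metis (mono_tags, lifting) lessThan_iff mem_Collect_eq sum.neutral)
      then show "q \<in> ?Y" using closure_subset[of "{q. \<rho> i q \<noteq> 0}"] by blast
    qed
  qed (rule compact_imp_closed[OF Y])
  have "?Y \<subseteq> dom_c c" using \<rho>(2,7) by blast
  moreover have "smooth_fun A UNIV g"
    unfolding g_def[abs_def] by (intro smooth_fun_sum open_UNIV \<rho>(4)) simp
  moreover have "0 \<le> g p" for p unfolding g_def by (intro sum_nonneg \<rho>(5)) simp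
  moreover have "(\<Sum>d\<in>{c}. g p) = 1" if "p \<in> Z" for p using \<rho>(8)[OF that] by (simp add: g_def)
  ultimately have P: "partition_on A Z {c} (\<lambda>_. g)"
    unfolding partition_on_def using c compact_closed_subset[OF Y closed_closure sub] sub by blast
  have "form_integral A \<eta> = cint c g \<eta>"
    using form_integral_eq[OF \<eta> P Z(3)] by simp
  also have "\<dots> = cint c (\<lambda>_. 1) \<eta>"
  proof (rule cint_cong[OF c])
    fix p assume p: "p \<in> dom_c c"
    show "of_real (g p) * \<eta> c p std_frame = of_real 1 * \<eta> c p std_frame"
    proof (cases "p \<in> Z")
      case False
      then show ?thesis using form_support_zero[OF c p, of \<eta>] Z(3) by auto
    qed (simp add: g_def \<rho>(8))
  qed
  finally show ?thesis by (simp add: cint_def)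
qed

text \<open>The form itself, not its derivative, is cut into pieces supported in single charts. The
  pieces add up to \<open>\<theta>\<close> everywhere, so their exterior derivatives add up to that
  of \<open>\<theta>\<close>, and derivatives of the cutoff functions need no discussion.\<close>

theorem Stokes:
  assumes \<theta>: "smooth_form A UNIV \<theta>" and K: "compact (form_support A \<theta>)"
  shows "form_integral A (ext_deriv A \<theta>) = 0"
proof -
  let ?K = "form_support A \<theta>"
  obtain C \<rho> where P: "partition_on A ?K C \<rho>" by (rule partition_on_exists[OF K])
  have C: "finite C" "\<And>p. p \<in> ?K \<Longrightarrow> (\<Sum>c\<in>C. \<rho> c p) = 1" using P by (auto simp: partition_on_def)
  note co = partition_cutoff[OF P]
  define \<eta> where "\<eta> d = (\<lambda>c p vs. of_real (\<rho> d p) * \<theta> c p vs)" for d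
  have sm: "smooth_form A UNIV (\<eta> d)" if "d \<in> C" for d
    unfolding \<eta>_def using co[OF that]
    by (intro smooth_form_scale_fun open_UNIV smooth_fun_of_real \<theta>) (auto simp: cutoff_def)
  have supp: "form_support A (\<eta> d) \<subseteq> closure {p. \<rho> d p \<noteq> 0} \<inter> ?K" if "d \<in> C" for d
  proof (rule form_support_subset)
    fix c p vs assume "c \<in> A" "p \<in> dom_c c" "p \<notin> closure {p. \<rho> d p \<noteq> 0} \<inter> ?K"
    then have "\<rho> d p = 0 \<or> \<theta> c p vs = 0" using cutoff_zero[of p "\<rho> d"] form_support_zero[of c p \<theta>] by blast
    then show "\<eta> d c p vs = 0" by (auto simp: \<eta>_def)
  qed (simp add: closed_Int form_support_closed)
  have L1: "L1loc_form A UNIV (ext_deriv A (\<eta> d))" if "d \<in> C" for d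
    by (intro smooth_form_L1loc smooth_form_ext_deriv open_UNIV sm that)
  have suppd: "form_support A (ext_deriv A (\<eta> d)) \<subseteq> ?K" if "d \<in> C" for d
    using form_support_ext_deriv supp[OF that] by blast
  have zero: "form_integral A (ext_deriv A (\<eta> d)) = 0" if "d \<in> C" for d
  proof -
    have Z: "compact (closure {p. \<rho> d p \<noteq> 0})" "closure {p. \<rho> d p \<noteq> 0} \<subseteq> dom_c d" and d: "d \<in> A"
      using co[OF that] by (auto simp: cutoff_def)
    have s: "form_support A (\<eta> d) \<subseteq> closure {p. \<rho> d p \<noteq> 0}" using supp[OF that] by blast
    show ?thesis
      unfolding form_integral_single_chart[OF d L1[OF that] Z subset_trans[OF form_support_ext_deriv s]]
      by (rule chart_integral_ext_deriv[OF d sm[OF that] Z s])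
  qed
  note sum = form_integral_sum[OF C(1) L1 K suppd]
  have "form_integral A (ext_deriv A \<theta>) = form_integral A (\<lambda>c p vs. \<Sum>d\<in>C. ext_deriv A (\<eta> d) c p vs)"
  proof (rule form_integral_cong[OF _ _ K form_support_ext_deriv])
    show "L1loc_form A UNIV (ext_deriv A \<theta>)"
      by (intro smooth_form_L1loc smooth_form_ext_deriv open_UNIV \<theta>)
    fix c p assume p: "c \<in> A" "p \<in> dom_c c"
    have "ext_deriv A \<theta> c p std_frame = ext_deriv A (\<lambda>c p vs. \<Sum>d\<in>C. \<eta> d c p vs) c p std_frame"
    proof (rule ext_deriv_cong[OF open_UNIV p(1) UNIV_I p(2)])
      fix q vs assume q: "q \<in> dom_c c"
      show "\<theta> c q vs = (\<Sum>d\<in>C. \<eta> d c q vs)"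
      proof (cases "q \<in> ?K")
        case True
        have "(\<Sum>d\<in>C. \<eta> d c q vs) = of_real (\<Sum>d\<in>C. \<rho> d q) * \<theta> c q vs"
          by (simp add: \<eta>_def sum_distrib_right)
        then show ?thesis using C(2)[OF True] by simp
      next
        case False
        then have "\<theta> c q vs = 0" by (rule form_support_zero[OF p(1) q])
        then show ?thesis by (simp add: \<eta>_def)
      qed
    qed
    also have "\<dots> = (\<Sum>d\<in>C. ext_deriv A (\<eta> d) c p std_frame)"
      by (rule ext_deriv_sum[OF open_UNIV sm p(1) UNIV_I p(2)])
    finally show "ext_deriv A \<theta> c p std_frame = (\<Sum>d\<in>C. ext_deriv A (\<eta> d) c p std_frame)" .
  qed (use sum in auto)
  also have "\<dots> = 0" using sum zero by simp
  finally show ?thesis .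
qed

text \<open>\<open>U\<close> and the complement of the support of \<open>\<eta>\<close> are open and
  cover the manifold; on the complement the product is zero.\<close>

lemma smooth_form_wedge_support:
  assumes U: "open U" and \<omega>: "smooth_form A U \<omega>" and \<eta>: "smooth_form A UNIV \<eta>" and supp: "form_support A \<eta> \<subseteq> U"
  shows "smooth_form A UNIV (wedge \<omega> \<eta>)"
proof (rule smooth_formI)
  show "form_on A UNIV (wedge \<omega> \<eta>)" by (intro form_on_wedge[OF _ _ supp] smooth_formD(1) \<omega> \<eta>)
  fix c assume c: "c \<in> A"
  let ?S = "map_c c ` (U \<inter> dom_c c)" and ?T = "map_c c ` (- form_support A \<eta> \<inter> dom_c c)"
  have S: "open ?S" and T: "open ?T"
    by (intro open_chart_image c U open_Compl form_support_closed)+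
  have "smooth_on (map_c c ` (UNIV \<inter> dom_c c)) (\<lambda>x. loc c (wedge \<omega> \<eta>) x vs)" for vs
  proof (rule smooth_on_local)
    fix x assume "x \<in> map_c c ` (UNIV \<inter> dom_c c)"
    then obtain p where p: "p \<in> dom_c c" "x = map_c c p" by blast
    show "\<exists>T. x \<in> T \<and> smooth_on T (\<lambda>x. loc c (wedge \<omega> \<eta>) x vs)"
    proof (cases "p \<in> U")
      case True
      have "fsmooth ?S (\<lambda>x. lwedge (loc c \<omega> x) (loc c \<eta> x))"
        by (rule fsmooth_lwedge[OF S smooth_formD(2)[OF \<omega> c] fsmooth_subset[OF smooth_formD(2)[OF \<eta> c]]]) auto
      then have "smooth_on ?S (\<lambda>x. loc c (wedge \<omega> \<eta>) x vs)"
        unfolding loc_wedge[abs_def] by (rule fsmoothD)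
      moreover have "x \<in> ?S" using True p by blast
      ultimately show ?thesis by (intro exI[of _ ?S] conjI)
    next
      case False
      have "loc c (wedge \<omega> \<eta>) y vs = 0" if y: "y \<in> ?T" for y
      proof -
        from y obtain q where q: "q \<in> dom_c c" "q \<notin> form_support A \<eta>" "y = map_c c q" by blast
        then have "q \<notin> form_support A (wedge \<omega> \<eta>)" using form_support_wedge_right by blast
        then show ?thesis using form_support_zero[OF c q(1)] q c by (simp add: loc_def)
      qed
      then have "smooth_on ?T (\<lambda>x. loc c (wedge \<omega> \<eta>) x vs)"
        by (subst smooth_on_cong[OF T, where g="\<lambda>_. 0"]) auto
      moreover have "x \<in> ?T" using False p supp by blast
      ultimately show ?thesis by (intro exI[of _ ?T] conjI)
    qed
  qed
  then show "fsmooth (map_c c ` (UNIV \<inter> dom_c c)) (loc c (wedge \<omega> \<eta>))" by (simp add: fsmooth_def)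
qed

text \<open>Stokes' theorem for \<open>wedge \<beta> \<psi>\<close>. Oddness of
  \<open>\<beta>\<close> makes the second term of Leibniz' rule negative, so that the two integrals
  agree without a sign.\<close>

lemma integration_by_parts:
  assumes U: "open U" and \<beta>: "smooth_form A U \<beta>" "\<And>c p. c \<in> A \<Longrightarrow> p \<in> U \<Longrightarrow> p \<in> dom_c c \<Longrightarrow> odd_fun (\<beta> c p)"
    and \<psi>: "smooth_form A UNIV \<psi>" "compact (form_support A \<psi>)" "form_support A \<psi> \<subseteq> U"
  shows "form_integral A (wedge (ext_deriv A \<beta>) \<psi>) = form_integral A (wedge \<beta> (ext_deriv A \<psi>))"
proof -
  let ?K = "form_support A \<psi>"
  have d\<beta>: "smooth_form A U (ext_deriv A \<beta>)" by (rule smooth_form_ext_deriv[OF U \<beta>(1)])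
  have d\<psi>: "smooth_form A UNIV (ext_deriv A \<psi>)" by (rule smooth_form_ext_deriv[OF open_UNIV \<psi>(1)])
  have sd: "form_support A (ext_deriv A \<psi>) \<subseteq> U" using form_support_ext_deriv \<psi>(3) by blast
  have sm: "smooth_form A UNIV (wedge \<beta> \<psi>)" by (rule smooth_form_wedge_support[OF U \<beta>(1) \<psi>(1,3)])
  have L1: "L1loc_form A UNIV (wedge (ext_deriv A \<beta>) \<psi>)"
    by (rule smooth_form_L1loc[OF open_UNIV smooth_form_wedge_support[OF U d\<beta> \<psi>(1,3)]])
  have L2: "L1loc_form A UNIV (wedge \<beta> (ext_deriv A \<psi>))"
    by (rule smooth_form_L1loc[OF open_UNIV smooth_form_wedge_support[OF U \<beta>(1) d\<psi> sd]])
  have s1: "form_support A (wedge (ext_deriv A \<beta>) \<psi>) \<subseteq> ?K" by (rule form_support_wedge_right)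
  have s2: "form_support A (wedge \<beta> (ext_deriv A \<psi>)) \<subseteq> ?K"
    using form_support_wedge_right form_support_ext_deriv by blast
  have s3: "form_support A (wedge \<beta> \<psi>) \<subseteq> ?K" by (rule form_support_wedge_right)
  have s4: "form_support A (ext_deriv A (wedge \<beta> \<psi>)) \<subseteq> ?K" using s3 form_support_ext_deriv by blast
  let ?R = "\<lambda>c p vs. 1 * wedge (ext_deriv A \<beta>) \<psi> c p vs + (-1) * wedge \<beta> (ext_deriv A \<psi>) c p vs"
  have s5: "form_support A ?R \<subseteq> ?K"
  proof (rule form_support_subset[OF form_support_closed])
    fix c p vs assume p: "c \<in> A" "p \<in> dom_c c" "p \<notin> ?K"
    have "wedge (ext_deriv A \<beta>) \<psi> c p vs = 0" "wedge \<beta> (ext_deriv A \<psi>) c p vs = 0"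
      by (rule form_support_zero[OF p(1,2)]; use s1 s2 p(3) in blast)+
    then show "?R c p vs = 0" by simp
  qed
  have "0 = form_integral A (ext_deriv A (wedge \<beta> \<psi>))"
    by (rule Stokes[OF sm compact_closed_subset[OF \<psi>(2) form_support_closed s3], symmetric])
  also have "\<dots> = form_integral A ?R"
  proof (rule form_integral_cong[OF _ L1loc_form_lincomb[OF L1 L2] \<psi>(2) s4 s5])
    show "L1loc_form A UNIV (ext_deriv A (wedge \<beta> \<psi>))"
      by (rule smooth_form_L1loc[OF open_UNIV smooth_form_ext_deriv[OF open_UNIV sm]])
    fix c p assume p: "c \<in> A" "p \<in> dom_c c" "p \<in> ?K"
    then have pU: "p \<in> U" using \<psi>(3) by blast
    show "ext_deriv A (wedge \<beta> \<psi>) c p std_frame = ?R c p std_frame"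
      unfolding ext_deriv_wedge[OF U \<beta>(1) smooth_form_subset[OF \<psi>(1) subset_UNIV] p(1) pU p(2)]
        odd_fun_lhat[OF \<beta>(2)[OF p(1) pU p(2)]] wedge_lwedge
      by (simp add: lwedge_uminus_left)
  qed
  also have "\<dots> = form_integral A (wedge (ext_deriv A \<beta>) \<psi>) - form_integral A (wedge \<beta> (ext_deriv A \<psi>))"
    by (subst form_integral_lincomb[OF L1 L2 \<psi>(2) s1 s2]) simp
  finally show ?thesis by simp
qed

end

section \<open>Currents\<close>

lemma iter_deriv_zero: "iter_deriv ws (\<lambda>x. 0) = (\<lambda>x. 0)"
  by (induction ws) (simp_all add: frechet_derivative_const)

lemma form_add_apply: "form_add \<omega> \<eta> c p vs = \<omega> c p vs + \<eta> c p vs"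
  by (simp add: form_add_def)

lemma form_scale_apply: "form_scale z \<omega> c p vs = z * \<omega> c p vs"
  by (simp add: form_scale_def)

lemma form_part_apply: "form_part k \<omega> c p vs = (if length vs = k then \<omega> c p vs else 0)"
  by (simp add: form_part_def)

lemma uniform_limit_zero_sum:
  fixes f :: "'i \<Rightarrow> nat \<Rightarrow> 'x \<Rightarrow> complex"
  assumes "finite I" "\<And>i. i \<in> I \<Longrightarrow> uniform_limit L (f i) (\<lambda>_. 0) sequentially"
  shows "uniform_limit L (\<lambda>j x. \<Sum>i\<in>I. z i * f i j x) (\<lambda>_. 0) sequentially"
  using assms
proof (induction I rule: finite_induct)
  case empty
  then show ?case by (simp add: uniform_limit_const)
next
  case (insert i I)
  have "uniform_limit L (\<lambda>j x. z i * f i j x) (\<lambda>x. z i * 0) sequentially"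
    by (rule bounded_linear.uniform_limit[OF bounded_linear_mult_right]) (use insert in auto)
  from uniform_limit_add[OF this insert.IH] insert show ?case by simp
qed

context oriented_manifold
begin

section \<open>Operations on test forms\<close>

lemma test_formD:
  assumes "test_form A \<psi>"
  shows "smooth_form A UNIV \<psi>" "compact (form_support A \<psi>)" "\<not> (c \<in> A \<and> p \<in> dom_c c) \<Longrightarrow> \<psi> c p vs = 0"
  using assms unfolding test_form_def by blast+

lemma test_formI:
  assumes "smooth_form A UNIV \<psi>" "compact K" "form_support A \<psi> \<subseteq> K"
    "\<And>c p vs. \<not> (c \<in> A \<and> p \<in> dom_c c) \<Longrightarrow> \<psi> c p vs = 0"
  shows "test_form A \<psi>"
  unfolding test_form_def
  using assms(1,4) compact_closed_subset[OF assms(2) form_support_closed assms(3)] by blast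

lemma test_form_wedge:
  assumes "smooth_form A UNIV \<eta>" "test_form A \<psi>"
  shows "test_form A (wedge \<eta> \<psi>)"
proof (rule test_formI[OF smooth_form_wedge[OF assms(1) test_formD(1)[OF assms(2)]] test_formD(2)[OF assms(2)] form_support_wedge_right])
  fix c p vs assume "\<not> (c \<in> A \<and> p \<in> dom_c c)"
  then have "\<psi> c p = (\<lambda>vs. 0)" using test_formD(3)[OF assms(2)] by blast
  then show "wedge \<eta> \<psi> c p vs = 0" by (simp add: wedge_lwedge lwedge_zero_right)
qed

lemma test_form_ext_deriv: "test_form A \<psi> \<Longrightarrow> test_form A (ext_deriv A \<psi>)"
  by (rule test_formI[OF smooth_form_ext_deriv[OF open_UNIV] _ form_support_ext_deriv])
     (auto dest: test_formD simp: ext_deriv_outside)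

lemma form_support_part: "form_support A (form_part k \<psi>) \<subseteq> form_support A \<psi>"
  by (rule form_support_subset[OF form_support_closed]) (simp add: form_part_def form_support_zero)

lemma test_form_part: "test_form A \<psi> \<Longrightarrow> test_form A (form_part k \<psi>)"
proof (rule test_formI[OF smooth_form_part _ form_support_part])
  show "form_part k \<psi> c p vs = 0" if "test_form A \<psi>" "\<not> (c \<in> A \<and> p \<in> dom_c c)" for c p vs
    using test_formD(3)[OF that] by (simp add: form_part_def)
qed (auto dest: test_formD)

lemma test_form_scale_fun:
  assumes "smooth_fun A UNIV g" "test_form A \<psi>"
  shows "test_form A (\<lambda>c p vs. g p * \<psi> c p vs)"
proof (rule test_formI[OF smooth_form_scale_fun[OF open_UNIV assms(1) test_formD(1)[OF assms(2)]] test_formD(2)[OF assms(2)]])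
  show "form_support A (\<lambda>c p vs. g p * \<psi> c p vs) \<subseteq> form_support A \<psi>"
    by (rule form_support_subset[OF form_support_closed]) (simp add: form_support_zero)
  show "g p * \<psi> c p vs = 0" if "\<not> (c \<in> A \<and> p \<in> dom_c c)" for c p vs
    using test_formD(3)[OF assms(2) that] by simp
qed

lemma test_form_scale: "test_form A \<psi> \<Longrightarrow> test_form A (form_scale z \<psi>)"
  unfolding form_scale_def using test_form_scale_fun[of "\<lambda>_. z" \<psi>] smooth_fun_const by blast

lemma test_form_add:
  assumes "test_form A \<psi>" "test_form A \<eta>"
  shows "test_form A (form_add \<psi> \<eta>)"
proof (rule test_formI[OF smooth_form_add[OF open_UNIV test_formD(1)[OF assms(1)] test_formD(1)[OF assms(2)]]
    compact_Un[OF test_formD(2)[OF assms(1)] test_formD(2)[OF assms(2)]]])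
  show "form_support A (form_add \<psi> \<eta>) \<subseteq> form_support A \<psi> \<union> form_support A \<eta>"
    by (rule form_support_subset) (simp_all add: form_add_def closed_Un form_support_closed form_support_zero)
  show "form_add \<psi> \<eta> c p vs = 0" if "\<not> (c \<in> A \<and> p \<in> dom_c c)" for c p vs
    using test_formD(3)[OF assms(1) that] test_formD(3)[OF assms(2) that] by (simp add: form_add_def)
qed

lemma L1loc_wedge_test:
  "L1loc_form A U \<omega> \<Longrightarrow> test_form A \<psi> \<Longrightarrow> form_support A \<psi> \<subseteq> U \<Longrightarrow> L1loc_form A UNIV (wedge \<omega> \<psi>)"
  by (rule L1loc_form_wedge) (auto dest: test_formD)

text \<open>The top coefficient of the product is a finite sum of products of coefficients. Those of
  \<open>\<Psi> j\<close> tend to 0 uniformly on the compact support of the cutoff, and those of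
  \<open>\<omega>\<close> times the cutoff are integrable.\<close>

lemma cint_wedge_tendsto:
  assumes c: "c \<in> A" and g: "cutoff c g" and \<omega>: "L1loc_form A UNIV \<omega>" and \<Psi>: "test_null_sequence A \<Psi>"
  shows "(\<lambda>j. cint c g (wedge \<omega> (\<Psi> j))) \<longlonglongrightarrow> 0"
proof -
  let ?S = "map_c c ` dom_c c" and ?L = "map_c c ` closure {p. g p \<noteq> 0}"
  let ?fr = "std_frame :: (real, 'n) vec list"
  let ?I = "Pow {..<length ?fr}" and ?J = "\<lambda>I. nths ?fr ({..<length ?fr} - I)"
  let ?h = "\<lambda>I x. indicat_real ?S x *\<^sub>R (of_real (g (inv_c c x)) * \<omega> c (inv_c c x) (nths ?fr I))"
  let ?F = "\<lambda>j x. indicat_real ?S x *\<^sub>R (of_real (g (inv_c c x)) * wedge \<omega> (\<Psi> j) c (inv_c c x) ?fr)"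
  have t: "test_form A (\<Psi> j)" for j using \<Psi> by (simp add: test_null_sequence_def)
  have Z: "compact (closure {p. g p \<noteq> 0})" "closure {p. g p \<noteq> 0} \<subseteq> dom_c c" using g by (auto simp: cutoff_def)
  have L: "compact ?L" by (rule compact_chart_image[OF c Z])
  have LS: "?L \<subseteq> ?S" using Z by blast
  have ih: "integrable lebesgue (?h I)" for I
    using cutoff_integrable[OF c g \<omega>, of "nths ?fr I"] by (simp add: set_integrable_def)
  have iF: "integrable lebesgue (?F j)" for j
    using cutoff_integrable[OF c g L1loc_wedge_test[OF \<omega> t[of j] subset_UNIV], of ?fr] by (simp add: set_integrable_def)
  define H where "H x = (\<Sum>I\<in>?I. norm (?h I x))" for x
  have iH: "integrable lebesgue H"
    unfolding H_def[abs_def] by (intro Bochner_Integration.integrable_sum integrable_norm ih)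
  have H0: "integral\<^sup>L lebesgue H \<ge> 0" by (rule integral_nonneg_AE) (simp add: H_def sum_nonneg)
  have lim: "uniform_limit ?L (\<lambda>j x. \<Psi> j c (inv_c c x) us) (\<lambda>_. 0) sequentially" for us
  proof -
    have "\<forall>c\<in>A. \<forall>L ws vs. compact L \<and> L \<subseteq> map_c c ` dom_c c \<longrightarrow>
        uniform_limit L (\<lambda>j. iter_deriv ws (\<lambda>x. \<Psi> j c (inv_c c x) vs)) (\<lambda>_. 0) sequentially"
      using \<Psi> by (simp add: test_null_sequence_def)
    from this[rule_format, OF c, of ?L "[]" us] show ?thesis using L LS by simp
  qed
  have ev: "\<forall>\<^sub>F j in sequentially. norm (integral\<^sup>L lebesgue (?F j)) \<le> e * integral\<^sup>L lebesgue H" if e: "e > 0" for e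
  proof -
    have "\<forall>\<^sub>F j in sequentially. \<forall>I\<in>?I. \<forall>x\<in>?L. dist (\<Psi> j c (inv_c c x) (?J I)) 0 < e"
    proof (rule eventually_ball_finite)
      show "\<forall>I\<in>?I. \<forall>\<^sub>F j in sequentially. \<forall>x\<in>?L. dist (\<Psi> j c (inv_c c x) (?J I)) 0 < e"
        using uniform_limitD[OF lim e] by blast
    qed simp
    then show ?thesis
    proof eventually_elim
      case (elim j)
      have "norm (?F j x) \<le> e * H x" for x
      proof (cases "x \<in> ?L")
        case True
        then have xS: "x \<in> ?S" using LS by blast
        have "?F j x = (\<Sum>I\<in>?I. shuffle_sign (length ?fr) I * (?h I x * \<Psi> j c (inv_c c x) (?J I)))"
          using xS by (simp add: wedge_lwedge lwedge_def sum_distrib_left mult_ac)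
        also have "norm \<dots> \<le> (\<Sum>I\<in>?I. norm (?h I x) * e)"
        proof (rule order_trans[OF norm_sum sum_mono])
          fix I assume "I \<in> ?I"
          then have "dist (\<Psi> j c (inv_c c x) (?J I)) 0 < e" using elim True by blast
          then have "norm (\<Psi> j c (inv_c c x) (?J I)) \<le> e" by simp
          then show "norm (shuffle_sign (length ?fr) I * (?h I x * \<Psi> j c (inv_c c x) (?J I))) \<le> norm (?h I x) * e"
            by (simp only: norm_mult shuffle_sign_def norm_power norm_minus_cancel norm_one power_one mult_1 mult_left_mono norm_ge_zero)
        qed
        also have "\<dots> = e * H x"
          unfolding H_def sum_distrib_left by (intro sum.cong refl mult.commute)
        finally show ?thesis .
      next
        case False
        have "?F j x = 0"
        proof (cases "x \<in> ?S")
          case True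
          then have "inv_c c x \<notin> closure {p. g p \<noteq> 0}"
            using False map_inv[OF c True] by (metis imageI)
          then show ?thesis using cutoff_zero[of "inv_c c x" g] by simp
        qed simp
        moreover have "0 \<le> e * H x"
          unfolding H_def by (intro mult_nonneg_nonneg sum_nonneg norm_ge_zero) (use e in simp)
        ultimately show ?thesis by (simp only: norm_zero)
      qed
      then have "norm (integral\<^sup>L lebesgue (?F j)) \<le> (\<integral>x. e * H x \<partial>lebesgue)"
        by (intro Bochner_Integration.integral_norm_bound_integral iF integrable_mult_right iH)
      then show ?case by simp
    qed
  qed
  have "(\<lambda>j. integral\<^sup>L lebesgue (?F j)) \<longlonglongrightarrow> 0"
  proof (rule tendstoI)
    fix e :: real assume e: "e > 0"
    \<comment> \<open>The summand 1 covers the case that the integral of \<open>H\<close> is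
      zero.\<close>
    let ?e = "e / (integral\<^sup>L lebesgue H + 1)"
    have "?e > 0" using e H0 by simp
    moreover have "?e * integral\<^sup>L lebesgue H < e" using e H0 by (simp add: divide_simps)
    ultimately show "\<forall>\<^sub>F j in sequentially. dist (integral\<^sup>L lebesgue (?F j)) 0 < e"
      using ev[of ?e] by (auto elim!: eventually_mono)
  qed
  then show ?thesis by (simp add: cint_def set_lebesgue_integral_def)
qed

lemma current_of_current:
  assumes \<omega>: "L1loc_form A UNIV \<omega>"
  shows "current A (current_of A \<omega>)"
  unfolding current_def
proof (intro conjI allI impI)
  show "current_of A \<omega> \<psi> = 0" if "\<not> test_form A \<psi>" for \<psi> using that by (simp add: current_of_def)
next
  fix \<psi> \<eta> assume "test_form A \<psi> \<and> test_form A \<eta>"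
  then have t: "test_form A \<psi>" "test_form A \<eta>" by auto
  have eq: "wedge \<omega> (form_add \<psi> \<eta>) = (\<lambda>c p vs. 1 * wedge \<omega> \<psi> c p vs + 1 * wedge \<omega> \<eta> c p vs)"
    by (intro ext) (simp add: wedge_lwedge form_add_def[abs_def] lwedge_add_right)
  have "form_integral A (wedge \<omega> (form_add \<psi> \<eta>)) = form_integral A (wedge \<omega> \<psi>) + form_integral A (wedge \<omega> \<eta>)"
    unfolding eq
    by (subst form_integral_lincomb[OF L1loc_wedge_test[OF \<omega> t(1) subset_UNIV] L1loc_wedge_test[OF \<omega> t(2) subset_UNIV]
        compact_Un[OF test_formD(2)[OF t(1)] test_formD(2)[OF t(2)]]])
       (use form_support_wedge_right in \<open>blast | simp\<close>)+
  then show "current_of A \<omega> (form_add \<psi> \<eta>) = current_of A \<omega> \<psi> + current_of A \<omega> \<eta>"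
    by (simp add: current_of_def t test_form_add)
next
  fix z \<psi> assume t: "test_form A \<psi>"
  have eq: "wedge \<omega> (form_scale z \<psi>) = form_scale z (wedge \<omega> \<psi>)"
    by (intro ext) (simp add: wedge_lwedge form_scale_def[abs_def] lwedge_cmult_right)
  have "form_integral A (wedge \<omega> (form_scale z \<psi>)) = z * form_integral A (wedge \<omega> \<psi>)"
    unfolding eq
    by (rule form_integral_scale[OF L1loc_wedge_test[OF \<omega> t subset_UNIV]
        compact_closed_subset[OF test_formD(2)[OF t] form_support_closed form_support_wedge_right]])
  then show "current_of A \<omega> (form_scale z \<psi>) = z * current_of A \<omega> \<psi>"
    by (simp add: current_of_def t test_form_scale)
next
  fix \<Psi> assume \<Psi>: "test_null_sequence A \<Psi>"
  then obtain K where K: "compact K" "\<And>j. form_support A (\<Psi> j) \<subseteq> K" and t: "\<And>j. test_form A (\<Psi> j)"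
    unfolding test_null_sequence_def by blast
  obtain C \<rho> where P: "partition_on A K C \<rho>" by (rule partition_on_exists[OF K(1)])
  have "current_of A \<omega> (\<Psi> j) = (\<Sum>c\<in>C. cint c (\<rho> c) (wedge \<omega> (\<Psi> j)))" for j
    using form_integral_eq[OF L1loc_wedge_test[OF \<omega> t subset_UNIV] P subset_trans[OF form_support_wedge_right K(2)]]
    by (simp add: current_of_def t)
  moreover have "(\<lambda>j. \<Sum>c\<in>C. cint c (\<rho> c) (wedge \<omega> (\<Psi> j))) \<longlonglongrightarrow> 0"
    by (rule tendsto_null_sum) (use partition_cutoff[OF P] cint_wedge_tendsto[OF _ _ \<omega> \<Psi>] in blast)
  ultimately show "(\<lambda>j. current_of A \<omega> (\<Psi> j)) \<longlonglongrightarrow> 0" by simp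
qed

text \<open>Derivatives of the coefficients of the exterior derivative are combinations of
  coefficients of \<open>\<Psi> j\<close> differentiated once more. This yields the continuity of
  \<open>current_deriv\<close>.\<close>

lemma test_null_sequence_part_deriv:
  assumes \<Psi>: "test_null_sequence A \<Psi>"
  shows "test_null_sequence A (\<lambda>j. form_part k (ext_deriv A (\<Psi> j)))"
proof -
  have t: "test_form A (\<Psi> j)" for j using \<Psi> by (simp add: test_null_sequence_def)
  obtain K where K: "compact K" "\<And>j. form_support A (\<Psi> j) \<subseteq> K"
    using \<Psi> unfolding test_null_sequence_def by blast
  have lim: "uniform_limit L (\<lambda>j. iter_deriv ws (\<lambda>x. \<Psi> j c (inv_c c x) vs)) (\<lambda>_. 0) sequentially"
    if "c \<in> A" "compact L" "L \<subseteq> map_c c ` dom_c c" for c L ws vs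
  proof -
    have "\<forall>c\<in>A. \<forall>L ws vs. compact L \<and> L \<subseteq> map_c c ` dom_c c \<longrightarrow>
        uniform_limit L (\<lambda>j. iter_deriv ws (\<lambda>x. \<Psi> j c (inv_c c x) vs)) (\<lambda>_. 0) sequentially"
      using \<Psi> by (simp add: test_null_sequence_def)
    then show ?thesis using that by blast
  qed
  show ?thesis
    unfolding test_null_sequence_def
  proof (intro conjI allI ballI impI)
    show "test_form A (form_part k (ext_deriv A (\<Psi> j)))" for j
      by (intro test_form_part test_form_ext_deriv t)
    show "\<exists>K. compact K \<and> (\<forall>j. form_support A (form_part k (ext_deriv A (\<Psi> j))) \<subseteq> K)"
      using K form_support_part form_support_ext_deriv by (meson subset_trans)
    fix c L ws vs assume c: "c \<in> A" and "compact L \<and> L \<subseteq> map_c c ` dom_c c"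
    then have L: "compact L" "L \<subseteq> map_c c ` dom_c c" by auto
    let ?S = "map_c c ` dom_c c"
    have S: "open ?S" by (rule chart_open_image[OF c])
    show "uniform_limit L (\<lambda>j. iter_deriv ws (\<lambda>x. form_part k (ext_deriv A (\<Psi> j)) c (inv_c c x) vs)) (\<lambda>_. 0) sequentially"
    proof (cases "length vs = k")
      case False
      then show ?thesis by (simp add: form_part_def iter_deriv_zero uniform_limit_const)
    next
      case True
      let ?u = "\<lambda>i. take i vs @ drop (Suc i) vs"
      let ?f = "\<lambda>i j x. iter_deriv (ws @ [vs ! i]) (\<lambda>x. \<Psi> j c (inv_c c x) (?u i)) x"
      have eq: "iter_deriv ws (\<lambda>x. form_part k (ext_deriv A (\<Psi> j)) c (inv_c c x) vs) x = (\<Sum>i<length vs. (-1) ^ i * ?f i j x)"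
        if x: "x \<in> ?S" for j x
      proof -
        have sm: "smooth_on ?S (pdir (vs ! i) (\<lambda>y. loc c (\<Psi> j) y (?u i)))" for i
          using fsmoothD[OF smooth_formD(2)[OF test_formD(1)[OF t] c]] by (intro smooth_on_pdir) simp
        have "iter_deriv ws (\<lambda>x. form_part k (ext_deriv A (\<Psi> j)) c (inv_c c x) vs) x
          = iter_deriv ws (\<lambda>x. \<Sum>i<length vs. (-1) ^ i * pdir (vs ! i) (\<lambda>y. loc c (\<Psi> j) y (?u i)) x) x"
        proof (rule iter_deriv_cong_open[OF S x])
          fix y assume "y \<in> ?S"
          then show "form_part k (ext_deriv A (\<Psi> j)) c (inv_c c y) vs
             = (\<Sum>i<length vs. (-1) ^ i * pdir (vs ! i) (\<lambda>y. loc c (\<Psi> j) y (?u i)) y)"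
            using ext_deriv_ld[OF c inv_in_dom[OF c]] True c by (simp add: form_part_def ld_def)
        qed
        also have "\<dots> = (\<Sum>i<length vs. (-1) ^ i * iter_deriv ws (pdir (vs ! i) (\<lambda>y. loc c (\<Psi> j) y (?u i))) x)"
          by (subst iter_deriv_sum[OF S x smooth_on_cmult[OF S sm]]) (simp add: iter_deriv_cmult[OF S x sm])
        finally show ?thesis by (simp add: iter_deriv_append loc_def)
      qed
      have "uniform_limit L (\<lambda>j x. \<Sum>i<length vs. (-1) ^ i * ?f i j x) (\<lambda>_. 0) sequentially"
        by (rule uniform_limit_zero_sum) (use lim[OF c L] in auto)
      then show ?thesis
        by (rule uniform_limit_cong'[THEN iffD2, rotated 2]) (use eq L in auto)
    qed
  qed
qed

lemma current_deriv_current: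
  assumes S: "current A S"
  shows "current A (current_deriv A S)"
  unfolding current_def
proof (intro conjI allI impI)
  let ?P = "\<lambda>k \<psi>. form_part (CARD('n) - k) (ext_deriv A \<psi>)"
  have tP: "test_form A (?P k \<psi>)" if "test_form A \<psi>" for k \<psi>
    by (intro test_form_part test_form_ext_deriv that)
  show "current_deriv A S \<psi> = 0" if "\<not> test_form A \<psi>" for \<psi> using that by (simp add: current_deriv_def)
  show "current_deriv A S (form_add \<psi> \<eta>) = current_deriv A S \<psi> + current_deriv A S \<eta>"
    if tt: "test_form A \<psi> \<and> test_form A \<eta>" for \<psi> \<eta>
  proof -
    have t: "test_form A \<psi>" "test_form A \<eta>" using tt by auto
    have "?P k (form_add \<psi> \<eta>) = form_add (?P k \<psi>) (?P k \<eta>)" for k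
    proof (intro ext)
      fix c p vs
      show "?P k (form_add \<psi> \<eta>) c p vs = form_add (?P k \<psi>) (?P k \<eta>) c p vs"
        using ext_deriv_add[OF open_UNIV test_formD(1)[OF t(1)] test_formD(1)[OF t(2)], of c p vs]
        by (cases "c \<in> A \<and> p \<in> dom_c c") (auto simp: form_part_apply form_add_apply ext_deriv_outside)
    qed
    then have "S (?P k (form_add \<psi> \<eta>)) = S (?P k \<psi>) + S (?P k \<eta>)" for k
      using S tP t by (simp add: current_def)
    then show ?thesis by (simp add: current_deriv_def t test_form_add sum.distrib distrib_left del: power_Suc)
  qed
  show "current_deriv A S (form_scale z \<psi>) = z * current_deriv A S \<psi>" if t: "test_form A \<psi>" for z \<psi>
  proof -
    have "?P k (form_scale z \<psi>) = form_scale z (?P k \<psi>)" for k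
    proof (intro ext)
      fix c p vs
      show "?P k (form_scale z \<psi>) c p vs = form_scale z (?P k \<psi>) c p vs"
        using ext_deriv_scale[OF open_UNIV test_formD(1)[OF t], of c p z vs]
        by (cases "c \<in> A \<and> p \<in> dom_c c") (auto simp: form_part_apply form_scale_apply ext_deriv_outside)
    qed
    then have "S (?P k (form_scale z \<psi>)) = z * S (?P k \<psi>)" for k
      using S tP t by (simp add: current_def)
    then show ?thesis by (simp add: current_deriv_def t test_form_scale sum_distrib_left algebra_simps)
  qed
  show "(\<lambda>j. current_deriv A S (\<Psi> j)) \<longlonglongrightarrow> 0" if \<Psi>: "test_null_sequence A \<Psi>" for \<Psi>
  proof -
    have "(\<lambda>j. \<Sum>k\<le>CARD('n). (-1) ^ (k + 1) * S (?P k (\<Psi> j))) \<longlonglongrightarrow> 0"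
    proof (intro tendsto_null_sum tendsto_mult_right_zero)
      fix k show "(\<lambda>j. S (?P k (\<Psi> j))) \<longlonglongrightarrow> 0"
        using S test_null_sequence_part_deriv[OF \<Psi>, of "CARD('n) - k"] unfolding current_def by blast
    qed
    moreover have "test_form A (\<Psi> j)" for j using \<Psi> by (simp add: test_null_sequence_def)
    ultimately show ?thesis by (simp add: current_deriv_def)
  qed
qed

lemma current_lincomb:
  assumes "current A S" "current A S'"
  shows "current A (\<lambda>\<psi>. z * S \<psi> + w * S' \<psi>)"
  unfolding current_def
proof (intro conjI allI impI)
  fix \<Psi> assume "test_null_sequence A \<Psi>"
  then have "(\<lambda>j. S (\<Psi> j)) \<longlonglongrightarrow> 0" "(\<lambda>j. S' (\<Psi> j)) \<longlonglongrightarrow> 0" using assms unfolding current_def by blast+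
  from tendsto_add[OF tendsto_mult_right_zero[OF this(1), of z] tendsto_mult_right_zero[OF this(2), of w]]
  show "(\<lambda>j. z * S (\<Psi> j) + w * S' (\<Psi> j)) \<longlonglongrightarrow> 0" by simp
qed (use assms in \<open>simp_all add: current_def algebra_simps\<close>)

text \<open>The degreewise signs in \<open>current_deriv\<close> disappear by
  \<open>odd_fun_signed_parts\<close>, applied to the list \<open>std_frame\<close> of length
  \<open>CARD('n)\<close>. The set \<open>U\<close> admits forms that are integrable only locally on
  a part of the manifold, such as \<open>dlog a\<close>.\<close>

lemma current_deriv_odd:
  assumes \<psi>: "test_form A \<psi>" "form_support A \<psi> \<subseteq> U" and \<omega>: "L1loc_form A U \<omega>"
    and odd: "\<And>c p. c \<in> A \<Longrightarrow> p \<in> dom_c c \<Longrightarrow> odd_fun (\<omega> c p)"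
  shows "current_deriv A (current_of A \<omega>) \<psi> = form_integral A (wedge \<omega> (ext_deriv A \<psi>))"
proof -
  let ?n = "CARD('n)" and ?d = "ext_deriv A \<psi>" and ?K = "form_support A \<psi>"
  let ?w = "\<lambda>k. form_scale ((-1) ^ (k + 1)) (wedge \<omega> (form_part (?n - k) ?d))"
  have td: "test_form A ?d" by (rule test_form_ext_deriv[OF \<psi>(1)])
  have tp: "test_form A (form_part k ?d)" for k by (rule test_form_part[OF td])
  have K: "compact ?K" by (rule test_formD(2)[OF \<psi>(1)])
  have sd: "form_support A ?d \<subseteq> ?K" by (rule form_support_ext_deriv)
  have sp: "form_support A (form_part k ?d) \<subseteq> ?K" for k using form_support_part sd by blast
  have L1p: "L1loc_form A UNIV (wedge \<omega> (form_part k ?d))" for k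
    by (rule L1loc_wedge_test[OF \<omega> tp]) (use sp \<psi>(2) in blast)
  have swp: "form_support A (wedge \<omega> (form_part k ?d)) \<subseteq> ?K" for k using form_support_wedge_right sp by blast
  have sww: "form_support A (?w k) \<subseteq> ?K" for k
  proof (rule form_support_subset[OF form_support_closed])
    fix c p vs assume p: "c \<in> A" "p \<in> dom_c c" "p \<notin> ?K"
    have "wedge \<omega> (form_part (?n - k) ?d) c p vs = 0"
      by (rule form_support_zero[OF p(1,2)]) (use swp p(3) in blast)
    then show "?w k c p vs = 0" by (simp add: form_scale_apply)
  qed
  have sum: "L1loc_form A UNIV (\<lambda>c p vs. \<Sum>k\<le>?n. ?w k c p vs) \<and> form_support A (\<lambda>c p vs. \<Sum>k\<le>?n. ?w k c p vs) \<subseteq> ?K \<and>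
     form_integral A (\<lambda>c p vs. \<Sum>k\<le>?n. ?w k c p vs) = (\<Sum>k\<le>?n. form_integral A (?w k))"
    by (rule form_integral_sum[OF _ L1loc_form_scale[OF L1p] K sww]) simp
  have "current_deriv A (current_of A \<omega>) \<psi> = (\<Sum>k\<le>?n. form_integral A (?w k))"
    using form_integral_scale[OF L1p compact_closed_subset[OF K form_support_closed swp]]
    by (simp add: current_deriv_def current_of_def \<psi>(1) tp)
  also have "\<dots> = form_integral A (\<lambda>c p vs. \<Sum>k\<le>?n. ?w k c p vs)" using sum by simp
  also have "\<dots> = form_integral A (wedge \<omega> ?d)"
  proof (rule form_integral_cong[OF _ L1loc_wedge_test[OF \<omega> td] K])
    show "form_support A ?d \<subseteq> U" using sd \<psi>(2) by blast
    show "form_support A (wedge \<omega> ?d) \<subseteq> ?K" using form_support_wedge_right sd by blast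
    fix c p assume p: "c \<in> A" "p \<in> dom_c c"
    have "length (std_frame :: (real, 'n) vec list) = ?n" by (rule std_frame_props)
    then show "(\<Sum>k\<le>?n. ?w k c p std_frame) = wedge \<omega> ?d c p std_frame"
      using odd_fun_signed_parts[OF odd[OF p], of "std_frame" "?d c p"]
      by (simp add: form_scale_def wedge_lwedge form_part_def[abs_def])
  qed (use sum in auto)
  finally show ?thesis .
qed

end

section \<open>Line bundles and connections\<close>

lemma alternating_one_form:
  assumes "linear f"
  shows "alternating (\<lambda>vs. case vs of [v] \<Rightarrow> f v | _ \<Rightarrow> (0::complex))"
  unfolding alternating_def
proof (intro conjI allI)
  fix us ws :: "'a list"
  show "linear (\<lambda>v. case us @ v # ws of [v] \<Rightarrow> f v | _ \<Rightarrow> 0)"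
  proof (cases "us = [] \<and> ws = []")
    case True
    then show ?thesis using assms by simp
  next
    case False
    have "(case us @ v # ws of [v] \<Rightarrow> f v | _ \<Rightarrow> 0) = 0" for v
      using False by (cases us; cases ws) (auto split: list.split)
    then show ?thesis by (simp add: linear_zero)
  qed
next
  fix us v vs and ws :: "'a list"
  show "(case us @ v # vs @ v # ws of [v] \<Rightarrow> f v | _ \<Rightarrow> 0) = 0"
    by (cases us; cases vs) (auto split: list.split)
qed

text \<open>A function as a form of degree 0. Its differential becomes an instance of
  \<open>ext_deriv\<close>, so the rules for forms apply to \<open>dlog\<close>.\<close>

definition zero_form :: "('a \<Rightarrow> complex) \<Rightarrow> ('a, 'n) form" where
  "zero_form g = (\<lambda>c p vs. g p * lone vs)"

context oriented_manifold
begin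

lemma smooth_form_cong:
  assumes U: "open U" and \<eta>: "smooth_form A U \<eta>"
    and eq: "\<And>c p vs. c \<in> A \<Longrightarrow> p \<in> U \<Longrightarrow> p \<in> dom_c c \<Longrightarrow> \<omega> c p vs = \<eta> c p vs"
  shows "smooth_form A U \<omega>"
proof (rule smooth_formI)
  have eq': "\<omega> c p = \<eta> c p" if "c \<in> A" "p \<in> U" "p \<in> dom_c c" for c p using eq[OF that] by blast
  note f = form_onD[OF smooth_formD(1)[OF \<eta>]]
  show "form_on A U \<omega>"
  proof (rule form_onI)
    show "alternating (\<omega> c p)" if "c \<in> A" "p \<in> U" "p \<in> dom_c c" for c p
      unfolding eq'[OF that] by (rule f(1)[OF that])
    show "\<omega> c p vs = \<omega> c' p (map (trans_deriv c c' p) vs)"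
      if "c \<in> A" "c' \<in> A" "p \<in> U" "p \<in> dom_c c" "p \<in> dom_c c'" for c c' p vs
      unfolding eq'[OF that(1,3,4)] eq'[OF that(2,3,5)] by (rule f(2)[OF that(1,3,4,2,5)])
  qed
  fix c assume c: "c \<in> A"
  show "fsmooth (map_c c ` (U \<inter> dom_c c)) (loc c \<omega>)"
  proof (rule fsmooth_cong[OF open_chart_image[OF c U] smooth_formD(2)[OF \<eta> c]])
    fix x vs assume "x \<in> map_c c ` (U \<inter> dom_c c)"
    then obtain p where "p \<in> U" "p \<in> dom_c c" "x = map_c c p" by blast
    then show "loc c \<omega> x vs = loc c \<eta> x vs" using eq[OF c] c by (simp add: loc_def)
  qed
qed

lemma smooth_form_local:
  assumes "\<And>p. \<exists>U. open U \<and> p \<in> U \<and> smooth_form A U \<omega>"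
  shows "smooth_form A UNIV \<omega>"
proof (rule smooth_formI)
  show "form_on A UNIV \<omega>"
  proof (rule form_onI)
    show "alternating (\<omega> c p)" if "c \<in> A" "p \<in> dom_c c" for c p
      using assms[of p] form_onD(1) smooth_formD(1) that by blast
    show "\<omega> c p vs = \<omega> c' p (map (trans_deriv c c' p) vs)"
      if "c \<in> A" "c' \<in> A" "p \<in> dom_c c" "p \<in> dom_c c'" for c c' p vs
    proof -
      obtain U where U: "p \<in> U" "smooth_form A U \<omega>" using assms[of p] by blast
      show ?thesis by (rule form_onD(2)[OF smooth_formD(1)[OF U(2)] that(1) U(1) that(3,2,4)])
    qed
  qed
  fix c assume c: "c \<in> A"
  have "smooth_on (map_c c ` (UNIV \<inter> dom_c c)) (\<lambda>x. loc c \<omega> x vs)" for vs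
  proof (rule smooth_on_local)
    fix x assume "x \<in> map_c c ` (UNIV \<inter> dom_c c)"
    then obtain p where p: "p \<in> dom_c c" "x = map_c c p" by blast
    obtain U where U: "p \<in> U" "smooth_form A U \<omega>" using assms[of p] by blast
    show "\<exists>T. x \<in> T \<and> smooth_on T (\<lambda>x. loc c \<omega> x vs)"
      by (intro exI[of _ "map_c c ` (U \<inter> dom_c c)"] conjI fsmoothD[OF smooth_formD(2)[OF U(2) c]])
         (use p U in blast)
  qed
  then show "fsmooth (map_c c ` (UNIV \<inter> dom_c c)) (loc c \<omega>)" by (simp add: fsmooth_def)
qed

lemma smooth_zero_form:
  assumes "open U" "smooth_fun A U g"
  shows "smooth_form A U (zero_form g)"
  unfolding zero_form_def
proof (rule smooth_form_scale_fun[OF assms smooth_formI[OF form_onI]])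
  fix c c' :: "('a, 'n) chart" and p :: 'a and vs :: "(real, 'n) vec list"
  show "lone vs = lone (map (trans_deriv c c' p) vs)" by (simp add: lone_def)
  show "fsmooth (map_c c ` (U \<inter> dom_c c)) (loc c (\<lambda>c p. lone))"
    by (simp add: loc_def[abs_def] fsmooth_const)
qed (rule alternating_lone)

lemma ext_deriv_zero_form:
  assumes "c \<in> A" "p \<in> dom_c c"
  shows "ext_deriv A (zero_form g) c p vs = (case vs of [v] \<Rightarrow> dir_deriv g c p v | _ \<Rightarrow> 0)"
proof -
  consider "vs = []" | v where "vs = [v]" | v w us where "vs = v # w # us" by (metis list.exhaust)
  then show ?thesis
  proof cases
    case 2
    then show ?thesis using assms
      by (simp add: ext_deriv_ld ld_Cons loc_def zero_form_def lone_def dir_deriv_def o_def)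
  next
    case 3
    have "ld (loc c (zero_form g)) (map_c c p) vs = 0"
      by (rule ld_zero[OF open_UNIV UNIV_I]) (use 3 in \<open>auto simp: loc_def zero_form_def lone_def\<close>)
    then show ?thesis using assms 3 by (simp add: ext_deriv_ld)
  qed (use assms in \<open>simp add: ext_deriv_ld\<close>)
qed

text \<open>Puts \<open>dlog g\<close> into the product form to which Leibniz' rule applies. At the
  zeros of \<open>g\<close> both sides are 0 by the convention for division.\<close>

lemma dlog_zero_form:
  assumes "c \<in> A" "p \<in> dom_c c"
  shows "dlog g c p vs = wedge (zero_form (\<lambda>p. 1 / g p)) (ext_deriv A (zero_form g)) c p vs"
proof -
  have "wedge (zero_form (\<lambda>p. 1 / g p)) (ext_deriv A (zero_form g)) c p vs = 1 / g p * ext_deriv A (zero_form g) c p vs"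
    unfolding wedge_lwedge zero_form_def[of "\<lambda>p. 1 / g p"] lwedge_cmult_left lwedge_lone_left ..
  then show ?thesis using assms by (auto simp: ext_deriv_zero_form dlog_def split: list.split)
qed

lemma smooth_dlog:
  assumes U: "open U" and g: "smooth_fun A U g" "\<And>p. p \<in> U \<Longrightarrow> g p \<noteq> 0"
  shows "smooth_form A U (dlog g)"
proof (rule smooth_form_cong[OF U smooth_form_scale_fun[OF U _ smooth_form_ext_deriv[OF U smooth_zero_form[OF U g(1)]]]])
  show "smooth_fun A U (\<lambda>p. 1 / g p)" by (rule smooth_fun_divide[OF U smooth_fun_const g])
  show "dlog g c p vs = 1 / g p * ext_deriv A (zero_form g) c p vs" if "c \<in> A" "p \<in> dom_c c" for c p vs
    using that by (auto simp: ext_deriv_zero_form dlog_def split: list.split)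
qed

text \<open>The differential of \<open>1 / g\<close> is a multiple of that of \<open>g\<close>, and
  the latter wedged with itself vanishes because it is odd. The computation works without a branch
  of the logarithm.\<close>

lemma ext_deriv_dlog:
  assumes U: "open U" and g: "smooth_fun A U g" "\<And>p. p \<in> U \<Longrightarrow> g p \<noteq> 0" and p: "c \<in> A" "p \<in> U" "p \<in> dom_c c"
  shows "ext_deriv A (dlog g) c p vs = 0"
proof -
  let ?h = "\<lambda>p. 1 / g p"
  have h: "smooth_fun A U ?h" by (rule smooth_fun_divide[OF U smooth_fun_const g])
  note dg = smooth_form_ext_deriv[OF U smooth_zero_form[OF U g(1)]]
  let ?dg = "ext_deriv A (zero_form g) c p"
  have x: "map_c c p \<in> map_c c ` (U \<inter> dom_c c)" using p by blast
  have gd: "(\<lambda>x. g (inv_c c x)) differentiable (at (map_c c p))"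
    by (rule smooth_on_differentiable[OF smooth_funD[OF g(1) p(1)] x])
  have "dir_deriv ?h c p v = - (1 / (g p)\<^sup>2) * dir_deriv g c p v" for v
    using frechet_derivative_at[OF has_derivative_inverse_fun[OF gd], symmetric] g(2)[OF p(2)] p
    by (simp add: dir_deriv_def o_def inverse_eq_divide power2_eq_square)
  then have dh: "ext_deriv A (zero_form ?h) c p = (\<lambda>vs. - (1 / (g p)\<^sup>2) * ?dg vs)"
    using p by (intro ext) (auto simp: ext_deriv_zero_form split: list.split)
  have "odd_fun ?dg" using p by (auto simp: odd_fun_def ext_deriv_zero_form split: list.split)
  from lwedge_commute(2)[OF this, of ?dg] have "lwedge ?dg ?dg vs = - lwedge ?dg ?dg vs"
    unfolding odd_fun_lhat[OF \<open>odd_fun ?dg\<close>] by (metis lwedge_uminus_left)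
  then have sq: "lwedge ?dg ?dg vs = 0" by simp
  have dd: "ext_deriv A (ext_deriv A (zero_form g)) c p = (\<lambda>vs. 0)"
    by (rule ext) (rule ext_deriv_ext_deriv[OF U smooth_zero_form[OF U g(1)] p])
  have "ext_deriv A (dlog g) c p vs = ext_deriv A (wedge (zero_form ?h) (ext_deriv A (zero_form g))) c p vs"
    by (rule ext_deriv_cong[OF U p]) (rule dlog_zero_form[OF p(1)])
  also have "\<dots> = lwedge (ext_deriv A (zero_form ?h) c p) ?dg vs"
    unfolding ext_deriv_wedge[OF U smooth_zero_form[OF U h] dg p] dd by (simp add: lwedge_zero_right)
  finally show ?thesis unfolding dh lwedge_cmult_left sq by simp
qed

end

section \<open>Frames and fibre coordinates of a line bundle\<close>

definition fib_coord :: "('a, 'e) line_bundle_data \<Rightarrow> ('a \<Rightarrow> 'e) \<Rightarrow> 'a \<Rightarrow> 'e \<Rightarrow> complex" where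
  "fib_coord E s p v = (THE z. v = fib_scale E z (s p))"

locale manifold_line_bundle = oriented_manifold A
  for A :: "('a::{t2_space, second_countable_topology}, 'n::{finite, linorder}) chart set" +
  fixes E :: "('a, 'e) line_bundle_data"
  assumes lb: "line_bundle A E"
begin

lemma triv_cover: obtains V t where "(V, t) \<in> trivs E" "p \<in> V"
proof -
  have "(\<Union>(U, t)\<in>trivs E. U) = UNIV" using lb unfolding line_bundle_def by (rule conjunct1)
  then have "p \<in> (\<Union>(U, t)\<in>trivs E. U)" by simp
  then show ?thesis using that by auto
qed

lemma trivD:
  assumes "(V, t) \<in> trivs E"
  shows "open V" "p \<in> V \<Longrightarrow> bij_betw t (fibre E p) UNIV"
    and "p \<in> V \<Longrightarrow> v \<in> fibre E p \<Longrightarrow> w \<in> fibre E p \<Longrightarrow> fib_add E v w \<in> fibre E p \<and> t (fib_add E v w) = t v + t w"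
    and "p \<in> V \<Longrightarrow> v \<in> fibre E p \<Longrightarrow> fib_scale E z v \<in> fibre E p \<and> t (fib_scale E z v) = z * t v"
  using lb assms unfolding line_bundle_def by blast+

lemma triv_transition:
  assumes "(V, t) \<in> trivs E" "(V', t') \<in> trivs E"
  obtains g where "smooth_fun A (V \<inter> V') g" "\<And>p v. p \<in> V \<Longrightarrow> p \<in> V' \<Longrightarrow> v \<in> fibre E p \<Longrightarrow> t' v = g p * t v"
proof -
  have "\<forall>(U, t)\<in>trivs E. \<forall>(U', t')\<in>trivs E. \<exists>g. smooth_fun A (U \<inter> U') g \<and>
        (\<forall>p\<in>U \<inter> U'. \<forall>v\<in>fibre E p. t' v = g p * t v)"
    using lb unfolding line_bundle_def by (elim conjE)
  from bspec[OF this assms(1)] have "\<forall>(U', t')\<in>trivs E. \<exists>g. smooth_fun A (V \<inter> U') g \<and>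
        (\<forall>p\<in>V \<inter> U'. \<forall>v\<in>fibre E p. t' v = g p * t v)" by simp
  from bspec[OF this assms(2)] show ?thesis using that by auto
qed

lemma fib_closed:
  assumes "v \<in> fibre E p"
  shows "fib_scale E z v \<in> fibre E p" "w \<in> fibre E p \<Longrightarrow> fib_add E v w \<in> fibre E p"
proof -
  obtain V t where "(V, t) \<in> trivs E" "p \<in> V" by (rule triv_cover)
  note T = trivD[OF this(1)]
  show "fib_scale E z v \<in> fibre E p" using T(4)[OF \<open>p \<in> V\<close> assms] by blast
  show "fib_add E v w \<in> fibre E p" if "w \<in> fibre E p" using T(3)[OF \<open>p \<in> V\<close> assms that] by blast
qed

lemma smooth_sectionD:
  assumes "smooth_section A E U s"
  shows "open U" "p \<in> U \<Longrightarrow> s p \<in> fibre E p" "(V, t) \<in> trivs E \<Longrightarrow> smooth_fun A (U \<inter> V) (\<lambda>p. t (s p))"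
  using assms unfolding smooth_section_def o_def by blast+

lemma smooth_section_subset:
  assumes "smooth_section A E U s" "open W" "W \<subseteq> U"
  shows "smooth_section A E W s"
  unfolding smooth_section_def
proof (intro conjI ballI)
  show "open W" by fact
  show "s p \<in> fibre E p" if "p \<in> W" for p using smooth_sectionD(2)[OF assms(1)] assms(3) that by blast
  fix x assume "x \<in> trivs E"
  then obtain V t where x: "x = (V, t)" "(V, t) \<in> trivs E" by (cases x) auto
  have "smooth_fun A (W \<inter> V) (\<lambda>p. t (s p))"
    by (rule smooth_fun_subset[OF smooth_sectionD(3)[OF assms(1) x(2)]]) (use assms(3) in blast)
  then show "case x of (V, t) \<Rightarrow> smooth_fun A (W \<inter> V) (t \<circ> s)" by (simp add: x o_def)
qed

lemma local_frameD:
  assumes "local_frame A E U s"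
  shows "smooth_section A E U s" "open U" "p \<in> U \<Longrightarrow> s p \<in> fibre E p"
  using assms smooth_sectionD unfolding local_frame_def by blast+

lemma local_frame_subset:
  assumes "local_frame A E U s" "open W" "W \<subseteq> U"
  shows "local_frame A E W s"
  using assms smooth_section_subset[OF _ assms(2,3)] unfolding local_frame_def by blast

lemma frame_triv_nonzero:
  assumes "local_frame A E U s" "p \<in> U" "(V, t) \<in> trivs E" "p \<in> V"
  shows "t (s p) \<noteq> 0"
proof
  assume 0: "t (s p) = 0"
  obtain v where v: "v \<in> fibre E p" "t v = 1"
    using trivD(2)[OF assms(3,4)] by (metis UNIV_I bij_betw_iff_bijections)
  obtain z where "v = fib_scale E z (s p)" using assms(1,2) v unfolding local_frame_def by blast
  then have "t v = z * t (s p)" using trivD(4)[OF assms(3,4) local_frameD(3)[OF assms(1,2)]] by simp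
  then show False using 0 v by simp
qed

text \<open>The ratio formula follows from the linearity of a trivialisation on the fibre. It
  reduces linearity and smoothness of coordinates to those of trivialisations.\<close>

lemma fib_coord:
  assumes s: "local_frame A E U s" "p \<in> U" and v: "v \<in> fibre E p"
  shows "v = fib_scale E (fib_coord E s p v) (s p)"
    and "(V, t) \<in> trivs E \<Longrightarrow> p \<in> V \<Longrightarrow> fib_coord E s p v = t v / t (s p)"
    and "v = fib_scale E z (s p) \<Longrightarrow> fib_coord E s p v = z"
proof -
  have ex: "\<exists>!z. v = fib_scale E z (s p)" using s v unfolding local_frame_def by blast
  show 1: "v = fib_scale E (fib_coord E s p v) (s p)"
    unfolding fib_coord_def by (rule theI'[OF ex])
  show "fib_coord E s p v = t v / t (s p)" if "(V, t) \<in> trivs E" "p \<in> V"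
  proof -
    have "t v = fib_coord E s p v * t (s p)"
      using trivD(4)[OF that local_frameD(3)[OF s]] 1 by metis
    then show ?thesis using frame_triv_nonzero[OF s that] by simp
  qed
  show "v = fib_scale E z (s p) \<Longrightarrow> fib_coord E s p v = z" using ex 1 by blast
qed

lemma fib_coord_scale_frame:
  assumes s: "local_frame A E U s" "p \<in> U"
  shows "fib_coord E s p (fib_scale E z (s p)) = z"
  by (rule fib_coord(3)[OF s fib_closed(1)[OF local_frameD(3)[OF s]] refl])

lemma fib_coord_linear:
  assumes s: "local_frame A E U s" "p \<in> U" and v: "v \<in> fibre E p"
  shows "fib_coord E s p (fib_scale E z v) = z * fib_coord E s p v"
    and "w \<in> fibre E p \<Longrightarrow> fib_coord E s p (fib_add E v w) = fib_coord E s p v + fib_coord E s p w"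
proof -
  obtain V t where V: "(V, t) \<in> trivs E" "p \<in> V" by (rule triv_cover)
  note co = fib_coord(2)[OF s _ V]
  show "fib_coord E s p (fib_scale E z v) = z * fib_coord E s p v"
    using trivD(4)[OF V v] by (simp add: co[OF v] co[OF fib_closed(1)[OF v]])
  show "fib_coord E s p (fib_add E v w) = fib_coord E s p v + fib_coord E s p w" if w: "w \<in> fibre E p"
    using trivD(3)[OF V v w] by (simp add: co[OF v] co[OF w] co[OF fib_closed(2)[OF v w]] add_divide_distrib)
qed

lemma fib_coord_eqI:
  assumes s: "local_frame A E U s" "p \<in> U" and v: "v \<in> fibre E p" "w \<in> fibre E p"
    and "fib_coord E s p v = fib_coord E s p w"
  shows "v = w"
  using fib_coord(1)[OF s v(1)] fib_coord(1)[OF s v(2)] assms(5) by metis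

lemma smooth_fib_coord:
  assumes s: "local_frame A E U s" and s': "smooth_section A E U s'"
  shows "smooth_fun A U (\<lambda>p. fib_coord E s p (s' p))"
proof (rule smooth_fun_local)
  fix p assume p: "p \<in> U"
  obtain V t where V: "(V, t) \<in> trivs E" "p \<in> V" by (rule triv_cover)
  have o: "open (U \<inter> V)" using local_frameD(2)[OF s] trivD(1)[OF V(1)] by blast
  have "smooth_fun A (U \<inter> V) (\<lambda>p. t (s' p) / t (s p))"
    by (rule smooth_fun_divide[OF o smooth_sectionD(3)[OF s' V(1)] smooth_sectionD(3)[OF local_frameD(1)[OF s] V(1)]])
       (use frame_triv_nonzero[OF s _ V(1)] in blast)
  then have "smooth_fun A (U \<inter> V) (\<lambda>p. fib_coord E s p (s' p))"
  proof (rule smooth_fun_cong[OF o])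
    fix q assume "q \<in> U \<inter> V"
    then show "fib_coord E s q (s' q) = t (s' q) / t (s q)"
      using fib_coord(2)[OF s _ smooth_sectionD(2)[OF s'] V(1)] by blast
  qed
  then show "\<exists>V. p \<in> V \<and> smooth_fun A V (\<lambda>p. fib_coord E s p (s' p))" using p V(2) by blast
qed

lemma smooth_section_scale:
  assumes "smooth_section A E U s" "smooth_fun A U g"
  shows "smooth_section A E U (\<lambda>p. fib_scale E (g p) (s p))"
  unfolding smooth_section_def
proof (intro conjI ballI)
  show "open U" by (rule smooth_sectionD(1)[OF assms(1)])
  show "fib_scale E (g p) (s p) \<in> fibre E p" if "p \<in> U" for p
    by (rule fib_closed(1)[OF smooth_sectionD(2)[OF assms(1) that]])
  fix x assume "x \<in> trivs E"
  then obtain V t where x: "x = (V, t)" "(V, t) \<in> trivs E" by (cases x) auto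
  have o: "open (U \<inter> V)" using smooth_sectionD(1)[OF assms(1)] trivD(1)[OF x(2)] by blast
  have "smooth_fun A (U \<inter> V) (\<lambda>p. g p * t (s p))"
    by (rule smooth_fun_mult[OF o smooth_fun_subset[OF assms(2)] smooth_sectionD(3)[OF assms(1) x(2)]]) blast
  then have "smooth_fun A (U \<inter> V) (\<lambda>p. t (fib_scale E (g p) (s p)))"
  proof (rule smooth_fun_cong[OF o])
    fix q assume "q \<in> U \<inter> V"
    then show "t (fib_scale E (g q) (s q)) = g q * t (s q)"
      using trivD(4)[OF x(2) _ smooth_sectionD(2)[OF assms(1)]] by blast
  qed
  then show "case x of (V, t) \<Rightarrow> smooth_fun A (U \<inter> V) (t \<circ> (\<lambda>p. fib_scale E (g p) (s p)))" by (simp add: x o_def)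
qed

lemma frame_exists: obtains U s where "p \<in> U" "local_frame A E U s"
proof -
  obtain U t where U: "(U, t) \<in> trivs E" "p \<in> U" by (rule triv_cover)
  \<comment> \<open>The section that the trivialisation sends to the constant 1; its coordinates are
    the values of \<open>t\<close>.\<close>
  define s where "s q = inv_into (fibre E q) t 1" for q
  have s: "s q \<in> fibre E q" "t (s q) = 1" if "q \<in> U" for q
  proof -
    have "1 \<in> t ` fibre E q" using trivD(2)[OF U(1) that] by (simp add: bij_betw_def)
    then show "s q \<in> fibre E q" "t (s q) = 1" unfolding s_def by (rule inv_into_into, rule f_inv_into_f)
  qed
  have sec: "smooth_section A E U s"
    unfolding smooth_section_def
  proof (intro conjI ballI)
    show "open U" by (rule trivD(1)[OF U(1)])
    fix x assume "x \<in> trivs E"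
    then obtain V t' where x: "x = (V, t')" "(V, t') \<in> trivs E" by (cases x) auto
    obtain g where g: "smooth_fun A (U \<inter> V) g" "\<And>q v. q \<in> U \<Longrightarrow> q \<in> V \<Longrightarrow> v \<in> fibre E q \<Longrightarrow> t' v = g q * t v"
      using triv_transition[OF U(1) x(2)] by blast
    have "smooth_fun A (U \<inter> V) (\<lambda>q. t' (s q))"
      by (rule smooth_fun_cong[OF _ g(1)]) (use trivD(1)[OF U(1)] trivD(1)[OF x(2)] g(2) s in auto)
    then show "case x of (V, t') \<Rightarrow> smooth_fun A (U \<inter> V) (t' \<circ> s)" by (simp add: x o_def)
  qed (rule s)
  have "\<exists>!z. v = fib_scale E z (s q)" if q: "q \<in> U" and v: "v \<in> fibre E q" for q v
  proof (rule ex1I[of _ "t v"])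
    have sc: "fib_scale E z (s q) \<in> fibre E q" "t (fib_scale E z (s q)) = z" for z
      using trivD(4)[OF U(1) q s(1)[OF q], of z] s(2)[OF q] by auto
    have inj: "inj_on t (fibre E q)" using trivD(2)[OF U(1) q] by (simp add: bij_betw_def)
    show "v = fib_scale E (t v) (s q)"
      by (rule inj_onD[OF inj]) (use sc v in auto)
    show "z = t v" if "v = fib_scale E z (s q)" for z using sc that by simp
  qed
  then have "local_frame A E U s" unfolding local_frame_def using sec by blast
  then show ?thesis using that U(2) by blast
qed

end

section \<open>Connections in local frames and their curvature\<close>

locale manifold_connection = manifold_line_bundle A E
  for A :: "('a::{t2_space, second_countable_topology}, 'n::{finite, linorder}) chart set"
    and E :: "('a, 'e) line_bundle_data" +
  fixes D :: "('a, 'n, 'e) covariant_deriv"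
  assumes conn: "connection A E D"
begin

lemma connectionD:
  assumes s: "smooth_section A E U s" and c: "c \<in> A"
  shows "smooth_section A E (U \<inter> dom_c c) (\<lambda>p. D s c p v)"
    and "p \<in> U \<Longrightarrow> p \<in> dom_c c \<Longrightarrow> D s c p (v + w) = fib_add E (D s c p v) (D s c p w)"
    and "p \<in> U \<Longrightarrow> p \<in> dom_c c \<Longrightarrow> D s c p (r *\<^sub>R v) = fib_scale E (of_real r) (D s c p v)"
    and "c' \<in> A \<Longrightarrow> p \<in> U \<Longrightarrow> p \<in> dom_c c \<Longrightarrow> p \<in> dom_c c' \<Longrightarrow> D s c p v = D s c' p (trans_deriv c c' p v)"
    and "smooth_section A E U s' \<Longrightarrow> p \<in> U \<Longrightarrow> p \<in> dom_c c \<Longrightarrow> (\<And>q. q \<in> U \<Longrightarrow> s q = s' q) \<Longrightarrow> D s c p v = D s' c p v"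
    and "smooth_fun A U g \<Longrightarrow> p \<in> U \<Longrightarrow> p \<in> dom_c c \<Longrightarrow> D (\<lambda>q. fib_scale E (g q) (s q)) c p v =
          fib_add E (fib_scale E (dir_deriv g c p v) (s p)) (fib_scale E (g p) (D s c p v))"
proof -
  note C = conn[unfolded connection_def, rule_format, OF s]
  show "smooth_section A E (U \<inter> dom_c c) (\<lambda>p. D s c p v)"
    using conjunct1[OF C] c by blast
  note C2 = conjunct2[OF C]
  show "p \<in> U \<Longrightarrow> p \<in> dom_c c \<Longrightarrow> D s c p (v + w) = fib_add E (D s c p v) (D s c p w)"
    "p \<in> U \<Longrightarrow> p \<in> dom_c c \<Longrightarrow> D s c p (r *\<^sub>R v) = fib_scale E (of_real r) (D s c p v)"
    using conjunct1[OF C2] c by blast+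
  note C3 = conjunct2[OF C2]
  show "c' \<in> A \<Longrightarrow> p \<in> U \<Longrightarrow> p \<in> dom_c c \<Longrightarrow> p \<in> dom_c c' \<Longrightarrow> D s c p v = D s c' p (trans_deriv c c' p v)"
    using conjunct1[OF C3] c by blast
  note C4 = conjunct2[OF C3]
  show "smooth_section A E U s' \<Longrightarrow> p \<in> U \<Longrightarrow> p \<in> dom_c c \<Longrightarrow> (\<And>q. q \<in> U \<Longrightarrow> s q = s' q) \<Longrightarrow> D s c p v = D s' c p v"
    using conjunct1[OF C4] c by blast
  show "smooth_fun A U g \<Longrightarrow> p \<in> U \<Longrightarrow> p \<in> dom_c c \<Longrightarrow> D (\<lambda>q. fib_scale E (g q) (s q)) c p v =
          fib_add E (fib_scale E (dir_deriv g c p v) (s p)) (fib_scale E (g p) (D s c p v))"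
    using conjunct2[OF C4] c by blast
qed

lemma D_in_fibre:
  assumes "smooth_section A E U s" "c \<in> A" "p \<in> U" "p \<in> dom_c c"
  shows "D s c p v \<in> fibre E p"
  using smooth_sectionD(2)[OF connectionD(1)[OF assms(1,2)]] assms(3,4) by blast

lemma connection_form_coord:
  "connection_form E D s c p vs = (case vs of [v] \<Rightarrow> fib_coord E s p (D s c p v) | _ \<Rightarrow> 0)"
  by (auto simp: connection_form_def fib_coord_def split: list.split)

lemma odd_connection_form: "odd_fun (connection_form E D s c p)"
  by (auto simp: odd_fun_def connection_form_def split: list.split)

lemma smooth_connection_form:
  assumes s: "local_frame A E U s"
  shows "smooth_form A U (connection_form E D s)"
proof (rule smooth_formI[OF form_onI])
  note sec = local_frameD(1)[OF s] and U = local_frameD(2)[OF s]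
  fix c p assume p: "c \<in> A" "p \<in> U" "p \<in> dom_c c"
  note fib = D_in_fibre[OF sec p]
  have "linear (\<lambda>v. fib_coord E s p (D s c p v))"
  proof (rule linearI)
    show "fib_coord E s p (D s c p (v + w)) = fib_coord E s p (D s c p v) + fib_coord E s p (D s c p w)" for v w
      unfolding connectionD(2)[OF sec p] by (rule fib_coord_linear(2)[OF s p(2) fib fib])
    show "fib_coord E s p (D s c p (r *\<^sub>R v)) = r *\<^sub>R fib_coord E s p (D s c p v)" for r v
      unfolding connectionD(3)[OF sec p] by (simp add: fib_coord_linear(1)[OF s p(2) fib] scaleR_conv_of_real)
  qed
  from alternating_one_form[OF this] show "alternating (connection_form E D s c p)"
    by (simp add: connection_form_coord[abs_def])
next
  note sec = local_frameD(1)[OF s]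
  fix c c' p and vs :: "(real, 'n) vec list" assume p: "c \<in> A" "c' \<in> A" "p \<in> U" "p \<in> dom_c c" "p \<in> dom_c c'"
  show "connection_form E D s c p vs = connection_form E D s c' p (map (trans_deriv c c' p) vs)"
    using connectionD(4)[OF sec p(1,2,3,4,5)] by (simp add: connection_form_coord split: list.split)
next
  note sec = local_frameD(1)[OF s] and U = local_frameD(2)[OF s]
  fix c assume c: "c \<in> A"
  have W: "open (U \<inter> dom_c c)" using U chart_open[OF c] by blast
  have "smooth_on (map_c c ` (U \<inter> dom_c c)) (\<lambda>x. fib_coord E s (inv_c c x) (D s c (inv_c c x) v))" for v
    using smooth_funD[OF smooth_fib_coord[OF local_frame_subset[OF s W Int_lower1] connectionD(1)[OF sec c]] c, of v]
    by (simp add: Int_assoc)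
  then have "smooth_on (map_c c ` (U \<inter> dom_c c)) (\<lambda>x. loc c (connection_form E D s) x vs)" for vs
    by (cases vs rule: list.exhaust[case_product list.exhaust[of "tl vs"]])
       (auto simp: loc_def connection_form_coord split: list.split)
  then show "fsmooth (map_c c ` (U \<inter> dom_c c)) (loc c (connection_form E D s))" by (simp add: fsmooth_def)
qed

text \<open>Leibniz' rule of the connection for \<open>s'\<close>, written as a coefficient function
  times the frame \<open>s\<close>.\<close>

lemma fib_coord_D:
  assumes s: "local_frame A E U s" and s': "smooth_section A E U s'" and p: "c \<in> A" "p \<in> U" "p \<in> dom_c c"
  shows "fib_coord E s p (D s' c p v) = dir_deriv (\<lambda>q. fib_coord E s q (s' q)) c p v
    + fib_coord E s p (s' p) * connection_form E D s c p [v]"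
proof -
  let ?g = "\<lambda>q. fib_coord E s q (s' q)"
  note sec = local_frameD(1)[OF s]
  have g: "smooth_fun A U ?g" by (rule smooth_fib_coord[OF s s'])
  note fD = D_in_fibre[OF sec p] and fs = local_frameD(3)[OF s p(2)]
  have eq: "s' q = fib_scale E (?g q) (s q)" if "q \<in> U" for q
    by (rule fib_coord(1)[OF s that smooth_sectionD(2)[OF s' that]])
  have "D s' c p v = D (\<lambda>q. fib_scale E (?g q) (s q)) c p v"
    by (rule connectionD(5)[OF s' p(1) smooth_section_scale[OF sec g] p(2,3) eq])
  also have "\<dots> = fib_add E (fib_scale E (dir_deriv ?g c p v) (s p)) (fib_scale E (?g p) (D s c p v))"
    by (rule connectionD(6)[OF sec p(1) g p(2,3)])
  finally show ?thesis
    using fib_coord_linear(2)[OF s p(2) fib_closed(1)[OF fs] fib_closed(1)[OF fD]]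
      fib_coord_scale_frame[OF s p(2)] fib_coord_linear(1)[OF s p(2) fD]
    by (simp add: connection_form_coord)
qed

lemma frame_coord_nonzero:
  assumes "local_frame A E U s" "local_frame A E U s'" "p \<in> U"
  shows "fib_coord E s p (s' p) \<noteq> 0"
proof -
  obtain V t where V: "(V, t) \<in> trivs E" "p \<in> V" by (rule triv_cover)
  show ?thesis
    using fib_coord(2)[OF assms(1,3) local_frameD(3)[OF assms(2,3)] V]
      frame_triv_nonzero[OF assms(1,3) V] frame_triv_nonzero[OF assms(2,3) V] by simp
qed

text \<open>The gauge transformation of a connection form. The fibres have dimension one, so nothing
  is conjugated and only the logarithmic differential of the transition function is added.\<close>

lemma connection_form_change:
  assumes s: "local_frame A E U s" and s': "local_frame A E U s'" and p: "c \<in> A" "p \<in> U" "p \<in> dom_c c"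
  shows "connection_form E D s' c p vs
    = form_add (connection_form E D s) (dlog (\<lambda>q. fib_coord E s q (s' q))) c p vs"
proof -
  let ?g = "\<lambda>q. fib_coord E s q (s' q)"
  have nz: "?g p \<noteq> 0" by (rule frame_coord_nonzero[OF s s' p(2)])
  have "connection_form E D s' c p [v] = dir_deriv ?g c p v / ?g p + connection_form E D s c p [v]" for v
  proof -
    note fD = D_in_fibre[OF local_frameD(1)[OF s'] p]
    have "D s' c p v = fib_scale E (connection_form E D s' c p [v]) (s' p)"
      using fib_coord(1)[OF s' p(2) fD] by (simp add: connection_form_coord)
    then have "fib_coord E s p (D s' c p v) = connection_form E D s' c p [v] * ?g p"
      by (metis fib_coord_linear(1)[OF s p(2) local_frameD(3)[OF s' p(2)]])
    then show ?thesis
      using fib_coord_D[OF s local_frameD(1)[OF s'] p, of v] nz by (simp add: field_simps)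
  qed
  then show ?thesis
    by (auto simp: form_add_apply dlog_def connection_form_def split: list.split)
qed

text \<open>A change of frame adds a logarithmic differential, which is closed; hence the definite
  description in \<open>curvature\<close> has exactly one value.\<close>

lemma curvature_eq:
  assumes s: "local_frame A E U s" and p: "c \<in> A" "p \<in> U" "p \<in> dom_c c"
  shows "curvature A E D c p vs = ext_deriv A (connection_form E D s) c p vs"
  unfolding curvature_def
proof (rule the_equality)
  show "\<exists>V t. p \<in> V \<and> local_frame A E V t \<and>
     ext_deriv A (connection_form E D s) c p vs = ext_deriv A (connection_form E D t) c p vs"
    using s p by blast
  fix z assume "\<exists>U s. p \<in> U \<and> local_frame A E U s \<and> z = ext_deriv A (connection_form E D s) c p vs"
  then obtain U' s' where s'0: "p \<in> U'" "local_frame A E U' s'" and z: "z = ext_deriv A (connection_form E D s') c p vs"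
    by blast
  let ?W = "U \<inter> U'"
  have W: "open ?W" using local_frameD(2)[OF s] local_frameD(2)[OF s'0(2)] by blast
  have fs: "local_frame A E ?W s" "local_frame A E ?W s'"
    using local_frame_subset[OF s W] local_frame_subset[OF s'0(2) W] by auto
  have pW: "p \<in> ?W" using p s'0 by blast
  let ?g = "\<lambda>q. fib_coord E s q (s' q)"
  have g: "smooth_fun A ?W ?g" by (rule smooth_fib_coord[OF fs(1) local_frameD(1)[OF fs(2)]])
  have nz: "?g q \<noteq> 0" if "q \<in> ?W" for q by (rule frame_coord_nonzero[OF fs that])
  have "z = ext_deriv A (form_add (connection_form E D s) (dlog ?g)) c p vs"
    unfolding z by (rule ext_deriv_cong[OF W p(1) pW p(3)]) (rule connection_form_change[OF fs p(1)])
  also have "\<dots> = ext_deriv A (connection_form E D s) c p vs + ext_deriv A (dlog ?g) c p vs"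
    by (rule ext_deriv_add[OF W smooth_connection_form[OF fs(1)] smooth_dlog[OF W g nz] p(1) pW p(3)])
  also have "\<dots> = ext_deriv A (connection_form E D s) c p vs"
    using ext_deriv_dlog[OF W g nz p(1) pW p(3)] by simp
  finally show "z = ext_deriv A (connection_form E D s) c p vs" .
qed

lemma smooth_curvature: "smooth_form A UNIV (curvature A E D)"
proof (rule smooth_form_local)
  fix p
  obtain U s where s: "p \<in> U" "local_frame A E U s" by (rule frame_exists)
  note U = local_frameD(2)[OF s(2)]
  have "smooth_form A U (curvature A E D)"
    by (rule smooth_form_cong[OF U smooth_form_ext_deriv[OF U smooth_connection_form[OF s(2)]]])
       (rule curvature_eq[OF s(2)])
  then show "\<exists>U. open U \<and> p \<in> U \<and> smooth_form A U (curvature A E D)" using U s(1) by blast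
qed

text \<open>The Bianchi identity: locally the curvature is exact.\<close>

lemma curvature_closed:
  assumes p: "c \<in> A" "p \<in> dom_c c"
  shows "ext_deriv A (curvature A E D) c p vs = 0"
proof -
  obtain U s where s: "p \<in> U" "local_frame A E U s" by (rule frame_exists)
  note U = local_frameD(2)[OF s(2)]
  have "ext_deriv A (curvature A E D) c p vs = ext_deriv A (ext_deriv A (connection_form E D s)) c p vs"
    by (rule ext_deriv_cong[OF U p(1) s(1) p(2)]) (rule curvature_eq[OF s(2) p(1)])
  then show ?thesis using ext_deriv_ext_deriv[OF U smooth_connection_form[OF s(2)] p(1) s(1) p(2)] by simp
qed

text \<open>At a list of odd length the exterior derivative looks at lists of even length, where a
  connection form vanishes.\<close>

lemma even_curvature:
  assumes p: "c \<in> A" "p \<in> dom_c c"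
  shows "even_fun (curvature A E D c p)"
  unfolding even_fun_def
proof (intro allI impI)
  fix vs :: "(real, 'n) vec list" assume odd: "odd (length vs)"
  obtain U s where s: "p \<in> U" "local_frame A E U s" by (rule frame_exists)
  have "ld (loc c (connection_form E D s)) (map_c c p) vs = 0"
  proof (rule ld_zero[OF open_UNIV UNIV_I])
    fix y and us :: "(real, 'n) vec list" assume "length us = length vs - 1"
    then have "even (length us)" using odd by simp
    then show "loc c (connection_form E D s) y us = 0"
      using odd_connection_form by (simp add: loc_def odd_fun_def)
  qed
  then show "curvature A E D c p vs = 0"
    using curvature_eq[OF s(2) p(1) s(1) p(2)] p by (simp add: ext_deriv_ld)
qed

end

section \<open>The form \<open>\<sigma>\<close> and the divisor\<close>

context oriented_manifold
begin

lemma dir_deriv_cong: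
  assumes "open W" "c \<in> A" "p \<in> W" "p \<in> dom_c c" "\<And>q. q \<in> W \<Longrightarrow> f q = g q"
  shows "dir_deriv f c p v = dir_deriv g c p v"
proof -
  have "frechet_derivative (f \<circ> inv_c c) (at (map_c c p)) = frechet_derivative (g \<circ> inv_c c) (at (map_c c p))"
    by (rule frechet_derivative_cong_open[OF open_chart_image[OF assms(2,1)]]) (use assms in auto)
  then show ?thesis by (simp add: dir_deriv_def)
qed

lemma dir_deriv_mult:
  assumes "smooth_fun A W f" "smooth_fun A W g" "c \<in> A" "p \<in> W" "p \<in> dom_c c"
  shows "dir_deriv (\<lambda>q. f q * g q) c p v = f p * dir_deriv g c p v + dir_deriv f c p v * g p"
proof -
  have x: "map_c c p \<in> map_c c ` (W \<inter> dom_c c)" using assms by blast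
  show ?thesis
    using pdir_mult[OF smooth_on_differentiable[OF smooth_funD[OF assms(1,3)] x]
        smooth_on_differentiable[OF smooth_funD[OF assms(2,3)] x], of v] assms(3,5)
    by (simp add: dir_deriv_def o_def)
qed

section \<open>Localisation of integrability and of currents\<close>

lemma L1loc_form_local:
  assumes \<omega>: "form_on A UNIV \<omega>"
    and loc: "\<And>p. \<exists>U. open U \<and> p \<in> U \<and> L1loc_form A U \<omega>"
  shows "L1loc_form A UNIV \<omega>"
proof (rule L1loc_formI[OF \<omega>])
  fix c K vs assume c: "c \<in> A" and K: "compact K" "K \<subseteq> map_c c ` (UNIV \<inter> dom_c c)"
  have "\<exists>r>0. (\<lambda>y. loc c \<omega> y vs) absolutely_integrable_on (K \<inter> cball x r)" if x: "x \<in> K" for x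
  proof -
    from x K(2) obtain p where p: "p \<in> dom_c c" "x = map_c c p" by blast
    obtain U where U: "open U" "p \<in> U" "L1loc_form A U \<omega>" using loc by blast
    have "x \<in> map_c c ` (U \<inter> dom_c c)" using p U by blast
    then obtain r where r: "r > 0" "cball x r \<subseteq> map_c c ` (U \<inter> dom_c c)"
      using open_chart_image[OF c U(1)] open_contains_cball by blast
    have "(\<lambda>y. loc c \<omega> y vs) absolutely_integrable_on (K \<inter> cball x r)"
      by (rule L1loc_formD(2)[OF U(3) c]) (use r K in \<open>auto intro: compact_Int\<close>)
    then show ?thesis using r(1) by blast
  qed
  then obtain r where r: "\<And>x. x \<in> K \<Longrightarrow> r x > 0"
    "\<And>x. x \<in> K \<Longrightarrow> (\<lambda>y. loc c \<omega> y vs) absolutely_integrable_on (K \<inter> cball x (r x))" by metis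
  obtain F where F: "F \<subseteq> K" "finite F" "K \<subseteq> (\<Union>x\<in>F. ball x (r x))"
  proof (rule compactE_image[OF K(1), of K "\<lambda>x. ball x (r x)"])
    show "K \<subseteq> (\<Union>x\<in>K. ball x (r x))" using r(1) by force
  qed (use that in auto)
  have "(\<lambda>y. loc c \<omega> y vs) absolutely_integrable_on (\<Union>x\<in>F. K \<inter> cball x (r x))"
    using F(2,1)
  proof (induction F rule: finite_induct)
    case (insert x F)
    then show ?case using absolutely_integrable_Un[OF r(2)[of x]] by simp
  qed simp
  moreover have "(\<Union>x\<in>F. K \<inter> cball x (r x)) = K" using F(3) ball_subset_cball by blast
  ultimately show "(\<lambda>y. loc c \<omega> y vs) absolutely_integrable_on K" by simp
qed

lemma current_sum:
  assumes S: "current A S" and I: "finite I" "\<And>i. i \<in> I \<Longrightarrow> test_form A (\<psi> i)"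
  shows "test_form A (\<lambda>c p vs. \<Sum>i\<in>I. \<psi> i c p vs) \<and> S (\<lambda>c p vs. \<Sum>i\<in>I. \<psi> i c p vs) = (\<Sum>i\<in>I. S (\<psi> i))"
  using I
proof (induction I rule: finite_induct)
  case empty
  have "form_support A (\<lambda>c p vs. 0) = {}" by (simp add: form_support_def)
  moreover have "smooth_form A UNIV (\<lambda>c p vs. 0)"
    by (rule smooth_formI[OF form_onI]) (auto simp: alternating_0 loc_def[abs_def] fsmooth_const)
  ultimately have t: "test_form A (\<lambda>c p vs. 0)" by (intro test_formI[of _ "{}"]) auto
  have "S (form_scale 0 (\<lambda>c p vs. 0)) = 0 * S (\<lambda>c p vs. 0)" using S t unfolding current_def by blast
  then show ?case using t by (simp add: form_scale_def)
next
  case (insert i I)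
  have t: "test_form A (\<psi> i)" "test_form A (\<lambda>c p vs. \<Sum>i\<in>I. \<psi> i c p vs)" using insert by auto
  have eq: "(\<lambda>c p vs. \<Sum>i\<in>insert i I. \<psi> i c p vs) = form_add (\<psi> i) (\<lambda>c p vs. \<Sum>i\<in>I. \<psi> i c p vs)"
    using insert(1,2) by (simp add: form_add_def)
  have "S (form_add (\<psi> i) (\<lambda>c p vs. \<Sum>i\<in>I. \<psi> i c p vs)) = S (\<psi> i) + S (\<lambda>c p vs. \<Sum>i\<in>I. \<psi> i c p vs)"
    using S t unfolding current_def by blast
  then show ?case unfolding eq using test_form_add[OF t] insert by simp
qed

text \<open>A partition of unity over the compact support writes a test form as a finite sum of test
  forms, each supported in one covering set. It serves the uniqueness of the divisor.\<close>

lemma current_local_eq: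
  assumes S: "current A S" "current A S'"
    and cov: "\<And>p. \<exists>W. open W \<and> p \<in> W \<and> P W"
    and eq: "\<And>W \<psi>. P W \<Longrightarrow> test_form A \<psi> \<Longrightarrow> form_support A \<psi> \<subseteq> W \<Longrightarrow> S \<psi> = S' \<psi>"
  shows "S = S'"
proof
  fix \<psi> show "S \<psi> = S' \<psi>"
  proof (cases "test_form A \<psi>")
    case False
    then show ?thesis using S unfolding current_def by simp
  next
    case t: True
    let ?K = "form_support A \<psi>"
    obtain n :: nat and \<rho> :: "nat \<Rightarrow> 'a \<Rightarrow> real" and d and W :: "nat \<Rightarrow> 'a set" where
      \<rho>: "\<And>i. i < n \<Longrightarrow> d i \<in> A" "\<And>i. i < n \<Longrightarrow> P (W i)" "\<And>i. i < n \<Longrightarrow> open (W i)"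
      "\<And>i. i < n \<Longrightarrow> smooth_fun A UNIV (\<rho> i)" "\<And>i q. i < n \<Longrightarrow> 0 \<le> \<rho> i q"
      "\<And>i. i < n \<Longrightarrow> compact (closure {q. \<rho> i q \<noteq> 0})"
      "\<And>i. i < n \<Longrightarrow> closure {q. \<rho> i q \<noteq> 0} \<subseteq> W i \<inter> dom_c (d i)"
      "\<And>p. p \<in> ?K \<Longrightarrow> (\<Sum>i<n. \<rho> i p) = 1"
      by (rule partition_of_unity[OF test_formD(2)[OF t], of P], rule cov, rule that)
    define \<eta> where "\<eta> i = (\<lambda>c p vs. of_real (\<rho> i p) * \<psi> c p vs)" for i
    have t\<eta>: "test_form A (\<eta> i)" if "i < n" for i
      unfolding \<eta>_def by (intro test_form_scale_fun smooth_fun_of_real open_UNIV \<rho>(4) that t)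
    have supp: "form_support A (\<eta> i) \<subseteq> W i" if i: "i < n" for i
    proof -
      have "form_support A (\<eta> i) \<subseteq> closure {q. \<rho> i q \<noteq> 0}"
      proof (rule form_support_subset[OF closed_closure])
        fix c p vs assume "p \<notin> closure {q. \<rho> i q \<noteq> 0}"
        then show "\<eta> i c p vs = 0" using cutoff_zero[of p "\<rho> i"] by (simp add: \<eta>_def)
      qed
      then show ?thesis using \<rho>(7)[OF i] by blast
    qed
    have sum: "\<psi> = (\<lambda>c p vs. \<Sum>i\<in>{..<n}. \<eta> i c p vs)"
    proof (intro ext)
      fix c p vs
      have e: "(\<Sum>i<n. \<eta> i c p vs) = of_real (\<Sum>i<n. \<rho> i p) * \<psi> c p vs"
        by (simp add: \<eta>_def sum_distrib_right)
      show "\<psi> c p vs = (\<Sum>i<n. \<eta> i c p vs)"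
      proof (cases "p \<in> ?K")
        case True
        then show ?thesis unfolding e by (simp add: \<rho>(8))
      next
        case False
        have "\<psi> c p vs = 0"
        proof (cases "c \<in> A \<and> p \<in> dom_c c")
          case True
          then show ?thesis using form_support_zero False by blast
        next
          case False
          then show ?thesis by (rule test_formD(3)[OF t])
        qed
        then show ?thesis unfolding e by simp
      qed
    qed
    have "S (\<lambda>c p vs. \<Sum>i\<in>{..<n}. \<eta> i c p vs) = (\<Sum>i<n. S (\<eta> i))"
      using current_sum[OF S(1) _ t\<eta>, of "{..<n}"] by simp
    moreover have "S' (\<lambda>c p vs. \<Sum>i\<in>{..<n}. \<eta> i c p vs) = (\<Sum>i<n. S' (\<eta> i))"
      using current_sum[OF S(2) _ t\<eta>, of "{..<n}"] by simp
    moreover have "(\<Sum>i<n. S (\<eta> i)) = (\<Sum>i<n. S' (\<eta> i))"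
      by (rule sum.cong[OF refl]) (use eq[OF \<rho>(2) t\<eta> supp] in auto)
    ultimately show ?thesis using sum by metis
  qed
qed

end

section \<open>The equation for \<open>\<sigma>\<close> in local frames\<close>

locale atomic_bundle_map = oriented_manifold A +
  E: manifold_connection A E D\<^sub>E + F: manifold_connection A F D\<^sub>F
  for A :: "('a::{t2_space, second_countable_topology}, 'n::{finite, linorder}) chart set"
    and E :: "('a, 'e) line_bundle_data" and F :: "('a, 'f) line_bundle_data"
    and D\<^sub>E :: "('a, 'n, 'e) covariant_deriv" and D\<^sub>F :: "('a, 'n, 'f) covariant_deriv" +
  fixes \<alpha> :: "'e \<Rightarrow> 'f"
  assumes bundle_map: "bundle_map A E F \<alpha>" and atomic: "atomic A E F \<alpha>"
begin

lemma bundle_mapD: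
  assumes "v \<in> fibre E p"
  shows "\<alpha> v \<in> fibre F p" "\<alpha> (fib_scale E z v) = fib_scale F z (\<alpha> v)"
  using bundle_map assms unfolding bundle_map_def by blast+

lemma bundle_map_section: "smooth_section A E U s \<Longrightarrow> smooth_section A F U (\<lambda>p. \<alpha> (s p))"
  using bundle_map unfolding bundle_map_def o_def by blast

lemma atomicD:
  assumes "local_rep A E F \<alpha> U a"
  shows "c \<in> A \<Longrightarrow> negligible (map_c c ` {p \<in> U \<inter> dom_c c. a p = 0})" "L1loc_form A U (dlog a)"
  using atomic assms unfolding atomic_def by blast+

lemma local_repE:
  assumes "local_rep A E F \<alpha> U a"
  obtains s t where "local_frame A E U s" "local_frame A F U t" "\<And>p. p \<in> U \<Longrightarrow> \<alpha> (s p) = fib_scale F (a p) (t p)"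
  using assms unfolding local_rep_def by blast

lemma local_rep_exists: obtains U a where "open U" "p \<in> U" "local_rep A E F \<alpha> U a"
proof -
  obtain U1 s where s: "p \<in> U1" "local_frame A E U1 s" by (rule E.frame_exists)
  obtain U2 t where t: "p \<in> U2" "local_frame A F U2 t" by (rule F.frame_exists)
  let ?U = "U1 \<inter> U2"
  have o: "open ?U" using E.local_frameD(2)[OF s(2)] F.local_frameD(2)[OF t(2)] by blast
  have s': "local_frame A E ?U s" by (rule E.local_frame_subset[OF s(2) o]) blast
  have t': "local_frame A F ?U t" by (rule F.local_frame_subset[OF t(2) o]) blast
  have "\<alpha> (s q) = fib_scale F (fib_coord F t q (\<alpha> (s q))) (t q)" if "q \<in> ?U" for q
    by (rule F.fib_coord(1)[OF t' that bundle_mapD(1)[OF E.local_frameD(3)[OF s' that]]])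
  then have "local_rep A E F \<alpha> ?U (\<lambda>q. fib_coord F t q (\<alpha> (s q)))"
    unfolding local_rep_def using s' t' by blast
  then show ?thesis using that o s(1) t(1) by blast
qed

context
  fixes U s t a
  assumes s: "local_frame A E U s" and t: "local_frame A F U t"
    and a: "\<And>p. p \<in> U \<Longrightarrow> \<alpha> (s p) = fib_scale F (a p) (t p)"
begin

lemma coord_bundle_map:
  assumes p: "p \<in> U" and v: "v \<in> fibre E p"
  shows "fib_coord F t p (\<alpha> v) = fib_coord E s p v * a p"
proof -
  note sp = E.local_frameD(3)[OF s p] and tp = F.local_frameD(3)[OF t p]
  have "\<alpha> v = fib_scale F (fib_coord E s p v) (\<alpha> (s p))"
    using E.fib_coord(1)[OF s p v] bundle_mapD(2)[OF sp] by metis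
  then have "fib_coord F t p (\<alpha> v) = fib_coord E s p v * fib_coord F t p (\<alpha> (s p))"
    using F.fib_coord_linear(1)[OF t p bundle_mapD(1)[OF sp]] by simp
  then show ?thesis using F.fib_coord_scale_frame[OF t p] by (simp add: a[OF p])
qed

lemma smooth_rep: "smooth_fun A U a"
proof (rule smooth_fun_cong[OF _ F.smooth_fib_coord[OF t bundle_map_section[OF E.local_frameD(1)[OF s]]]])
  show "a p = fib_coord F t p (\<alpha> (s p))" if "p \<in> U" for p
    using F.fib_coord_scale_frame[OF t that] by (simp add: a[OF that])
qed (rule E.local_frameD(2)[OF s])

lemma vanishes_at_rep:
  assumes p: "p \<in> U"
  shows "vanishes_at E F \<alpha> p \<longleftrightarrow> a p = 0"
proof
  note sp = E.local_frameD(3)[OF s p]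
  show "a p = 0" if "vanishes_at E F \<alpha> p"
  proof -
    have "\<alpha> (s p) = fib_scale F 0 (\<alpha> (s p))" using that sp unfolding vanishes_at_def by blast
    then have "fib_coord F t p (\<alpha> (s p)) = 0 * fib_coord F t p (\<alpha> (s p))"
      using F.fib_coord_linear(1)[OF t p bundle_mapD(1)[OF sp]] by metis
    then show ?thesis using F.fib_coord_scale_frame[OF t p] by (simp add: a[OF p])
  qed
  show "vanishes_at E F \<alpha> p" if "a p = 0"
    unfolding vanishes_at_def
  proof
    fix v assume v: "v \<in> fibre E p"
    note fv = bundle_mapD(1)[OF v]
    show "\<alpha> v = fib_scale F 0 (\<alpha> v)"
      by (rule F.fib_coord_eqI[OF t p fv F.fib_closed(1)[OF fv]])
         (simp add: F.fib_coord_linear(1)[OF t p fv] coord_bundle_map[OF p v] that)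
  qed
qed

text \<open>The derivative of the coordinate of \<open>s'\<close> occurs once in
  \<open>D\<^sub>F\<close> of the image and once in the image of \<open>D\<^sub>E\<close>, and
  cancels. So the result depends on \<open>s'\<close> only through its value at \<open>p\<close>, as
  is right for a derivative on the homomorphism bundle.\<close>

lemma coord_hom_deriv:
  assumes p: "c \<in> A" "p \<in> U" "p \<in> dom_c c" and s': "smooth_section A E U' s'" "p \<in> U'"
  shows "hom_deriv F D\<^sub>E D\<^sub>F \<alpha> s' c p v \<in> fibre F p"
    and "fib_coord F t p (hom_deriv F D\<^sub>E D\<^sub>F \<alpha> s' c p v) = fib_coord E s p (s' p) *
      (dir_deriv a c p v + a p * connection_form F D\<^sub>F t c p [v] - a p * connection_form E D\<^sub>E s c p [v])"
proof -
  let ?W = "U \<inter> U'"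
  have W: "open ?W" using E.local_frameD(2)[OF s] E.smooth_sectionD(1)[OF s'(1)] by blast
  have pW: "p \<in> ?W" using p s' by blast
  have fs: "local_frame A E ?W s" by (rule E.local_frame_subset[OF s W]) blast
  have ft: "local_frame A F ?W t" by (rule F.local_frame_subset[OF t W]) blast
  have sec: "smooth_section A E ?W s'" by (rule E.smooth_section_subset[OF s'(1) W]) blast
  note sec' = bundle_map_section[OF sec]
  let ?g = "\<lambda>q. fib_coord E s q (s' q)"
  have g: "smooth_fun A ?W ?g" by (rule E.smooth_fib_coord[OF fs sec])
  have sa: "smooth_fun A ?W a" by (rule smooth_fun_subset[OF smooth_rep]) blast
  have ga: "fib_coord F t q (\<alpha> (s' q)) = ?g q * a q" if "q \<in> ?W" for q
    by (rule coord_bundle_map[OF _ E.smooth_sectionD(2)[OF sec that]]) (use that in blast)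
  have fE: "D\<^sub>E s' c p v \<in> fibre E p" by (rule E.D_in_fibre[OF sec p(1) pW p(3)])
  have fF: "D\<^sub>F (\<lambda>q. \<alpha> (s' q)) c p v \<in> fibre F p" by (rule F.D_in_fibre[OF sec' p(1) pW p(3)])
  note f\<alpha> = bundle_mapD(1)[OF fE]
  note f\<alpha>' = F.fib_closed(1)[OF f\<alpha>, of "-1"]
  show "hom_deriv F D\<^sub>E D\<^sub>F \<alpha> s' c p v \<in> fibre F p"
    unfolding hom_deriv_def o_def by (rule F.fib_closed(2)[OF fF f\<alpha>'])
  have "fib_coord F t p (D\<^sub>F (\<lambda>q. \<alpha> (s' q)) c p v) = dir_deriv (\<lambda>q. fib_coord F t q (\<alpha> (s' q))) c p v
     + fib_coord F t p (\<alpha> (s' p)) * connection_form F D\<^sub>F t c p [v]"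
    by (rule F.fib_coord_D[OF ft sec' p(1) pW p(3)])
  also have "dir_deriv (\<lambda>q. fib_coord F t q (\<alpha> (s' q))) c p v = dir_deriv (\<lambda>q. ?g q * a q) c p v"
    by (rule dir_deriv_cong[OF W p(1) pW p(3) ga])
  also have "\<dots> = ?g p * dir_deriv a c p v + dir_deriv ?g c p v * a p"
    by (rule dir_deriv_mult[OF g sa p(1) pW p(3)])
  finally have 1: "fib_coord F t p (D\<^sub>F (\<lambda>q. \<alpha> (s' q)) c p v) = ?g p * dir_deriv a c p v + dir_deriv ?g c p v * a p
     + ?g p * a p * connection_form F D\<^sub>F t c p [v]"
    by (simp add: ga[OF pW])
  have 2: "fib_coord F t p (\<alpha> (D\<^sub>E s' c p v)) = (dir_deriv ?g c p v + ?g p * connection_form E D\<^sub>E s c p [v]) * a p"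
    unfolding coord_bundle_map[OF p(2) fE] E.fib_coord_D[OF fs sec p(1) pW p(3)] ..
  show "fib_coord F t p (hom_deriv F D\<^sub>E D\<^sub>F \<alpha> s' c p v) = ?g p *
      (dir_deriv a c p v + a p * connection_form F D\<^sub>F t c p [v] - a p * connection_form E D\<^sub>E s c p [v])"
    unfolding hom_deriv_def o_def F.fib_coord_linear(2)[OF t p(2) fF f\<alpha>'] F.fib_coord_linear(1)[OF t p(2) f\<alpha>] 1 2
    by (simp add: algebra_simps)
qed

text \<open>By \<open>coord_hom_deriv\<close>, both sides are proportional to the coordinate of
  \<open>s'\<close> at \<open>p\<close>. The frame \<open>s\<close> alone therefore determines
  \<open>z\<close>, and the equation for every other section follows. Solving for \<open>z\<close>
  divides by \<open>a p\<close>.\<close>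

lemma sigma_condition:
  assumes p: "c \<in> A" "p \<in> U" "p \<in> dom_c c" and nz: "a p \<noteq> 0"
  shows "(\<forall>U' s'. p \<in> U' \<and> smooth_section A E U' s' \<longrightarrow> hom_deriv F D\<^sub>E D\<^sub>F \<alpha> s' c p v = fib_scale F z (\<alpha> (s' p)))
    \<longleftrightarrow> z = dlog a c p [v] + (connection_form F D\<^sub>F t c p [v] - connection_form E D\<^sub>E s c p [v])"
    (is "?L \<longleftrightarrow> z = ?Z")
proof
  have Z: "dir_deriv a c p v + a p * connection_form F D\<^sub>F t c p [v] - a p * connection_form E D\<^sub>E s c p [v] = a p * ?Z"
    using nz by (simp add: dlog_def field_simps)
  show "z = ?Z" if L: ?L
  proof -
    note sp = E.local_frameD(3)[OF s p(2)]
    have "hom_deriv F D\<^sub>E D\<^sub>F \<alpha> s c p v = fib_scale F z (\<alpha> (s p))"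
      using L p(2) E.local_frameD(1)[OF s] by blast
    then have "fib_coord F t p (fib_scale F z (\<alpha> (s p))) = fib_coord E s p (s p) * (a p * ?Z)"
      using coord_hom_deriv(2)[OF p E.local_frameD(1)[OF s] p(2), of v] Z by simp
    moreover have "fib_coord E s p (s p) \<noteq> 0" by (rule E.frame_coord_nonzero[OF s s p(2)])
    ultimately show ?thesis
      using nz by (simp add: F.fib_coord_linear(1)[OF t p(2) bundle_mapD(1)[OF sp]] coord_bundle_map[OF p(2) sp])
  qed
  show ?L if z: "z = ?Z"
  proof (intro allI impI)
    fix U' s' assume "p \<in> U' \<and> smooth_section A E U' s'"
    then have s': "smooth_section A E U' s'" "p \<in> U'" by auto
    note sp = E.smooth_sectionD(2)[OF s']
    note fa = bundle_mapD(1)[OF sp]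
    show "hom_deriv F D\<^sub>E D\<^sub>F \<alpha> s' c p v = fib_scale F z (\<alpha> (s' p))"
      by (rule F.fib_coord_eqI[OF t p(2) coord_hom_deriv(1)[OF p s'] F.fib_closed(1)[OF fa]])
         (simp add: coord_hom_deriv(2)[OF p s'] Z F.fib_coord_linear(1)[OF t p(2) fa] coord_bundle_map[OF p(2) sp] z)
  qed
qed

lemma sigma_local:
  assumes \<sigma>: "form_degree A 1 \<sigma>" "satisfies_sigma_eq A E F D\<^sub>E D\<^sub>F \<alpha> \<sigma>"
    and p: "c \<in> A" "p \<in> U" "p \<in> dom_c c" and nz: "a p \<noteq> 0"
  shows "\<sigma> c p vs = dlog a c p vs + (connection_form F D\<^sub>F t c p vs - connection_form E D\<^sub>E s c p vs)"
proof (cases "length vs = 1")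
  case True
  then obtain v where v: "vs = [v]" by (cases vs) auto
  have nv: "\<not> vanishes_at E F \<alpha> p" using vanishes_at_rep[OF p(2)] nz by simp
  have "\<forall>U' s'. p \<in> U' \<and> smooth_section A E U' s' \<longrightarrow> hom_deriv F D\<^sub>E D\<^sub>F \<alpha> s' c p v = fib_scale F (\<sigma> c p [v]) (\<alpha> (s' p))"
    using \<sigma>(2) p nv unfolding satisfies_sigma_eq_def by blast
  then show ?thesis using sigma_condition[OF p nz] v by simp
next
  case False
  then have "\<sigma> c p vs = 0" using \<sigma>(1) p unfolding form_degree_def by blast
  moreover have "dlog a c p vs = 0" "connection_form F D\<^sub>F t c p vs = 0" "connection_form E D\<^sub>E s c p vs = 0"
    using False by (auto simp: dlog_def connection_form_def split: list.split)
  ultimately show ?thesis by simp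
qed

end

abbreviation is_sigma :: "('a, 'n) form \<Rightarrow> bool" where
  "is_sigma \<sigma> \<equiv> form_on A UNIV \<sigma> \<and> form_degree A 1 \<sigma> \<and> satisfies_sigma_eq A E F D\<^sub>E D\<^sub>F \<alpha> \<sigma>"

text \<open>At the zeros of \<open>\<alpha>\<close> the equation leaves the value open. The choice 0
  is alternating and compatible with changes of chart, so that a form on the whole manifold
  results.\<close>

definition sigma0 :: "('a, 'n) form" where
  "sigma0 c p vs = (case vs of [v] \<Rightarrow> if vanishes_at E F \<alpha> p then 0 else
     (THE z. \<forall>U s. p \<in> U \<and> smooth_section A E U s \<longrightarrow> hom_deriv F D\<^sub>E D\<^sub>F \<alpha> s c p v = fib_scale F z (\<alpha> (s p)))
   | _ \<Rightarrow> 0)"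

lemma sigma0_local:
  assumes s: "local_frame A E U s" and t: "local_frame A F U t"
    and a: "\<And>p. p \<in> U \<Longrightarrow> \<alpha> (s p) = fib_scale F (a p) (t p)"
    and p: "c \<in> A" "p \<in> U" "p \<in> dom_c c"
  shows "sigma0 c p vs = (if a p = 0 then 0
    else dlog a c p vs + (connection_form F D\<^sub>F t c p vs - connection_form E D\<^sub>E s c p vs))"
proof (cases "length vs = 1")
  case True
  then obtain v where v: "vs = [v]" by (cases vs) auto
  show ?thesis
  proof (cases "a p = 0")
    case nz: False
    have "(THE z. \<forall>U s. p \<in> U \<and> smooth_section A E U s \<longrightarrow> hom_deriv F D\<^sub>E D\<^sub>F \<alpha> s c p v = fib_scale F z (\<alpha> (s p)))
       = dlog a c p [v] + (connection_form F D\<^sub>F t c p [v] - connection_form E D\<^sub>E s c p [v])"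
      using sigma_condition[OF s t a p nz] by (intro the_equality) blast+
    then show ?thesis using vanishes_at_rep[OF s t a p(2)] nz by (simp add: sigma0_def v)
  qed (simp add: sigma0_def v vanishes_at_rep[OF s t a p(2)])
next
  case False
  then have "sigma0 c p vs = 0" by (auto simp: sigma0_def split: list.split)
  moreover have "dlog a c p vs = 0" "connection_form F D\<^sub>F t c p vs = 0" "connection_form E D\<^sub>E s c p vs = 0"
    using False by (auto simp: dlog_def connection_form_def split: list.split)
  ultimately show ?thesis by simp
qed

lemma is_sigma_sigma0: "is_sigma sigma0"
proof (intro conjI)
  have deg: "sigma0 c p vs = 0" if "length vs \<noteq> 1" for c p vs
    using that by (auto simp: sigma0_def split: list.split)
  then show "form_degree A 1 sigma0" by (simp add: form_degree_def)
  show "form_on A UNIV sigma0"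
  proof (rule form_onI)
    fix c p assume p: "c \<in> A" "p \<in> dom_c c"
    obtain U a where U: "p \<in> U" "local_rep A E F \<alpha> U a" by (rule local_rep_exists)
    obtain s t where st: "local_frame A E U s" "local_frame A F U t"
      "\<And>p. p \<in> U \<Longrightarrow> \<alpha> (s p) = fib_scale F (a p) (t p)" by (rule local_repE[OF U(2)], rule that)
    note l = sigma0_local[OF st p(1) U(1) p(2)]
    note fo = form_onD(1)[OF _ p(1) U(1) p(2)]
    show "alternating (sigma0 c p)"
    proof (cases "a p = 0")
      case True
      then have "sigma0 c p = (\<lambda>vs. 0)" using l by (simp add: fun_eq_iff)
      then show ?thesis by (simp add: alternating_0)
    next
      case False
      then have "sigma0 c p = (\<lambda>vs. dlog a c p vs + (connection_form F D\<^sub>F t c p vs - connection_form E D\<^sub>E s c p vs))"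
        using l by (simp add: fun_eq_iff)
      then show ?thesis
        by (simp add: alternating_add alternating_diff fo[OF L1loc_formD(1)[OF atomicD(2)[OF U(2)]]]
            fo[OF smooth_formD(1)[OF F.smooth_connection_form[OF st(2)]]]
            fo[OF smooth_formD(1)[OF E.smooth_connection_form[OF st(1)]]])
    qed
  next
    fix c c' p vs assume p: "c \<in> A" "c' \<in> A" "p \<in> dom_c c" "p \<in> dom_c c'"
    obtain U a where U: "p \<in> U" "local_rep A E F \<alpha> U a" by (rule local_rep_exists)
    obtain s t where st: "local_frame A E U s" "local_frame A F U t"
      "\<And>p. p \<in> U \<Longrightarrow> \<alpha> (s p) = fib_scale F (a p) (t p)" by (rule local_repE[OF U(2)], rule that)
    note fo = form_onD(2)[OF _ p(1) U(1) p(3) p(2,4)]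
    have "sigma0 c' p (map (trans_deriv c c' p) vs) = (if a p = 0 then 0 else dlog a c p vs
        + (connection_form F D\<^sub>F t c p vs - connection_form E D\<^sub>E s c p vs))"
      unfolding fo[OF L1loc_formD(1)[OF atomicD(2)[OF U(2)]], of vs]
        fo[OF smooth_formD(1)[OF F.smooth_connection_form[OF st(2)]], of vs]
        fo[OF smooth_formD(1)[OF E.smooth_connection_form[OF st(1)]], of vs]
      by (rule sigma0_local[OF st p(2) U(1) p(4)])
    moreover have "sigma0 c p vs = (if a p = 0 then 0 else dlog a c p vs
        + (connection_form F D\<^sub>F t c p vs - connection_form E D\<^sub>E s c p vs))"
      by (rule sigma0_local[OF st p(1) U(1) p(3)])
    ultimately show "sigma0 c p vs = sigma0 c' p (map (trans_deriv c c' p) vs)" by simp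
  qed
  show "satisfies_sigma_eq A E F D\<^sub>E D\<^sub>F \<alpha> sigma0"
    unfolding satisfies_sigma_eq_def
  proof (intro ballI impI allI)
    fix c p V s' v assume p: "c \<in> A" "p \<in> dom_c c" and nv: "\<not> vanishes_at E F \<alpha> p" and s': "p \<in> V \<and> smooth_section A E V s'"
    obtain U a where U: "p \<in> U" "local_rep A E F \<alpha> U a" by (rule local_rep_exists)
    obtain s t where st: "local_frame A E U s" "local_frame A F U t"
      "\<And>p. p \<in> U \<Longrightarrow> \<alpha> (s p) = fib_scale F (a p) (t p)" by (rule local_repE[OF U(2)], rule that)
    have nz: "a p \<noteq> 0" using vanishes_at_rep[OF st U(1)] nv by simp
    have "sigma0 c p [v] = dlog a c p [v] + (connection_form F D\<^sub>F t c p [v] - connection_form E D\<^sub>E s c p [v])"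
      using sigma0_local[OF st p(1) U(1) p(2)] nz by simp
    then show "hom_deriv F D\<^sub>E D\<^sub>F \<alpha> s' c p v = fib_scale F (sigma0 c p [v]) (\<alpha> (s' p))"
      using sigma_condition[OF st p(1) U(1) p(2) nz] s' by blast
  qed
qed

lemma L1loc_sigma:
  assumes \<sigma>: "is_sigma \<sigma>"
  shows "L1loc_form A UNIV \<sigma>"
proof (rule L1loc_form_local)
  show "form_on A UNIV \<sigma>" using \<sigma> by blast
  fix p
  obtain U a where U: "open U" "p \<in> U" "local_rep A E F \<alpha> U a" by (rule local_rep_exists)
  obtain s t where st: "local_frame A E U s" "local_frame A F U t"
    "\<And>p. p \<in> U \<Longrightarrow> \<alpha> (s p) = fib_scale F (a p) (t p)" by (rule local_repE[OF U(3)], rule that)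
  let ?\<beta> = "form_diff (connection_form F D\<^sub>F t) (connection_form E D\<^sub>E s)"
  have \<beta>: "smooth_form A U ?\<beta>"
    by (rule smooth_form_diff[OF U(1) F.smooth_connection_form[OF st(2)] E.smooth_connection_form[OF st(1)]])
  have L1: "L1loc_form A U (\<lambda>c p vs. 1 * dlog a c p vs + 1 * ?\<beta> c p vs)"
    by (rule L1loc_form_lincomb[OF atomicD(2)[OF U(3)] smooth_form_L1loc[OF U(1) \<beta>]])
  have "L1loc_form A U \<sigma>"
  proof (rule L1loc_formI)
    show "form_on A U \<sigma>" using \<sigma> form_on_subset by blast
    fix c K vs assume c: "c \<in> A" and K: "compact K" "K \<subseteq> map_c c ` (U \<inter> dom_c c)"
    show "(\<lambda>x. loc c \<sigma> x vs) absolutely_integrable_on K"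
    proof (rule absolutely_integrable_spike[OF L1loc_formD(2)[OF L1 c K] atomicD(1)[OF U(3) c]])
      fix x assume x: "x \<in> K - map_c c ` {p \<in> U \<inter> dom_c c. a p = 0}"
      then obtain q where q: "q \<in> U" "q \<in> dom_c c" "x = map_c c q" using K(2) by blast
      then have "a q \<noteq> 0" using x by blast
      then show "loc c \<sigma> x vs = loc c (\<lambda>c p vs. 1 * dlog a c p vs + 1 * ?\<beta> c p vs) x vs"
        using sigma_local[OF st _ _ c q(1,2)] \<sigma> q c by (simp add: loc_def form_diff_def)
    qed
  qed
  then show "\<exists>U. open U \<and> p \<in> U \<and> L1loc_form A U \<sigma>" using U by blast
qed

lemma odd_sigma:
  assumes "is_sigma \<sigma>" "c \<in> A" "p \<in> dom_c c"
  shows "odd_fun (\<sigma> c p)"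
  using assms unfolding odd_fun_def form_degree_def by (metis even_numeral odd_one)

abbreviation curv_diff :: "('a, 'n) form" where
  "curv_diff \<equiv> form_diff (curvature A F D\<^sub>F) (curvature A E D\<^sub>E)"

lemma smooth_curv_diff: "smooth_form A UNIV curv_diff"
  by (rule smooth_form_diff[OF open_UNIV F.smooth_curvature E.smooth_curvature])

text \<open>A global formula for the divisor. Locally \<open>da/a = \<sigma> - \<omega>\<^sub>F + \<omega>\<^sub>E\<close>, and \<open>d(\<omega>\<^sub>F - \<omega>\<^sub>E)\<close> is
  the difference of the curvatures.\<close>

definition sigma_divisor :: "('a, 'n) form \<Rightarrow> ('a, 'n) functional" where
  "sigma_divisor \<sigma> \<psi> = 1 / (2 * of_real pi * \<i>) * current_deriv A (current_of A \<sigma>) \<psi>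
     + (- (1 / (2 * of_real pi * \<i>))) * current_of A curv_diff \<psi>"

lemma current_sigma_divisor: "is_sigma \<sigma> \<Longrightarrow> current A (sigma_divisor \<sigma>)"
  unfolding sigma_divisor_def[abs_def]
  by (intro current_lincomb current_deriv_current current_of_current L1loc_sigma
      smooth_form_L1loc[OF open_UNIV smooth_curv_diff])

lemma current_deriv_sigma:
  assumes "is_sigma \<sigma>" "test_form A \<psi>"
  shows "current_deriv A (current_of A \<sigma>) \<psi> = form_integral A (wedge \<sigma> (ext_deriv A \<psi>))"
  by (rule current_deriv_odd[OF assms(2) subset_UNIV L1loc_sigma odd_sigma]) (use assms in auto)

text \<open>The difference of the curvatures is locally the exterior derivative of the difference
  \<open>?\<beta>\<close> of the connection forms, and integration by parts moves that derivative to
  \<open>\<psi>\<close>. Now \<open>\<sigma>\<close> and \<open>?\<beta>\<close> are both paired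
  with \<open>ext_deriv A \<psi>\<close>, and off a null set their difference is
  \<open>dlog a\<close>.\<close>

lemma sigma_divisor_local:
  assumes \<sigma>: "is_sigma \<sigma>" and rep: "local_rep A E F \<alpha> U a" and \<psi>: "test_form A \<psi>" "form_support A \<psi> \<subseteq> U"
  shows "sigma_divisor \<sigma> \<psi> = current_deriv A (current_of A (form_scale (1 / (2 * of_real pi * \<i>)) (dlog a))) \<psi>"
proof -
  let ?z = "1 / (2 * of_real pi * \<i>) :: complex" and ?d = "ext_deriv A \<psi>" and ?K = "form_support A \<psi>"
  obtain s t where st: "local_frame A E U s" "local_frame A F U t"
    "\<And>p. p \<in> U \<Longrightarrow> \<alpha> (s p) = fib_scale F (a p) (t p)" by (rule local_repE[OF rep], rule that)
  have U: "open U" by (rule E.local_frameD(2)[OF st(1)])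
  let ?\<theta>F = "connection_form F D\<^sub>F t" and ?\<theta>E = "connection_form E D\<^sub>E s"
  let ?\<beta> = "form_diff ?\<theta>F ?\<theta>E"
  have s\<theta>: "smooth_form A U ?\<theta>F" "smooth_form A U ?\<theta>E"
    by (rule F.smooth_connection_form[OF st(2)], rule E.smooth_connection_form[OF st(1)])
  have \<beta>: "smooth_form A U ?\<beta>" by (rule smooth_form_diff[OF U s\<theta>])
  have odd\<beta>: "odd_fun (?\<beta> c p)" for c p
    using F.odd_connection_form[of t c p] E.odd_connection_form[of s c p] by (simp add: odd_fun_def form_diff_def)
  have K: "compact ?K" and s\<psi>: "smooth_form A UNIV \<psi>" using test_formD[OF \<psi>(1)] by auto
  have td: "test_form A ?d" by (rule test_form_ext_deriv[OF \<psi>(1)])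
  have sd: "form_support A ?d \<subseteq> ?K" by (rule form_support_ext_deriv)
  have sdU: "form_support A ?d \<subseteq> U" using sd \<psi>(2) by blast
  have sw: "form_support A (wedge \<omega> ?d) \<subseteq> ?K" for \<omega> using form_support_wedge_right sd by blast
  have L\<sigma>: "L1loc_form A UNIV (wedge \<sigma> ?d)" by (rule L1loc_wedge_test[OF L1loc_sigma[OF \<sigma>] td subset_UNIV])
  have L\<beta>: "L1loc_form A UNIV (wedge ?\<beta> ?d)" by (rule L1loc_wedge_test[OF smooth_form_L1loc[OF U \<beta>] td sdU])
  have La: "L1loc_form A U (form_scale ?z (dlog a))" by (rule L1loc_form_scale[OF atomicD(2)[OF rep]])
  have La': "L1loc_form A UNIV (wedge (form_scale ?z (dlog a)) ?d)" by (rule L1loc_wedge_test[OF La td sdU])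
  have "current_of A curv_diff \<psi> = form_integral A (wedge curv_diff \<psi>)" by (simp add: current_of_def \<psi>)
  also have "\<dots> = form_integral A (wedge (ext_deriv A ?\<beta>) \<psi>)"
  proof (rule form_integral_cong[OF _ _ K form_support_wedge_right form_support_wedge_right])
    show "L1loc_form A UNIV (wedge curv_diff \<psi>)"
      by (rule L1loc_wedge_test[OF smooth_form_L1loc[OF open_UNIV smooth_curv_diff] \<psi>(1) subset_UNIV])
    show "L1loc_form A UNIV (wedge (ext_deriv A ?\<beta>) \<psi>)"
      by (rule L1loc_wedge_test[OF smooth_form_L1loc[OF U smooth_form_ext_deriv[OF U \<beta>]] \<psi>])
    fix c p assume p: "c \<in> A" "p \<in> dom_c c" "p \<in> ?K"
    then have pU: "p \<in> U" using \<psi>(2) by blast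
    have "curv_diff c p = ext_deriv A ?\<beta> c p"
      using F.curvature_eq[OF st(2) p(1) pU p(2)] E.curvature_eq[OF st(1) p(1) pU p(2)]
        ext_deriv_diff[OF U s\<theta> p(1) pU p(2)] by (simp add: fun_eq_iff form_diff_def[of "curvature _ _ _"])
    then show "wedge curv_diff \<psi> c p std_frame = wedge (ext_deriv A ?\<beta>) \<psi> c p std_frame"
      by (simp add: wedge_lwedge)
  qed
  also have "\<dots> = form_integral A (wedge ?\<beta> ?d)"
    by (rule integration_by_parts[OF U \<beta> odd\<beta> s\<psi> K \<psi>(2)])
  finally have "sigma_divisor \<sigma> \<psi> = ?z * form_integral A (wedge \<sigma> ?d) + (- ?z) * form_integral A (wedge ?\<beta> ?d)"
    by (simp add: sigma_divisor_def current_deriv_sigma[OF \<sigma> \<psi>(1)])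
  also have "\<dots> = form_integral A (\<lambda>c p vs. ?z * wedge \<sigma> ?d c p vs + (- ?z) * wedge ?\<beta> ?d c p vs)"
    by (rule form_integral_lincomb[OF L\<sigma> L\<beta> K sw sw, symmetric])
  also have "\<dots> = form_integral A (wedge (form_scale ?z (dlog a)) ?d)"
  proof (rule form_integral_cong_AE[OF L1loc_form_lincomb[OF L\<sigma> L\<beta>] La' K _ sw])
    show "form_support A (\<lambda>c p vs. ?z * wedge \<sigma> ?d c p vs + (- ?z) * wedge ?\<beta> ?d c p vs) \<subseteq> ?K"
    proof (rule form_support_subset[OF form_support_closed])
      fix c p vs assume p: "c \<in> A" "p \<in> dom_c c" "p \<notin> ?K"
      have "wedge \<sigma> ?d c p vs = 0" "wedge ?\<beta> ?d c p vs = 0"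
        by (rule form_support_zero[OF p(1,2)]; use sw p(3) in blast)+
      then show "?z * wedge \<sigma> ?d c p vs + (- ?z) * wedge ?\<beta> ?d c p vs = 0" by simp
    qed
    fix c assume c: "c \<in> A"
    let ?N = "map_c c ` {p \<in> U \<inter> dom_c c. a p = 0}"
    have "?z * wedge \<sigma> ?d c p std_frame + (- ?z) * wedge ?\<beta> ?d c p std_frame = wedge (form_scale ?z (dlog a)) ?d c p std_frame"
      if p: "p \<in> dom_c c \<inter> ?K" "map_c c p \<notin> ?N" for p
    proof -
      have pU: "p \<in> U" using p \<psi>(2) by blast
      then have "a p \<noteq> 0" using p by blast
      then have "\<sigma> c p = (\<lambda>vs. dlog a c p vs + ?\<beta> c p vs)"
        using sigma_local[OF st _ _ c pU] \<sigma> p by (simp add: fun_eq_iff form_diff_def)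
      then have "wedge \<sigma> ?d c p std_frame = lwedge (dlog a c p) (?d c p) std_frame + wedge ?\<beta> ?d c p std_frame"
        by (simp add: wedge_lwedge lwedge_add_left)
      moreover have "wedge (form_scale ?z (dlog a)) ?d c p std_frame = ?z * lwedge (dlog a c p) (?d c p) std_frame"
        by (simp only: wedge_lwedge form_scale_def lwedge_cmult_left)
      ultimately show ?thesis by (simp add: algebra_simps)
    qed
    then show "\<exists>N. negligible N \<and> (\<forall>p\<in>dom_c c \<inter> ?K. map_c c p \<notin> N \<longrightarrow>
        ?z * wedge \<sigma> ?d c p std_frame + (- ?z) * wedge ?\<beta> ?d c p std_frame = wedge (form_scale ?z (dlog a)) ?d c p std_frame)"
      using atomicD(1)[OF rep c] by blast
  qed
  also have "\<dots> = current_deriv A (current_of A (form_scale ?z (dlog a))) \<psi>"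
  proof (rule current_deriv_odd[OF \<psi> La, symmetric])
    show "odd_fun (form_scale ?z (dlog a) c p)" for c p
      by (auto simp: odd_fun_def form_scale_def dlog_def split: list.split)
  qed
  finally show ?thesis .
qed

text \<open>The equation holds for every solution \<open>\<sigma>\<close>; in particular the right
  side does not depend on the values of \<open>\<sigma>\<close> at the zeros of
  \<open>\<alpha>\<close>.\<close>

lemma divisor_eq:
  assumes \<sigma>: "is_sigma \<sigma>"
  shows "divisor A E F \<alpha> = sigma_divisor \<sigma>"
  unfolding divisor_def
proof (rule the_equality)
  let ?P = "\<lambda>S. current A S \<and>
     (\<forall>U a \<psi>. local_rep A E F \<alpha> U a \<and> test_form A \<psi> \<and> form_support A \<psi> \<subseteq> U \<longrightarrow>
        S \<psi> = current_deriv A (current_of A (form_scale (1 / (2 * of_real pi * \<i>)) (dlog a))) \<psi>)"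
  show P: "?P (sigma_divisor \<sigma>)"
    using current_sigma_divisor[OF \<sigma>] sigma_divisor_local[OF \<sigma>] by blast
  fix S assume S: "?P S"
  show "S = sigma_divisor \<sigma>"
  proof (rule current_local_eq[of _ _ "\<lambda>W. \<exists>a. local_rep A E F \<alpha> W a"])
    show "\<exists>W. open W \<and> p \<in> W \<and> (\<exists>a. local_rep A E F \<alpha> W a)" for p
    proof -
      obtain U a where "open U" "p \<in> U" "local_rep A E F \<alpha> U a" by (rule local_rep_exists)
      then show ?thesis by blast
    qed
    fix W \<psi> assume "\<exists>a. local_rep A E F \<alpha> W a" and \<psi>: "test_form A \<psi>" "form_support A \<psi> \<subseteq> W"
    then obtain a where a: "local_rep A E F \<alpha> W a" by blast
    have "S \<psi> = current_deriv A (current_of A (form_scale (1 / (2 * of_real pi * \<i>)) (dlog a))) \<psi>"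
      using S a \<psi> by blast
    then show "S \<psi> = sigma_divisor \<sigma> \<psi>" using sigma_divisor_local[OF \<sigma> a \<psi>] by simp
  qed (use S P in blast)+
qed

end

section \<open>Polynomials in the curvatures\<close>

text \<open>For a power of degree \<open>k\<close> the quotient is the sum of all
  \<open>x^i y^j\<close> with \<open>i + j + 1 = k\<close>. The polynomial with the resulting
  coefficients is written down, multiplied by the divisor, and the divisor is cancelled.\<close>

lemma coeff_diff_quot: "coeff (coeff (diff_quot \<phi>) j) i = coeff \<phi> (i + j + 1)"
proof -
  let ?N = "degree \<phi>"
  \<comment> \<open>Both sums run past the true degrees; the surplus coefficients of
    \<open>\<phi>\<close> are zero.\<close>
  define Q where "Q = (\<Sum>j\<le>?N. monom (\<Sum>i\<le>?N. monom (coeff \<phi> (i + j + 1)) i) j)"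
  have Q: "coeff (coeff Q j) i = coeff \<phi> (i + j + 1)" for i j
  proof -
    have "coeff Q j = (if j \<le> ?N then (\<Sum>i\<le>?N. monom (coeff \<phi> (i + j + 1)) i) else 0)"
      by (simp add: Q_def coeff_sum)
    then have "coeff (coeff Q j) i = (if j \<le> ?N \<and> i \<le> ?N then coeff \<phi> (i + j + 1) else 0)"
      by (simp add: coeff_sum)
    then show ?thesis by (auto simp: coeff_eq_0)
  qed
  have "map_poly (\<lambda>a. [:a:]) \<phi> - [:\<phi>:] = [:- [:0, 1:], 1:] * Q"
  proof (intro poly_eqI)
    fix j i
    show "coeff (coeff (map_poly (\<lambda>a. [:a:]) \<phi> - [:\<phi>:]) j) i = coeff (coeff ([:- [:0, 1:], 1:] * Q) j) i"
      by (cases i; cases j) (simp_all add: coeff_map_poly coeff_pCons Q split: nat.split)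
  qed
  then have "diff_quot \<phi> = [:- [:0, 1:], 1:] * Q div [:- [:0, 1:], 1:]"
    by (simp only: diff_quot_def)
  also have "\<dots> = Q" by (rule nonzero_mult_div_cancel_left) simp
  finally have "diff_quot \<phi> = Q" .
  then show ?thesis using Q by simp
qed

definition lpoly :: "complex poly \<Rightarrow> ('v list \<Rightarrow> complex) \<Rightarrow> 'v list \<Rightarrow> complex" where
  "lpoly \<phi> a vs = (\<Sum>k\<le>degree \<phi>. coeff \<phi> k * lpow a k vs)"

definition lpoly2 :: "complex poly poly \<Rightarrow> ('v list \<Rightarrow> complex) \<Rightarrow> ('v list \<Rightarrow> complex) \<Rightarrow> 'v list \<Rightarrow> complex" where
  "lpoly2 q a b vs = (\<Sum>j\<le>degree q. \<Sum>i\<le>degree (coeff q j). coeff (coeff q j) i * lwedge (lpow a i) (lpow b j) vs)"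

lemma poly_form_lpoly: "poly_form \<phi> \<omega> c p = lpoly \<phi> (\<omega> c p)"
  by (rule ext) (simp add: poly_form_def lpoly_def form_power_lpow)

lemma poly2_form_lpoly2: "poly2_form q \<xi> \<eta> c p = lpoly2 q (\<xi> c p) (\<eta> c p)"
  by (rule ext) (simp add: poly2_form_def lpoly2_def wedge_lwedge form_power_lpow)

text \<open>The ranges are enlarged to a square, where the added coefficients vanish, so that sums
  can be swapped and shifted in \<open>lpoly_diff\<close>.\<close>

lemma lpoly2_diff_quot:
  "lpoly2 (diff_quot \<phi>) a b vs =
    (\<Sum>j\<le>degree \<phi>. \<Sum>i\<le>degree \<phi>. coeff \<phi> (i + j + 1) * lwedge (lpow a i) (lpow b j) vs)"
proof -
  let ?N = "degree \<phi>" and ?q = "diff_quot \<phi>"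
  let ?L = "\<lambda>i j. lwedge (lpow a i) (lpow b j) vs"
  have d1: "degree (coeff ?q j) \<le> ?N" for j
    by (rule degree_le) (simp add: coeff_diff_quot coeff_eq_0)
  have d2: "degree ?q \<le> ?N"
    by (rule degree_le) (simp add: poly_eq_iff coeff_diff_quot coeff_eq_0)
  have "lpoly2 ?q a b vs = (\<Sum>j\<le>degree ?q. \<Sum>i\<le>?N. coeff (coeff ?q j) i * ?L i j)"
    unfolding lpoly2_def
    by (intro sum.cong refl sum.mono_neutral_left) (use d1 in \<open>auto simp: coeff_eq_0\<close>)
  also have "\<dots> = (\<Sum>j\<le>?N. \<Sum>i\<le>?N. coeff (coeff ?q j) i * ?L i j)"
    by (intro sum.mono_neutral_left) (use d2 in \<open>auto simp: coeff_eq_0\<close>)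
  finally show ?thesis by (simp add: coeff_diff_quot)
qed

text \<open>The wedge with \<open>a\<close> raises the first exponent; the wedge with
  \<open>b\<close> raises the second, after \<open>b\<close> has been moved past the power of
  \<open>a\<close>, which its evenness allows. With \<open>coeff \<phi> (i + j)\<close> built into
  \<open>M i j\<close>, the two double sums cancel except for the edges \<open>i = 0\<close> and
  \<open>j = 0\<close>, which are the polynomials in \<open>b\<close> and in
  \<open>a\<close>.\<close>

lemma lpoly_diff:
  assumes a: "even_fun a" and b: "even_fun b"
  shows "lwedge (\<lambda>vs. b vs - a vs) (lpoly2 (diff_quot \<phi>) a b) vs = lpoly \<phi> b vs - lpoly \<phi> a vs"
proof -
  let ?N = "degree \<phi>"
  define L where "L i j = lwedge (lpow a i) (lpow b j) vs" for i j
  define M where "M i j = coeff \<phi> (i + j) * L i j" for i j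
  have La: "lwedge a (lwedge (lpow a i) (lpow b j)) vs = L (Suc i) j" for i j
    by (simp add: L_def lwedge_assoc)
  have "lwedge b (lwedge (lpow a i) (lpow b j)) = lwedge (lpow a i) (lwedge b (lpow b j))" for i j
    unfolding lwedge_assoc[symmetric] lwedge_commute(1)[OF b, of "lpow a i"] ..
  then have Lb: "lwedge b (lwedge (lpow a i) (lpow b j)) vs = L i (Suc j)" for i j
    by (simp add: L_def)
  \<comment> \<open>Vanishing beyond the degree makes the index shifts free of terms at the upper
    end.\<close>
  have M0: "M i (Suc ?N) = 0" "M (Suc ?N) i = 0" for i
    by (auto simp: M_def coeff_eq_0)
  have row: "(\<Sum>j\<le>?N. M i (Suc j)) = (\<Sum>j\<le>?N. M i j) - M i 0" for i
  proof -
    have "M i 0 + (\<Sum>j\<le>?N. M i (Suc j)) = (\<Sum>j\<le>Suc ?N. M i j)" by (rule sum.atMost_Suc_shift[symmetric])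
    then show ?thesis using M0 by (simp add: algebra_simps)
  qed
  have col: "(\<Sum>i\<le>?N. M (Suc i) j) = (\<Sum>i\<le>?N. M i j) - M 0 j" for j
  proof -
    have "M 0 j + (\<Sum>i\<le>?N. M (Suc i) j) = (\<Sum>i\<le>Suc ?N. M i j)" by (rule sum.atMost_Suc_shift[symmetric])
    then show ?thesis using M0 by (simp add: algebra_simps)
  qed
  have "lwedge (\<lambda>vs. b vs - a vs) (lpoly2 (diff_quot \<phi>) a b) vs
     = (\<Sum>j\<le>?N. \<Sum>i\<le>?N. coeff \<phi> (i + j + 1) * (L i (Suc j) - L (Suc i) j))"
    unfolding lpoly2_diff_quot[abs_def] lwedge_sum_right lwedge_cmult_right lwedge_diff_left La Lb ..
  also have "\<dots> = (\<Sum>j\<le>?N. \<Sum>i\<le>?N. M i (Suc j)) - (\<Sum>j\<le>?N. \<Sum>i\<le>?N. M (Suc i) j)"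
    by (simp add: M_def right_diff_distrib sum_subtractf)
  also have "(\<Sum>j\<le>?N. \<Sum>i\<le>?N. M i (Suc j)) = (\<Sum>i\<le>?N. \<Sum>j\<le>?N. M i j) - (\<Sum>i\<le>?N. M i 0)"
    by (subst sum.swap) (simp add: row sum_subtractf)
  also have "(\<Sum>j\<le>?N. \<Sum>i\<le>?N. M (Suc i) j) = (\<Sum>i\<le>?N. \<Sum>j\<le>?N. M i j) - (\<Sum>j\<le>?N. M 0 j)"
    by (simp add: col sum_subtractf) (rule sum.swap)
  finally show ?thesis
    by (simp add: M_def L_def lwedge_lone_left lwedge_lone_right lpoly_def)
qed

lemma even_fun_lpoly2: "even_fun a \<Longrightarrow> even_fun b \<Longrightarrow> even_fun (lpoly2 q a b)"
  using lwedge_parity(1)[of "lpow a _" "lpow b _"] even_fun_lpow[of a] even_fun_lpow[of b]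
  unfolding even_fun_def lpoly2_def by (simp add: sum.neutral)

section \<open>Closed forms\<close>

context oriented_manifold
begin

definition closed_form :: "('a, 'n) form \<Rightarrow> bool" where
  "closed_form \<omega> \<longleftrightarrow> smooth_form A UNIV \<omega> \<and> (\<forall>c\<in>A. \<forall>p\<in>dom_c c. ext_deriv A \<omega> c p = (\<lambda>vs. 0))"

lemma closed_form_wedge:
  assumes "closed_form \<omega>" "closed_form \<eta>"
  shows "closed_form (wedge \<omega> \<eta>)"
proof -
  have s: "smooth_form A UNIV \<omega>" "smooth_form A UNIV \<eta>" using assms by (auto simp: closed_form_def)
  have "ext_deriv A (wedge \<omega> \<eta>) c p = (\<lambda>vs. 0)" if p: "c \<in> A" "p \<in> dom_c c" for c p
  proof -
    have "ext_deriv A \<omega> c p = (\<lambda>vs. 0)" "ext_deriv A \<eta> c p = (\<lambda>vs. 0)"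
      using assms p unfolding closed_form_def by blast+
    then show ?thesis
      by (intro ext) (simp add: ext_deriv_wedge[OF open_UNIV s p(1) UNIV_I p(2)] lwedge_zero_left lwedge_zero_right)
  qed
  then show ?thesis
    unfolding closed_form_def using smooth_form_wedge[OF s] by blast
qed

lemma closed_form_sum:
  assumes "\<And>i. i \<in> I \<Longrightarrow> closed_form (\<omega> i)"
  shows "closed_form (\<lambda>c p vs. \<Sum>i\<in>I. \<omega> i c p vs)"
  using assms unfolding closed_form_def
  by (auto simp: fun_eq_iff ext_deriv_sum[OF open_UNIV] intro!: smooth_form_sum open_UNIV)

lemma closed_form_cmult:
  assumes "closed_form \<omega>"
  shows "closed_form (\<lambda>c p vs. z * \<omega> c p vs)"
  using assms ext_deriv_scale[OF open_UNIV, of \<omega> _ _ z] smooth_form_scale[OF open_UNIV, of \<omega> z]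
  unfolding closed_form_def form_scale_def by (auto simp: fun_eq_iff)

lemma closed_form_one: "closed_form form_one"
proof -
  have eq: "form_one = (zero_form (\<lambda>_. 1) :: ('a, 'n) form)"
    by (intro ext) (simp add: form_one_def zero_form_def lone_def)
  have "dir_deriv (\<lambda>_. 1) c p v = 0" for c :: "('a, 'n) chart" and p v
    by (simp add: dir_deriv_def o_def frechet_derivative_const)
  then show ?thesis
    unfolding closed_form_def eq
    by (auto simp: fun_eq_iff ext_deriv_zero_form smooth_zero_form smooth_fun_const split: list.split)
qed

lemma closed_form_power: "closed_form \<omega> \<Longrightarrow> closed_form (form_power \<omega> k)"
  by (induction k) (auto intro: closed_form_one closed_form_wedge)

lemma closed_poly2_form: "closed_form \<xi> \<Longrightarrow> closed_form \<eta> \<Longrightarrow> closed_form (poly2_form q \<xi> \<eta>)"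
  unfolding poly2_form_def
  by (intro closed_form_sum closed_form_cmult closed_form_wedge closed_form_power)

lemma closed_poly_form: "closed_form \<omega> \<Longrightarrow> closed_form (poly_form \<phi> \<omega>)"
  unfolding poly_form_def by (intro closed_form_sum closed_form_cmult closed_form_power)

end

section \<open>The identity of currents\<close>

context atomic_bundle_map
begin

text \<open>Everything is expressed by two integrals: \<open>?X\<close> pairs
  \<open>\<sigma>\<close> with the exterior derivative of the test form
  \<open>wedge ?q \<psi>\<close>, and \<open>?Y\<close> pairs the difference of the curvatures with
  this test form. The divisor contributes both, the derivative of \<open>T\<close> cancels the
  first, and \<open>lpoly_diff\<close> identifies the second with the left side.\<close>

lemma divisor_formula:
  fixes e f :: "('a, 'n) form"
  assumes e: "e = form_scale (\<i> / (2 * of_real pi)) (curvature A E D\<^sub>E)"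
    and f: "f = form_scale (\<i> / (2 * of_real pi)) (curvature A F D\<^sub>F)"
    and \<sigma>: "is_sigma \<sigma>"
    and T: "T = form_scale (\<i> / (2 * of_real pi)) (wedge (poly2_form (diff_quot \<phi>) e f) \<sigma>)"
  shows "L1loc_form A UNIV T"
    and "current_of A (form_diff (poly_form \<phi> f) (poly_form \<phi> e)) =
      (\<lambda>\<psi>. even_form_times_current A (poly2_form (diff_quot \<phi>) e f) (divisor A E F \<alpha>) \<psi>
        + current_deriv A (current_of A T) \<psi>)"
proof -
  let ?k = "\<i> / (2 * of_real pi) :: complex" and ?z = "1 / (2 * of_real pi * \<i>) :: complex"
  let ?q = "poly2_form (diff_quot \<phi>) e f" and ?\<Phi> = "form_diff (poly_form \<phi> f) (poly_form \<phi> e)"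
  \<comment> \<open>The normalisations of the divisor and of the forms \<open>e\<close>,
    \<open>f\<close> are opposite constants; this is why the terms in \<open>?X\<close>
    cancel.\<close>
  have z: "- ?z = ?k" by (simp add: field_simps)
  have ce: "closed_form e" and cf: "closed_form f"
    unfolding e f form_scale_def
    by (intro closed_form_cmult; auto simp: closed_form_def fun_eq_iff E.smooth_curvature F.smooth_curvature
        E.curvature_closed F.curvature_closed)+
  have ev: "even_fun (e c p)" "even_fun (f c p)" if "c \<in> A" "p \<in> dom_c c" for c p
    using E.even_curvature[OF that] F.even_curvature[OF that] by (auto simp: e f even_fun_def form_scale_def)
  have cq: "closed_form ?q" by (rule closed_poly2_form[OF ce cf])
  then have sq: "smooth_form A UNIV ?q" and dq: "\<And>c p. c \<in> A \<Longrightarrow> p \<in> dom_c c \<Longrightarrow> ext_deriv A ?q c p = (\<lambda>vs. 0)"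
    by (auto simp: closed_form_def)
  have evq: "even_fun (?q c p)" if "c \<in> A" "p \<in> dom_c c" for c p
    unfolding poly2_form_lpoly2 by (rule even_fun_lpoly2[OF ev[OF that]])
  have s\<Phi>: "smooth_form A UNIV ?\<Phi>"
    using closed_poly_form[OF ce] closed_poly_form[OF cf] by (intro smooth_form_diff) (auto simp: closed_form_def)
  \<comment> \<open>\<open>L1loc_form_wedge\<close> expects the smooth factor on the right, while
    \<open>T\<close> has it on the left.\<close>
  have q\<sigma>: "wedge ?q \<sigma> c p = lwedge (\<sigma> c p) (?q c p)" if "c \<in> A" "p \<in> dom_c c" for c p
    unfolding wedge_lwedge by (rule lwedge_commute(1)[OF evq[OF that]])
  have L1: "L1loc_form A UNIV (wedge ?q \<sigma>)"
    by (rule L1loc_form_cong[OF L1loc_form_wedge[OF L1loc_sigma[OF \<sigma>] sq subset_UNIV]])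
       (simp add: q\<sigma> wedge_lwedge[of \<sigma>])
  show LT: "L1loc_form A UNIV T" unfolding T by (rule L1loc_form_scale[OF L1])
  have oddT: "odd_fun (T c p)" if "c \<in> A" "p \<in> dom_c c" for c p
  proof -
    have "odd_fun (wedge ?q \<sigma> c p)"
      unfolding wedge_lwedge using lwedge_parity(2) evq[OF that] odd_sigma[OF \<sigma> that] by blast
    then show ?thesis by (simp add: T odd_fun_def form_scale_def)
  qed
  show "current_of A ?\<Phi> = (\<lambda>\<psi>. even_form_times_current A ?q (divisor A E F \<alpha>) \<psi> + current_deriv A (current_of A T) \<psi>)"
  proof
    fix \<psi>
    show "current_of A ?\<Phi> \<psi> = even_form_times_current A ?q (divisor A E F \<alpha>) \<psi> + current_deriv A (current_of A T) \<psi>"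
    proof (cases "test_form A \<psi>")
      case False
      then show ?thesis by (simp add: current_of_def even_form_times_current_def current_deriv_def)
    next
      case t: True
      let ?K = "form_support A \<psi>"
      have K: "compact ?K" and s\<psi>: "smooth_form A UNIV \<psi>" using test_formD[OF t] by auto
      have tq: "test_form A (wedge ?q \<psi>)" by (rule test_form_wedge[OF sq t])
      let ?X = "wedge \<sigma> (ext_deriv A (wedge ?q \<psi>))" and ?Y = "wedge curv_diff (wedge ?q \<psi>)"
      have sqK: "form_support A (wedge ?q \<psi>) \<subseteq> ?K" by (rule form_support_wedge_right)
      have sX: "form_support A ?X \<subseteq> ?K"
        using form_support_wedge_right form_support_ext_deriv sqK by blast
      have sY: "form_support A ?Y \<subseteq> ?K" using form_support_wedge_right sqK by blast
      have scale: "form_support A (form_scale z \<omega>) \<subseteq> ?K" if "form_support A \<omega> \<subseteq> ?K" for z \<omega>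
      proof (rule form_support_subset[OF form_support_closed])
        fix c p vs assume p: "c \<in> A" "p \<in> dom_c c" "p \<notin> ?K"
        have "\<omega> c p vs = 0" by (rule form_support_zero[OF p(1,2)]) (use that p(3) in blast)
        then show "form_scale z \<omega> c p vs = 0" by (simp add: form_scale_apply)
      qed
      have LX: "L1loc_form A UNIV ?X"
        by (rule L1loc_wedge_test[OF L1loc_sigma[OF \<sigma>] test_form_ext_deriv[OF tq] subset_UNIV])
      have LY: "L1loc_form A UNIV ?Y"
        by (rule L1loc_wedge_test[OF smooth_form_L1loc[OF open_UNIV smooth_curv_diff] tq subset_UNIV])
      have "current_deriv A (current_of A T) \<psi> = form_integral A (wedge T (ext_deriv A \<psi>))"
        by (rule current_deriv_odd[OF t subset_UNIV LT oddT])
      also have "\<dots> = form_integral A (form_scale ?k ?X)"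
      proof (rule form_integral_cong[OF L1loc_wedge_test[OF LT test_form_ext_deriv[OF t] subset_UNIV]
            L1loc_form_scale[OF LX] K _ scale[OF sX]])
        show "form_support A (wedge T (ext_deriv A \<psi>)) \<subseteq> ?K"
          using form_support_wedge_right form_support_ext_deriv by blast
        fix c p assume p: "c \<in> A" "p \<in> dom_c c"
        \<comment> \<open>Closedness of \<open>?q\<close> removes the first term of Leibniz' rule,
          and evenness the sign of the second.\<close>
        have "ext_deriv A (wedge ?q \<psi>) c p = lwedge (?q c p) (ext_deriv A \<psi> c p)"
          by (rule ext) (simp add: ext_deriv_wedge[OF open_UNIV sq s\<psi> p(1) UNIV_I p(2)] dq[OF p]
              even_fun_lhat[OF evq[OF p]] lwedge_zero_left)
        then have "?X c p = lwedge (wedge ?q \<sigma> c p) (ext_deriv A \<psi> c p)"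
          by (simp add: wedge_lwedge[of \<sigma>] q\<sigma>[OF p] lwedge_assoc)
        then show "wedge T (ext_deriv A \<psi>) c p std_frame = form_scale ?k ?X c p std_frame"
          by (simp only: T form_scale_def wedge_lwedge[of "\<lambda>c p vs. ?k * _ c p vs"] lwedge_cmult_left)
      qed
      also have "\<dots> = ?k * form_integral A ?X"
        by (rule form_integral_scale[OF LX compact_closed_subset[OF K form_support_closed sX]])
      finally have dT: "current_deriv A (current_of A T) \<psi> = ?k * form_integral A ?X" .
      have "even_form_times_current A ?q (divisor A E F \<alpha>) \<psi> = sigma_divisor \<sigma> (wedge ?q \<psi>)"
        by (simp add: even_form_times_current_def t divisor_eq[OF \<sigma>])
      also have "\<dots> = ?z * form_integral A ?X + (- ?z) * form_integral A ?Y"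
        unfolding sigma_divisor_def current_deriv_sigma[OF \<sigma> tq] by (simp add: current_of_def tq)
      finally have div: "even_form_times_current A ?q (divisor A E F \<alpha>) \<psi> = - ?k * form_integral A ?X + ?k * form_integral A ?Y"
        unfolding z[symmetric] by simp
      have "current_of A ?\<Phi> \<psi> = form_integral A (wedge ?\<Phi> \<psi>)" by (simp add: current_of_def t)
      also have "\<dots> = form_integral A (form_scale ?k ?Y)"
      proof (rule form_integral_cong[OF L1loc_wedge_test[OF smooth_form_L1loc[OF open_UNIV s\<Phi>] t subset_UNIV]
            L1loc_form_scale[OF LY] K form_support_wedge_right scale[OF sY]])
        fix c p assume p: "c \<in> A" "p \<in> dom_c c"
        have fe: "(\<lambda>vs. f c p vs - e c p vs) = (\<lambda>vs. ?k * curv_diff c p vs)"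
          by (simp add: e f form_scale_def form_diff_def right_diff_distrib)
        have "?\<Phi> c p = lwedge (\<lambda>vs. f c p vs - e c p vs) (?q c p)"
          using lpoly_diff[OF ev[OF p], of \<phi>] by (simp add: fun_eq_iff form_diff_def poly_form_lpoly poly2_form_lpoly2)
        also have "\<dots> = (\<lambda>vs. ?k * lwedge (curv_diff c p) (?q c p) vs)"
          unfolding fe by (rule ext) (rule lwedge_cmult_left)
        finally have "wedge ?\<Phi> \<psi> c p std_frame = ?k * lwedge (lwedge (curv_diff c p) (?q c p)) (\<psi> c p) std_frame"
          unfolding wedge_lwedge[of ?\<Phi>] by (simp only: lwedge_cmult_left)
        then show "wedge ?\<Phi> \<psi> c p std_frame = form_scale ?k ?Y c p std_frame"
          by (simp only: form_scale_apply wedge_lwedge lwedge_assoc)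
      qed
      also have "\<dots> = ?k * form_integral A ?Y"
        by (rule form_integral_scale[OF LY compact_closed_subset[OF K form_support_closed sY]])
      finally show ?thesis unfolding dT div by simp
    qed
  qed
qed

end

text \<open>The first conjunct keeps the second from being vacuous. As the equation leaves
  \<open>\<sigma>\<close> undetermined at the zeros of \<open>\<alpha>\<close>, the formula is
  asserted for every solution.\<close>

theorem theoremA:
  fixes A :: "('a::{t2_space, second_countable_topology}, 'n::{finite, linorder}) chart set"
    and E :: "('a, 'e) line_bundle_data" and F :: "('a, 'f) line_bundle_data"
    and D\<^sub>E :: "('a, 'n, 'e) covariant_deriv" and D\<^sub>F :: "('a, 'n, 'f) covariant_deriv"
    and \<phi> :: "complex poly" and \<alpha> :: "'e \<Rightarrow> 'f" and e f :: "('a, 'n) form"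
  assumes "oriented_atlas A"
    and "line_bundle A E" and "line_bundle A F"
    and "connection A E D\<^sub>E" and "connection A F D\<^sub>F"
    and "e = form_scale (\<i> / (2 * of_real pi)) (curvature A E D\<^sub>E)"
    and "f = form_scale (\<i> / (2 * of_real pi)) (curvature A F D\<^sub>F)"
    and "bundle_map A E F \<alpha>" and "atomic A E F \<alpha>"
  shows
    "(\<exists>\<sigma>. form_on A UNIV \<sigma> \<and> form_degree A 1 \<sigma> \<and> satisfies_sigma_eq A E F D\<^sub>E D\<^sub>F \<alpha> \<sigma>) \<and>
     (\<forall>\<sigma>. form_on A UNIV \<sigma> \<and> form_degree A 1 \<sigma> \<and> satisfies_sigma_eq A E F D\<^sub>E D\<^sub>F \<alpha> \<sigma> \<longrightarrow>
        L1loc_form A UNIV \<sigma> \<and>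
        (\<exists>T. T = form_scale (\<i> / (2 * of_real pi)) (wedge (poly2_form (diff_quot \<phi>) e f) \<sigma>) \<and>
             L1loc_form A UNIV T \<and>
             current_of A (form_diff (poly_form \<phi> f) (poly_form \<phi> e)) =
               (\<lambda>\<psi>. even_form_times_current A (poly2_form (diff_quot \<phi>) e f) (divisor A E F \<alpha>) \<psi>
                     + current_deriv A (current_of A T) \<psi>)))"
proof -
  interpret atomic_bundle_map A E F D\<^sub>E D\<^sub>F \<alpha>
    by unfold_locales (fact assms)+
  show ?thesis
  proof (rule conjI)
    show "\<exists>\<sigma>. is_sigma \<sigma>" by (rule exI[of _ sigma0]) (rule is_sigma_sigma0)
    show "\<forall>\<sigma>. is_sigma \<sigma> \<longrightarrow> L1loc_form A UNIV \<sigma> \<and>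
        (\<exists>T. T = form_scale (\<i> / (2 * of_real pi)) (wedge (poly2_form (diff_quot \<phi>) e f) \<sigma>) \<and>
             L1loc_form A UNIV T \<and>
             current_of A (form_diff (poly_form \<phi> f) (poly_form \<phi> e)) =
               (\<lambda>\<psi>. even_form_times_current A (poly2_form (diff_quot \<phi>) e f) (divisor A E F \<alpha>) \<psi>
                     + current_deriv A (current_of A T) \<psi>))"
    proof (intro allI impI)
      fix \<sigma> assume \<sigma>: "is_sigma \<sigma>"
      show "L1loc_form A UNIV \<sigma> \<and>
        (\<exists>T. T = form_scale (\<i> / (2 * of_real pi)) (wedge (poly2_form (diff_quot \<phi>) e f) \<sigma>) \<and>
             L1loc_form A UNIV T \<and>
             current_of A (form_diff (poly_form \<phi> f) (poly_form \<phi> e)) =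
               (\<lambda>\<psi>. even_form_times_current A (poly2_form (diff_quot \<phi>) e f) (divisor A E F \<alpha>) \<psi>
                     + current_deriv A (current_of A T) \<psi>))"
        using L1loc_sigma[OF \<sigma>] divisor_formula[OF assms(6,7) \<sigma> refl, of \<phi>] by blast
    qed
  qed
qed

end
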